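(* Let $\mathcal V=(V,\eta,\xi)$ be a left cyclic polarized arrangement of $n$ hyperplanes in $(k+1)$-space ($k\ge0$), let $\hat{\mathcal V}$ be a left cyclic polarized arrangement of $n+1$ hyperplanes in $(k+1)$-space whose first deletion is $\mathcal V$, let $\mathcal V'=(V',\eta',\xi')$ be the first restriction of $\hat{\mathcal V}$, and let $\mathcal V''=(V',-\eta',-\xi')$, which is a left cyclic polarized arrangement of $n$ hyperplanes in $k$-space. With the bimodules $\mathbf F_k$, $\mathbf{Rest}''_1$, $\mathbf{Del}'_1$ and the identifications $\tilde B(\mathcal V)\cong\mathcal B_l(n,k+1)$, $\tilde B^+(\hat{\mathcal V})\cong\mathcal B'(n+1,k+1)$, $\tilde B(\mathcal V'')\cong\mathcal B_l(n,k)$ described in the context, there is an isomorphism of $(\mathcal B_l(n,k),\mathcal B_l(n,k+1))$-bimodules $$\mathbf F_k\cong\mathbf{Rest}''_1\otimes_{\mathcal B'(n+1,k+1)}\mathbf{Del}'_1.$$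
   Context: **Arrangements.** A polarized arrangement of $n$ hyperplanes in $k$-space is $(V,\eta,\xi)$: $V\subset\mathbb R^n$ a $k$-dimensional subspace, $\eta\in\mathbb R^n/V$ with every representative having at least $n-k$ nonzero entries, $\xi\in V^*=(\mathbb R^n)^*/V^\perp$ with every representative having at least $k$ nonzero entries. In the affine space $V+\eta\subset\mathbb R^n$ put $H_i=\{x:x_i=0\}$, $H_S=\bigcap_{i\in S}H_i$, $\Delta_\alpha=\{x:\alpha(i)x_i\ge0\ \forall i\}$ for $\alpha\in\{+,-\}^n$. $\alpha$ is feasible if $\Delta_\alpha\neq\emptyset$, bounded if an affine function on $V+\eta$ with linear part $\xi$ is bounded above on $\Delta_\alpha$; $\mathcal P$ is the set of bounded feasible $\alpha$. It is left cyclic if $V+\langle\eta\rangle\in\mathrm{Gr}^{>0}_{k+1,n}$, $\{(\xi(v),v):v\in V\}\in\mathrm{Gr}^{>0}_{k,n+1}$, and the first coordinate of the orthogonal projection of a representative of $\eta$ onto $V^\perp$ is positive; $\mathrm{Gr}^{>0}$ denotes subspaces with all Plücker coordinates nonzero of the same sign. For left cyclic arrangements in $k$-space, $\mathcal P$ is the set of $\alpha$ such that $+\alpha$ has exactly $k$ sign changes. **Deletion, restriction.** Let $\pi:\mathbb R^{n+1}\to\mathbb R^n$ forget the first coordinate and $\iota:\mathbb R^n\to\mathbb R^{n+1}$ be the inclusion of the first coordinate hyperplane. For $\hat{\mathcal V}=(\hat V,\hat\eta,\hat\xi)$ with $n+1$ hyperplanes, its first deletion is $(\pi(\hat V),\pi(\hat\eta),\hat\xi\circ(\pi|_{\hat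 V})^{-1})$ and its first restriction is $(\iota^{-1}(\hat V),\iota^{-1}(\hat\eta),\hat\xi|_{\iota^{-1}(\hat V)})$. **Algebras.** $\tilde B(\mathcal V)=\bigoplus_{\alpha,\beta\in\mathcal P}\tilde R_{\alpha\beta}$, $\tilde R_{\alpha\beta}=\mathbb Z[u_1,\dots,u_n]/(u_S:\Delta_\alpha\cap\Delta_\beta\cap H_S=\emptyset)$, $u_S=\prod_{i\in S}u_i$, $f_{\alpha,\beta}$ the class of $1$, with $\mathbb Z[u]$-bilinear product $f_{\alpha,\beta}f_{\beta,\gamma}=u_{S(\alpha\beta\gamma)}f_{\alpha,\gamma}$, $S(\alpha\beta\gamma)=\{i:\alpha(i)=\gamma(i)\ne\beta(i)\}$ (other products $0$); put $e_\alpha=f_{\alpha,\alpha}$, and set $f_{\alpha,\beta}=0$ if $\alpha$ or $\beta$ is infeasible. $\tilde B^+(\hat{\mathcal V})=\epsilon\tilde B(\hat{\mathcal V})\epsilon$ with $\epsilon=\sum_{\alpha(1)=+}e_\alpha$. $\mathcal B(n,k)$ is the path algebra over $\mathbb Z$ (paths composed left to right) of the quiver with vertices the $k$-element subsets $\mathbf x\subset\{0,\dots,n\}$ and arrows, for $1\le i\le n$, $R_i:\mathbf x\to\mathbf y$, $L_i:\mathbf y\to\mathbf x$ when $\mathbf x\cap\{i-1,i\}=\{i-1\}$, $\mathbf y=(\mathbf x\setminus\{i-1\})\cup\{i\}$, and $U_i:\mathbf x\to\mathbf x$, modulo $R_iU_j=U_jR_i$, $L_iU_j=U_jL_i$, $U_iU_j=U_jU_i$;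 $R_iL_i=U_i=L_iR_i$; $R_iR_j=R_jR_i$, $L_iL_j=L_jL_i$, $L_iR_j=R_jL_i$ ($|i-j|>1$); $R_{i-1}R_i=0=L_iL_{i-1}$; $U_i\mathbf I_{\mathbf x}=0$ if $\mathbf x\cap\{i-1,i\}=\emptyset$ ($\mathbf I_{\mathbf x}$ the trivial path). $\mathcal B_l(n,k)$ and $\mathcal B'(n,k)$ are the idempotent truncations $\bigoplus\mathbf I_{\mathbf x}\mathcal B(n,k)\mathbf I_{\mathbf x'}$ to $k$-subsets of $\{0,\dots,n-1\}$ and of $\{1,\dots,n-1\}$. **Identifications.** For a left cyclic arrangement of $n$ hyperplanes in $k$-space, $\mathcal B_l(n,k)\cong\tilde B$ by $\mathbf I_{\mathbf x}\mapsto e_{\alpha_{\mathbf x}}$, arrows $R_i,L_i:\mathbf x\to\mathbf y$ to $f_{\alpha_{\mathbf x},\alpha_{\mathbf y}}$, $U_i\mathbf I_{\mathbf x}\mapsto u_ie_{\alpha_{\mathbf x}}$, where $\alpha_{\mathbf x}\in\mathcal P$ is determined by $\mathbf x=\{i\in\{0,\dots,n-1\}:\alpha_{\mathbf x}(i)\ne\alpha_{\mathbf x}(i+1)\}$, $\alpha_{\mathbf x}(0)=+$. This is applied to $\mathcal V$ and $\mathcal V''$; applied to $\hat{\mathcal V}$ it restricts to $\mathcal B'(n+1,k+1)\cong\tilde B^+(\hat{\mathcal V})$. **Bimodules.** A (not necessarily unital) ring homomorphism $\varphi:A\to B$ gives the $(B,A)$-bimodule $B\varphi(1_A)$, with $A$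 acting on the right through $\varphi$. - $\mathbf{Del}'_1$ is the bimodule of the homomorphism $\tilde B(\mathcal V)\to\tilde B^+(\hat{\mathcal V})$, $f_{\alpha,\beta}\mapsto f_{+\alpha,+\beta}$ ($+\alpha$ is $\alpha$ with a plus prepended), $u_j\mapsto u_{j+1}$. - $\mathbf{Rest}''_1$ is the bimodule of the composite $\tilde B^+(\hat{\mathcal V})\to\tilde B(\mathcal V')\to\tilde B(\mathcal V'')$, where the first map is $f_{+\alpha,+\beta}\mapsto f_{\alpha,\beta}$, $u_1\mapsto1$, $u_j\mapsto u_{j-1}$ for $j>1$, and the second is the sign-change isomorphism $f_{\alpha,\beta}\mapsto f_{-\alpha,-\beta}$, $u_j\mapsto u_j$ ($-\alpha$ is $\alpha$ with all signs reversed). - $\mathbf F_k$ is the bimodule of the ring homomorphism $\mathcal B_l(n,k+1)\to\mathcal B_l(n,k)$ that sends $\mathbf I_{\mathbf x}$ to $\mathbf I_{\mathbf x\setminus\{0\}}$ if $0\in\mathbf x$ and to $0$ otherwise; sends an arrow $R_i$ or $L_i$ from $\mathbf x$ to $\mathbf y$ to the arrow with the same label from $\mathbf x\setminus\{0\}$ to $\mathbf y\setminus\{0\}$ if $0\in\mathbf x\cap\mathbf y$ and to $0$ otherwise; and sends $U_i\mathbf I_{\mathbf x}$ to $U_i\mathbf I_{\mathbf x\setminus\{0\}}$ if $0\in\mathbf x$ and to $0$ otherwise. Thus $\mathbf F_k=\mathcal B_l(n,k)\cdot\sum_{0\notin\mathbf x}\mathbf I_{\mathbf x}$ as a left module. 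*)

theory Defs
  imports
    "HOL-Algebra.QuotRing"
    "HOL-Algebra.Free_Abelian_Groups"
    "HOL-Algebra.Generated_Groups"
    "Jordan_Normal_Form.VS_Connect"
    "Jordan_Normal_Form.DL_Submatrix"
begin

section \<open>Rings, bimodules and tensor products\<close>

definition corner :: "'a ring \<Rightarrow> 'a \<Rightarrow> 'a ring" where
  "corner A e = A\<lparr>carrier := {e \<otimes>\<^bsub>A\<^esub> a \<otimes>\<^bsub>A\<^esub> e | a. a \<in> carrier A}, one := e\<rparr>"

text \<open>The map between quotients induced by an additive map \<open>h\<close> on representatives, with values
  cosets of \<open>J\<close> in \<open>S\<close>; if \<open>h\<close> respects the ideals, all cosets in the union coincide.\<close>

definition quot_map :: "'b ring \<Rightarrow> 'b set \<Rightarrow> ('a \<Rightarrow> 'b) \<Rightarrow> 'a set \<Rightarrow> 'b set" where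
  "quot_map S J h X = (\<Union>x\<in>X. J +>\<^bsub>S\<^esub> h x)"

text \<open>As for \<^type>\<open>module\<close>, the fields \<open>mult\<close> and \<open>one\<close> inherited from \<^type>\<open>ring\<close>
  are not used.\<close>

record ('s, 'm, 'r) bimodule = "'m ring" +
  lact :: "'s \<Rightarrow> 'm \<Rightarrow> 'm"
  ract :: "'m \<Rightarrow> 'r \<Rightarrow> 'm"

definition hom_bimodule :: "'a ring \<Rightarrow> 'b ring \<Rightarrow> ('a \<Rightarrow> 'b) \<Rightarrow> ('b, 'b, 'a) bimodule" where
  "hom_bimodule A B \<phi> =
     \<lparr>carrier = {b \<otimes>\<^bsub>B\<^esub> \<phi> \<one>\<^bsub>A\<^esub> | b. b \<in> carrier B}, monoid.mult = undefined, one = undefined,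
      ring.zero = \<zero>\<^bsub>B\<^esub>, add = add B,
      lact = (\<lambda>b m. b \<otimes>\<^bsub>B\<^esub> m), ract = (\<lambda>m a. m \<otimes>\<^bsub>B\<^esub> \<phi> a)\<rparr>"

definition restrict_scalars ::
    "('s \<Rightarrow> 'u) \<Rightarrow> ('r \<Rightarrow> 'v) \<Rightarrow> ('u, 'm, 'v) bimodule \<Rightarrow> ('s, 'm, 'r) bimodule" where
  "restrict_scalars \<phi> \<psi> M =
     \<lparr>carrier = carrier M, monoid.mult = undefined, one = undefined, ring.zero = \<zero>\<^bsub>M\<^esub>, add = add M,
      lact = (\<lambda>s. lact M (\<phi> s)), ract = (\<lambda>m r. ract M m (\<psi> r))\<rparr>"

text \<open>The tensor product over \<open>R\<close>: the free abelian group on pairs modulo the subgroup generated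
  by biadditivity and \<open>R\<close>-balancedness.\<close>

definition tensor_rels ::
    "'r ring \<Rightarrow> ('s, 'm, 'r) bimodule \<Rightarrow> ('r, 'n, 't) bimodule \<Rightarrow> (('m \<times> 'n) \<Rightarrow>\<^sub>0 int) set" where
  "tensor_rels R M N =
     {frag_of (m \<oplus>\<^bsub>M\<^esub> m', x) - frag_of (m, x) - frag_of (m', x) | m m' x.
        m \<in> carrier M \<and> m' \<in> carrier M \<and> x \<in> carrier N} \<union>
     {frag_of (m, x \<oplus>\<^bsub>N\<^esub> x') - frag_of (m, x) - frag_of (m, x') | m x x'.
        m \<in> carrier M \<and> x \<in> carrier N \<and> x' \<in> carrier N} \<union>
     {frag_of (ract M m r, x) - frag_of (m, lact N r x) | m r x.
        m \<in> carrier M \<and> r \<in> carrier R \<and> x \<in> carrier N}"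

definition tensor ::
    "'r ring \<Rightarrow> ('s, 'm, 'r) bimodule \<Rightarrow> ('r, 'n, 't) bimodule \<Rightarrow>
     ('s, (('m \<times> 'n) \<Rightarrow>\<^sub>0 int) set, 't) bimodule" where
  "tensor R M N =
     (let G = free_Abelian_group (carrier M \<times> carrier N);
          H = generate G (tensor_rels R M N)
      in \<lparr>carrier = carrier (G Mod H), monoid.mult = undefined, one = undefined,
          ring.zero = \<one>\<^bsub>G Mod H\<^esub>, add = (\<lambda>X Y. X \<otimes>\<^bsub>G Mod H\<^esub> Y),
          lact = (\<lambda>s X. \<Union>z\<in>X. H #>\<^bsub>G\<^esub> frag_extend (\<lambda>(m, x). frag_of (lact M s m, x)) z),
          ract = (\<lambda>X t. \<Union>z\<in>X. H #>\<^bsub>G\<^esub> frag_extend (\<lambda>(m, x). frag_of (m, ract N x t)) z)\<rparr>)"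

definition bimodule_iso ::
    "'s ring \<Rightarrow> 'r ring \<Rightarrow> ('s, 'm, 'r) bimodule \<Rightarrow> ('s, 'n, 'r) bimodule \<Rightarrow> ('m \<Rightarrow> 'n) set" where
  "bimodule_iso S R M N = {h. bij_betw h (carrier M) (carrier N) \<and>
     (\<forall>x\<in>carrier M. \<forall>y\<in>carrier M. h (x \<oplus>\<^bsub>M\<^esub> y) = h x \<oplus>\<^bsub>N\<^esub> h y) \<and>
     (\<forall>s\<in>carrier S. \<forall>x\<in>carrier M. h (lact M s x) = lact N s (h x)) \<and>
     (\<forall>x\<in>carrier M. \<forall>r\<in>carrier R. h (ract M x r) = ract N (h x) r)}"

definition bimodule_isomorphic ::
    "'s ring \<Rightarrow> 'r ring \<Rightarrow> ('s, 'm, 'r) bimodule \<Rightarrow> ('s, 'n, 'r) bimodule \<Rightarrow> bool" where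
  "bimodule_isomorphic S R M N \<longleftrightarrow> bimodule_iso S R M N \<noteq> {}"


section \<open>Polarized arrangements\<close>

text \<open>Coordinates are numbered from 1 in the mathematics and from 0 in \<^typ>\<open>real vec\<close>: the
  \<open>i\<close>-th hyperplane is \<open>x $ (i - 1) = 0\<close>. Likewise the sign vector \<open>\<alpha>\<close> is a list with
  \<open>\<alpha>(i) = \<alpha> ! (i - 1)\<close>, where \<open>True\<close> stands for \<open>+\<close>.\<close>

type_synonym signs = "bool list"

text \<open>\<open>aeta\<close> is an element of the quotient by \<open>aspace\<close>, i.e. a coset; as a set of vectors it is
  the affine space in which the hyperplanes live. \<open>axi\<close> is a linear functional on \<open>aspace\<close>,
  normalised to be \<open>undefined\<close> elsewhere so that equality of arrangements is meaningful.\<close>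

record arrangement =
  aspace :: "real vec set"
  aeta :: "real vec set"
  axi :: "real vec \<Rightarrow> real"

definition subspace_dim :: "nat \<Rightarrow> nat \<Rightarrow> real vec set \<Rightarrow> bool" where
  "subspace_dim n k W \<longleftrightarrow>
     VectorSpace.subspace class_ring W (module_vec TYPE(real) n) \<and>
     vectorspace.fin_dim class_ring (module_vec TYPE(real) n\<lparr>carrier := W\<rparr>) \<and>
     vectorspace.dim class_ring (module_vec TYPE(real) n\<lparr>carrier := W\<rparr>) = k"

definition polarized_arrangement :: "nat \<Rightarrow> nat \<Rightarrow> arrangement \<Rightarrow> bool" where
  "polarized_arrangement n k A \<longleftrightarrow>
     subspace_dim n k (aspace A) \<and>
     (\<exists>w\<in>carrier_vec n. aeta A = {w + v | v. v \<in> aspace A}) \<and>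
     (\<forall>w\<in>aeta A. n - k \<le> card {i. i < n \<and> w $ i \<noteq> 0}) \<and>
     axi A \<in> extensional (aspace A) \<and>
     (\<forall>u\<in>aspace A. \<forall>v\<in>aspace A. axi A (u + v) = axi A u + axi A v) \<and>
     (\<forall>v\<in>aspace A. \<forall>c. axi A (c \<cdot>\<^sub>v v) = c * axi A v) \<and>
     (\<forall>c\<in>carrier_vec n. (\<forall>v\<in>aspace A. c \<bullet> v = axi A v) \<longrightarrow>
        k \<le> card {i. i < n \<and> c $ i \<noteq> 0})"

definition Gr_pos :: "nat \<Rightarrow> nat \<Rightarrow> real vec set set" where
  "Gr_pos k n = {W. subspace_dim n k W \<and>
     (\<exists>M\<in>carrier_mat k n. vec_space.row_space n M = W \<and>
        ((\<forall>I. I \<subseteq> {..<n} \<and> card I = k \<longrightarrow> det (submatrix M UNIV I) > 0) \<or>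
         (\<forall>I. I \<subseteq> {..<n} \<and> card I = k \<longrightarrow> det (submatrix M UNIV I) < 0)))}"

definition is_orth_projection :: "real vec set \<Rightarrow> real vec \<Rightarrow> real vec \<Rightarrow> bool" where
  "is_orth_projection W x p \<longleftrightarrow> p \<in> W \<and> (\<forall>w\<in>W. (x - p) \<bullet> w = 0)"

definition left_cyclic :: "nat \<Rightarrow> nat \<Rightarrow> arrangement \<Rightarrow> bool" where
  "left_cyclic n k A \<longleftrightarrow>
     polarized_arrangement n k A \<and>
     {v + c \<cdot>\<^sub>v w | v c w. v \<in> aspace A \<and> w \<in> aeta A} \<in> Gr_pos (k + 1) n \<and>
     {vCons (axi A v) v | v. v \<in> aspace A} \<in> Gr_pos k (n + 1) \<and>
     (\<exists>w\<in>aeta A. \<exists>p. is_orth_projection (vec_module.orthogonal_complement n (aspace A)) w p \<and> p $ 0 > 0)"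

definition forget_first :: "real vec \<Rightarrow> real vec" where
  "forget_first v = vec (dim_vec v - 1) (\<lambda>i. v $ (i + 1))"

definition first_deletion :: "arrangement \<Rightarrow> arrangement" where
  "first_deletion A =
     \<lparr>aspace = forget_first ` aspace A, aeta = forget_first ` aeta A,
      axi = restrict (axi A \<circ> the_inv_into (aspace A) forget_first) (forget_first ` aspace A)\<rparr>"

definition first_restriction :: "arrangement \<Rightarrow> arrangement" where
  "first_restriction A =
     \<lparr>aspace = vCons 0 -` aspace A, aeta = vCons 0 -` aeta A,
      axi = restrict (axi A \<circ> vCons 0) (vCons 0 -` aspace A)\<rparr>"

definition opposite :: "arrangement \<Rightarrow> arrangement" where
  "opposite A =
     \<lparr>aspace = aspace A, aeta = uminus ` aeta A, axi = restrict (\<lambda>v. - axi A v) (aspace A)\<rparr>"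

definition hyp :: "arrangement \<Rightarrow> nat set \<Rightarrow> real vec set" where
  "hyp A S = {x \<in> aeta A. \<forall>i\<in>S. x $ (i - 1) = 0}"

definition chamber :: "arrangement \<Rightarrow> signs \<Rightarrow> real vec set" where
  "chamber A \<alpha> = {x \<in> aeta A. \<forall>i\<in>{1..length \<alpha>}.
     if \<alpha> ! (i - 1) then x $ (i - 1) \<ge> 0 else x $ (i - 1) \<le> 0}"

definition bounded_signs :: "arrangement \<Rightarrow> signs \<Rightarrow> bool" where
  "bounded_signs A \<alpha> \<longleftrightarrow>
     (\<exists>f. (\<forall>x\<in>aeta A. \<forall>v\<in>aspace A. f (x + v) = f x + axi A v) \<and> bdd_above (f ` chamber A \<alpha>))"

definition BF :: "nat \<Rightarrow> arrangement \<Rightarrow> signs set" where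
  "BF n A = {\<alpha>. length \<alpha> = n \<and> chamber A \<alpha> \<noteq> {} \<and> bounded_signs A \<alpha>}"


section \<open>The convolution algebra of an arrangement\<close>

type_synonym zpoly = "(nat \<Rightarrow>\<^sub>0 nat) \<Rightarrow>\<^sub>0 int"

definition uvar :: "nat \<Rightarrow> zpoly" where
  "uvar i = Poly_Mapping.single (Poly_Mapping.single i 1) 1"

definition Zu :: "nat \<Rightarrow> zpoly ring" where
  "Zu n = \<lparr>carrier = {p. \<forall>m\<in>Poly_Mapping.keys p. Poly_Mapping.keys m \<subseteq> {1..n}},
     monoid.mult = (*), one = 1, ring.zero = 0, add = (+)\<rparr>"

definition uprod :: "nat set \<Rightarrow> zpoly" where
  "uprod S = (\<Prod>i\<in>S. uvar i)"

definition poly_subst :: "(nat \<Rightarrow> zpoly) \<Rightarrow> zpoly \<Rightarrow> zpoly" where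
  "poly_subst \<theta> p = (\<Sum>m\<in>Poly_Mapping.keys p. of_int (Poly_Mapping.lookup p m) *
     (\<Prod>i\<in>Poly_Mapping.keys m. \<theta> i ^ Poly_Mapping.lookup m i))"

definition sep :: "signs \<Rightarrow> signs \<Rightarrow> signs \<Rightarrow> nat set" where
  "sep \<alpha> \<beta> \<gamma> = {i \<in> {1..length \<alpha>}. \<alpha> ! (i - 1) = \<gamma> ! (i - 1) \<and> \<alpha> ! (i - 1) \<noteq> \<beta> ! (i - 1)}"

definition Rideal :: "nat \<Rightarrow> arrangement \<Rightarrow> signs \<Rightarrow> signs \<Rightarrow> zpoly set" where
  "Rideal n A \<alpha> \<beta> =
     Idl\<^bsub>Zu n\<^esub> {uprod S | S. S \<subseteq> {1..n} \<and> chamber A \<alpha> \<inter> chamber A \<beta> \<inter> hyp A S = {}}"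

text \<open>The direct sum of the quotients of \<open>\<int>[u\<^sub>1,\<dots>,u\<^sub>n]\<close> by \<open>Rideal n A \<alpha> \<beta>\<close> is realised as the
  direct sum of copies of \<open>\<int>[u\<^sub>1,\<dots>,u\<^sub>n]\<close> (\<open>Bfree\<close>, with basis the matrix units \<open>f\<^sub>\<alpha>\<^sub>\<beta>\<close>)
  modulo the direct sum of the ideals (\<open>Bideal\<close>). The product of \<open>Bfree\<close> is the bilinear extension
  of \<open>f\<^sub>\<alpha>\<^sub>\<beta> f\<^sub>\<beta>\<^sub>\<gamma> = u\<^bsub>sep \<alpha> \<beta> \<gamma>\<^esub> f\<^sub>\<alpha>\<^sub>\<gamma>\<close>.\<close>

definition Bfree :: "nat \<Rightarrow> arrangement \<Rightarrow> (signs \<Rightarrow> signs \<Rightarrow> zpoly) ring" where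
  "Bfree n A =
     \<lparr>carrier = {M. \<forall>\<alpha> \<beta>. M \<alpha> \<beta> \<in> carrier (Zu n) \<and> (\<alpha> \<notin> BF n A \<or> \<beta> \<notin> BF n A \<longrightarrow> M \<alpha> \<beta> = 0)},
      monoid.mult = (\<lambda>M N \<alpha> \<gamma>. \<Sum>\<beta>\<in>BF n A. uprod (sep \<alpha> \<beta> \<gamma>) * M \<alpha> \<beta> * N \<beta> \<gamma>),
      one = (\<lambda>\<alpha> \<beta>. if \<alpha> = \<beta> \<and> \<alpha> \<in> BF n A then 1 else 0),
      ring.zero = (\<lambda>\<alpha> \<beta>. 0),
      add = (\<lambda>M N \<alpha> \<beta>. M \<alpha> \<beta> + N \<alpha> \<beta>)\<rparr>"

definition Bideal :: "nat \<Rightarrow> arrangement \<Rightarrow> (signs \<Rightarrow> signs \<Rightarrow> zpoly) set" where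
  "Bideal n A = {M \<in> carrier (Bfree n A). \<forall>\<alpha>\<in>BF n A. \<forall>\<beta>\<in>BF n A. M \<alpha> \<beta> \<in> Rideal n A \<alpha> \<beta>}"

type_synonym conv = "(signs \<Rightarrow> signs \<Rightarrow> zpoly) set"

definition Btilde :: "nat \<Rightarrow> arrangement \<Rightarrow> conv ring" where
  "Btilde n A = Bfree n A Quot Bideal n A"

text \<open>\<open>p f\<^sub>\<alpha>\<^sub>\<beta>\<close>, which is 0 unless \<open>\<alpha>\<close> and \<open>\<beta>\<close> are bounded and feasible.\<close>

definition munit :: "nat \<Rightarrow> arrangement \<Rightarrow> zpoly \<Rightarrow> signs \<Rightarrow> signs \<Rightarrow> (signs \<Rightarrow> signs \<Rightarrow> zpoly)" where
  "munit n A p \<alpha> \<beta> =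
     (\<lambda>\<alpha>' \<beta>'. if \<alpha>' = \<alpha> \<and> \<beta>' = \<beta> \<and> \<alpha> \<in> BF n A \<and> \<beta> \<in> BF n A then p else 0)"

definition pf_elt :: "nat \<Rightarrow> arrangement \<Rightarrow> zpoly \<Rightarrow> signs \<Rightarrow> signs \<Rightarrow> conv" where
  "pf_elt n A p \<alpha> \<beta> = Bideal n A +>\<^bsub>Bfree n A\<^esub> munit n A p \<alpha> \<beta>"

abbreviation f_elt :: "nat \<Rightarrow> arrangement \<Rightarrow> signs \<Rightarrow> signs \<Rightarrow> conv" where
  "f_elt n A \<alpha> \<beta> \<equiv> pf_elt n A 1 \<alpha> \<beta>"

abbreviation BF_plus :: "nat \<Rightarrow> arrangement \<Rightarrow> signs set" where
  "BF_plus n A \<equiv> {\<alpha> \<in> BF n A. \<alpha> ! 0}"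

definition Btilde_plus :: "nat \<Rightarrow> arrangement \<Rightarrow> conv ring" where
  "Btilde_plus n A = corner (Btilde n A) (\<Oplus>\<^bsub>Btilde n A\<^esub>\<alpha>\<in>BF_plus n A. f_elt n A \<alpha> \<alpha>)"

text \<open>The additive map \<open>f\<^sub>\<alpha>\<^sub>\<beta> \<mapsto> f\<^bsub>\<tau> \<alpha>, \<tau> \<beta>\<^esub>\<close>, \<open>u\<^sub>j \<mapsto> \<theta> j\<close> (for \<open>\<alpha>\<close>, \<open>\<beta>\<close> in \<open>T\<close>), first on
  representatives and then on classes, with values in the algebra of an arrangement \<open>C\<close> of
  \<open>m\<close> hyperplanes.\<close>

definition relabel ::
    "nat \<Rightarrow> arrangement \<Rightarrow> signs set \<Rightarrow> (signs \<Rightarrow> signs) \<Rightarrow> (nat \<Rightarrow> zpoly) \<Rightarrow>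
     (signs \<Rightarrow> signs \<Rightarrow> zpoly) \<Rightarrow> (signs \<Rightarrow> signs \<Rightarrow> zpoly)" where
  "relabel m C T \<tau> \<theta> M =
     (\<lambda>\<alpha>' \<beta>'. \<Sum>\<alpha>\<in>T. \<Sum>\<beta>\<in>T. munit m C (poly_subst \<theta> (M \<alpha> \<beta>)) (\<tau> \<alpha>) (\<tau> \<beta>) \<alpha>' \<beta>')"

definition relabel_hom ::
    "nat \<Rightarrow> arrangement \<Rightarrow> signs set \<Rightarrow> (signs \<Rightarrow> signs) \<Rightarrow> (nat \<Rightarrow> zpoly) \<Rightarrow> conv \<Rightarrow> conv" where
  "relabel_hom m C T \<tau> \<theta> = quot_map (Bfree m C) (Bideal m C) (relabel m C T \<tau> \<theta>)"

definition del_hom :: "nat \<Rightarrow> arrangement \<Rightarrow> arrangement \<Rightarrow> conv \<Rightarrow> conv" where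
  "del_hom n V Vh = relabel_hom (n + 1) Vh (BF n V) (\<lambda>\<alpha>. True # \<alpha>) (\<lambda>j. uvar (j + 1))"

definition rest_hom :: "nat \<Rightarrow> arrangement \<Rightarrow> conv \<Rightarrow> conv" where
  "rest_hom n Vh = relabel_hom n (first_restriction Vh) (BF_plus (n + 1) Vh) tl
     (\<lambda>j. if j = 1 then 1 else uvar (j - 1))"

definition sign_change_hom :: "nat \<Rightarrow> arrangement \<Rightarrow> conv \<Rightarrow> conv" where
  "sign_change_hom n A = relabel_hom n (opposite A) (BF n A) (map Not) uvar"


section \<open>The strands algebra by generators and relations\<close>

datatype arrow = AR nat | AL nat | AU nat

text \<open>\<open>arrow_target n a x\<close> is the target of the arrow labelled \<open>a\<close> with source \<open>x\<close>,
  if there is one.\<close>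

fun arrow_target :: "nat \<Rightarrow> arrow \<Rightarrow> nat set \<Rightarrow> nat set option" where
  "arrow_target n (AR i) x =
     (if i \<in> {1..n} \<and> x \<inter> {i - 1, i} = {i - 1} then Some (insert i (x - {i - 1})) else None)"
| "arrow_target n (AL i) x =
     (if i \<in> {1..n} \<and> x \<inter> {i - 1, i} = {i} then Some (insert (i - 1) (x - {i})) else None)"
| "arrow_target n (AU i) x = (if i \<in> {1..n} then Some x else None)"

definition vertices :: "nat \<Rightarrow> nat \<Rightarrow> nat set set" where
  "vertices n k = {x. x \<subseteq> {0..n} \<and> card x = k}"

text \<open>A path is given by its initial vertex and its sequence of labels, read left to right.\<close>

type_synonym path = "nat set \<times> arrow list"

fun walk :: "nat \<Rightarrow> nat set \<Rightarrow> arrow list \<Rightarrow> nat set option" where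
  "walk n x [] = Some x"
| "walk n x (a # w) = (case arrow_target n a x of None \<Rightarrow> None | Some y \<Rightarrow> walk n y w)"

fun visited :: "nat \<Rightarrow> nat set \<Rightarrow> arrow list \<Rightarrow> nat set list" where
  "visited n x [] = [x]"
| "visited n x (a # w) =
     x # (case arrow_target n a x of None \<Rightarrow> [] | Some y \<Rightarrow> visited n y w)"

definition paths :: "nat \<Rightarrow> nat \<Rightarrow> path set" where
  "paths n k = {(x, w). x \<in> vertices n k \<and> walk n x w \<noteq> None}"

definition path_comp :: "nat \<Rightarrow> path \<Rightarrow> path \<Rightarrow> path \<Rightarrow>\<^sub>0 int" where
  "path_comp n p q =
     (if walk n (fst p) (snd p) = Some (fst q) then frag_of (fst p, snd p @ snd q) else 0)"

definition path_alg :: "nat \<Rightarrow> nat \<Rightarrow> (path \<Rightarrow>\<^sub>0 int) ring" where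
  "path_alg n k =
     \<lparr>carrier = {g. Poly_Mapping.keys g \<subseteq> paths n k},
      monoid.mult = (\<lambda>g h. frag_extend (\<lambda>p. frag_extend (path_comp n p) h) g),
      one = (\<Sum>x\<in>vertices n k. frag_of (x, [])),
      ring.zero = 0,
      add = (+)\<rparr>"

definition path_elt :: "nat \<Rightarrow> nat \<Rightarrow> nat set \<Rightarrow> arrow list \<Rightarrow> path \<Rightarrow>\<^sub>0 int" where
  "path_elt n k x w = (if (x, w) \<in> paths n k then frag_of (x, w) else 0)"

text \<open>An identity between composites of arrows is imposed at every initial vertex; a composite
  that is not a path in the quiver counts as 0. The relation \<open>R\<^sub>i L\<^sub>i = U\<^sub>i = L\<^sub>i R\<^sub>i\<close> is
  imposed only where the composites are paths: in particular \<open>U\<^sub>i I\<^sub>x\<close> is not 0 when both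
  \<open>i - 1\<close> and \<open>i\<close> lie in \<open>x\<close>.\<close>

definition path_rels :: "nat \<Rightarrow> nat \<Rightarrow> (path \<Rightarrow>\<^sub>0 int) set" where
  "path_rels n k =
     (\<Union>x\<in>vertices n k. \<Union>i\<in>{1..n}. \<Union>j\<in>{1..n}.
        {path_elt n k x [AR i, AU j] - path_elt n k x [AU j, AR i],
         path_elt n k x [AL i, AU j] - path_elt n k x [AU j, AL i],
         path_elt n k x [AU i, AU j] - path_elt n k x [AU j, AU i]}) \<union>
     (\<Union>x\<in>vertices n k. \<Union>i\<in>{1..n}.
        (if x \<inter> {i - 1, i} = {i - 1} then {path_elt n k x [AR i, AL i] - path_elt n k x [AU i]} else {}) \<union>
        (if x \<inter> {i - 1, i} = {i} then {path_elt n k x [AL i, AR i] - path_elt n k x [AU i]} else {}) \<union>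
        (if x \<inter> {i - 1, i} = {} then {path_elt n k x [AU i]} else {})) \<union>
     (\<Union>x\<in>vertices n k. \<Union>(i, j)\<in>{(i, j). i \<in> {1..n} \<and> j \<in> {1..n} \<and> (i + 1 < j \<or> j + 1 < i)}.
        {path_elt n k x [AR i, AR j] - path_elt n k x [AR j, AR i],
         path_elt n k x [AL i, AL j] - path_elt n k x [AL j, AL i],
         path_elt n k x [AL i, AR j] - path_elt n k x [AR j, AL i]}) \<union>
     (\<Union>x\<in>vertices n k. \<Union>i\<in>{2..n}.
        {path_elt n k x [AR (i - 1), AR i], path_elt n k x [AL i, AL (i - 1)]})"

definition path_ideal :: "nat \<Rightarrow> nat \<Rightarrow> (path \<Rightarrow>\<^sub>0 int) set" where
  "path_ideal n k = Idl\<^bsub>path_alg n k\<^esub> (path_rels n k)"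

type_synonym strand = "(path \<Rightarrow>\<^sub>0 int) set"

definition Bquiv :: "nat \<Rightarrow> nat \<Rightarrow> strand ring" where
  "Bquiv n k = path_alg n k Quot path_ideal n k"

definition path_class :: "nat \<Rightarrow> nat \<Rightarrow> nat set \<Rightarrow> arrow list \<Rightarrow> strand" where
  "path_class n k x w = path_ideal n k +>\<^bsub>path_alg n k\<^esub> path_elt n k x w"

definition ksubsets :: "nat set \<Rightarrow> nat \<Rightarrow> nat set set" where
  "ksubsets X k = {x. x \<subseteq> X \<and> card x = k}"

definition truncation :: "nat \<Rightarrow> nat \<Rightarrow> nat set set \<Rightarrow> strand ring" where
  "truncation n k T = corner (Bquiv n k) (\<Oplus>\<^bsub>Bquiv n k\<^esub>x\<in>T. path_class n k x [])"

definition Bl :: "nat \<Rightarrow> nat \<Rightarrow> strand ring" where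
  "Bl n k = truncation n k (ksubsets {0..<n} k)"

definition Bprime :: "nat \<Rightarrow> nat \<Rightarrow> strand ring" where
  "Bprime n k = truncation n k (ksubsets {1..<n} k)"


section \<open>The identifications\<close>

definition sign_changes :: "signs \<Rightarrow> nat set" where
  "sign_changes \<alpha> = {i. i < length \<alpha> \<and> (True # \<alpha>) ! i \<noteq> (True # \<alpha>) ! (i + 1)}"

definition signs_of :: "nat \<Rightarrow> nat set \<Rightarrow> signs" where
  "signs_of n x = (THE \<alpha>. length \<alpha> = n \<and> sign_changes \<alpha> = x)"

definition is_identification :: "nat \<Rightarrow> nat \<Rightarrow> arrangement \<Rightarrow> (strand \<Rightarrow> conv) \<Rightarrow> bool" where
  "is_identification n k A \<Phi> \<longleftrightarrow>
     \<Phi> \<in> ring_iso (Bl n k) (Btilde n A) \<and>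
     (\<forall>x\<in>ksubsets {0..<n} k.
        \<Phi> (path_class n k x []) = f_elt n A (signs_of n x) (signs_of n x)) \<and>
     (\<forall>x\<in>ksubsets {0..<n} k. \<forall>y\<in>ksubsets {0..<n} k. \<forall>i\<in>{1..n}. \<forall>a\<in>{AR i, AL i}.
        arrow_target n a x = Some y \<longrightarrow>
        \<Phi> (path_class n k x [a]) = f_elt n A (signs_of n x) (signs_of n y)) \<and>
     (\<forall>x\<in>ksubsets {0..<n} k. \<forall>i\<in>{1..n}.
        \<Phi> (path_class n k x [AU i]) = pf_elt n A (uvar i) (signs_of n x) (signs_of n x))"

text \<open>For left cyclic \<open>A\<close> such an isomorphism exists, and it is unique on \<open>carrier (Bl n k)\<close>
  because the listed elements generate this ring.\<close>

definition identification :: "nat \<Rightarrow> nat \<Rightarrow> arrangement \<Rightarrow> strand \<Rightarrow> conv" where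
  "identification n k A = (SOME \<Phi>. is_identification n k A \<Phi>)"


section \<open>The bimodules\<close>

abbreviation V'' :: "arrangement \<Rightarrow> arrangement" where
  "V'' Vh \<equiv> opposite (first_restriction Vh)"

definition Del1 :: "nat \<Rightarrow> nat \<Rightarrow> arrangement \<Rightarrow> arrangement \<Rightarrow> (strand, conv, strand) bimodule" where
  "Del1 n k V Vh =
     restrict_scalars (identification (n + 1) (k + 1) Vh) (identification n (k + 1) V)
       (hom_bimodule (Btilde n V) (Btilde_plus (n + 1) Vh) (del_hom n V Vh))"

definition Rest1 :: "nat \<Rightarrow> nat \<Rightarrow> arrangement \<Rightarrow> (strand, conv, strand) bimodule" where
  "Rest1 n k Vh =
     restrict_scalars (identification n k (V'' Vh)) (identification (n + 1) (k + 1) Vh)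
       (hom_bimodule (Btilde_plus (n + 1) Vh) (Btilde n (V'' Vh))
          (sign_change_hom n (first_restriction Vh) \<circ> rest_hom n Vh))"

text \<open>The homomorphism keeps the labels of a path and removes 0 from all its vertices if all of
  them contain 0, and kills the path otherwise.\<close>

definition F_path :: "nat \<Rightarrow> path \<Rightarrow> path \<Rightarrow>\<^sub>0 int" where
  "F_path n = (\<lambda>(x, w). if \<forall>y\<in>set (visited n x w). 0 \<in> y then frag_of (x - {0}, w) else 0)"

definition F_hom :: "nat \<Rightarrow> nat \<Rightarrow> strand \<Rightarrow> strand" where
  "F_hom n k = quot_map (path_alg n k) (path_ideal n k) (frag_extend (F_path n))"

definition F_bimod :: "nat \<Rightarrow> nat \<Rightarrow> (strand, strand, strand) bimodule" where
  "F_bimod n k = hom_bimodule (Bl n (k + 1)) (Bl n k) (F_hom n k)"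

end

theory Submission
 imports Defs "Jordan_Normal_Form.DL_Rank_Submatrix"
begin

text \<open>Both bimodules in the tensor product come from ring homomorphisms, so the product is the bimodule
 of their composite, and the claim is that under the identifications this composite is the
 quotient map \<open>B\<^sub>l(n, k + 1) \<rightarrow> B\<^sub>l(n, k)\<close> defining \<open>F\<^sub>k\<close>. To compare them on representatives, the quiver
 relations are replaced by a normal form: a path is determined by its end points and by the number
 of times it crosses each position, and it vanishes iff it covers an interval whose two end points
 are both unoccupied. The same interval condition describes when \<open>\<Delta>\<^sub>\<alpha> \<inter> \<Delta>\<^sub>\<beta> \<inter> H\<^sub>S\<close> is empty for
 a left cyclic arrangement; there it follows from the sign patterns of vectors in totally positive
 subspaces.\<close>

text \<open>The composite keeps every coefficient and reverses all signs: deletion prepends a plus,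
  restriction removes it, and the first variable, which restriction sends to 1, is not in the image
  of deletion. Reversing all signs changes the set of sign changes only at 0. So vertices containing
  0 lose it, and those without 0 get k + 2 sign changes and become infeasible. A path that leaves 0
  is killed by F_k but not, on representatives, by the composite; removing 0 then leaves 0 and 1
  unoccupied, so its monomial lies in the ideal. Three obstacles shape the rest. The identifications
  are chosen by \<open>SOME\<close> from values on generators, so their existence and uniqueness
  require solving the word problem of the quiver. A truncation restricts only the ends of paths,
  while the prescribed values concern arrows between vertices without n; paths must be rewritten to
  avoid n. The positivity in the definition of left cyclic holds up to a common sign, which the
  condition on the orthogonal projection fixes; for the restriction the signs come out right because
  \<eta> and \<xi> are both negated.\<close>

abbreviation keys :: "('a \<Rightarrow>\<^sub>0 'b::zero) => 'a set" where "keys \<equiv> Poly_Mapping.keys"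
abbreviation lookup :: "('a \<Rightarrow>\<^sub>0 'b::zero) => 'a => 'b" where "lookup \<equiv> Poly_Mapping.lookup"
abbreviation single :: "'a => 'b => ('a \<Rightarrow>\<^sub>0 'b::zero)" where "single \<equiv> Poly_Mapping.single"
abbreviation sc :: "signs => nat set" where "sc \<equiv> sign_changes"

section \<open>Cosets, quotient rings and corners\<close>

lemma (in ideal) coset_add_mem: "i \<in> I ==> b \<in> carrier R ==> I +> (i \<oplus> b) = I +> b"
 by (metis a_Hcarr a_rcos_const a_rcos_sum a_r_coset_def a_coset_add_assoc a_subset)

lemma (in ideal) coset_eqD:
 assumes "I +> a = I +> b" "a \<in> carrier R" "b \<in> carrier R"
 obtains i where "i \<in> I" "a = i \<oplus> b"
proof -
 have "a \<in> I +> b" using a_rcos_self[OF assms(2)] assms(1) by simp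
 thus thesis using that unfolding a_r_coset_def' by blast
qed

lemma carrier_quot: "carrier (R Quot I) = {I +>\<^bsub>R\<^esub> a | a. a \<in> carrier R}"
 by (auto simp: FactRing_def A_RCOSETS_def')

lemma (in ideal) quot_simps:
 shows "a \<in> carrier R ==> b \<in> carrier R ==> (I +> a) \<otimes>\<^bsub>R Quot I\<^esub> (I +> b) = I +> (a \<otimes> b)"
  and "a \<in> carrier R ==> b \<in> carrier R ==> (I +> a) \<oplus>\<^bsub>R Quot I\<^esub> (I +> b) = I +> (a \<oplus> b)"
  and "\<one>\<^bsub>R Quot I\<^esub> = I +> \<one>" and "\<zero>\<^bsub>R Quot I\<^esub> = I +> \<zero>"
  and "a \<in> carrier R ==> I +> a \<in> carrier (R Quot I)"
 by (auto simp: FactRing_def rcoset_mult_add a_rcos_sum a_coset_add_zero[OF a_subset] A_RCOSETS_def')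

lemma quot_map_coset:
 assumes I: "ideal I R" and J: "ideal J S"
  and h: "\<And>a. a \<in> carrier R ==> h a \<in> carrier S"
  and add: "\<And>a b. a \<in> carrier R ==> b \<in> carrier R ==> h (a \<oplus>\<^bsub>R\<^esub> b) = h a \<oplus>\<^bsub>S\<^esub> h b"
  and IJ: "\<And>i. i \<in> I ==> h i \<in> J" and a: "a \<in> carrier R"
 shows "quot_map S J h (I +>\<^bsub>R\<^esub> a) = J +>\<^bsub>S\<^esub> h a"
proof -
 interpret I: ideal I R by fact
 interpret J: ideal J S by fact
 have "J +>\<^bsub>S\<^esub> h x = J +>\<^bsub>S\<^esub> h a" if "x \<in> I +>\<^bsub>R\<^esub> a" for x
 proof -
  obtain i where "i \<in> I" "x = i \<oplus>\<^bsub>R\<^esub> a" using \<open>x \<in> _\<close> unfolding a_r_coset_def' by blast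
  thus ?thesis using J.coset_add_mem[OF IJ h[OF a]] add a I.a_Hcarr by simp
 qed
 moreover have "a \<in> I +>\<^bsub>R\<^esub> a" using I.a_rcos_self a by blast
 ultimately show ?thesis unfolding quot_map_def by blast
qed

lemma corner_sel [simp]:
 "monoid.mult (corner A e) = monoid.mult A" "add (corner A e) = add A" "\<zero>\<^bsub>corner A e\<^esub> = \<zero>\<^bsub>A\<^esub>" "\<one>\<^bsub>corner A e\<^esub> = e"
 by (simp_all add: corner_def)

text \<open>As \<open>e\<close> is idempotent, the compressed elements are those fixed by
  \<open>e\<close> on both sides; in this form closure under the operations is an equational
  check.\<close>

lemma corner_carrier:
 fixes R :: "'a ring"
 assumes "ring R" "e \<in> carrier R" "e \<otimes>\<^bsub>R\<^esub> e = e"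
 shows "carrier (corner R e) = {a \<in> carrier R. e \<otimes>\<^bsub>R\<^esub> a = a \<and> a \<otimes>\<^bsub>R\<^esub> e = a}"
proof -
 interpret ring R by fact
 have "e \<otimes>\<^bsub>R\<^esub> a \<otimes>\<^bsub>R\<^esub> e \<in> carrier R \<and> e \<otimes>\<^bsub>R\<^esub> (e \<otimes>\<^bsub>R\<^esub> a \<otimes>\<^bsub>R\<^esub> e) = e \<otimes>\<^bsub>R\<^esub> a \<otimes>\<^bsub>R\<^esub> e \<and> e \<otimes>\<^bsub>R\<^esub> a \<otimes>\<^bsub>R\<^esub> e \<otimes>\<^bsub>R\<^esub> e = e \<otimes>\<^bsub>R\<^esub> a \<otimes>\<^bsub>R\<^esub> e"
  if "a \<in> carrier R" for a
  using assms that by (metis m_assoc m_closed)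
 moreover have "\<exists>b. a = e \<otimes>\<^bsub>R\<^esub> b \<otimes>\<^bsub>R\<^esub> e \<and> b \<in> carrier R" if "a \<in> carrier R" "e \<otimes>\<^bsub>R\<^esub> a = a" "a \<otimes>\<^bsub>R\<^esub> e = a" for a
  using that by metis
 ultimately show ?thesis unfolding corner_def by auto
qed

lemma corner_ring:
 fixes R :: "'a ring"
 assumes "ring R" "e \<in> carrier R" "e \<otimes>\<^bsub>R\<^esub> e = e"
 shows "ring (corner R e)"
proof -
 interpret ring R by fact
 show ?thesis
proof (intro ringI abelian_groupI monoidI)
 note c = corner_carrier[OF assms]
 fix x y z
 show "\<exists>y\<in>carrier (corner R e). y \<oplus>\<^bsub>corner R e\<^esub> x = \<zero>\<^bsub>corner R e\<^esub>" if "x \<in> carrier (corner R e)"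
  using that assms unfolding c by (intro bexI[of _ "\<ominus>\<^bsub>R\<^esub> x"]) (auto simp: l_neg r_minus l_minus)
 show "x \<otimes>\<^bsub>corner R e\<^esub> y \<in> carrier (corner R e)"
  if "x \<in> carrier (corner R e)" "y \<in> carrier (corner R e)"
  using that assms unfolding c by (auto simp: m_assoc[symmetric]) (simp add: m_assoc)
qed (use assms in \<open>auto simp: corner_carrier[OF assms] m_assoc a_assoc r_distr l_distr, auto simp: a_ac\<close>)
qed

lemma restrict_scalars_sel [simp]:
 "carrier (restrict_scalars p q M) = carrier M" "add (restrict_scalars p q M) = add M"
 "\<zero>\<^bsub>restrict_scalars p q M\<^esub> = \<zero>\<^bsub>M\<^esub>"
 "lact (restrict_scalars p q M) s = lact M (p s)" "ract (restrict_scalars p q M) m r = ract M m (q r)"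
 by (simp_all add: restrict_scalars_def)

lemma hom_bimodule_sel [simp]:
 "carrier (hom_bimodule A B f) = {b \<otimes>\<^bsub>B\<^esub> f \<one>\<^bsub>A\<^esub> | b. b \<in> carrier B}"
 "add (hom_bimodule A B f) = add B" "\<zero>\<^bsub>hom_bimodule A B f\<^esub> = \<zero>\<^bsub>B\<^esub>"
 "lact (hom_bimodule A B f) b m = b \<otimes>\<^bsub>B\<^esub> m" "ract (hom_bimodule A B f) m a = m \<otimes>\<^bsub>B\<^esub> f a"
 by (simp_all add: hom_bimodule_def)

section \<open>The tensor product of two bimodules of homomorphisms\<close>

lemma frag_coset_eq_iff:
 assumes "subgroup H (free_Abelian_group X)"
 shows "H #>\<^bsub>free_Abelian_group X\<^esub> z = H #>\<^bsub>free_Abelian_group X\<^esub> z' \<longleftrightarrow> z - z' \<in> H"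
proof -
 have 0: "0 \<in> H" using subgroup.one_closed[OF assms] by simp
 have add: "a + b \<in> H" if "a \<in> H" "b \<in> H" for a b using subgroup.m_closed[OF assms that] by simp
 have "a \<in> H ==> keys a \<subseteq> X" for a using subgroup.mem_carrier[OF assms] by fastforce
 hence neg: "- a \<in> H" if "a \<in> H" for a using subgroup.m_inv_closed[OF assms that] that by simp
 have *: "H #>\<^bsub>free_Abelian_group X\<^esub> z = {h + z | h. h \<in> H}" for z
  by (auto simp: r_coset_def)
 have "z - z' \<in> H" if "{h + z | h. h \<in> H} = {h + z' | h. h \<in> H}"
 proof -
  have "0 + z \<in> {h + z' | h. h \<in> H}" using 0 that by blast
  thus ?thesis by auto
 qed
 moreover have "{h + z | h. h \<in> H} \<subseteq> {h + z' | h. h \<in> H}" if "z - z' \<in> H" for z z'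
  using add[OF _ that] by (force simp: algebra_simps)
 moreover have "z' - z \<in> H" if "z - z' \<in> H" using neg[OF that] by simp
 ultimately show ?thesis unfolding * by blast
qed

text \<open>The inverse of the isomorphism is \<open>m \<mapsto> m \<otimes> \<psi> 1\<close>, because \<open>m \<otimes> x = m \<phi>(x) \<otimes> \<psi> 1\<close>.\<close>

lemma tensor_hom_bimodules:
 fixes A :: "'a ring" and B :: "'b ring" and C :: "'c ring"
  and R :: "'r ring" and S :: "'s ring" and T :: "'t ring"
 assumes "ring A" "ring B" "ring C"
  and psi: "\<And>x. x \<in> carrier A ==> \<psi> x \<in> carrier B"
  and psi_mult: "\<And>x y. x \<in> carrier A ==> y \<in> carrier A ==> \<psi> (x \<otimes>\<^bsub>A\<^esub> y) = \<psi> x \<otimes>\<^bsub>B\<^esub> \<psi> y"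
  and phi: "\<And>x. x \<in> carrier B ==> \<phi> x \<in> carrier C"
  and phi_add: "\<And>x y. x \<in> carrier B ==> y \<in> carrier B ==> \<phi> (x \<oplus>\<^bsub>B\<^esub> y) = \<phi> x \<oplus>\<^bsub>C\<^esub> \<phi> y"
  and phi_mult: "\<And>x y. x \<in> carrier B ==> y \<in> carrier B ==> \<phi> (x \<otimes>\<^bsub>B\<^esub> y) = \<phi> x \<otimes>\<^bsub>C\<^esub> \<phi> y"
  and p: "\<And>s. s \<in> carrier S ==> p s \<in> carrier C"
  and q: "q ` carrier R = carrier B"
  and r: "\<And>t. t \<in> carrier T ==> r t \<in> carrier A"
 shows "bimodule_isomorphic S T (restrict_scalars p r (hom_bimodule A C (\<phi> \<circ> \<psi>)))
  (tensor R (restrict_scalars p q (hom_bimodule B C \<phi>)) (restrict_scalars q r (hom_bimodule A B \<psi>)))"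
proof -
 interpret A: ring A by fact
 interpret B: ring B by fact
 interpret C: ring C by fact
 define M where "M = restrict_scalars p q (hom_bimodule B C \<phi>)"
 define N where "N = restrict_scalars q r (hom_bimodule A B \<psi>)"
 define L where "L = restrict_scalars p r (hom_bimodule A C (\<phi> \<circ> \<psi>))"
 define u where "u = \<psi> \<one>\<^bsub>A\<^esub>"
 define G where "G = free_Abelian_group (carrier M \<times> carrier N)"
 define H where "H = generate G (tensor_rels R M N)"
 note [simp] = psi phi
 have u [simp]: "u \<in> carrier B" by (simp add: u_def)
 have uu: "\<psi> x \<otimes>\<^bsub>B\<^esub> u = \<psi> x" "u \<otimes>\<^bsub>B\<^esub> \<psi> x = \<psi> x" if "x \<in> carrier A" for x
  unfolding u_def using that by (metis psi_mult A.one_closed A.r_one A.l_one)+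
 have ph1: "\<phi> x \<otimes>\<^bsub>C\<^esub> \<phi> \<one>\<^bsub>B\<^esub> = \<phi> x" if "x \<in> carrier B" for x
  using that by (metis phi_mult B.one_closed B.r_one)
 have cM: "carrier M = {m \<in> carrier C. m \<otimes>\<^bsub>C\<^esub> \<phi> \<one>\<^bsub>B\<^esub> = m}"
 proof -
  have "b \<otimes>\<^bsub>C\<^esub> \<phi> \<one>\<^bsub>B\<^esub> \<otimes>\<^bsub>C\<^esub> \<phi> \<one>\<^bsub>B\<^esub> = b \<otimes>\<^bsub>C\<^esub> \<phi> \<one>\<^bsub>B\<^esub>" if "b \<in> carrier C" for b
   using that by (simp add: C.m_assoc ph1)
  thus ?thesis by (force simp: M_def)
 qed
 have cN: "carrier N = {x \<in> carrier B. x \<otimes>\<^bsub>B\<^esub> u = x}"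
 proof -
  have "b \<otimes>\<^bsub>B\<^esub> u \<otimes>\<^bsub>B\<^esub> u = b \<otimes>\<^bsub>B\<^esub> u" if "b \<in> carrier B" for b
   using that uu[of "\<one>\<^bsub>A\<^esub>"] by (simp add: B.m_assoc flip: u_def)
  thus ?thesis by (force simp: N_def u_def)
 qed
 have cL: "carrier L = {m \<in> carrier C. m \<otimes>\<^bsub>C\<^esub> \<phi> u = m}"
 proof -
  have "b \<otimes>\<^bsub>C\<^esub> \<phi> u \<otimes>\<^bsub>C\<^esub> \<phi> u = b \<otimes>\<^bsub>C\<^esub> \<phi> u" if "b \<in> carrier C" for b
   using that uu[of "\<one>\<^bsub>A\<^esub>"] by (simp add: C.m_assoc flip: u_def phi_mult)
  thus ?thesis by (force simp: L_def u_def)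
 qed
 \<comment> \<open>\<open>\<phi> u\<close> absorbs the image of the unit under
   \<open>\<phi>\<close>, so the bimodule of the composite lies inside that of
   \<open>\<phi>\<close>.\<close>
 have LM: "carrier L \<subseteq> carrier M"
 proof
  fix m assume "m \<in> carrier L"
  hence m: "m \<in> carrier C" "m \<otimes>\<^bsub>C\<^esub> \<phi> u = m" by (auto simp: cL)
  have "m \<otimes>\<^bsub>C\<^esub> \<phi> u \<otimes>\<^bsub>C\<^esub> \<phi> \<one>\<^bsub>B\<^esub> = m \<otimes>\<^bsub>C\<^esub> \<phi> u"
   using m(1) by (simp add: C.m_assoc ph1)
  thus "m \<in> carrier M" using m by (simp add: cM)
 qed
 have [simp]: "add M = add C" "add N = add B" "add L = add C"
  "lact M s m = p s \<otimes>\<^bsub>C\<^esub> m" "ract M m c = m \<otimes>\<^bsub>C\<^esub> \<phi> (q c)"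
  "lact N c x = q c \<otimes>\<^bsub>B\<^esub> x" "ract N x t = x \<otimes>\<^bsub>B\<^esub> \<psi> (r t)"
  "lact L s m = p s \<otimes>\<^bsub>C\<^esub> m" "ract L m t = m \<otimes>\<^bsub>C\<^esub> \<phi> (\<psi> (r t))" for s m c x t
  by (simp_all add: M_def N_def L_def)
 have q' [simp]: "q c \<in> carrier B" if "c \<in> carrier R" for c using q that by blast
 note [simp] = p r
 have Madd [simp]: "m \<oplus>\<^bsub>C\<^esub> m' \<in> carrier M" if "m \<in> carrier M" "m' \<in> carrier M" for m m'
  using that by (auto simp: cM C.l_distr)
 have Nadd [simp]: "x \<oplus>\<^bsub>B\<^esub> x' \<in> carrier N" if "x \<in> carrier N" "x' \<in> carrier N" for x x'
  using that by (auto simp: cN B.l_distr)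
 have MR [simp]: "m \<otimes>\<^bsub>C\<^esub> \<phi> b \<in> carrier M" if "m \<in> carrier M" "b \<in> carrier B" for m b
  using that by (auto simp: cM C.m_assoc ph1)
 have NR [simp]: "b \<otimes>\<^bsub>B\<^esub> x \<in> carrier N" if "x \<in> carrier N" "b \<in> carrier B" for x b
  using that by (auto simp: cN B.m_assoc)
 have SM [simp]: "c \<otimes>\<^bsub>C\<^esub> m \<in> carrier M" if "m \<in> carrier M" "c \<in> carrier C" for m c
  using that by (auto simp: cM C.m_assoc)
 have NT [simp]: "x \<otimes>\<^bsub>B\<^esub> \<psi> a \<in> carrier N" if "x \<in> carrier N" "a \<in> carrier A" for x a
  using that by (auto simp: cN B.m_assoc uu)
 have uN [simp]: "u \<in> carrier N" using uu[of "\<one>\<^bsub>A\<^esub>"] by (simp add: cN flip: u_def)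
 have MC: "m \<in> carrier C" if "m \<in> carrier M" for m using that by (simp add: cM)
 have NB: "x \<in> carrier B" if "x \<in> carrier N" for x using that by (simp add: cN)
 have rels_cases: thesis
  if "z \<in> tensor_rels R M N"
   and "\<And>m m' x. m \<in> carrier M ==> m' \<in> carrier M ==> x \<in> carrier N ==>
     z = frag_of (m \<oplus>\<^bsub>C\<^esub> m', x) - frag_of (m, x) - frag_of (m', x) ==> thesis"
   and "\<And>m x x'. m \<in> carrier M ==> x \<in> carrier N ==> x' \<in> carrier N ==>
     z = frag_of (m, x \<oplus>\<^bsub>B\<^esub> x') - frag_of (m, x) - frag_of (m, x') ==> thesis"
   and "\<And>m b x. m \<in> carrier M ==> b \<in> carrier R ==> x \<in> carrier N ==>
     z = frag_of (m \<otimes>\<^bsub>C\<^esub> \<phi> (q b), x) - frag_of (m, q b \<otimes>\<^bsub>B\<^esub> x) ==> thesis" for z thesis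
 proof -
  note w = that
  from w(1) show thesis
   unfolding tensor_rels_def Un_iff
  proof (elim disjE, goal_cases)
   case 1
   then obtain m m' x where "m \<in> carrier M" "m' \<in> carrier M" "x \<in> carrier N"
    "z = frag_of (m \<oplus>\<^bsub>M\<^esub> m', x) - frag_of (m, x) - frag_of (m', x)" by blast
   thus ?case by (intro w(2)) simp_all
  next
   case 2
   then obtain m x x' where "m \<in> carrier M" "x \<in> carrier N" "x' \<in> carrier N"
    "z = frag_of (m, x \<oplus>\<^bsub>N\<^esub> x') - frag_of (m, x) - frag_of (m, x')" by blast
   thus ?case by (intro w(3)) simp_all
  next
   case 3
   then obtain m b x where "m \<in> carrier M" "b \<in> carrier R" "x \<in> carrier N"
    "z = frag_of (ract M m b, x) - frag_of (m, lact N b x)" by blast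
   thus ?case by (intro w(4)) simp_all
  qed
 qed
 have G: "group G" "comm_group G" by (simp_all add: G_def abelian_free_Abelian_group)
 interpret G: comm_group G by fact
 have cG: "z \<in> carrier G \<longleftrightarrow> keys z \<subseteq> carrier M \<times> carrier N" for z by (simp add: G_def)
 have keys_d: "keys (a - b) \<subseteq> X" if "keys a \<subseteq> X" "keys b \<subseteq> X"
  for a b :: "'c \<times> 'b \<Rightarrow>\<^sub>0 int" and X
  by (rule order_trans[OF keys_diff Un_least[OF that]])
 have "keys z \<subseteq> carrier M \<times> carrier N" if "z \<in> tensor_rels R M N" for z
  using that by (rule rels_cases) (simp_all add: keys_d)
 hence rels: "tensor_rels R M N \<subseteq> carrier G" by (auto simp: cG)
 have Hsub: "subgroup H G" unfolding H_def by (rule G.generate_is_subgroup[OF rels])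
 have Hn: "H \<lhd> G" by (simp add: Hsub G.normal_iff_subgroup)
 interpret H: normal H G by fact
 have HC: "h \<in> carrier G" if "h \<in> H" for h by (rule subgroup.mem_carrier[OF Hsub that])
 have H0: "0 \<in> H" using subgroup.one_closed[OF Hsub] unfolding G_def one_free_Abelian_group .
 have Hadd: "a + b \<in> H" if "a \<in> H" "b \<in> H" for a b
  using subgroup.m_closed[OF Hsub that] unfolding G_def mult_free_Abelian_group .
 have Hneg: "- a \<in> H" if "a \<in> H" for a
 proof -
  have "keys a \<subseteq> carrier M \<times> carrier N" using HC[OF that] unfolding cG .
  hence inv: "inv\<^bsub>G\<^esub> a = - a" unfolding G_def by (rule inv_free_Abelian_group)
  show ?thesis using subgroup.m_inv_closed[OF Hsub that] unfolding inv .
 qed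
 have Hdiff: "a - b \<in> H" if "a \<in> H" "b \<in> H" for a b using Hadd[OF that(1) Hneg[OF that(2)]] unfolding add_uminus_conv_diff .
 have relH: "z \<in> H" if "z \<in> tensor_rels R M N" for z unfolding H_def using that by (rule generate.incl)
 have r1: "frag_of (m \<oplus>\<^bsub>C\<^esub> m', x) - frag_of (m, x) - frag_of (m', x) \<in> H"
  if "m \<in> carrier M" "m' \<in> carrier M" "x \<in> carrier N" for m m' x
  by (rule relH, unfold tensor_rels_def, rule UnI1, rule UnI1, rule CollectI,
    rule exI[of _ m], rule exI[of _ m'], rule exI[of _ x]) (use that in simp)
 have r2: "frag_of (m, x \<oplus>\<^bsub>B\<^esub> x') - frag_of (m, x) - frag_of (m, x') \<in> H"
  if "m \<in> carrier M" "x \<in> carrier N" "x' \<in> carrier N" for m x x'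
  by (rule relH, unfold tensor_rels_def, rule UnI1, rule UnI2, rule CollectI,
    rule exI[of _ m], rule exI[of _ x], rule exI[of _ x']) (use that in simp)
 have r3: "frag_of (m \<otimes>\<^bsub>C\<^esub> \<phi> b, x) - frag_of (m, b \<otimes>\<^bsub>B\<^esub> x) \<in> H"
  if "m \<in> carrier M" "b \<in> carrier B" "x \<in> carrier N" for m b x
 proof -
  have "b \<in> q ` carrier R" unfolding q by (rule that)
  then obtain c where "c \<in> carrier R" "q c = b" by (elim imageE) simp
  thus ?thesis
   by (intro relH, unfold tensor_rels_def, intro UnI2, intro CollectI,
     intro exI[of _ m], intro exI[of _ c], intro exI[of _ x]) (use that in simp)
 qed
 have coset_eq: "H #>\<^bsub>G\<^esub> z = H #>\<^bsub>G\<^esub> z' \<longleftrightarrow> z - z' \<in> H" for z z'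
  using frag_coset_eq_iff[of H "carrier M \<times> carrier N"] Hsub by (simp add: G_def)
 \<comment> \<open>The actions on the tensor product are unions over representatives. They are
   single cosets because a linear extension that sends the relations into \<open>H\<close> preserves
   \<open>H\<close>.\<close>
 have ext_H: "frag_extend F z \<in> H"
  if F: "\<And>z. z \<in> tensor_rels R M N ==> frag_extend F z \<in> H" and "z \<in> H" for F z
  using that(2) unfolding H_def
 proof (induction z rule: generate.induct)
  case one thus ?case using H0 by (simp add: G_def H_def)
 next
  case (incl h) thus ?case using F by (simp add: H_def)
 next
  case (inv h)
  hence "inv\<^bsub>G\<^esub> h = - h" using rels by (auto simp: G_def)
  thus ?case using Hneg[OF F[OF inv]] by (simp add: frag_extend_minus H_def)
 next
  case (eng a b) thus ?case using Hadd by (simp add: G_def H_def frag_extend_add)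
 qed
 have Ul: "(\<Union>z\<in>H #>\<^bsub>G\<^esub> z0. H #>\<^bsub>G\<^esub> frag_extend F z) = H #>\<^bsub>G\<^esub> frag_extend F z0"
  if F: "\<And>z. z \<in> tensor_rels R M N ==> frag_extend F z \<in> H" for F z0
 proof -
  have "H #>\<^bsub>G\<^esub> frag_extend F z = H #>\<^bsub>G\<^esub> frag_extend F z0" if "z \<in> H #>\<^bsub>G\<^esub> z0" for z
  proof -
   have "\<exists>h\<in>H. z = h + z0" using that by (auto simp: r_coset_def G_def)
   then obtain h where "h \<in> H" "z = h + z0" by blast
   thus ?thesis using ext_H[OF F] by (simp add: coset_eq frag_extend_add)
  qed
  moreover have "z0 \<in> H #>\<^bsub>G\<^esub> z0" using H0 by (force simp: r_coset_def G_def)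
  ultimately show ?thesis by blast
 qed
 define TT where "TT = tensor R M N"
 have TT: "carrier TT = carrier (G Mod H)" "X \<oplus>\<^bsub>TT\<^esub> Y = X \<otimes>\<^bsub>G Mod H\<^esub> Y"
  "lact TT s X = (\<Union>z\<in>X. H #>\<^bsub>G\<^esub> frag_extend (\<lambda>(m, x). frag_of (lact M s m, x)) z)"
  "ract TT X t = (\<Union>z\<in>X. H #>\<^bsub>G\<^esub> frag_extend (\<lambda>(m, x). frag_of (m, ract N x t)) z)" for X Y s t
  by (simp_all add: TT_def tensor_def Let_def G_def H_def)
 have lactT: "lact TT s (H #>\<^bsub>G\<^esub> frag_of (m, x)) = H #>\<^bsub>G\<^esub> frag_of (p s \<otimes>\<^bsub>C\<^esub> m, x)"
  if s: "s \<in> carrier S" for s m x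
  unfolding TT
 proof (subst Ul)
  fix z assume "z \<in> tensor_rels R M N"
  thus "frag_extend (\<lambda>(m, x). frag_of (lact M s m, x)) z \<in> H"
  proof (rule rels_cases, goal_cases)
   case 1 thus ?thesis using s by (auto simp: frag_extend_diff C.r_distr MC intro!: r1)
  next
   case 2 thus ?thesis using s by (auto simp: frag_extend_diff intro!: r2)
  next
   case 3 thus ?thesis using s by (auto simp: frag_extend_diff MC C.m_assoc[symmetric] intro!: r3)
  qed
 qed simp
 have ractT: "ract TT (H #>\<^bsub>G\<^esub> frag_of (m, x)) t = H #>\<^bsub>G\<^esub> frag_of (m, x \<otimes>\<^bsub>B\<^esub> \<psi> (r t))"
  if t: "t \<in> carrier T" for t m x
  unfolding TT
 proof (subst Ul)
  fix z assume "z \<in> tensor_rels R M N"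
  thus "frag_extend (\<lambda>(m, x). frag_of (m, ract N x t)) z \<in> H"
  proof (rule rels_cases, goal_cases)
   case 1 thus ?thesis using t by (auto simp: frag_extend_diff intro!: r1)
  next
   case 2 thus ?thesis using t by (auto simp: frag_extend_diff B.l_distr NB intro!: r2)
  next
   case 3 thus ?thesis using t by (auto simp: frag_extend_diff NB B.m_assoc intro!: r3)
  qed
 qed simp
 \<comment> \<open>\<open>g\<close> is the map m \<otimes> x to m \<phi>(x), built on the free
   abelian group; it descends because it kills each of the three kinds of relations.\<close>
 have "(\<lambda>(m, x). m \<otimes>\<^bsub>C\<^esub> \<phi> x) ` (carrier M \<times> carrier N) \<subseteq> carrier C"
  by (auto simp: MC NB)
 from C.add.free_Abelian_group_universal[OF this] obtain g where "g \<in> hom (free_Abelian_group (carrier M \<times> carrier N)) (add_monoid C)"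
  and gf': "\<And>y. y \<in> carrier M \<times> carrier N ==> g (frag_of y) = (case y of (m, x) => m \<otimes>\<^bsub>C\<^esub> \<phi> x)"
  by metis
 hence g: "g \<in> hom G (add_monoid C)" unfolding G_def by metis
 have gf: "g (frag_of (m, x)) = m \<otimes>\<^bsub>C\<^esub> \<phi> x" if "m \<in> carrier M" "x \<in> carrier N" for m x
  using gf'[of "(m, x)"] that by simp
 interpret g: group_hom G "add_monoid C" g by unfold_locales (rule g)
 have g_add: "g (a + b) = g a \<oplus>\<^bsub>C\<^esub> g b" if "a \<in> carrier G" "b \<in> carrier G" for a b
  using g.hom_mult[OF that] by (simp add: G_def)
 have g_neg: "g (- a) = \<ominus>\<^bsub>C\<^esub> g a" if "a \<in> carrier G" for a
  using g.hom_inv[OF that] that by (simp add: G_def a_inv_def)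
 have negG: "- a \<in> carrier G" if "a \<in> carrier G" for a using that by (simp add: cG)
 have g_diff: "g (a - b) = g a \<ominus>\<^bsub>C\<^esub> g b" if "a \<in> carrier G" "b \<in> carrier G" for a b
  using g_add[OF that(1) negG[OF that(2)]] g_neg[OF that(2)] by (simp add: a_minus_def)
 have diffG: "a - b \<in> carrier G" if "a \<in> carrier G" "b \<in> carrier G" for a b
  using that keys_diff by (fastforce simp: cG)
 have fG: "frag_of (m, x) \<in> carrier G" if "m \<in> carrier M" "x \<in> carrier N" for m x
  using that by (simp add: cG)
 have C_cancel: "a \<oplus>\<^bsub>C\<^esub> b \<ominus>\<^bsub>C\<^esub> a \<ominus>\<^bsub>C\<^esub> b = \<zero>\<^bsub>C\<^esub>" if "a \<in> carrier C" "b \<in> carrier C" for a b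
 proof -
  have "a \<oplus>\<^bsub>C\<^esub> b \<ominus>\<^bsub>C\<^esub> a = b"
   using that by (simp add: C.a_comm[of a b] C.a_assoc C.minus_eq C.r_neg)
  thus ?thesis using that by (simp add: C.minus_eq C.r_neg)
 qed
 have g_rel: "g z = \<zero>\<^bsub>C\<^esub>" if "z \<in> tensor_rels R M N" for z
  using that
 proof (rule rels_cases, goal_cases)
  case 1 thus ?thesis
   by (simp add: g_diff diffG fG gf MC NB C.l_distr C_cancel)
 next
  case 2 thus ?thesis
   by (simp add: g_diff diffG fG gf MC NB phi_add C.r_distr C_cancel)
 next
  case 3 thus ?thesis
   by (simp add: g_diff diffG fG gf MC NB phi_mult C.m_assoc C.minus_eq C.r_neg)
 qed
 have g_H: "g z = \<zero>\<^bsub>C\<^esub>" if "z \<in> H" for z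
 proof -
  have "tensor_rels R M N \<subseteq> kernel G (add_monoid C) g" using rels g_rel by (auto simp: kernel_def)
  hence "H \<subseteq> kernel G (add_monoid C) g"
   unfolding H_def by (rule G.generate_subgroup_incl[OF _ g.subgroup_kernel])
  thus ?thesis using that by (auto simp: kernel_def)
 qed
 define h where "h m = H #>\<^bsub>G\<^esub> frag_of (m, u)" for m
 have LC: "m \<in> carrier C" "m \<otimes>\<^bsub>C\<^esub> \<phi> u = m" "m \<in> carrier M" if m: "m \<in> carrier L" for m
 proof -
  show "m \<in> carrier M" using LM m by (rule subsetD)
  show "m \<in> carrier C" "m \<otimes>\<^bsub>C\<^esub> \<phi> u = m" using m unfolding cL mem_Collect_eq by simp_all
 qed
 have Lphi: "m \<otimes>\<^bsub>C\<^esub> \<phi> x \<in> carrier L" if m: "m \<in> carrier M" and x: "x \<in> carrier N" for m x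
 proof -
  have x': "x \<in> carrier B" "x \<otimes>\<^bsub>B\<^esub> u = x" using x unfolding cN by simp_all
  have "m \<otimes>\<^bsub>C\<^esub> \<phi> x \<otimes>\<^bsub>C\<^esub> \<phi> u = m \<otimes>\<^bsub>C\<^esub> \<phi> (x \<otimes>\<^bsub>B\<^esub> u)"
   using MC[OF m] x'(1) phi_mult[OF x'(1) u] by (simp add: C.m_assoc)
  thus ?thesis using MC[OF m] x' unfolding cL by simp
 qed
 have Ladd: "a \<oplus>\<^bsub>C\<^esub> b \<in> carrier L" if "a \<in> carrier L" "b \<in> carrier L" for a b
  using that by (auto simp: cL C.l_distr)
 have Lneg: "\<ominus>\<^bsub>C\<^esub> a \<in> carrier L" if "a \<in> carrier L" for a
  using that by (auto simp: cL C.l_minus)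
 have L0: "\<zero>\<^bsub>C\<^esub> \<in> carrier L" by (auto simp: cL)
 \<comment> \<open>Modulo \<open>H\<close> every element is m \<otimes> u with m = g z. On
   generators this is balancing together with x u = x; differences need the biadditivity relation,
   since \<open>frag_of\<close> itself is not additive.\<close>
 have surj: "g z \<in> carrier L \<and> z - frag_of (g z, u) \<in> H" if "keys z \<subseteq> carrier M \<times> carrier N" for z
 proof -
  have "z \<in> carrier G \<and> g z \<in> carrier L \<and> z - frag_of (g z, u) \<in> H"
   using that
  proof (induction z rule: frag_induction)
   case zero
   have "g 0 = \<zero>\<^bsub>C\<^esub>" using g_H[OF H0] .
   thus ?case using r1[OF LC(3)[OF L0] LC(3)[OF L0] uN] H0 HC L0 by simp
  next
   case (diff a b)
   let ?f = "\<lambda>m. frag_of (m, u)"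
   have d: "g (a - b) = g a \<ominus>\<^bsub>C\<^esub> g b" "g (a - b) \<in> carrier L"
    using diff g_diff Ladd Lneg by (auto simp: a_minus_def)
   have "g (a - b) \<oplus>\<^bsub>C\<^esub> g b = g a"
    using diff LC by (simp add: d a_minus_def C.a_assoc C.l_neg)
   hence "?f (g a) - ?f (g (a - b)) - ?f (g b) \<in> H"
    using r1[OF LC(3)[OF d(2)], of "g b" u] diff LC uN by metis
   hence "(a - ?f (g a)) - (b - ?f (g b)) + (?f (g a) - ?f (g (a - b)) - ?f (g b)) \<in> H"
    using diff Hdiff Hadd by blast
   thus ?case using diff d diffG by (simp add: algebra_simps)
  next
   case (one a)
   then obtain m x where a: "a = (m, x)" "m \<in> carrier M" "x \<in> carrier N" by auto
   have "frag_of (m \<otimes>\<^bsub>C\<^esub> \<phi> x, u) - frag_of (m, x \<otimes>\<^bsub>B\<^esub> u) \<in> H" using a NB by (intro r3) auto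
   from Hneg[OF this] show ?case using a Lphi fG by (simp add: gf cN)
  qed
  thus ?thesis by simp
 qed
 have "bij_betw h (carrier L) (carrier TT)"
  unfolding bij_betw_def
 proof
  show "inj_on h (carrier L)"
  proof (rule inj_onI)
   fix a b assume ab: "a \<in> carrier L" "b \<in> carrier L" "h a = h b"
   hence "g (frag_of (a, u) - frag_of (b, u)) = \<zero>\<^bsub>C\<^esub>" by (intro g_H) (simp add: h_def coset_eq)
   hence "a \<ominus>\<^bsub>C\<^esub> b = \<zero>\<^bsub>C\<^esub>" using ab LC by (simp add: g_diff fG gf)
   thus "a = b" using ab LC by simp
  qed
  show "h ` carrier L = carrier TT"
  proof
   show "h ` carrier L \<subseteq> carrier TT"
   proof (rule image_subsetI)
    fix m assume "m \<in> carrier L"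
    from fG[OF LC(3)[OF this] uN] show "h m \<in> carrier TT"
     unfolding TT FactGroup_def RCOSETS_def h_def by auto
   qed
   show "carrier TT \<subseteq> h ` carrier L"
   proof
    fix X assume "X \<in> carrier TT"
    then obtain z where z: "z \<in> carrier G" "X = H #>\<^bsub>G\<^esub> z"
     unfolding TT FactGroup_def RCOSETS_def by auto
    hence "X = h (g z)" "g z \<in> carrier L" using surj[of z] by (auto simp: cG h_def coset_eq)
    thus "X \<in> h ` carrier L" by blast
   qed
  qed
 qed
 moreover have "h (x \<oplus>\<^bsub>L\<^esub> y) = h x \<oplus>\<^bsub>TT\<^esub> h y" if "x \<in> carrier L" "y \<in> carrier L" for x y
 proof -
  have "h x \<oplus>\<^bsub>TT\<^esub> h y = H #>\<^bsub>G\<^esub> (frag_of (x, u) + frag_of (y, u))"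
   using H.rcos_sum[of "frag_of (x, u)" "frag_of (y, u)"] that LC fG by (simp add: TT h_def FactGroup_def) (simp add: G_def)
  also have "\<dots> = h (x \<oplus>\<^bsub>L\<^esub> y)"
   using Hneg[OF r1[of x y u]] that LC by (simp add: h_def coset_eq algebra_simps)
  finally show ?thesis by simp
 qed
 moreover have "h (lact L s x) = lact TT s (h x)" if "s \<in> carrier S" "x \<in> carrier L" for s x
  using that lactT by (simp add: h_def)
 moreover have "h (ract L x t) = ract TT (h x) t" if "t \<in> carrier T" "x \<in> carrier L" for t x
  using that ractT r3[of x "\<psi> (r t)" u] LC by (simp add: h_def coset_eq uu)
 ultimately show ?thesis
  unfolding bimodule_isomorphic_def bimodule_iso_def L_def[symmetric] M_def[symmetric] N_def[symmetric] TT_def[symmetric]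
  by blast
qed

section \<open>The path algebra\<close>

lemma finite_vertices [simp]: "finite (vertices n k)"
 by (rule finite_subset[of _ "Pow {0..n}"]) (auto simp: vertices_def)

lemma vertices_finite: "x \<in> vertices n k ==> finite x"
 unfolding vertices_def using finite_subset by auto

lemma inter_pair_iff:
 assumes "1 \<le> (i::nat)"
 shows "x \<inter> {i - 1, i} = {i - 1} \<longleftrightarrow> i - 1 \<in> x \<and> i \<notin> x"
  and "x \<inter> {i - 1, i} = {i} \<longleftrightarrow> i - 1 \<notin> x \<and> i \<in> x"
proof -
 have "i - 1 \<noteq> i" "i \<noteq> i - 1" using assms by simp_all
 thus "x \<inter> {i - 1, i} = {i - 1} \<longleftrightarrow> i - 1 \<in> x \<and> i \<notin> x"
  "x \<inter> {i - 1, i} = {i} \<longleftrightarrow> i - 1 \<notin> x \<and> i \<in> x"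
  by (cases "i - 1 \<in> x"; cases "i \<in> x"; simp add: Int_insert_right)+
qed

text \<open>Membership conditions replace the intersections of the definition in the simplifier. At
  i = 0 truncated subtraction makes i - 1 and i coincide, and the two forms agree there because the
  range condition fails in both.\<close>

lemma arrow_target_move:
 "arrow_target n (AR i) x = (if 1 \<le> i \<and> i \<le> n \<and> i - 1 \<in> x \<and> i \<notin> x then Some (insert i (x - {i - 1})) else None)"
 "arrow_target n (AL i) x = (if 1 \<le> i \<and> i \<le> n \<and> i - 1 \<notin> x \<and> i \<in> x then Some (insert (i - 1) (x - {i})) else None)"
 by (cases "1 \<le> i"; simp only: arrow_target.simps atLeastAtMost_iff inter_pair_iff simp_thms if_False)+

declare arrow_target.simps(1,2) [simp del] arrow_target_move [simp]

lemma arrow_target_vertices: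
 assumes "x \<in> vertices n k" "arrow_target n a x = Some y" shows "y \<in> vertices n k"
proof -
 have fin: "finite x" using assms(1) by (rule vertices_finite)
 have move: "insert j (x - {i}) \<in> vertices n k" if "i \<in> x" "j \<notin> x" "j \<le> n" for i j
 proof -
  have "card (insert j (x - {i})) = card x"
   using fin that by (metis Diff_iff card.insert card.remove finite_Diff)
  thus ?thesis using assms(1) that unfolding vertices_def by auto
 qed
 show ?thesis
  using assms by (cases a) (auto split: if_splits intro!: move)
qed

lemma walk_append:
 "walk n x (u @ v) = (case walk n x u of None => None | Some y => walk n y v)"
 by (induction u arbitrary: x) (auto split: option.splits)

lemma walk_vertices: "x \<in> vertices n k ==> walk n x w = Some y ==> y \<in> vertices n k"
 by (induction w arbitrary: x) (auto split: option.splits dest: arrow_target_vertices)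

abbreviation pmult :: "nat => (path \<Rightarrow>\<^sub>0 int) => (path \<Rightarrow>\<^sub>0 int) => path \<Rightarrow>\<^sub>0 int" where
 "pmult n g h \<equiv> frag_extend (\<lambda>p. frag_extend (path_comp n p) h) g"

lemma path_alg_sel [simp]:
 "g \<in> carrier (path_alg n k) \<longleftrightarrow> keys g \<subseteq> paths n k"
 "g \<otimes>\<^bsub>path_alg n k\<^esub> h = pmult n g h" "\<zero>\<^bsub>path_alg n k\<^esub> = 0"
 "g \<oplus>\<^bsub>path_alg n k\<^esub> h = g + h" "\<one>\<^bsub>path_alg n k\<^esub> = (\<Sum>x\<in>vertices n k. frag_of (x, []))"
 by (simp_all add: path_alg_def)

lemma frag_extend_zero_fun [simp]: "frag_extend (\<lambda>p. 0) c = 0"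
 by (rule frag_extend_eq_0) simp

lemma frag_extend_diff_fun: "frag_extend (\<lambda>p. f p - g p) c = frag_extend f c - frag_extend g c"
 using subset_UNIV[of "keys c"] by (induction c rule: frag_induction) (auto simp: frag_extend_diff)

lemma frag_extend_add_fun: "frag_extend (\<lambda>p. f p + g p) c = frag_extend f c + frag_extend g c"
 using subset_UNIV[of "keys c"] by (induction c rule: frag_induction) (auto simp: frag_extend_diff)

lemma pmult_diff:
 "pmult n (g - g') h = pmult n g h - pmult n g' h" "pmult n g (h - h') = pmult n g h - pmult n g h'"
 by (simp_all add: frag_extend_diff frag_extend_diff_fun)

lemma pmult_add:
 "pmult n (g + g') h = pmult n g h + pmult n g' h" "pmult n g (h + h') = pmult n g h + pmult n g h'"
 by (simp_all add: frag_extend_add frag_extend_add_fun)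

lemma pmult_zero [simp]: "pmult n 0 h = 0" "pmult n g 0 = 0"
 by simp (metis pmult_diff(2) diff_self)

lemma pmult_frag: "pmult n (frag_of p) (frag_of q) = path_comp n p q"
 by simp

lemma path_comp_keys:
 assumes "p \<in> paths n k" "q \<in> paths n k" shows "keys (path_comp n p q) \<subseteq> paths n k"
 using assms by (auto simp: path_comp_def paths_def walk_append split: option.splits)

text \<open>On three single paths both bracketings are the concatenation, or 0 when some ends do not
  meet; linearity is then used in one argument at a time.\<close>

lemma pmult_assoc: "pmult n (pmult n f g) h = pmult n f (pmult n g h)"
proof -
 have gen: "pmult n (path_comp n p q) (frag_of r) = pmult n (frag_of p) (path_comp n q r)" for p q r
  by (auto simp: path_comp_def walk_append frag_extend_eq_0 split: option.splits)
 have 1: "pmult n (path_comp n p q) h = pmult n (frag_of p) (pmult n (frag_of q) h)" for p q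
  using subset_UNIV
 proof (induction h rule: frag_induction)
  case (one r) thus ?case using gen[where p=p and q=q and r=r] by simp
 next
  case (diff a b) thus ?case by (simp only: pmult_diff)
 qed simp
 have 2: "pmult n (pmult n (frag_of p) g) h = pmult n (frag_of p) (pmult n g h)" for p
  using subset_UNIV
 proof (induction g rule: frag_induction)
  case (one r) thus ?case using 1[where p=p and q=r] by simp
 next
  case (diff a b) thus ?case by (simp only: pmult_diff)
 qed simp
 show ?thesis
  using subset_UNIV
 proof (induction f rule: frag_induction)
  case (one r) thus ?case using 2[where p=r] by simp
 next
  case (diff a b) thus ?case by (simp only: pmult_diff)
 qed simp
qed

text \<open>Of all trivial paths exactly one composes with a given path on each side, the one at its
  source or at its target.\<close>

lemma path_unit:
 assumes "keys g \<subseteq> paths n k"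
 shows "pmult n (\<Sum>x\<in>vertices n k. frag_of (x, [])) g = g"
  and "pmult n g (\<Sum>x\<in>vertices n k. frag_of (x, [])) = g"
proof -
 have 1: "pmult n (\<Sum>x\<in>vertices n k. frag_of (x, [])) (frag_of p) = frag_of p" if "p \<in> paths n k" for p
 proof -
  have "(\<Sum>x\<in>vertices n k. path_comp n (x, []) p) = (\<Sum>x\<in>{fst p}. path_comp n (x, []) p)"
   using that by (intro sum.mono_neutral_right) (auto simp: path_comp_def paths_def)
  thus ?thesis by (simp add: frag_extend_sum o_def) (simp add: path_comp_def)
 qed
 show "pmult n (\<Sum>x\<in>vertices n k. frag_of (x, [])) g = g"
  using assms by (induction g rule: frag_induction) (simp_all only: pmult_diff pmult_zero 1)
 have 2: "pmult n (frag_of p) (\<Sum>x\<in>vertices n k. frag_of (x, [])) = frag_of p" if p: "p \<in> paths n k" for p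
 proof -
  obtain y where y: "walk n (fst p) (snd p) = Some y" "y \<in> vertices n k"
   using p walk_vertices by (fastforce simp: paths_def)
  have "(\<Sum>x\<in>vertices n k. path_comp n p (x, [])) = (\<Sum>x\<in>{y}. path_comp n p (x, []))"
   using y by (intro sum.mono_neutral_right) (auto simp: path_comp_def)
  thus ?thesis using y by (simp add: frag_extend_sum o_def) (simp add: path_comp_def)
 qed
 show "pmult n g (\<Sum>x\<in>vertices n k. frag_of (x, [])) = g"
  using assms by (induction g rule: frag_induction) (simp_all only: pmult_diff pmult_zero 2)
qed

lemma keys_diff_subset: "keys a \<subseteq> X ==> keys b \<subseteq> X ==> keys (a - b) \<subseteq> X"
 for a b :: "'a \<Rightarrow>\<^sub>0 int"
 using keys_diff[of a b] by blast

lemma keys_add_subset: "keys a \<subseteq> X ==> keys b \<subseteq> X ==> keys (a + b) \<subseteq> X"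
 for a b :: "'a \<Rightarrow>\<^sub>0 int"
 using Poly_Mapping.keys_add[of a b] by blast

lemma keys_frag_extend_subset:
 assumes "\<And>p. p \<in> keys g ==> keys (f p) \<subseteq> X"
 shows "keys (frag_extend f g) \<subseteq> X"
 using keys_frag_extend[of f g] assms by blast

lemma pmult_keys:
 assumes "keys g \<subseteq> paths n k" "keys h \<subseteq> paths n k"
 shows "keys (pmult n g h) \<subseteq> paths n k"
 by (intro keys_frag_extend_subset path_comp_keys) (use assms in auto)

lemma path_alg_ring: "ring (path_alg n k)"
proof (rule ringI)
 show "abelian_group (path_alg n k)"
 proof (rule abelian_groupI)
  fix g assume "g \<in> carrier (path_alg n k)"
  thus "\<exists>h\<in>carrier (path_alg n k). h \<oplus>\<^bsub>path_alg n k\<^esub> g = \<zero>\<^bsub>path_alg n k\<^esub>"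
   by (intro bexI[of _ "- g"]) auto
 qed (auto simp: keys_add_subset add.assoc add.commute)
 show "Group.monoid (path_alg n k)"
 proof (rule monoidI)
  show "\<one>\<^bsub>path_alg n k\<^esub> \<in> carrier (path_alg n k)"
   using keys_sum[of "\<lambda>x. frag_of (x, [])" "vertices n k"] by (fastforce simp: paths_def)
 qed (simp_all only: path_alg_sel pmult_keys path_unit pmult_assoc)
qed (simp_all add: pmult_add)

section \<open>Crossing numbers and vanishing monomials\<close>

fun ix :: "arrow => nat" where
 "ix (AR i) = i" | "ix (AL i) = i" | "ix (AU i) = i"

fun wt :: "arrow => nat" where
 "wt (AR i) = 1" | "wt (AL i) = 1" | "wt (AU i) = 2"

text \<open>Twice the exponent of \<open>u\<^sub>i\<close> contributed by a word: an arrow \<open>R\<^sub>i\<close> or \<open>L\<^sub>i\<close> counts one half.\<close>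

definition cnt :: "arrow list => nat => nat" where
 "cnt w i = (\<Sum>a\<leftarrow>w. if ix a = i then wt a else 0)"

lemma cnt_simps [simp]: "cnt [] i = 0" "cnt (a # w) i = (if ix a = i then wt a else 0) + cnt w i"
 "cnt (u @ v) i = cnt u i + cnt v i"
 by (simp_all add: cnt_def)

lemma cnt_append: "cnt (u @ v) = (\<lambda>i. cnt u i + cnt v i)"
 by (rule ext) simp

lemma wt_pos [simp]: "0 < wt a" by (cases a) auto

lemma cnt_pos_iff: "0 < cnt w i \<longleftrightarrow> i \<in> ix ` set w"
 by (induction w) auto

text \<open>A monomial with support \<open>Z\<close> kills the vertex \<open>x\<close> when it contains all steps between two unoccupied
 positions.\<close>

definition bad :: "nat => nat set => nat set => bool" where
 "bad n x Z \<longleftrightarrow> (\<exists>a b. a < b \<and> b \<le> n \<and> a \<notin> x \<and> b \<notin> x \<and> {a<..b} \<subseteq> Z)"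

lemma bad_mono: "bad n x Z ==> Z \<subseteq> Z' ==> bad n x Z'"
 unfolding bad_def by blast

lemma badI: "a < b ==> b \<le> n ==> a \<notin> x ==> b \<notin> x ==> {a<..b} \<subseteq> Z ==> bad n x Z"
 unfolding bad_def by blast

text \<open>Moving an element from i - 1 to i moves the hole from i to i - 1. An interval ending at
  i loses its last step, one starting at i gains the step i, which lies in \<open>Z\<close>, and all
  other intervals keep their ends.\<close>

lemma bad_right:
 assumes "bad n x Z" "i \<in> Z" "1 \<le> i" "i \<le> n" "i - 1 \<in> x" "i \<notin> x"
 shows "bad n (insert i (x - {i - 1})) Z"
proof -
 obtain a b where ab: "a < b" "b \<le> n" "a \<notin> x" "b \<notin> x" "{a<..b} \<subseteq> Z"
  using assms(1) by (auto simp: bad_def)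
 consider "b = i" | "a = i" | "a \<noteq> i" "b \<noteq> i" by blast
 thus ?thesis
 proof cases
  case 1
  hence "a \<noteq> i - 1" using ab assms by metis
  moreover have "{a<..i - 1} \<subseteq> {a<..b}" using 1 by auto
  hence "{a<..i - 1} \<subseteq> Z" using ab(5) by (rule order_trans)
  ultimately show ?thesis using 1 ab assms by (intro badI[of a "i - 1"]) auto
 next
  case 2
  have "{i - 1<..b} \<subseteq> insert i {i<..b}" by auto
  with 2 ab assms show ?thesis by (intro badI[of "i - 1" b]) auto
 next
  case 3
  with ab assms show ?thesis by (intro badI[of a b]) auto
 qed
qed

lemma bad_left:
 assumes "bad n x Z" "i \<in> Z" "1 \<le> i" "i \<le> n" "i - 1 \<notin> x" "i \<in> x"
 shows "bad n (insert (i - 1) (x - {i})) Z"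
proof -
 obtain a b where ab: "a < b" "b \<le> n" "a \<notin> x" "b \<notin> x" "{a<..b} \<subseteq> Z"
  using assms(1) by (auto simp: bad_def)
 consider "b = i - 1" | "a = i - 1" | "a \<noteq> i - 1" "b \<noteq> i - 1" by blast
 thus ?thesis
 proof cases
  case 1
  have "{a<..i} \<subseteq> insert i {a<..i - 1}" by auto
  with 1 ab assms show ?thesis by (intro badI[of a i]) auto
 next
  case 2
  hence "b \<noteq> i" using ab assms by metis
  moreover have "{i<..b} \<subseteq> {a<..b}" using 2 by auto
  hence "{i<..b} \<subseteq> Z" using ab(5) by (rule order_trans)
  ultimately show ?thesis using 2 ab assms by (intro badI[of i b]) auto
 next
  case 3
  with ab assms show ?thesis by (intro badI[of a b]) auto
 qed
qed

lemma bad_step: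
 assumes "arrow_target n a x = Some y" "ix a \<in> Z"
 shows "bad n x Z \<longleftrightarrow> bad n y Z"
proof (cases a)
 case (AR i)
 hence i: "1 \<le> i" "i \<le> n" "i - 1 \<in> x" "i \<notin> x" "y = insert i (x - {i - 1})"
  using assms by (auto split: if_splits)
 hence x: "insert (i - 1) (y - {i}) = x" "i - 1 \<notin> y" "i \<in> y" by auto
 have Z: "i \<in> Z" using assms AR by simp
 show ?thesis
 proof
  show "bad n y Z" if "bad n x Z" unfolding i(5) using that Z i(1-4) by (rule bad_right)
  show "bad n x Z" if "bad n y Z" using bad_left[OF that Z i(1,2) x(2,3)] unfolding x(1) .
 qed
next
 case (AL i)
 hence i: "1 \<le> i" "i \<le> n" "i - 1 \<notin> x" "i \<in> x" "y = insert (i - 1) (x - {i})"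
  using assms by (auto split: if_splits)
 hence x: "insert i (y - {i - 1}) = x" "i - 1 \<in> y" "i \<notin> y" by auto
 have Z: "i \<in> Z" using assms AL by simp
 show ?thesis
 proof
  show "bad n y Z" if "bad n x Z" unfolding i(5) using that Z i(1-4) by (rule bad_left)
  show "bad n x Z" if "bad n y Z" using bad_right[OF that Z i(1,2) x(2,3)] unfolding x(1) .
 qed
qed (use assms in \<open>auto split: if_splits\<close>)

text \<open>Crossing a step of \<open>Z\<close> preserves badness, so the vanishing of a monomial
  can be tested at either end of a path. This is what makes the kernel of \<open>nfe n\<close> a
  two-sided ideal.\<close>

lemma bad_walk:
 "walk n x w = Some y ==> ix ` set w \<subseteq> Z ==> bad n x Z \<longleftrightarrow> bad n y Z"
proof (induction w arbitrary: x)
 case (Cons a w)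
 then obtain x' where "arrow_target n a x = Some x'" "walk n x' w = Some y" by (auto split: option.splits)
 thus ?case using Cons bad_step by auto
qed simp

text \<open>The normal form of a path: its end points and the exponents of the monomial, or 0 if the monomial
 kills its initial vertex. The path ideal will turn out to be the kernel of this map.\<close>

definition nf :: "nat => path => (nat set \<times> nat set \<times> (nat => nat)) \<Rightarrow>\<^sub>0 int" where
 "nf n = (\<lambda>(x, w). if bad n x (ix ` set w) then 0 else frag_of (x, the (walk n x w), cnt w))"

abbreviation nfe :: "nat => (path \<Rightarrow>\<^sub>0 int) => (nat set \<times> nat set \<times> (nat => nat)) \<Rightarrow>\<^sub>0 int" where
 "nfe n \<equiv> frag_extend (nf n)"

definition nf_ideal :: "nat => nat => (path \<Rightarrow>\<^sub>0 int) set" where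
 "nf_ideal n k = {g. keys g \<subseteq> paths n k \<and> nfe n g = 0}"

text \<open>The normal form of a composite depends on the second factor only through the normal form
  of that factor. When the latter is 0, \<open>bad_walk\<close> carries the bad interval back to the
  source of the first factor.\<close>

lemma nf_comp_left:
 assumes q: "q \<in> paths n k" and p: "p \<in> paths n k"
 shows "nfe n (path_comp n q p) = frag_extend (\<lambda>(x, z, c).
  if walk n (fst q) (snd q) = Some x \<and> \<not> bad n (fst q) (ix ` set (snd q) \<union> {i. 0 < c i})
  then frag_of (fst q, z, \<lambda>i. cnt (snd q) i + c i) else 0) (nf n p)"
proof -
 obtain x w where p': "p = (x, w)" by (cases p)
 obtain x0 u where q': "q = (x0, u)" by (cases q)
 obtain y where y: "walk n x0 u = Some y" using q q' by (auto simp: paths_def)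
 have un: "ix ` set (u @ w) = ix ` set u \<union> ix ` set w" by auto
 have "bad n x0 (ix ` set u \<union> ix ` set w)" if "bad n y (ix ` set w)"
  using bad_walk[OF y, of "ix ` set u \<union> ix ` set w"] bad_mono[OF that] by auto
 thus ?thesis using y un
  by (auto simp: p' q' path_comp_def nf_def walk_append cnt_pos_iff cnt_append simp del: set_append)
qed

lemma nf_comp_right:
 assumes q: "q \<in> paths n k" and p: "p \<in> paths n k"
 shows "nfe n (path_comp n p q) = frag_extend (\<lambda>(x, z, c).
  if z = fst q \<and> \<not> bad n x ({i. 0 < c i} \<union> ix ` set (snd q))
  then frag_of (x, the (walk n (fst q) (snd q)), \<lambda>i. c i + cnt (snd q) i) else 0) (nf n p)"
proof -
 obtain x w where p': "p = (x, w)" by (cases p)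
 obtain x0 u where q': "q = (x0, u)" by (cases q)
 obtain y where y: "walk n x w = Some y" using p p' by (auto simp: paths_def)
 have un: "ix ` set (w @ u) = ix ` set w \<union> ix ` set u" by auto
 have "bad n x (ix ` set w \<union> ix ` set u)" if "bad n x (ix ` set w)"
  using bad_mono[OF that] by auto
 thus ?thesis using y un
  by (auto simp: p' q' path_comp_def nf_def walk_append cnt_pos_iff cnt_append simp del: set_append)
qed

lemma frag_extend_linear:
 assumes "\<And>p. p \<in> keys g ==> F (frag_of p) = G (frag_of p)"
  and "F 0 = 0" "G 0 = 0" "\<And>a b. F (a - b) = F a - F b" "\<And>a b. G (a - b) = G a - G b"
 shows "F g = G g"
 using order_refl[of "keys g"] by (induction g rule: frag_induction) (use assms in auto)

lemma nf_ideal_ideal: "ideal (nf_ideal n k) (path_alg n k)"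
proof (rule idealI[OF path_alg_ring])
 interpret ring "path_alg n k" by (rule path_alg_ring)
 have neg: "\<ominus>\<^bsub>path_alg n k\<^esub> g = - g" if "keys g \<subseteq> paths n k" for g
  using that by (intro minus_equality) auto
 show "subgroup (nf_ideal n k) (add_monoid (path_alg n k))"
 proof
  fix g assume "g \<in> nf_ideal n k"
  thus "inv\<^bsub>add_monoid (path_alg n k)\<^esub> g \<in> nf_ideal n k"
   using neg by (simp add: nf_ideal_def a_inv_def frag_extend_minus)
 qed (auto simp: nf_ideal_def frag_extend_add keys_add_subset)
next
 fix g h assume g: "g \<in> nf_ideal n k" and h: "h \<in> carrier (path_alg n k)"
 have gk: "keys g \<subseteq> paths n k" "nfe n g = 0" using g by (auto simp: nf_ideal_def)
 have hk: "keys h \<subseteq> paths n k" using h by simp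
 have 1: "nfe n (pmult n (frag_of q) g) = 0" if q: "q \<in> paths n k" for q
 proof -
  let ?T = "frag_extend (\<lambda>(x, z, c).
   if walk n (fst q) (snd q) = Some x \<and> \<not> bad n (fst q) (ix ` set (snd q) \<union> {i. 0 < c i})
   then frag_of (fst q, z, \<lambda>i. cnt (snd q) i + c i) else 0)"
  have "nfe n (pmult n (frag_of q) g) = ?T (nfe n g)"
   by (rule frag_extend_linear) (use gk q in \<open>auto simp only: pmult_diff frag_extend_diff pmult_frag frag_extend_of nf_comp_left pmult_zero frag_extend_0\<close>)
  thus ?thesis using gk by simp
 qed
 have "nfe n (pmult n h g) = 0"
  using hk by (induction h rule: frag_induction) (simp_all only: 1 pmult_diff frag_extend_diff pmult_zero frag_extend_0 diff_self)
 thus "h \<otimes>\<^bsub>path_alg n k\<^esub> g \<in> nf_ideal n k" using pmult_keys[OF hk gk(1)] by (simp add: nf_ideal_def)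
 have 2: "nfe n (pmult n g (frag_of q)) = 0" if q: "q \<in> paths n k" for q
 proof -
  let ?T = "frag_extend (\<lambda>(x, z, c).
   if z = fst q \<and> \<not> bad n x ({i. 0 < c i} \<union> ix ` set (snd q))
   then frag_of (x, the (walk n (fst q) (snd q)), \<lambda>i. c i + cnt (snd q) i) else 0)"
  have "nfe n (pmult n g (frag_of q)) = ?T (nfe n g)"
   by (rule frag_extend_linear) (use gk q in \<open>auto simp only: pmult_diff frag_extend_diff pmult_frag frag_extend_of nf_comp_right pmult_zero frag_extend_0\<close>)
  thus ?thesis using gk by simp
 qed
 have "nfe n (pmult n g h) = 0"
  using hk by (induction h rule: frag_induction) (simp_all only: 2 frag_extend_zero_fun frag_extend_diff_fun pmult_diff frag_extend_diff pmult_zero frag_extend_0 diff_self)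
 thus "g \<otimes>\<^bsub>path_alg n k\<^esub> h \<in> nf_ideal n k" using pmult_keys[OF gk(1) hk] by (simp add: nf_ideal_def)
qed

lemma path_elt_keys: "keys (path_elt n k x w) \<subseteq> paths n k"
 by (simp add: path_elt_def)

lemma path_elt_diff_nf_ideal:
 assumes "walk n x u = walk n x v" "cnt u = cnt v"
 shows "path_elt n k x u - path_elt n k x v \<in> nf_ideal n k"
proof -
 have "ix ` set u = ix ` set v" using assms(2) cnt_pos_iff by (metis subsetI subset_antisym)
 hence "nfe n (path_elt n k x u) = nfe n (path_elt n k x v)"
  using assms by (auto simp: path_elt_def paths_def nf_def)
 thus ?thesis
  unfolding nf_ideal_def using keys_diff_subset[OF path_elt_keys path_elt_keys] by (simp add: frag_extend_diff)
qed

lemma path_elt_bad_nf_ideal: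
 assumes "bad n x (ix ` set u)" shows "path_elt n k x u \<in> nf_ideal n k"
 using assms path_elt_keys by (auto simp: nf_ideal_def path_elt_def nf_def)

definition far :: "nat => nat => bool" where
 "far i j \<longleftrightarrow> i + 1 < j \<or> j + 1 < i"

lemma walk_far:
 assumes "far i j" "1 \<le> i" "1 \<le> j"
 shows "walk n x [AR i, AR j] = walk n x [AR j, AR i]" "walk n x [AL i, AL j] = walk n x [AL j, AL i]"
   "walk n x [AL i, AR j] = walk n x [AR j, AL i]"
proof -
 have ne: "i \<noteq> j" "i - 1 \<noteq> j" "i \<noteq> j - 1" "i - 1 \<noteq> j - 1" "j \<noteq> i - 1" "j - 1 \<noteq> i" "j - 1 \<noteq> i - 1"
  using assms by (auto simp: far_def)
 have swap: "insert j (insert i (x - {i'}) - {j'}) = insert i (insert j (x - {j'}) - {i'})"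
  if "i \<noteq> j'" "j \<noteq> i'" for i i' j j' :: nat and x
  using that by auto
 show "walk n x [AR i, AR j] = walk n x [AR j, AR i]" "walk n x [AL i, AL j] = walk n x [AL j, AL i]"
   "walk n x [AL i, AR j] = walk n x [AR j, AL i]"
  using ne swap by (auto simp del: One_nat_def)
qed

text \<open>Each relation compares two words with the same end points and crossing numbers, or is a
  single word over a bad interval. For \<open>AR (i - 1)\<close> followed by \<open>AR i\<close> to
  be a path, i - 1 and i must be unoccupied at the start; for \<open>AL i\<close> followed by
  \<open>AL (i - 1)\<close> these positions are i - 2 and i - 1.\<close>

lemma path_rels_subset: "path_rels n k \<subseteq> nf_ideal n k"
proof -
 have cnt2: "cnt [a, b] = cnt [b, a]" for a b by (auto simp: fun_eq_iff)
 have 1: "path_elt n k x [a, b] - path_elt n k x [b, a] \<in> nf_ideal n k"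
  if "walk n x [a, b] = walk n x [b, a]" for x a b
  using that cnt2 by (rule path_elt_diff_nf_ideal)
 have mov: "walk n x [AR i, AU j] = walk n x [AU j, AR i]" "walk n x [AL i, AU j] = walk n x [AU j, AL i]"
   "walk n x [AU i, AU j] = walk n x [AU j, AU i]" for x i j by auto
 have RL: "path_elt n k x [AR i, AL i] - path_elt n k x [AU i] \<in> nf_ideal n k"
  if "x \<inter> {i - 1, i} = {i - 1}" "i \<in> {1..n}" for x i
 proof (rule path_elt_diff_nf_ideal)
  have "1 \<le> i" "i - 1 \<in> x" "i \<notin> x" "i \<le> n" using that inter_pair_iff(1)[of i x] by auto
  thus "walk n x [AR i, AL i] = walk n x [AU i]" by auto
 qed (auto simp: fun_eq_iff)
 have LR: "path_elt n k x [AL i, AR i] - path_elt n k x [AU i] \<in> nf_ideal n k"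
  if "x \<inter> {i - 1, i} = {i}" "i \<in> {1..n}" for x i
 proof (rule path_elt_diff_nf_ideal)
  have "1 \<le> i" "i - 1 \<notin> x" "i \<in> x" "i \<le> n" using that inter_pair_iff(2)[of i x] by auto
  thus "walk n x [AL i, AR i] = walk n x [AU i]" by auto
 qed (auto simp: fun_eq_iff)
 have U: "path_elt n k x [AU i] \<in> nf_ideal n k" if "x \<inter> {i - 1, i} = {}" "i \<in> {1..n}" for x i
  by (rule path_elt_bad_nf_ideal, rule badI[of "i - 1" i]) (use that in auto)
 have RR: "path_elt n k x [AR (i - 1), AR i] \<in> nf_ideal n k" if "i \<in> {2..n}" for x i
 proof (cases "walk n x [AR (i - 1), AR i]")
  case (Some y)
  thus ?thesis using that
   by (intro path_elt_bad_nf_ideal badI[of "i - 1" i]) (auto split: if_splits)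
 qed (auto simp: path_elt_def paths_def nf_ideal_def)
 have LL: "path_elt n k x [AL i, AL (i - 1)] \<in> nf_ideal n k" if "i \<in> {2..n}" for x i
 proof (cases "walk n x [AL i, AL (i - 1)]")
  case (Some y)
  hence "i - 1 \<notin> x" "i - 1 - 1 \<notin> insert (i - 1) (x - {i})" by (auto split: if_splits)
  moreover have "i - 1 - 1 = i - 2" "i - 2 \<noteq> i" using that by auto
  ultimately have "i - 1 \<notin> x" "i - 2 \<notin> x" by auto
  moreover have "{i - 2<..i - 1} = {i - 1}" using that by auto
  ultimately show ?thesis using that
   by (intro path_elt_bad_nf_ideal badI[of "i - 2" "i - 1"]) auto
 qed (auto simp: path_elt_def paths_def nf_ideal_def)
 note m = mov[THEN 1] and f = walk_far[THEN 1]
 show ?thesis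
  unfolding path_rels_def
 proof (intro Un_least UN_least, goal_cases)
  case (1 x i j) thus ?case by (simp only: insert_subset empty_subsetI m simp_thms)
 next
  case (2 x i) thus ?case using RL[of x i] by (cases "x \<inter> {i - 1, i} = {i - 1}") simp_all
 next
  case (3 x i) thus ?case using LR[of x i] by (cases "x \<inter> {i - 1, i} = {i}") simp_all
 next
  case (4 x i) thus ?case using U[of x i] by (cases "x \<inter> {i - 1, i} = {}") simp_all
 next
  case (5 x ij) thus ?case by (cases ij) (simp only: mem_Collect_eq prod.case atLeastAtMost_iff f far_def insert_subset empty_subsetI simp_thms)
 next
  case (6 x i) thus ?case by (simp only: RR LL insert_subset empty_subsetI simp_thms)
 qed
qed

lemma path_rels_carrier: "path_rels n k \<subseteq> carrier (path_alg n k)"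
 using path_rels_subset[of n k] by (auto simp: nf_ideal_def)

lemma path_ideal_ideal: "ideal (path_ideal n k) (path_alg n k)"
 unfolding path_ideal_def by (rule ring.genideal_ideal[OF path_alg_ring path_rels_carrier])

lemma path_rels_in: "path_rels n k \<subseteq> path_ideal n k"
 unfolding path_ideal_def by (rule ring.genideal_self[OF path_alg_ring path_rels_carrier])

lemma path_ideal_subset: "path_ideal n k \<subseteq> nf_ideal n k"
 unfolding path_ideal_def by (rule ring.genideal_minimal[OF path_alg_ring nf_ideal_ideal path_rels_subset])

section \<open>Normal forms of paths\<close>

lemma path_ideal_closed:
 shows "0 \<in> path_ideal n k"
  and "g \<in> path_ideal n k ==> h \<in> path_ideal n k ==> g + h \<in> path_ideal n k"
  and "g \<in> path_ideal n k ==> - g \<in> path_ideal n k"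
  and "g \<in> path_ideal n k ==> h \<in> path_ideal n k ==> g - h \<in> path_ideal n k"
  and "g \<in> path_ideal n k ==> keys h \<subseteq> paths n k ==> pmult n g h \<in> path_ideal n k"
  and "g \<in> path_ideal n k ==> keys h \<subseteq> paths n k ==> pmult n h g \<in> path_ideal n k"
proof -
 interpret I: ideal "path_ideal n k" "path_alg n k" by (rule path_ideal_ideal)
 show "0 \<in> path_ideal n k" using additive_subgroup.zero_closed[OF ideal.axioms(1)[OF path_ideal_ideal], of n k] by simp
 show add: "g + h \<in> path_ideal n k" if "g \<in> path_ideal n k" "h \<in> path_ideal n k" for g h
  using additive_subgroup.a_closed[OF ideal.axioms(1)[OF path_ideal_ideal] that] by simp
 show neg: "- g \<in> path_ideal n k" if "g \<in> path_ideal n k" for g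
 proof -
  have "keys g \<subseteq> paths n k" using I.a_Hcarr[OF that] by simp
  hence "\<ominus>\<^bsub>path_alg n k\<^esub> g = - g" by (intro I.minus_equality) auto
  thus ?thesis using additive_subgroup.a_inv_closed[OF ideal.axioms(1)[OF path_ideal_ideal] that] by simp
 qed
 show "g - h \<in> path_ideal n k" if "g \<in> path_ideal n k" "h \<in> path_ideal n k" for g h
  using add[OF that(1) neg[OF that(2)]] by simp
 show "pmult n g h \<in> path_ideal n k" if "g \<in> path_ideal n k" "keys h \<subseteq> paths n k"
  using I.I_r_closed[OF that(1), of h] that(2) by simp
 show "pmult n h g \<in> path_ideal n k" if "g \<in> path_ideal n k" "keys h \<subseteq> paths n k"
  using I.I_l_closed[OF that(1), of h] that(2) by simp
qed

lemma path_elt_append: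
 assumes "x \<in> vertices n k" "walk n x u = Some y"
 shows "path_elt n k x (u @ v) = pmult n (path_elt n k x u) (path_elt n k y v)"
 using assms walk_vertices[OF assms] by (auto simp: path_elt_def paths_def walk_append path_comp_def)

definition zro :: "nat => nat => nat set => arrow list => bool" where
 "zro n k x w \<longleftrightarrow> path_elt n k x w \<in> path_ideal n k"

text \<open>Equality of the targets is part of the relation because two words that both vanish in
  the quotient may end at different vertices, and then a common continuation could be a path for
  only one of them.\<close>

definition eqv :: "nat => nat => nat set => arrow list => arrow list => bool" where
 "eqv n k x u v \<longleftrightarrow> walk n x u = walk n x v \<and> path_elt n k x u - path_elt n k x v \<in> path_ideal n k"

lemma eqv_refl [simp]: "eqv n k x u u" by (simp add: eqv_def path_ideal_closed(1))

lemma eqv_sym: "eqv n k x u v ==> eqv n k x v u"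
 unfolding eqv_def using path_ideal_closed(3)[of "path_elt n k x u - path_elt n k x v"] by simp

lemma eqv_trans [trans]: "eqv n k x u v ==> eqv n k x v w ==> eqv n k x u w"
 unfolding eqv_def using path_ideal_closed(2)[of "path_elt n k x u - path_elt n k x v" n k "path_elt n k x v - path_elt n k x w"] by simp

lemma eqv_walk: "eqv n k x u v ==> walk n x u = walk n x v" by (simp add: eqv_def)

lemma eqv_zro: "eqv n k x u v ==> zro n k x v ==> zro n k x u"
 unfolding eqv_def zro_def
 using path_ideal_closed(2)[of "path_elt n k x u - path_elt n k x v" n k "path_elt n k x v"] by simp

lemma zro_nonpath: "walk n x u = None ==> zro n k x u"
 by (simp add: zro_def path_elt_def paths_def path_ideal_closed)

lemma eqv_append:
 assumes x: "x \<in> vertices n k" and e: "eqv n k x u v" shows "eqv n k x (u @ w) (v @ w)"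
proof (cases "walk n x u")
 case None
 thus ?thesis using e by (auto simp: eqv_def walk_append path_elt_def paths_def path_ideal_closed)
next
 case (Some y)
 hence v: "walk n x v = Some y" using e by (simp add: eqv_def)
 have "pmult n (path_elt n k x u - path_elt n k x v) (path_elt n k y w) \<in> path_ideal n k"
  by (rule path_ideal_closed(5)) (use e path_elt_keys in \<open>auto simp: eqv_def\<close>)
 thus ?thesis using Some v
  by (simp add: eqv_def walk_append path_elt_append[OF x Some] path_elt_append[OF x v] pmult_diff)
qed

lemma eqv_prepend:
 assumes x: "x \<in> vertices n k" and p: "walk n x p = Some y" and e: "eqv n k y u v"
 shows "eqv n k x (p @ u) (p @ v)"
proof -
 have "pmult n (path_elt n k x p) (path_elt n k y u - path_elt n k y v) \<in> path_ideal n k"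
  by (rule path_ideal_closed(6)) (use e path_elt_keys in \<open>auto simp: eqv_def\<close>)
 thus ?thesis using e p
  by (simp add: eqv_def walk_append path_elt_append[OF x p] pmult_diff)
qed

lemma eqv_Cons:
 assumes x: "x \<in> vertices n k" and a: "arrow_target n a x = Some y" and e: "eqv n k y u v"
 shows "eqv n k x (a # u) (a # v)"
 using eqv_prepend[OF x, of "[a]" y u v] a e by simp

lemma zro_append: "x \<in> vertices n k ==> zro n k x u ==> zro n k x (u @ w)"
proof (cases "walk n x u")
 case (Some y)
 assume "x \<in> vertices n k" "zro n k x u"
 thus ?thesis
  unfolding zro_def path_elt_append[OF \<open>x \<in> _\<close> Some] by (intro path_ideal_closed(5)[OF _ path_elt_keys])
qed (auto intro: zro_nonpath simp: walk_append)

lemma zro_prepend: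
 assumes "x \<in> vertices n k" "walk n x p = Some y" "zro n k y u" shows "zro n k x (p @ u)"
 using assms(3) unfolding zro_def path_elt_append[OF assms(1,2)] by (intro path_ideal_closed(6)[OF _ path_elt_keys])

lemma zro_Cons:
 assumes "x \<in> vertices n k" "arrow_target n a x = Some y" "zro n k y u" shows "zro n k x (a # u)"
 using zro_prepend[OF assms(1), of "[a]" y u] assms by simp

section \<open>Commutation of arrows and reduction of words\<close>

fun isU :: "arrow => bool" where
 "isU (AU i) = True" | "isU _ = False"

lemma arrow_target_ix: "arrow_target n a x = Some y ==> 1 \<le> ix a \<and> ix a \<le> n"
 by (cases a) (auto split: if_splits)

lemma rels_comm:
 assumes "x \<in> vertices n k" "i \<in> {1..n}" "j \<in> {1..n}"
 shows "path_elt n k x [AR i, AU j] - path_elt n k x [AU j, AR i] \<in> path_rels n k"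
  "path_elt n k x [AL i, AU j] - path_elt n k x [AU j, AL i] \<in> path_rels n k"
  "path_elt n k x [AU i, AU j] - path_elt n k x [AU j, AU i] \<in> path_rels n k"
  "far i j ==> path_elt n k x [AR i, AR j] - path_elt n k x [AR j, AR i] \<in> path_rels n k"
  "far i j ==> path_elt n k x [AL i, AL j] - path_elt n k x [AL j, AL i] \<in> path_rels n k"
  "far i j ==> path_elt n k x [AL i, AR j] - path_elt n k x [AR j, AL i] \<in> path_rels n k"
 unfolding path_rels_def
 subgoal by (rule UnI1, rule UnI1, rule UnI1) (use assms in blast)
 subgoal by (rule UnI1, rule UnI1, rule UnI1) (use assms in blast)
 subgoal by (rule UnI1, rule UnI1, rule UnI1) (use assms in blast)
 subgoal by (rule UnI1, rule UnI2, rule UN_I[OF assms(1)], rule UN_I[of "(i, j)"]) (use assms in \<open>simp_all add: far_def\<close>)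
 subgoal by (rule UnI1, rule UnI2, rule UN_I[OF assms(1)], rule UN_I[of "(i, j)"]) (use assms in \<open>simp_all add: far_def\<close>)
 subgoal by (rule UnI1, rule UnI2, rule UN_I[OF assms(1)], rule UN_I[of "(i, j)"]) (use assms in \<open>simp_all add: far_def\<close>)
 done

lemma far_sym: "far i j ==> far j i" by (auto simp: far_def)

text \<open>Each commutation relation is listed in one order of its two labels, so it is used up to
  sign. That the word is a path places both indices in the range where the relations are
  imposed.\<close>

lemma path_elt_comm:
 assumes x: "x \<in> vertices n k" and w: "walk n x [a, b] \<noteq> None" and c: "isU a \<or> isU b \<or> far (ix a) (ix b)"
 shows "path_elt n k x [a, b] - path_elt n k x [b, a] \<in> path_ideal n k"
proof -
 obtain y z where "arrow_target n a x = Some y" "arrow_target n b y = Some z" using w by (auto split: option.splits)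
 hence i: "ix a \<in> {1..n}" "ix b \<in> {1..n}" using arrow_target_ix by auto
 note r = rels_comm[OF x]
 have "path_elt n k x [a, b] - path_elt n k x [b, a] \<in> path_rels n k \<or>
    path_elt n k x [b, a] - path_elt n k x [a, b] \<in> path_rels n k"
 proof (cases a)
  case a: (AR i)
  show ?thesis
  proof (cases b)
   case (AR j)
   thus ?thesis using r(4)[of i j] i c a far_sym[of i j] by simp
  next
   case (AL j)
   thus ?thesis using r(6)[of j i] i c a far_sym[of i j] by simp
  next
   case (AU j)
   thus ?thesis using r(1)[of i j] i c a far_sym[of i j] by simp
  qed
 next
  case a: (AL i)
  show ?thesis
  proof (cases b)
   case (AR j)
   thus ?thesis using r(6)[of i j] i c a far_sym[of i j] by simp
  next
   case (AL j)
   thus ?thesis using r(5)[of i j] i c a far_sym[of i j] by simp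
  next
   case (AU j)
   thus ?thesis using r(2)[of i j] i c a far_sym[of i j] by simp
  qed
 next
  case a: (AU i)
  show ?thesis
  proof (cases b)
   case (AR j)
   thus ?thesis using r(1)[of j i] i c a far_sym[of i j] by simp
  next
   case (AL j)
   thus ?thesis using r(2)[of j i] i c a far_sym[of i j] by simp
  next
   case (AU j)
   thus ?thesis using r(3)[of i j] i c a far_sym[of i j] by simp
  qed
 qed
 hence "path_elt n k x [a, b] - path_elt n k x [b, a] \<in> path_ideal n k \<or>
    path_elt n k x [b, a] - path_elt n k x [a, b] \<in> path_ideal n k"
  using path_rels_in by blast
 thus ?thesis using path_ideal_closed(3)[of "path_elt n k x [b, a] - path_elt n k x [a, b]" n k] by auto
qed

lemma walk_comm:
 assumes "isU a \<or> isU b \<or> far (ix a) (ix b)" shows "walk n x [a, b] = walk n x [b, a]"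
proof (cases "isU a \<or> isU b")
 case True
 have *: "walk n x [AU i, b] = walk n x [b, AU i]" for i b by (cases b) auto
 have U: "\<exists>i. a = AU i" if "isU a" for a using that by (cases a) auto
 from True show ?thesis
 proof
  assume "isU a"
  with U obtain i where "a = AU i" by metis
  thus ?thesis by (simp only: *[of i b])
 next
  assume "isU b"
  with U obtain i where "b = AU i" by metis
  thus ?thesis by (simp only: *[of i a])
 qed
next
 case False
 hence f: "far (ix a) (ix b)" using assms by simp
 have "arrow_target n a x = None" if "ix a < 1" for a x using that by (cases a) auto
 hence 0: "walk n x [a, b] = walk n x [b, a]" if "\<not> (1 \<le> ix a \<and> 1 \<le> ix b)"
  using that by (auto split: option.splits)
 show ?thesis
 proof (cases "1 \<le> ix a \<and> 1 \<le> ix b")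
  case True
  thus ?thesis using False f walk_far[of "ix a" "ix b" n x] walk_far[of "ix b" "ix a" n x] far_sym[OF f]
   by (cases a; cases b) (simp_all del: walk.simps)
 qed (rule 0)
qed

lemma eqv_comm:
 assumes x: "x \<in> vertices n k" and c: "isU a \<or> isU b \<or> far (ix a) (ix b)"
 shows "eqv n k x [a, b] [b, a]"
proof (cases "walk n x [a, b] = None")
 case True
 thus ?thesis using walk_comm[OF c, of n x] by (simp add: eqv_def path_elt_def paths_def path_ideal_closed del: walk.simps)
qed (use path_elt_comm[OF x _ c] walk_comm[OF c, of n x] in \<open>simp add: eqv_def del: walk.simps\<close>)

lemma eqv_comm_word:
 assumes "x \<in> vertices n k" "\<And>b. b \<in> set u ==> isU a \<or> isU b \<or> far (ix a) (ix b)"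
 shows "eqv n k x (a # u) (u @ [a])"
 using assms
proof (induction u arbitrary: x)
 case (Cons b u)
 have 1: "eqv n k x (a # b # u) (b # a # u)"
  using eqv_append[OF Cons.prems(1) eqv_comm[OF Cons.prems(1), of a b], of u] Cons.prems(2) by simp
 show ?case
 proof (cases "arrow_target n b x")
  case (Some y)
  have "eqv n k y (a # u) (u @ [a])"
   using Cons arrow_target_vertices[OF Cons.prems(1) Some] by auto
  hence "eqv n k x (b # a # u) (b # u @ [a])" by (rule eqv_Cons[OF Cons.prems(1) Some])
  from eqv_trans[OF 1 this] show ?thesis by simp
 next
  case None
  hence "walk n x (b # a # u) = None" "walk n x (b # u @ [a]) = None" by simp_all
  hence "eqv n k x (b # a # u) (b # u @ [a])" by (simp add: eqv_def path_elt_def paths_def path_ideal_closed)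
  from eqv_trans[OF 1 this] show ?thesis by simp
 qed
qed simp

lemma zro_ctx:
 assumes x: "x \<in> vertices n k" and e: "\<And>y. y \<in> vertices n k ==> walk n x p = Some y ==> zro n k y u"
 shows "zro n k x (p @ u @ q)"
proof (cases "walk n x p")
 case None
 thus ?thesis by (intro zro_nonpath) (simp add: walk_append)
next
 case (Some y)
 have y: "y \<in> vertices n k" using walk_vertices x Some by blast
 show ?thesis by (rule zro_prepend[OF x Some zro_append[OF y e[OF y Some]]])
qed

lemma path_rels_special:
 assumes x: "x \<in> vertices n k" and i: "1 \<le> i" "i \<le> n"
 shows "i - 1 \<in> x ==> i \<notin> x ==> eqv n k x [AR i, AL i] [AU i]"
  "i - 1 \<notin> x ==> i \<in> x ==> eqv n k x [AL i, AR i] [AU i]"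
  "i - 1 \<notin> x ==> i \<notin> x ==> zro n k x [AU i]"
  "2 \<le> i ==> zro n k x [AR (i - 1), AR i]"
  "2 \<le> i ==> zro n k x [AL i, AL (i - 1)]"
proof -
 have i': "i \<in> {1..n}" using i by simp
 note ip = inter_pair_iff[OF i(1)]
 show "eqv n k x [AR i, AL i] [AU i]" if "i - 1 \<in> x" "i \<notin> x"
 proof -
  have "path_elt n k x [AR i, AL i] - path_elt n k x [AU i] \<in> path_rels n k"
   unfolding path_rels_def
   by (rule UnI1, rule UnI1, rule UnI2, rule UN_I[OF x], rule UN_I[OF i'], rule UnI1, rule UnI1)
    (use that ip in simp)
  thus ?thesis using that i path_rels_in unfolding eqv_def by auto
 qed
 show "eqv n k x [AL i, AR i] [AU i]" if "i - 1 \<notin> x" "i \<in> x"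
 proof -
  have "path_elt n k x [AL i, AR i] - path_elt n k x [AU i] \<in> path_rels n k"
   unfolding path_rels_def
   by (rule UnI1, rule UnI1, rule UnI2, rule UN_I[OF x], rule UN_I[OF i'], rule UnI1, rule UnI2)
    (use that ip in simp)
  thus ?thesis using that i path_rels_in unfolding eqv_def by auto
 qed
 show "zro n k x [AU i]" if "i - 1 \<notin> x" "i \<notin> x"
 proof -
  have "path_elt n k x [AU i] \<in> path_rels n k"
   unfolding path_rels_def
   by (rule UnI1, rule UnI1, rule UnI2, rule UN_I[OF x], rule UN_I[OF i'], rule UnI2)
    (use that in simp)
  thus ?thesis using path_rels_in unfolding zro_def by auto
 qed
 show "zro n k x [AR (i - 1), AR i]" if "2 \<le> i"
 proof -
  have "i \<in> {2..n}" using that i by simp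
  hence "path_elt n k x [AR (i - 1), AR i] \<in> path_rels n k"
   unfolding path_rels_def using x by (intro UnI2) blast
  thus ?thesis using path_rels_in unfolding zro_def by auto
 qed
 show "zro n k x [AL i, AL (i - 1)]" if "2 \<le> i"
 proof -
  have "i \<in> {2..n}" using that i by simp
  hence "path_elt n k x [AL i, AL (i - 1)] \<in> path_rels n k"
   unfolding path_rels_def using x by (intro UnI2) blast
  thus ?thesis using path_rels_in unfolding zro_def by auto
 qed
qed

text \<open>Only the steps v and v + 1 touch the position v.\<close>

lemma walk_keep:
 assumes "walk n x w = Some y" "v \<notin> ix ` set w" "Suc v \<notin> ix ` set w"
 shows "v \<in> y \<longleftrightarrow> v \<in> x"
 using assms
proof (induction w arbitrary: x)
 case (Cons a w)
 then obtain x' where x': "arrow_target n a x = Some x'" "walk n x' w = Some y" by (auto split: option.splits)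
 have "v \<in> x' \<longleftrightarrow> v \<in> x" using x'(1) Cons.prems by (cases a) (auto split: if_splits)
 thus ?case using Cons x' by auto
qed simp

text \<open>The part of a nonvanishing word that remains once pairs of opposite crossings have been
  turned into letters U and collected in front; see \<open>reduce_word\<close>.\<close>

definition reduced :: "arrow list => bool" where
 "reduced r \<longleftrightarrow> distinct (map ix r) \<and> (\<forall>a\<in>set r. \<not> isU a)"

text \<open>Without the index i, an index above i and one below i differ by at least 2, so the two
  groups of letters commute past each other, and inside each group the order is kept.\<close>

lemma eqv_split_high_low:
 assumes "x \<in> vertices n k" "i \<notin> ix ` set u"
 shows "eqv n k x u (filter (\<lambda>a. i < ix a) u @ filter (\<lambda>a. ix a < i) u)"
  and "eqv n k x u (filter (\<lambda>a. ix a < i) u @ filter (\<lambda>a. i < ix a) u)"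
proof -
 have *: "eqv n k x u (filter P u @ filter (\<lambda>a. \<not> P a) u)"
  if "\<And>a b. a \<in> set u ==> b \<in> set u ==> P a ==> \<not> P b ==> far (ix b) (ix a)" "x \<in> vertices n k" for P x
  using that
 proof (induction u arbitrary: x)
  case (Cons a u)
  let ?H = "filter P u" let ?L = "filter (\<lambda>a. \<not> P a) u"
  have 1: "eqv n k x (a # u) (a # ?H @ ?L)"
  proof (cases "arrow_target n a x")
   case None thus ?thesis by (simp add: eqv_def path_elt_def paths_def path_ideal_closed)
  next
   case (Some y)
   have "eqv n k y u (?H @ ?L)" using Cons arrow_target_vertices[OF Cons.prems(2) Some] by simp
   thus ?thesis by (rule eqv_Cons[OF Cons.prems(2) Some])
  qed
  show ?case
  proof (cases "P a")
   case False
   hence "eqv n k x (a # ?H) (?H @ [a])"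
    by (intro eqv_comm_word) (use Cons.prems in auto)
   from eqv_trans[OF 1] eqv_append[OF Cons.prems(2) this, of ?L] show ?thesis using False by simp
  qed (use 1 in simp)
 qed simp
 have ne: "ix a \<noteq> i" if "a \<in> set u" for a using assms(2) that by auto
 have "filter (\<lambda>a. \<not> i < ix a) u = filter (\<lambda>a. ix a < i) u" by (rule filter_cong) (use ne in force)+
 moreover have "eqv n k x u (filter (\<lambda>a. i < ix a) u @ filter (\<lambda>a. \<not> i < ix a) u)"
  by (rule *[OF _ assms(1)]) (use ne in \<open>force simp: far_def\<close>)
 ultimately show "eqv n k x u (filter (\<lambda>a. i < ix a) u @ filter (\<lambda>a. ix a < i) u)" by simp
 have "filter (\<lambda>a. \<not> ix a < i) u = filter (\<lambda>a. i < ix a) u" by (rule filter_cong) (use ne in force)+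
 moreover have "eqv n k x u (filter (\<lambda>a. ix a < i) u @ filter (\<lambda>a. \<not> ix a < i) u)"
  by (rule *[OF _ assms(1)]) (use ne in \<open>force simp: far_def\<close>)
 ultimately show "eqv n k x u (filter (\<lambda>a. ix a < i) u @ filter (\<lambda>a. i < ix a) u)" by simp
qed

lemma reduced_Cons: "reduced (a # r) \<longleftrightarrow> \<not> isU a \<and> ix a \<notin> ix ` set r \<and> reduced r"
 by (auto simp: reduced_def)

lemma reduced_append: "reduced (u @ v) \<longleftrightarrow> reduced u \<and> reduced v \<and> ix ` set u \<inter> ix ` set v = {}"
 by (auto simp: reduced_def)

lemma split_first:
 assumes "\<exists>a\<in>set w. P a"
 obtains p a q where "w = p @ a # q" "P a" "\<forall>b\<in>set p. \<not> P b"
 using split_list_first_prop[OF assms] by metis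

lemma split_ix:
 assumes "i \<in> ix ` set w"
 obtains p a q where "w = p @ a # q" "ix a = i" "i \<notin> ix ` set p"
proof -
 have "\<exists>a\<in>set w. ix a = i" using assms by auto
 from split_first[OF this] that show thesis by (metis imageE)
qed

lemma walk_append_Some:
 "walk n x (u @ v) = Some z ==> (\<And>y. walk n x u = Some y ==> walk n y v = Some z ==> thesis) ==> thesis"
 by (auto simp: walk_append split: option.splits)

lemma walk_Cons_Some:
 "walk n x (a # v) = Some z ==> (\<And>y. arrow_target n a x = Some y ==> walk n y v = Some z ==> thesis) ==> thesis"
 by (auto split: option.splits)

lemma arrow_cases:
 assumes "arrow_target n a x = Some y" "\<not> isU a"
 obtains (R) i where "a = AR i" "1 \<le> i" "i \<le> n" "i - 1 \<in> x" "i \<notin> x" "y = insert i (x - {i - 1})"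
 | (L) i where "a = AL i" "1 \<le> i" "i \<le> n" "i - 1 \<notin> x" "i \<in> x" "y = insert (i - 1) (x - {i})"
 using assms by (cases a) (auto split: if_splits)

lemma eqv_nonpath: "walk n x u = None ==> walk n x v = None ==> eqv n k x u v"
 by (simp add: eqv_def path_elt_def paths_def path_ideal_closed)

text \<open>Prepending an arrow to a reduced word: either its index is new, or it meets the earlier occurrence of
 its index and forms a \<open>U\<close>, or it runs into a vanishing product of two adjacent steps.\<close>

lemma reduce_step:
 assumes x: "x \<in> vertices n k" and a: "\<not> isU a" and r: "reduced r"
 shows "zro n k x (a # r) \<or> (\<exists>us r'. eqv n k x (a # r) (map AU us @ r') \<and> reduced r')"
proof (cases "walk n x (a # r)")
 case None thus ?thesis using zro_nonpath by blast
next
 case (Some z)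
 define i where "i = ix a"
 obtain y where y: "arrow_target n a x = Some y" "walk n y r = Some z" using Some by (rule walk_Cons_Some)
 have yv: "y \<in> vertices n k" using arrow_target_vertices[OF x y(1)] .
 show ?thesis
 proof (cases "i \<in> ix ` set r")
  case False
  hence "eqv n k x (a # r) (map AU [] @ (a # r)) \<and> reduced (a # r)" using a r by (simp add: reduced_Cons i_def)
  thus ?thesis by blast
 next
  case True
  then obtain u b v where uv: "r = u @ b # v" "ix b = i" "i \<notin> ix ` set u" by (rule split_ix)
  have ru: "reduced u" "reduced (u @ v)" "\<not> isU b" using r by (auto simp: uv reduced_append reduced_Cons)
  \<comment> \<open>The letters before \<open>b\<close> avoid i, so they split into a part above and
    a part below i, in either order. Only the indices i + 1 and i - 1 can stop \<open>a\<close> from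
    reaching \<open>b\<close>.\<close>
  define H where "H = filter (\<lambda>a. i < ix a) u"
  define L where "L = filter (\<lambda>a. ix a < i) u"
  have HL: "eqv n k y u (H @ L)" "eqv n k y u (L @ H)" unfolding H_def L_def by (rule eqv_split_high_low[OF yv uv(3)])+
  obtain y1 y2 where y1: "walk n y u = Some y1" "arrow_target n b y1 = Some y2" "walk n y2 v = Some z"
   using y(2) unfolding uv(1) by (elim walk_append_Some walk_Cons_Some)
  have wHL: "walk n y (H @ L) = Some y1" "walk n y (L @ H) = Some y1" using eqv_walk[OF HL(1)] eqv_walk[OF HL(2)] y1(1) by simp_all
  have commH: "eqv n k x (a # p) (p @ [a])" if "set p \<subseteq> set H" "\<forall>c\<in>set p. ix c \<noteq> i + 1" for p
   by (rule eqv_comm_word[OF x]) (use that in \<open>force simp: H_def i_def far_def\<close>)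
  have commL: "eqv n k x (a # p) (p @ [a])" if "set p \<subseteq> set L" "\<forall>c\<in>set p. ix c \<noteq> i - 1" for p
   by (rule eqv_comm_word[OF x]) (use that in \<open>force simp: L_def i_def far_def\<close>)
  have toHL: "eqv n k x (a # r) (a # H @ L @ b # v)" "eqv n k x (a # r) (a # L @ H @ b # v)"
   using eqv_Cons[OF x y(1) eqv_append[OF yv HL(1), of "b # v"]] eqv_Cons[OF x y(1) eqv_append[OF yv HL(2), of "b # v"]]
   by (simp_all add: uv)
  have zH: "zro n k x (a # r)" if inH: "i + 1 \<in> ix ` set H"
   and z2: "\<And>x' c. x' \<in> vertices n k ==> walk n x' [a, c] \<noteq> None ==> c \<in> set H ==> ix c = i + 1 ==> zro n k x' [a, c]"
  proof -
   obtain p c q where p: "H = p @ c # q" "ix c = i + 1" "i + 1 \<notin> ix ` set p" using inH by (rule split_ix)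
   have "eqv n k x (a # p) (p @ [a])"
   proof (rule commH)
    show "set p \<subseteq> set H" using p(1) by auto
    show "\<forall>c\<in>set p. ix c \<noteq> i + 1" using p(3) by (metis imageI)
   qed
   from eqv_append[OF x this, of "c # q @ L @ b # v"]
   have e: "eqv n k x (a # H @ L @ b # v) (p @ [a, c] @ q @ L @ b # v)" by (simp add: p)
   have "zro n k x (p @ [a, c] @ (q @ L @ b # v))"
   proof (rule zro_ctx[OF x])
    fix x' assume x': "x' \<in> vertices n k"
    show "zro n k x' [a, c]"
     using z2[OF x'] p zro_nonpath[of n x' "[a, c]" k] by (cases "walk n x' [a, c] = None") (auto simp del: walk.simps)
   qed
   thus ?thesis using eqv_zro[OF toHL(1)] eqv_zro[OF e] by simp
  qed
  have zL: "zro n k x (a # r)" if inL: "i - 1 \<in> ix ` set L"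
   and z2: "\<And>x' c. x' \<in> vertices n k ==> walk n x' [a, c] \<noteq> None ==> c \<in> set L ==> ix c = i - 1 ==> zro n k x' [a, c]"
  proof -
   obtain p c q where p: "L = p @ c # q" "ix c = i - 1" "i - 1 \<notin> ix ` set p" using inL by (rule split_ix)
   have "eqv n k x (a # p) (p @ [a])"
   proof (rule commL)
    show "set p \<subseteq> set L" using p(1) by auto
    show "\<forall>c\<in>set p. ix c \<noteq> i - 1" using p(3) by (metis imageI)
   qed
   from eqv_append[OF x this, of "c # q @ H @ b # v"]
   have e: "eqv n k x (a # L @ H @ b # v) (p @ [a, c] @ q @ H @ b # v)" by (simp add: p)
   have "zro n k x (p @ [a, c] @ (q @ H @ b # v))"
   proof (rule zro_ctx[OF x])
    fix x' assume x': "x' \<in> vertices n k"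
    show "zro n k x' [a, c]"
     using z2[OF x'] p zro_nonpath[of n x' "[a, c]" k] by (cases "walk n x' [a, c] = None") (auto simp del: walk.simps)
   qed
   thus ?thesis using eqv_zro[OF toHL(2)] eqv_zro[OF e] by simp
  qed
  have nu: "\<not> isU c" if "c \<in> set u" for c using ru(1) that by (auto simp: reduced_def)
  have Hu: "set H \<subseteq> set u" "set L \<subseteq> set u" by (auto simp: H_def L_def)
  have hl: "i \<notin> ix ` set H" "i \<notin> ix ` set L" "i - 1 \<notin> ix ` set H" "Suc i \<notin> ix ` set L"
   by (auto simp: H_def L_def)
  have rH: "reduced H" "reduced L" using ru(1) by (auto simp: H_def L_def reduced_def distinct_map_filter)
  \<comment> \<open>For \<open>a = AR i\<close>, the first following letter with index i + 1 must be
    \<open>AR (i + 1)\<close>, and the adjacent product is 0. A letter with index i - 1 cannot occur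
    otherwise: it would fill position i - 1 while i is occupied, and \<open>b\<close> could not act.
    The case \<open>AL i\<close> is the mirror image. With neither neighbour present,
    \<open>a\<close> and \<open>b\<close> meet as opposite arrows and form
    \<open>AU i\<close>.\<close>
  have mid: "zro n k x (a # r) \<or> (i + 1 \<notin> ix ` set u \<and> i - 1 \<notin> ix ` set u \<and> 1 \<le> i \<and> i \<le> n \<and>
    (\<forall>x'\<in>vertices n k. walk n x' [a, b] \<noteq> None \<longrightarrow> eqv n k x' [a, b] [AU i]))"
   using y(1) a
  proof (cases rule: arrow_cases)
   case (R j)
   hence ai: "a = AR i" by (simp add: i_def)
   show ?thesis
   proof (cases "i + 1 \<in> ix ` set u")
    case True
    hence "i + 1 \<in> ix ` set H" by (auto simp: H_def)
    hence "zro n k x (a # r)"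
    proof (rule zH)
     fix x' c assume c: "x' \<in> vertices n k" "walk n x' [a, c] \<noteq> None" "c \<in> set H" "ix c = i + 1"
     hence "c = AR (i + 1)" using nu[OF subsetD[OF Hu(1) c(3)]] ai by (cases c) (auto split: if_splits)
     moreover have "i + 1 \<le> n" using c by (auto split: option.splits dest: arrow_target_ix)
     ultimately show "zro n k x' [a, c]"
      using path_rels_special(4)[OF c(1), of "i + 1"] R ai by simp
    qed
    thus ?thesis ..
   next
    case False
    have "i - 1 \<notin> ix ` set u"
    proof
     assume "i - 1 \<in> ix ` set u"
     moreover have "i \<noteq> 0" using R ai by simp
     ultimately have "i - 1 \<in> ix ` set L" by (force simp: L_def)
     then obtain p c q where p: "L = p @ c # q" "ix c = i - 1" "i - 1 \<notin> ix ` set p" by (rule split_ix)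
     obtain t1 t2 t3 where t: "walk n y H = Some t1" "walk n t1 p = Some t2" "arrow_target n c t2 = Some t3" "walk n t3 q = Some y1"
      using wHL(1) unfolding p by (elim walk_append_Some walk_Cons_Some)
     have "i - 1 \<notin> ix ` set q" using rH(2) p by (simp add: reduced_append reduced_Cons)
     moreover have "i \<notin> ix ` set p" "i \<notin> ix ` set q" "Suc i \<notin> ix ` set p" "Suc i \<notin> ix ` set q"
      using hl(2,4) unfolding p(1) by auto
     ultimately have nq: "i - 1 \<notin> ix ` set q" "i \<notin> ix ` set p" "i \<notin> ix ` set q" "Suc i \<notin> ix ` set p" "Suc i \<notin> ix ` set q" .
     have nH: "Suc i \<notin> ix ` set H" using False Hu by auto
     have i1: "Suc (i - 1) = i" using \<open>i \<noteq> 0\<close> by simp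
     have "i - 1 \<notin> y" "i \<in> y" using R ai by auto
     hence "i - 1 \<notin> t1" "i \<in> t1" using walk_keep[OF t(1), of "i - 1"] walk_keep[OF t(1), of i] hl nH i1 by simp_all
     hence "i - 1 \<notin> t2" "i \<in> t2" using walk_keep[OF t(2), of "i - 1"] walk_keep[OF t(2), of i] nq p(3) i1 by simp_all
     moreover have "\<not> isU c" using nu Hu p by auto
     ultimately have "i - 1 \<in> t3" "i \<in> t3" using t(3) p(2) \<open>i \<noteq> 0\<close> by (cases c; auto split: if_splits)+
     hence "i - 1 \<in> y1" "i \<in> y1" using walk_keep[OF t(4), of "i - 1"] walk_keep[OF t(4), of i] nq i1 by simp_all
     with y1(2) ru(3) uv(2) show False by (cases b) (auto split: if_splits)
    qed
    moreover have "eqv n k x' [a, b] [AU i]" if "x' \<in> vertices n k" "walk n x' [a, b] \<noteq> None" for x'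
    proof -
     have "b = AL i" using that ru(3) uv(2) ai by (cases b) (auto split: if_splits)
     thus ?thesis using that ai path_rels_special(1)[OF that(1), of i] by (auto split: if_splits)
    qed
    ultimately show ?thesis using False R ai by auto
   qed
  next
   case (L j)
   hence ai: "a = AL i" by (simp add: i_def)
   show ?thesis
   proof (cases "i - 1 \<in> ix ` set u")
    case True
    moreover have i0: "i \<noteq> 0" using L ai by simp
    ultimately have "i - 1 \<in> ix ` set L" by (force simp: L_def)
    hence "zro n k x (a # r)"
    proof (rule zL)
     fix x' c assume c: "x' \<in> vertices n k" "walk n x' [a, c] \<noteq> None" "c \<in> set L" "ix c = i - 1"
     hence "c = AL (i - 1)" using nu[OF subsetD[OF Hu(2) c(3)]] ai by (cases c) (auto split: if_splits)
     moreover have "2 \<le> i" "i \<le> n" using c ai by (auto split: option.splits if_splits dest!: arrow_target_ix[of n c])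
     ultimately show "zro n k x' [a, c]"
      using path_rels_special(5)[OF c(1), of "i"] L ai by simp
    qed
    thus ?thesis ..
   next
    case False
    have "i + 1 \<notin> ix ` set u"
    proof
     assume "i + 1 \<in> ix ` set u"
     moreover have "i \<noteq> 0" using L ai by simp
     ultimately have "i + 1 \<in> ix ` set H" by (force simp: H_def)
     then obtain p c q where p: "H = p @ c # q" "ix c = i + 1" "i + 1 \<notin> ix ` set p" by (rule split_ix)
     obtain t1 t2 t3 where t: "walk n y L = Some t1" "walk n t1 p = Some t2" "arrow_target n c t2 = Some t3" "walk n t3 q = Some y1"
      using wHL(2) unfolding p by (elim walk_append_Some walk_Cons_Some)
     have "Suc i \<notin> ix ` set q" using rH(1) p by (simp add: reduced_append reduced_Cons)
     moreover have "i \<notin> ix ` set p" "i \<notin> ix ` set q" "i - 1 \<notin> ix ` set p" "i - 1 \<notin> ix ` set q"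
      using hl(1,3) unfolding p(1) by auto
     ultimately have nq: "Suc i \<notin> ix ` set q" "i \<notin> ix ` set p" "i \<notin> ix ` set q" "i - 1 \<notin> ix ` set p" "i - 1 \<notin> ix ` set q" .
     have nL: "i - 1 \<notin> ix ` set L" using False Hu by auto
     have i1: "Suc (i - 1) = i" using \<open>i \<noteq> 0\<close> by simp
     have "i - 1 \<in> y" "i \<notin> y" using L ai by auto
     hence "i - 1 \<in> t1" "i \<notin> t1" using walk_keep[OF t(1), of "i - 1"] walk_keep[OF t(1), of i] hl nL i1 by simp_all
     hence "i - 1 \<in> t2" "i \<notin> t2" using walk_keep[OF t(2), of "i - 1"] walk_keep[OF t(2), of i] nq p(3) i1 by simp_all
     moreover have "\<not> isU c" using nu Hu p by auto
     ultimately have "i - 1 \<in> t3" "i \<in> t3" using t(3) p(2) \<open>i \<noteq> 0\<close> by (cases c; auto split: if_splits)+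
     hence "i - 1 \<in> y1" "i \<in> y1" using walk_keep[OF t(4), of "i - 1"] walk_keep[OF t(4), of i] nq i1 by simp_all
     with y1(2) ru(3) uv(2) show False by (cases b) (auto split: if_splits)
    qed
    moreover have "eqv n k x' [a, b] [AU i]" if "x' \<in> vertices n k" "walk n x' [a, b] \<noteq> None" for x'
    proof -
     have "b = AR i" using that ru(3) uv(2) ai by (cases b) (auto split: if_splits)
     thus ?thesis using that ai path_rels_special(2)[OF that(1), of i] by (auto split: if_splits)
    qed
    ultimately show ?thesis using False L ai by auto
   qed
  qed
  thus ?thesis
  proof
   assume m: "i + 1 \<notin> ix ` set u \<and> i - 1 \<notin> ix ` set u \<and> 1 \<le> i \<and> i \<le> n \<and>
    (\<forall>x'\<in>vertices n k. walk n x' [a, b] \<noteq> None \<longrightarrow> eqv n k x' [a, b] [AU i])"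
   have "eqv n k x (a # u) (u @ [a])"
   proof (rule eqv_comm_word[OF x])
    fix c assume "c \<in> set u"
    hence "ix c \<noteq> i + 1" "ix c \<noteq> i - 1" "ix c \<noteq> i" using m uv(3) by (metis imageI)+
    thus "isU a \<or> isU c \<or> far (ix a) (ix c)" unfolding far_def i_def[symmetric] by linarith
   qed
   from eqv_append[OF x this, of "b # v"] have 1: "eqv n k x (a # r) (u @ [a, b] @ v)" by (simp add: uv)
   then obtain s where s: "walk n x (u @ [a, b] @ v) = Some z" using Some by (simp add: eqv_walk del: walk.simps)
   then obtain s1 where s1: "walk n x u = Some s1" "walk n s1 ([a, b] @ v) = Some z" by (rule walk_append_Some)
   then obtain s2 where "walk n s1 [a, b] = Some s2" by (blast elim: walk_append_Some)
   hence "walk n s1 [a, b] \<noteq> None" by simp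
   moreover have s1v: "s1 \<in> vertices n k" using walk_vertices[OF x s1(1)] .
   ultimately have "eqv n k s1 [a, b] [AU i]" using m by blast
   hence 2: "eqv n k x (u @ [a, b] @ v) (u @ [AU i] @ v)"
    using s1 by (intro eqv_prepend[OF x s1(1)] eqv_append[OF s1v])
   have "eqv n k x (u @ [AU i]) (AU i # u)" by (rule eqv_sym, rule eqv_comm_word[OF x]) simp
   from eqv_append[OF x this, of v] have 3: "eqv n k x (u @ [AU i] @ v) (map AU [i] @ (u @ v))" by simp
   show ?thesis using eqv_trans[OF eqv_trans[OF 1 2] 3] ru(2) by blast
  qed blast
 qed
qed

text \<open>Words are built from the right: a new letter \<open>AU i\<close> joins those in front,
  and any other letter passes the letters U and is absorbed by \<open>reduce_step\<close>.\<close>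

lemma reduce_word:
 assumes "x \<in> vertices n k"
 shows "zro n k x w \<or> (\<exists>us r. eqv n k x w (map AU us @ r) \<and> reduced r)"
 using assms
proof (induction w arbitrary: x)
 case Nil
 have "eqv n k x [] (map AU [] @ []) \<and> reduced []" by (simp add: reduced_def)
 thus ?case by blast
next
 case (Cons a w)
 show ?case
 proof (cases "arrow_target n a x")
  case None thus ?thesis by (simp add: zro_nonpath)
 next
  case (Some y)
  have y: "y \<in> vertices n k" using arrow_target_vertices[OF Cons.prems Some] .
  from Cons.IH[OF y] show ?thesis
  proof
   assume "zro n k y w"
   thus ?thesis using zro_Cons[OF Cons.prems Some] by blast
  next
   assume "\<exists>us r. eqv n k y w (map AU us @ r) \<and> reduced r"
   then obtain us r where e: "eqv n k y w (map AU us @ r)" and r: "reduced r" by blast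
   have 1: "eqv n k x (a # w) (a # map AU us @ r)" by (rule eqv_Cons[OF Cons.prems Some e])
   show ?thesis
   proof (cases "isU a")
    case True
    hence "a # map AU us @ r = map AU (ix a # us) @ r" by (cases a) auto
    with 1 r show ?thesis by metis
   next
    case False
    have "eqv n k x (a # map AU us) (map AU us @ [a])" by (rule eqv_comm_word[OF Cons.prems]) auto
    from eqv_append[OF Cons.prems this, of r]
    have 2: "eqv n k x (a # w) (map AU us @ (a # r))" using eqv_trans[OF 1] by simp
    show ?thesis
    proof (cases "walk n x (map AU us)")
     case None
     thus ?thesis using eqv_zro[OF 2] zro_nonpath by (simp add: walk_append)
    next
     case (Some x')
     have x': "x' \<in> vertices n k" using walk_vertices[OF Cons.prems Some] .
     from reduce_step[OF x' False r] show ?thesis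
     proof
      assume "zro n k x' (a # r)"
      thus ?thesis using eqv_zro[OF 2 zro_prepend[OF Cons.prems Some]] by blast
     next
      assume "\<exists>us' r'. eqv n k x' (a # r) (map AU us' @ r') \<and> reduced r'"
      then obtain us' r' where 3: "eqv n k x' (a # r) (map AU us' @ r')" and r': "reduced r'" by blast
      from eqv_trans[OF 2 eqv_prepend[OF Cons.prems Some 3]]
      have "eqv n k x (a # w) (map AU (us @ us') @ r')" by simp
      with r' show ?thesis by blast
     qed
    qed
   qed
  qed
 qed
qed

section \<open>Reduced words are determined by their ends and their support\<close>

lemma card_below_insert:
 assumes "finite x" "b \<notin> x" "a \<in> x"
 shows "int (card (insert b (x - {a}) \<inter> {..<i})) = int (card (x \<inter> {..<i})) + (if b < i then 1 else 0) - (if a < i then 1 else 0)"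
proof -
 have 1: "card (x \<inter> {..<i}) = card ((x - {a}) \<inter> {..<i}) + (if a < i then 1 else 0)"
 proof (cases "a < i")
  case True
  hence "x \<inter> {..<i} = insert a ((x - {a}) \<inter> {..<i})" using assms by auto
  thus ?thesis using True assms(1) by simp
 next
  case False
  hence "(x - {a}) \<inter> {..<i} = x \<inter> {..<i}" by auto
  thus ?thesis using False by simp
 qed
 have 2: "card (insert b (x - {a}) \<inter> {..<i}) = card ((x - {a}) \<inter> {..<i}) + (if b < i then 1 else 0)"
 proof (cases "b < i")
  case True
  hence "insert b (x - {a}) \<inter> {..<i} = insert b ((x - {a}) \<inter> {..<i})" by auto
  thus ?thesis using True assms by simp
 next
  case False
  hence "insert b (x - {a}) \<inter> {..<i} = (x - {a}) \<inter> {..<i}" by auto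
  thus ?thesis using False by simp
 qed
 show ?thesis using 1 2 by simp
qed

text \<open>Only step i changes the number of elements below i: \<open>AR i\<close> lowers it by one
  and \<open>AL i\<close> raises it by one. The net number of crossings is therefore fixed by the
  end points.\<close>

lemma displacement:
 assumes "x \<in> vertices n k" "walk n x w = Some z"
 shows "int (card (x \<inter> {..<i})) + int (count_list w (AL i)) = int (card (z \<inter> {..<i})) + int (count_list w (AR i))"
 using assms
proof (induction w arbitrary: x)
 case (Cons a w)
 obtain y where y: "arrow_target n a x = Some y" "walk n y w = Some z" by (rule walk_Cons_Some[OF Cons.prems(2)])
 have fin: "finite x" using vertices_finite Cons.prems(1) .
 have IH: "int (card (y \<inter> {..<i})) + int (count_list w (AL i)) = int (card (z \<inter> {..<i})) + int (count_list w (AR i))"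
  by (rule Cons.IH[OF arrow_target_vertices[OF Cons.prems(1) y(1)] y(2)])
 show ?case
 proof (cases a)
  case (AR j)
  hence j: "1 \<le> j" "j - 1 \<in> x" "j \<notin> x" "y = insert j (x - {j - 1})" using y(1) by (auto split: if_splits)
  have "(j - Suc 0 < i) = (j \<le> i)" using j(1) by arith
  thus ?thesis using IH card_below_insert[OF fin j(3,2), of i] j(1) unfolding j(4) AR
   by (cases j i rule: linorder_cases) simp_all
 next
  case (AL j)
  hence j: "1 \<le> j" "j - 1 \<notin> x" "j \<in> x" "y = insert (j - 1) (x - {j})" using y(1) by (auto split: if_splits)
  have "(j - Suc 0 < i) = (j \<le> i)" using j(1) by arith
  thus ?thesis using IH card_below_insert[OF fin j(2,3), of i] j(1) unfolding j(4) AL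
   by (cases j i rule: linorder_cases) simp_all
 next
  case (AU j)
  thus ?thesis using IH y(1) by (auto split: if_splits)
 qed
qed simp

lemma count_list_reduced: "reduced w ==> a \<in> set w ==> ix b = ix a ==> count_list w b = (if b = a then 1 else 0)"
proof (induction w)
 case (Cons c w)
 show ?case
 proof (cases "ix a \<in> ix ` set w")
  case True
  hence "c \<noteq> a" "c \<noteq> b" using Cons.prems by (auto simp: reduced_Cons)
  thus ?thesis using Cons by (auto simp: reduced_Cons)
 next
  case False
  hence "c = a" "b \<notin> set w" using Cons.prems by (auto, metis imageI)
  thus ?thesis by (auto simp: count_list_0_iff)
 qed
qed simp

text \<open>A reduced word crosses the step once, and by \<open>displacement\<close> the end points
  determine the direction.\<close>

lemma reduced_letter:
 assumes x: "x \<in> vertices n k" and u: "walk n x u = Some z" "reduced u" and v: "walk n x v = Some z" "reduced v"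
  and a: "a \<in> set u" and b: "b \<in> set v" and ab: "ix a = ix b"
 shows "a = b"
proof (rule ccontr)
 assume ne: "a \<noteq> b"
 have "\<not> isU a" "\<not> isU b" using u(2) v(2) a b by (auto simp: reduced_def)
 then obtain i where i: "a = AR i \<and> b = AL i \<or> a = AL i \<and> b = AR i" using ne ab by (cases a; cases b) auto
 have "count_list u (AL i) = (if AL i = a then 1 else 0)" "count_list u (AR i) = (if AR i = a then 1 else 0)"
  "count_list v (AL i) = (if AL i = b then 1 else 0)" "count_list v (AR i) = (if AR i = b then 1 else 0)"
  using count_list_reduced[OF u(2) a] count_list_reduced[OF v(2) b] i by auto
 with displacement[OF x u(1), of i] displacement[OF x v(1), of i] i show False by auto
qed

text \<open>The first arrow of one word commutes to the front of the other, as anything adjacent before it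
 would block it.\<close>

lemma reduced_unique:
 assumes "x \<in> vertices n k" "walk n x u = Some z" "reduced u" "walk n x v = Some z" "reduced v" "ix ` set u = ix ` set v"
 shows "eqv n k x u v"
 using assms
proof (induction u arbitrary: x v)
 case Nil thus ?case by simp
next
 case (Cons a u)
 note x = Cons.prems(1)
 obtain y where y: "arrow_target n a x = Some y" "walk n y u = Some z" using Cons.prems(2) by (rule walk_Cons_Some)
 have "ix a \<in> ix ` set v" using Cons.prems(6) by auto
 then obtain p b q where v: "v = p @ b # q" "ix b = ix a" "ix a \<notin> ix ` set p" by (rule split_ix)
 have "a = b" using reduced_letter[OF Cons.prems(1-5), of a b] v by simp
 define i where "i = ix a"
 have "\<not> isU a" "reduced u" "i \<notin> ix ` set u" using Cons.prems(3) by (simp_all add: reduced_Cons i_def)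
 moreover have "reduced p" "reduced q" "i \<notin> ix ` set q" "ix ` set p \<inter> ix ` set (b # q) = {}"
  using Cons.prems(5) unfolding v(1) i_def v(2)[symmetric] by (simp_all add: reduced_append reduced_Cons)
 moreover from this have "reduced (p @ q)" unfolding reduced_append by auto
 ultimately have rp: "reduced p" "\<not> isU a" "i \<notin> ix ` set q" "reduced (p @ q)" "reduced u" "i \<notin> ix ` set u"
  by simp_all
 obtain t1 t2 where t: "walk n x p = Some t1" "arrow_target n a t1 = Some t2"
  using Cons.prems(4) unfolding v(1) \<open>a = b\<close> by (elim walk_append_Some walk_Cons_Some)
 have i1: "1 \<le> i" "Suc (i - 1) = i" using arrow_target_ix[OF y(1)] by (auto simp: i_def)
 \<comment> \<open>The first letter of \<open>p\<close> with index i - 1 or i + 1 would toggle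
   position i - 1 or i, and nothing later in \<open>p\<close> could undo this, since
   \<open>p\<close> is reduced and avoids i. But \<open>a\<close> can act both before and after
   \<open>p\<close>, which requires the same occupancy of these two positions.\<close>
 have "ix c \<noteq> i + 1 \<and> ix c \<noteq> i - 1" if "c \<in> set p" for c
 proof (rule ccontr)
  assume "\<not> (ix c \<noteq> i + 1 \<and> ix c \<noteq> i - 1)"
  with that have "\<exists>c\<in>set p. ix c = i + 1 \<or> ix c = i - 1" by blast
  then obtain p1 d p2 where p: "p = p1 @ d # p2" "ix d = i + 1 \<or> ix d = i - 1" "\<forall>c\<in>set p1. \<not> (ix c = i + 1 \<or> ix c = i - 1)"
   by (rule split_first)
  obtain s1 s2 where s: "walk n x p1 = Some s1" "arrow_target n d s1 = Some s2" "walk n s2 p2 = Some t1"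
   using t(1) unfolding p(1) by (elim walk_append_Some walk_Cons_Some)
  have n1: "i \<notin> ix ` set p1" "Suc i \<notin> ix ` set p1" "i - 1 \<notin> ix ` set p1" "i \<notin> ix ` set p2" "\<not> isU d"
   "ix d \<notin> ix ` set p2"
   using v(3) p(1,3) rp(1) by (auto simp: i_def reduced_append reduced_Cons)
  have k1: "i - 1 \<in> s1 \<longleftrightarrow> i - 1 \<in> x" "i \<in> s1 \<longleftrightarrow> i \<in> x"
   using walk_keep[OF s(1), of "i - 1"] walk_keep[OF s(1), of i] n1 i1 by simp_all
  have k2: "ix d = i - 1 ==> i - 1 \<in> t1 \<longleftrightarrow> i - 1 \<in> s2" "ix d = i + 1 ==> i \<in> t1 \<longleftrightarrow> i \<in> s2"
   using walk_keep[OF s(3), of "i - 1"] walk_keep[OF s(3), of i] n1 i1 by simp_all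
  show False
   using y(1) rp(2)
  proof (cases rule: arrow_cases)
   case (R j)
   hence j: "j = i" by (simp add: i_def)
   have "i - 1 \<in> t1" "i \<notin> t1" using t(2) R j by (auto split: if_splits)
   thus False using p(2) k1 k2 R j s(2) n1(5) i1 by (cases d) (auto split: if_splits)
  next
   case (L j)
   hence j: "j = i" by (simp add: i_def)
   have "i - 1 \<notin> t1" "i \<in> t1" using t(2) L j by (auto split: if_splits)
   thus False using p(2) k1 k2 L j s(2) n1(5) i1 by (cases d) (auto split: if_splits)
  qed
 qed
 moreover have "ix c \<noteq> i" if "c \<in> set p" for c using v(3) that by (metis imageI i_def)
 ultimately have "isU a \<or> isU c \<or> far (ix a) (ix c)" if "c \<in> set p" for c
  using that unfolding far_def i_def[symmetric] by (metis add_diff_inverse_nat diff_is_0_eq i1(1) less_one linorder_neqE_nat nat_less_le not_less_eq Suc_eq_plus1 add.commute less_diff_conv)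
 hence "eqv n k x (a # p) (p @ [a])" by (rule eqv_comm_word[OF x])
 from eqv_append[OF x this, of q] have 1: "eqv n k x (a # p @ q) v" by (simp add: v \<open>a = b\<close>)
 have "walk n x (a # p @ q) = Some z" using Cons.prems(4) eqv_walk[OF 1] by (simp only:)
 hence w: "walk n y (p @ q) = Some z" using y(1) by simp
 have "ix ` set u = ix ` set (p @ q)"
 proof -
  have "insert i (ix ` set u) = insert i (ix ` set (p @ q))" using Cons.prems(6) by (auto simp: v i_def)
  moreover have "i \<notin> ix ` set (p @ q)" using v(3) rp(3) by (auto simp: i_def)
  ultimately show ?thesis using rp(6) by (metis insert_ident)
 qed
 hence "eqv n k y u (p @ q)"
  by (intro Cons.IH[OF arrow_target_vertices[OF x y(1)] y(2) rp(5) w rp(4)])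
 from eqv_trans[OF eqv_Cons[OF x y(1) this] 1] show ?case .
qed

section \<open>Words that vanish\<close>

lemma walk_U: "(\<forall>i\<in>set us. 1 \<le> i \<and> i \<le> n) ==> walk n x (map AU us) = Some x"
 by (induction us) auto

lemma walk_U_Some: "walk n x (map AU us) = Some y ==> y = x \<and> (\<forall>i\<in>set us. 1 \<le> i \<and> i \<le> n)"
 by (induction us) (auto split: if_splits)

lemma eqv_U_perm:
 assumes x: "x \<in> vertices n k" and "mset us = mset vs"
 shows "eqv n k x (map AU us) (map AU vs)"
 using assms(2)
proof (induction us arbitrary: vs)
 case (Cons i us)
 then obtain p q where vs: "vs = p @ i # q" by (metis list.set_intros(1) set_mset_mset split_list)
 hence "mset us = mset (p @ q)" using Cons.prems by simp
 hence "eqv n k x (map AU us) (map AU (p @ q))" by (rule Cons.IH)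
 hence 1: "eqv n k x (map AU (i # us)) (AU i # map AU (p @ q))"
 proof (cases "arrow_target n (AU i) x")
  case (Some y)
  hence "y = x" by (simp split: if_splits)
  thus ?thesis using eqv_Cons[OF x Some] \<open>eqv n k x (map AU us) (map AU (p @ q))\<close> by simp
 qed (auto intro: eqv_nonpath)
 have "eqv n k x (AU i # map AU p) (map AU p @ [AU i])" by (rule eqv_comm_word[OF x]) simp
 from eqv_append[OF x this, of "map AU q"] have "eqv n k x (AU i # map AU (p @ q)) (map AU vs)" by (simp add: vs)
 with 1 show ?case by (rule eqv_trans)
qed simp

text \<open>Induction on the length of the interval. If b - 1 is unoccupied, \<open>AU b\<close>
  already vanishes. Otherwise \<open>AU b\<close> is \<open>AR b\<close> followed by
  \<open>AL b\<close>, and after \<open>AR b\<close> the hole has moved to b - 1, where the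
  remaining letters cover the shorter interval.\<close>

lemma bad_U_zero:
 assumes "x \<in> vertices n k" "a < b" "b \<le> n" "a \<notin> x" "b \<notin> x" "{a<..b} \<subseteq> set us"
 shows "zro n k x (map AU us)"
 using assms
proof (induction "b - a" arbitrary: x us b rule: less_induct)
 case less
 note x = less.prems(1)
 have b: "b \<in> set us" "1 \<le> b" using less.prems by auto
 define vs where "vs = remove1 b us"
 have "mset us = mset (b # vs)" using b by (simp add: vs_def)
 hence 1: "eqv n k x (map AU us) (AU b # map AU vs)" using eqv_U_perm[OF x] by fastforce
 have "zro n k x (AU b # map AU vs)"
 proof (cases "b - 1 \<in> x")
  case False
  hence "zro n k x [AU b]" using path_rels_special(3)[OF x b(2) less.prems(3)] less.prems(5) by simp
  from zro_append[OF x this, of "map AU vs"] show ?thesis by simp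
 next
  case True
  define x' where "x' = insert b (x - {b - 1})"
  have t: "arrow_target n (AR b) x = Some x'" using True less.prems b by (simp add: x'_def)
  have x': "x' \<in> vertices n k" using arrow_target_vertices[OF x t] .
  have ab: "a < b - 1" using True less.prems(2,4) by (metis Suc_diff_1 Suc_leI b(2) less_Suc_eq_le nat_less_le not_less_eq less_eq_Suc_le One_nat_def)
  have sub: "{a<..b - 1} \<subseteq> set vs"
  proof
   fix j assume j: "j \<in> {a<..b - 1}"
   hence "j \<in> set us" "j \<noteq> b" using less.prems(6) b(2) by auto
   thus "j \<in> set vs" by (simp add: vs_def)
  qed
  have "zro n k x' (map AU vs)"
   by (rule less.hyps[of "b - 1", OF _ x' ab _ _ _ sub])
    (use ab less.prems b(2) in \<open>auto simp: x'_def\<close>)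
  from zro_append[OF x' this, of "[AL b]"] have "zro n k x (AR b # map AU vs @ [AL b])"
   by (rule zro_Cons[OF x t])
  moreover have "eqv n k x (AU b # map AU vs) (AR b # map AU vs @ [AL b])"
  proof -
   have "eqv n k x [AU b] [AR b, AL b]"
    using path_rels_special(1)[OF x b(2) less.prems(3) True less.prems(5)] by (rule eqv_sym)
   from eqv_append[OF x this, of "map AU vs"] have "eqv n k x (AU b # map AU vs) (AR b # AL b # map AU vs)" by simp
   moreover have "eqv n k x' (AL b # map AU vs) (map AU vs @ [AL b])" by (rule eqv_comm_word[OF x']) auto
   ultimately show ?thesis using eqv_Cons[OF x t] eqv_trans by blast
  qed
  ultimately show ?thesis using eqv_zro by blast
 qed
 with 1 show ?case using eqv_zro by blast
qed

text \<open>Cutting at interior holes keeps both ends unoccupied. An occupied interior makes the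
  first arrow inside the interval predictable, which \<open>bad_reduced_zero\<close>
  exploits.\<close>

lemma bad_minimal:
 assumes "bad n x Z"
 obtains a b where "a < b" "b \<le> n" "a \<notin> x" "b \<notin> x" "{a<..b} \<subseteq> Z" "{a<..<b} \<subseteq> x"
proof -
 have "\<exists>a b. a < b \<and> b \<le> n \<and> a \<notin> x \<and> b \<notin> x \<and> {a<..b} \<subseteq> Z \<and> {a<..<b} \<subseteq> x"
  if "a < b \<and> b \<le> n \<and> a \<notin> x \<and> b \<notin> x \<and> {a<..b} \<subseteq> Z" for a b
  using that
 proof (induction "b - a" arbitrary: b rule: less_induct)
  case less
  show ?case
  proof (cases "{a<..<b} \<subseteq> x")
   case False
   then obtain e where "e \<in> {a<..<b}" "e \<notin> x" by blast
   hence e: "a < e" "e < b" "e \<notin> x" by simp_all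
   have "{a<..e} \<subseteq> {a<..b}" using e by auto
   hence "{a<..e} \<subseteq> Z" using less.prems by blast
   thus ?thesis using less.hyps[of e] e less.prems by auto
  qed (use less.prems in blast)
 qed
 thus thesis using assms that unfolding bad_def by metis
qed

text \<open>Induction on the length of \<open>r\<close>, with a bad interval from a to b whose
  interior is occupied. If the letters U cover it, \<open>bad_U_zero\<close> applies. Otherwise
  consider the first letter c of \<open>r\<close>: either the rest is still bad after c, or c is
  \<open>AR a\<close> or \<open>AL (b + 1)\<close>, which fills one end of the interval from
  outside. Then the first later letter d inside the interval must act at the other end and can be
  brought next to c. Either the product of c and d is 0 by a relation, or d moves to the front and
  leaves a shorter bad interval for the rest.\<close>

lemma bad_reduced_zero:
 assumes "x \<in> vertices n k" "reduced r" "bad n x (set us \<union> ix ` set r)"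
 shows "zro n k x (map AU us @ r)"
 using assms
proof (induction "length r" arbitrary: x r rule: less_induct)
 case less
 note x = less.prems(1)
 show ?case
 proof (cases "walk n x (map AU us @ r)")
  case None thus ?thesis by (rule zro_nonpath)
 next
  case (Some z)
  obtain a b where ab: "a < b" "b \<le> n" "a \<notin> x" "b \<notin> x" "{a<..b} \<subseteq> set us \<union> ix ` set r" "{a<..<b} \<subseteq> x"
   using bad_minimal[OF less.prems(3)] by metis
  have us: "walk n x (map AU us) = Some x" "walk n x r = Some z"
   using Some walk_U_Some by (auto elim!: walk_append_Some)
  have U0: "zro n k x (map AU us @ r)" if "{a<..b} \<subseteq> set us"
   by (rule zro_append[OF x bad_U_zero[OF x ab(1-4) that]])
  have step: "zro n k x (map AU us @ c # q)"
   if c: "arrow_target n c x = Some y" "reduced (c # q)" "length (c # q) = length r" "bad n y (set us \<union> ix ` set q)" for c q y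
  proof -
   have y: "y \<in> vertices n k" using arrow_target_vertices[OF x c(1)] .
   have "zro n k y (map AU us @ q)"
    by (rule less.hyps[OF _ y _ c(4)]) (use c(2,3) in \<open>auto simp: reduced_Cons\<close>)
   hence 1: "zro n k x (c # map AU us @ q)" by (rule zro_Cons[OF x c(1)])
   have "eqv n k x (map AU us @ [c]) (c # map AU us)" by (rule eqv_sym, rule eqv_comm_word[OF x]) auto
   from eqv_append[OF x this, of q] eqv_zro 1 show ?thesis by fastforce
  qed
  show ?thesis
  proof (cases r)
   case Nil thus ?thesis using U0 ab(5) by simp
  next
   case (Cons c q)
   have rc: "reduced (c # q)" "\<not> isU c" "reduced q" "ix c \<notin> ix ` set q" using less.prems(2) Cons by (auto simp: reduced_Cons)
   obtain y where y: "arrow_target n c x = Some y" "walk n y q = Some z" using us(2) unfolding Cons by (rule walk_Cons_Some)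
   have yv: "y \<in> vertices n k" using arrow_target_vertices[OF x y(1)] .
   define Z where "Z = set us \<union> ix ` set q"
   have Zr: "set us \<union> ix ` set r = insert (ix c) Z" by (auto simp: Z_def Cons)
   show ?thesis
   proof (cases "bad n y Z")
    case True thus ?thesis using step[OF y(1) rc(1)] by (simp add: Z_def Cons)
   next
    case False
    have cZ: "ix c \<notin> Z"
    proof
     assume "ix c \<in> Z"
     hence "bad n x Z" using less.prems(3) unfolding Zr by (simp add: insert_absorb)
     thus False using bad_step[OF y(1) \<open>ix c \<in> Z\<close>] False by blast
    qed
    have abZ: "j \<in> Z" if "a < j" "j \<le> b" "j \<noteq> ix c" for j using ab(5) that unfolding Zr by auto
    have int: "j \<in> x" if "a < j" "j < b" for j using ab(6) that by auto
    have nbad: "\<not> (a' < b' \<and> b' \<le> n \<and> a' \<notin> y \<and> b' \<notin> y \<and> {a'<..b'} \<subseteq> Z)" for a' b'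
     using False unfolding bad_def by blast
    have qnu: "\<not> isU d" if "d \<in> set q" for d using rc(3) that by (auto simp: reduced_def)
    \<comment> \<open>Every other letter leaves holes at both ends of a possibly shorter interval
      inside \<open>Z\<close>, contrary to \<open>nbad\<close>.\<close>
    have cases: "c = AR a \<and> 1 \<le> a \<or> c = AL (b + 1) \<and> b + 1 \<le> n"
     using y(1) rc(2)
    proof (cases rule: arrow_cases)
     case (R i)
     show ?thesis
     proof (cases "i = a")
      case False
      have "\<not> (a < i \<and> i \<le> b)"
      proof
       assume i: "a < i \<and> i \<le> b"
       have "\<not> i < b" using int[of i] R(5) i by blast
       hence "i = b" using i by simp
       moreover have "a \<noteq> i - 1" using R(4) ab(3) by metis
       ultimately have "a < b - 1" "b - 1 \<notin> y" "a \<notin> y" using i R ab(3) by auto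
       moreover have "{a<..b - 1} \<subseteq> Z" using abZ R(1) \<open>i = b\<close> by auto
       ultimately show False using nbad[of a "b - 1"] ab(2) by auto
      qed
      hence "a \<notin> y" "b \<notin> y" "{a<..b} \<subseteq> Z" using R False ab abZ by auto
      thus ?thesis using nbad[of a b] ab(1,2) by blast
     qed (use R in auto)
    next
     case (L i)
     show ?thesis
     proof (cases "i = b + 1")
      case False
      have "\<not> (a < i \<and> i \<le> b)"
      proof
       assume i: "a < i \<and> i \<le> b"
       have "i - 1 < b" using i by auto
       hence "\<not> a < i - 1" using int[of "i - 1"] L(4) by blast
       hence "i = a + 1" using i by auto
       moreover have "i \<noteq> b" using L(5) ab(4) by metis
       ultimately have "a + 1 < b" "b \<notin> y" "a + 1 \<notin> y" using i L ab(4) by auto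
       moreover have "{a + 1<..b} \<subseteq> Z" using abZ L(1) \<open>i = a + 1\<close> by auto
       ultimately show False using nbad[of "a + 1" b] ab(2) by auto
      qed
      moreover from this have "i - 1 \<noteq> a" "i - 1 \<noteq> b" using False ab(1) L(2) by auto
      ultimately have "a \<notin> y" "b \<notin> y" "{a<..b} \<subseteq> Z" using L ab(3,4) abZ by auto
      thus ?thesis using nbad[of a b] ab(1,2) by blast
     qed (use L in auto)
    qed
    have iab: "ix c \<notin> {a<..b}" using cases by auto
    hence abZ': "{a<..b} \<subseteq> Z" using abZ by (metis greaterThanAtMost_iff subsetI)
    show ?thesis
    proof (cases "\<exists>d\<in>set q. ix d \<in> {a<..b}")
     case False
     hence "{a<..b} \<subseteq> set us" using abZ' unfolding Z_def by fastforce
     thus ?thesis by (rule U0)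
    next
     case True
     then obtain p d q' where q: "q = p @ d # q'" "ix d \<in> {a<..b}" "\<forall>e\<in>set p. ix e \<notin> {a<..b}"
      by (rule split_first)
     obtain s1 s2 where s: "walk n y p = Some s1" "arrow_target n d s1 = Some s2"
      using y(2) unfolding q(1) by (elim walk_append_Some walk_Cons_Some)
     have du: "\<not> isU d" using qnu q(1) by simp
     have rq: "reduced p" "reduced (p @ q')" "ix d \<notin> ix ` set (p @ q')" "\<not> isU d" "ix c \<noteq> ix d" "ix c \<notin> ix ` set p" "ix c \<notin> ix ` set q'"
      using rc(3,4) unfolding q(1) by (auto simp: reduced_append reduced_Cons)
     have pn: "j \<notin> ix ` set p" if "a < j" "j \<le> b" for j using q(3) that by auto
     have keep: "v \<in> s1 \<longleftrightarrow> v \<in> y" if "v \<notin> ix ` set p" "Suc v \<notin> ix ` set p" for v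
      using walk_keep[OF s(1) that] .
     have swap: "eqv n k x (map AU us @ r) (map AU us @ c # d # p @ q')"
      if "\<And>e. e \<in> set p ==> far (ix d) (ix e)"
     proof -
      have "eqv n k y (p @ [d]) (d # p)" by (rule eqv_sym, rule eqv_comm_word[OF yv]) (use that in auto)
      from eqv_Cons[OF x y(1) eqv_append[OF yv this, of q']]
      have "eqv n k x r (c # d # p @ q')" by (simp add: Cons q(1))
      from eqv_prepend[OF x us(1) this] show ?thesis by simp
     qed
     have swap2: "zro n k x (map AU us @ c # d # p @ q')"
      if f: "far (ix c) (ix d)" and t: "arrow_target n d x = Some t" and bd: "bad n t (set us \<union> ix ` set (c # p @ q'))" for t
     proof -
      have "eqv n k x ([c, d] @ p @ q') ([d, c] @ p @ q')" by (rule eqv_append[OF x eqv_comm[OF x]]) (use f in simp)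
      from eqv_prepend[OF x us(1) this]
      have 1: "eqv n k x (map AU us @ c # d # p @ q') (map AU us @ d # c # p @ q')" by simp
      have "zro n k x (map AU us @ d # c # p @ q')"
       by (rule step[OF t]) (use rq rc bd in \<open>auto simp: reduced_Cons Cons q(1)\<close>)
      with 1 show ?thesis by (rule eqv_zro)
     qed
     have Zs: "j \<in> set us \<union> ix ` set (c # p @ q')" if "a < j" "j \<le> b" "j \<noteq> ix d" for j
      using abZ' that unfolding Z_def q(1) by auto
     from cases show ?thesis
     proof
      assume c: "c = AL (b + 1) \<and> b + 1 \<le> n"
      have yx: "y = insert b (x - {b + 1})" "b + 1 \<in> x" using y(1) c by (auto split: if_splits)
      have bs: "b \<in> s1" using keep[of b] pn[of b] rq(6) c yx ab(1) by auto
      have ints: "j \<in> s1" if "a < j" "j < b" for j using keep[of j] pn[of j] pn[of "Suc j"] that int yx by auto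
      have d: "ix d = a + 1 \<and> a \<notin> s1 \<and> d = AL (a + 1)"
       using s(2) du
      proof (cases rule: arrow_cases)
       case (R i)
       thus ?thesis using bs ints[of i] q(2) by (cases "i = b") auto
      next
       case (L i)
       hence "i - 1 < b" using q(2) by auto
       hence "\<not> a < i - 1" using ints[of "i - 1"] L(4) by blast
       hence "i = a + 1" using L(1) q(2) by auto
       thus ?thesis using L by auto
      qed
      \<comment> \<open>A letter with index a before \<open>d\<close> would fill position a, which
        \<open>d = AL (a + 1)\<close> needs unoccupied. This excludes the lower neighbour of the
        index of \<open>d\<close>.\<close>
      have "a \<notin> ix ` set p"
      proof
       assume "a \<in> ix ` set p"
       then obtain p1 e p2 where p: "p = p1 @ e # p2" "ix e = a" "a \<notin> ix ` set p1" by (rule split_ix)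
       obtain w1 w2 where w: "walk n y p1 = Some w1" "arrow_target n e w1 = Some w2" "walk n w2 p2 = Some s1"
        using s(1) unfolding p(1) by (elim walk_append_Some walk_Cons_Some)
       have n2: "a \<notin> ix ` set p2" "Suc a \<notin> ix ` set p1" "Suc a \<notin> ix ` set p2" "\<not> isU e"
        using rq(1) pn[of "Suc a"] ab(1) p by (auto simp: reduced_append reduced_Cons)
       have "a \<notin> y" using yx ab by auto
       hence "a \<notin> w1" using walk_keep[OF w(1), of a] p(3) n2 by simp
       hence "a \<in> w2" using w(2) p(2) n2(4) by (cases e) (auto split: if_splits)
       thus False using walk_keep[OF w(3), of a] n2 d by simp
      qed
      hence "far (ix d) (ix e)" if "e \<in> set p" for e
      proof -
       have "ix e \<noteq> a" using \<open>a \<notin> ix ` set p\<close> that by auto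
       moreover have "ix e \<noteq> a + 1" using pn[of "a + 1"] ab(1) imageI[OF that, of ix] by auto
       moreover have "ix e \<noteq> a + 2"
       proof
        assume e: "ix e = a + 2"
        have "a + 2 \<le> b \<or> a + 2 = b + 1" using ab(1) by auto
        thus False using pn[of "ix e"] rq(6) c imageI[OF that, of ix] e by auto
       qed
       ultimately show ?thesis using d by (auto simp: far_def)
      qed
      hence sw: "eqv n k x (map AU us @ r) (map AU us @ c # d # p @ q')" by (rule swap)
      have "zro n k x (map AU us @ c # d # p @ q')"
      proof (cases "a + 1 = b")
       case True
       have "zro n k x [c, d]" using path_rels_special(5)[OF x, of "b + 1"] c d True by auto
       hence "zro n k x (map AU us @ [c, d] @ (p @ q'))" by (intro zro_ctx[OF x]) (use us(1) in auto)
       thus ?thesis by simp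
      next
       case False
       hence lt: "a + 1 < b" using ab(1) by simp
       have t: "arrow_target n d x = Some (insert a (x - {a + 1}))" using d ab int[of "a + 1"] lt by auto
       have "{a + 1<..b} \<subseteq> set us \<union> ix ` set (c # p @ q')"
       proof
        fix j assume "j \<in> {a + 1<..b}"
        thus "j \<in> set us \<union> ix ` set (c # p @ q')" using d by (intro Zs) auto
       qed
       hence "bad n (insert a (x - {a + 1})) (set us \<union> ix ` set (c # p @ q'))"
        using lt ab(2,4) by (intro badI[of "a + 1" b]) simp_all
       thus ?thesis by (intro swap2[OF _ t]) (use c d lt in \<open>auto simp: far_def\<close>)
      qed
      with sw show ?thesis by (rule eqv_zro)
     next
      assume c: "c = AR a \<and> 1 \<le> a"
      have yx: "y = insert a (x - {a - 1})" "a - 1 \<in> x" using y(1) c by (auto split: if_splits)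
      have as: "a \<in> s1" using keep[of a] pn[of "Suc a"] rq(6) c yx ab(1) by auto
      have ints: "j \<in> s1" if "a < j" "j < b" for j using keep[of j] pn[of j] pn[of "Suc j"] that int yx by auto
      have d: "ix d = b \<and> b \<notin> s1 \<and> d = AR b"
       using s(2) du
      proof (cases rule: arrow_cases)
       case (R i)
       hence "\<not> i < b" using ints[of i] q(2) by auto
       thus ?thesis using R q(2) by auto
      next
       case (L i)
       hence "a < i - 1 \<or> a = i - 1" "i - 1 < b" using q(2) by auto
       thus ?thesis using as ints[of "i - 1"] L by auto
      qed
      have "Suc b \<notin> ix ` set p"
      proof
       assume "Suc b \<in> ix ` set p"
       then obtain p1 e p2 where p: "p = p1 @ e # p2" "ix e = Suc b" "Suc b \<notin> ix ` set p1" by (rule split_ix)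
       obtain w1 w2 where w: "walk n y p1 = Some w1" "arrow_target n e w1 = Some w2" "walk n w2 p2 = Some s1"
        using s(1) unfolding p(1) by (elim walk_append_Some walk_Cons_Some)
       have n2: "b \<notin> ix ` set p2" "b \<notin> ix ` set p1" "Suc b \<notin> ix ` set p2" "\<not> isU e"
        using rq(1) pn[of b] ab(1) p by (auto simp: reduced_append reduced_Cons)
       have "b \<notin> y" using yx ab by auto
       hence "b \<notin> w1" using walk_keep[OF w(1), of b] p(3) n2 by simp
       hence "b \<in> w2" using w(2) p(2) n2(4) by (cases e) (auto split: if_splits)
       thus False using walk_keep[OF w(3), of b] n2 d by simp
      qed
      hence "far (ix d) (ix e)" if "e \<in> set p" for e
      proof -
       have "ix e \<noteq> Suc b" using \<open>Suc b \<notin> ix ` set p\<close> that by (metis imageI)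
       moreover have "ix e \<noteq> b" using pn[of b] ab(1) that by auto
       moreover have "Suc (ix e) \<noteq> b"
       proof
        assume "Suc (ix e) = b"
        hence "ix e = a \<or> a < ix e \<and> ix e \<le> b" using ab(1) by auto
        thus False using pn[of "ix e"] rq(6) c that by auto
       qed
       ultimately show ?thesis using d by (auto simp: far_def)
      qed
      hence sw: "eqv n k x (map AU us @ r) (map AU us @ c # d # p @ q')" by (rule swap)
      have "zro n k x (map AU us @ c # d # p @ q')"
      proof (cases "a + 1 = b")
       case True
       have "zro n k x [c, d]" using path_rels_special(4)[OF x, of "b"] c d True ab by auto
       hence "zro n k x (map AU us @ [c, d] @ (p @ q'))" by (intro zro_ctx[OF x]) (use us(1) in auto)
       thus ?thesis by simp
      next
       case False
       hence lt: "a + 1 < b" using ab(1) by simp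
       have "b - 1 \<in> x" using int[of "b - 1"] lt by auto
       hence t: "arrow_target n d x = Some (insert b (x - {b - 1}))" using d ab lt by auto
       have "{a<..b - 1} \<subseteq> set us \<union> ix ` set (c # p @ q')"
       proof
        fix j assume "j \<in> {a<..b - 1}"
        thus "j \<in> set us \<union> ix ` set (c # p @ q')" using d lt by (intro Zs) auto
       qed
       hence "bad n (insert b (x - {b - 1})) (set us \<union> ix ` set (c # p @ q'))"
        using lt ab(2,3) by (intro badI[of a "b - 1"]) simp_all
       thus ?thesis by (intro swap2[OF _ t]) (use c d lt in \<open>auto simp: far_def\<close>)
      qed
      with sw show ?thesis by (rule eqv_zro)
     qed
    qed
   qed
  qed
 qed
qed

section \<open>The path ideal as the kernel of the normal form\<close>

lemma eqv_nf:
 assumes "x \<in> vertices n k" "eqv n k x u v" "walk n x u = Some y"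
 shows "nf n (x, u) = nf n (x, v)"
proof -
 have "walk n x v = Some y" using eqv_walk[OF assms(2)] assms(3) by simp
 hence p: "path_elt n k x u = frag_of (x, u)" "path_elt n k x v = frag_of (x, v)"
  using assms by (auto simp: path_elt_def paths_def)
 have "nfe n (path_elt n k x u - path_elt n k x v) = 0"
  using assms(2) path_ideal_subset unfolding eqv_def nf_ideal_def by blast
 thus ?thesis unfolding p by (simp add: frag_extend_diff)
qed

lemma zro_bad:
 assumes "x \<in> vertices n k" "zro n k x u" "walk n x u = Some y" shows "bad n x (ix ` set u)"
proof -
 have p: "path_elt n k x u = frag_of (x, u)" using assms by (auto simp: path_elt_def paths_def)
 have "nfe n (path_elt n k x u) = 0"
  using assms(2) path_ideal_subset unfolding zro_def nf_ideal_def by blast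
 thus ?thesis unfolding p by (simp add: nf_def split: if_splits)
qed

lemma bad_zro:
 assumes x: "x \<in> vertices n k" and b: "bad n x (ix ` set w)" shows "zro n k x w"
proof (cases "walk n x w")
 case None thus ?thesis by (rule zro_nonpath)
next
 case (Some y)
 from reduce_word[OF x, of w] show ?thesis
 proof
  assume "\<exists>us r. eqv n k x w (map AU us @ r) \<and> reduced r"
  then obtain us r where e: "eqv n k x w (map AU us @ r)" and r: "reduced r" by blast
  have "nf n (x, map AU us @ r) = 0" using eqv_nf[OF x e Some] b by (simp add: nf_def)
  hence "bad n x (ix ` set (map AU us @ r))" by (simp add: nf_def split: if_splits)
  hence "bad n x (set us \<union> ix ` set r)" by (simp add: image_Un image_image)
  from eqv_zro[OF e bad_reduced_zero[OF x r this]] show ?thesis .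
 qed
qed

lemma cnt_reduced: "reduced r ==> cnt r i = (if i \<in> ix ` set r then 1 else 0)"
proof (induction r)
 case (Cons a r)
 hence "wt a = 1" by (cases a) (auto simp: reduced_Cons)
 thus ?case using Cons by (auto simp: reduced_Cons)
qed simp

lemma cnt_U: "cnt (map AU us) i = 2 * count_list us i"
 by (induction us) auto

text \<open>The crossing number of step i is twice the multiplicity of \<open>AU i\<close>, plus 1
  if the reduced part contains i. So its parity gives the support of the reduced part and the
  remainder gives the letters U, and both parts are then unique up to \<open>eqv\<close>.\<close>

lemma same_nf_eqv:
 assumes x: "x \<in> vertices n k" and u: "walk n x u = Some z" and v: "walk n x v = Some z" and c: "cnt u = cnt v"
  and nb: "\<not> bad n x (ix ` set u)"
 shows "eqv n k x u v"
proof -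
 have "ix ` set u = ix ` set v" using c cnt_pos_iff by (metis subsetI subset_antisym)
 hence nb': "\<not> bad n x (ix ` set v)" using nb by simp
 have "\<exists>us r. eqv n k x w (map AU us @ r) \<and> reduced r \<and> cnt (map AU us @ r) = cnt w \<and> walk n x (map AU us) = Some x \<and> walk n x r = Some z"
  if w: "walk n x w = Some z" "\<not> bad n x (ix ` set w)" for w
 proof -
  have "\<not> zro n k x w" using zro_bad[OF x _ w(1)] w(2) by blast
  then obtain us r where e: "eqv n k x w (map AU us @ r)" and r: "reduced r" using reduce_word[OF x, of w] by blast
  have "cnt (map AU us @ r) = cnt w" using eqv_nf[OF x e w(1)] w(2) by (simp add: nf_def frag_of_eq split: if_splits)
  moreover obtain y where y: "walk n x (map AU us) = Some y" "walk n y r = Some z"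
   using w(1) unfolding eqv_walk[OF e] by (rule walk_append_Some)
  moreover have "y = x" using walk_U_Some[OF y(1)] by simp
  ultimately show ?thesis using e r by blast
 qed
 from this[OF u nb] this[OF v nb'] obtain us r vs s where
  1: "eqv n k x u (map AU us @ r)" "reduced r" "cnt (map AU us @ r) = cnt u" "walk n x (map AU us) = Some x" "walk n x r = Some z"
  and 2: "eqv n k x v (map AU vs @ s)" "reduced s" "cnt (map AU vs @ s) = cnt v" "walk n x (map AU vs) = Some x" "walk n x s = Some z"
  by blast
 have eq: "2 * count_list us i + (if i \<in> ix ` set r then 1 else 0) = 2 * count_list vs i + (if i \<in> ix ` set s then 1 else (0::nat))" for i
  using fun_cong[OF trans[OF 1(3) trans[OF c 2(3)[symmetric]]], of i]
  by (simp only: cnt_simps cnt_U cnt_reduced[OF 1(2)] cnt_reduced[OF 2(2)])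
 have "i \<in> ix ` set r \<longleftrightarrow> i \<in> ix ` set s" for i using eq[of i] by (auto split: if_splits) presburger+
 hence "ix ` set r = ix ` set s" by blast
 hence 3: "eqv n k x r s" by (intro reduced_unique[OF x 1(5,2) 2(5,2)])
 have "count (mset w) i = count_list w i" for w :: "nat list" and i by (induction w) auto
 moreover have "count_list us i = count_list vs i" for i using eq[of i] \<open>ix ` set r = ix ` set s\<close> by simp
 ultimately have "mset us = mset vs" by (intro multiset_eqI) simp
 hence 4: "eqv n k x (map AU us) (map AU vs)" by (rule eqv_U_perm[OF x])
 have "eqv n k x (map AU us @ r) (map AU vs @ s)"
  by (rule eqv_trans[OF eqv_append[OF x 4] eqv_prepend[OF x 2(4) 3]])
 thus ?thesis using 1(1) 2(1) eqv_trans eqv_sym by metis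
qed

text \<open>The map \<open>rep\<close> chooses one path for every normal form. Modulo the path ideal
  each element equals the image of its normal form under \<open>rep\<close>, hence lies in the ideal
  when the normal form is 0.\<close>

theorem path_ideal_eq: "path_ideal n k = nf_ideal n k"
proof
 define rep where "rep t = frag_of (SOME p. p \<in> paths n k \<and> \<not> bad n (fst p) (ix ` set (snd p)) \<and>
   (fst p, the (walk n (fst p) (snd p)), cnt (snd p)) = t)" for t
 have gen: "frag_of p - frag_extend rep (nf n p) \<in> path_ideal n k" if p: "p \<in> paths n k" for p
 proof -
  obtain x w where pw: "p = (x, w)" by (cases p)
  obtain z where x: "x \<in> vertices n k" and z: "walk n x w = Some z" using p by (auto simp: paths_def pw)
  have pe: "path_elt n k x w = frag_of p" using p by (simp add: path_elt_def pw)
  show ?thesis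
  proof (cases "bad n x (ix ` set w)")
   case True
   thus ?thesis using bad_zro[OF x True] unfolding zro_def pe by (simp add: nf_def pw)
  next
   case False
   let ?P = "\<lambda>p. p \<in> paths n k \<and> \<not> bad n (fst p) (ix ` set (snd p)) \<and>
     (fst p, the (walk n (fst p) (snd p)), cnt (snd p)) = (x, z, cnt w)"
   define p' where "p' = (SOME p. ?P p)"
   have "?P p" using p False z by (simp add: pw)
   hence P': "?P p'" unfolding p'_def by (rule someI)
   obtain w' where pw': "p' = (x, w')" using P' by (cases p') auto
   have z': "walk n x w' = Some z" "cnt w = cnt w'" using P' by (auto simp: pw' paths_def)
   have "eqv n k x w w'" by (rule same_nf_eqv[OF x z z'(1,2) False])
   moreover have "path_elt n k x w' = frag_of p'" using P' by (simp add: pw' path_elt_def)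
   moreover have "frag_extend rep (nf n p) = frag_of p'" using False z by (simp add: nf_def pw rep_def p'_def)
   ultimately show ?thesis by (simp add: eqv_def pe)
  qed
 qed
 have *: "g - frag_extend rep (nfe n g) \<in> path_ideal n k" if "keys g \<subseteq> paths n k" for g
  using that
 proof (induction g rule: frag_induction)
  case (diff a b)
  have *: "a - b - frag_extend rep (nfe n (a - b)) = (a - frag_extend rep (nfe n a)) - (b - frag_extend rep (nfe n b))"
   by (simp add: frag_extend_diff)
  show ?case using path_ideal_closed(4)[OF diff] unfolding * .
 qed (use gen path_ideal_closed(1) in auto)
 show "nf_ideal n k \<subseteq> path_ideal n k"
 proof
  fix g assume "g \<in> nf_ideal n k"
  thus "g \<in> path_ideal n k" using *[of g] by (simp add: nf_ideal_def)
 qed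
qed (rule path_ideal_subset)

section \<open>Sign vectors and paths\<close>

text \<open>This is the sign at the one-based index i of the sign vector whose set of sign changes
  is \<open>x\<close>.\<close>

definition sgn_at :: "nat set => nat => bool" where
 "sgn_at x i \<longleftrightarrow> even (card (x \<inter> {..<i}))"

lemma sgn_at_0 [simp]: "sgn_at x 0" by (simp add: sgn_at_def)

lemma sgn_at_Suc: "finite x ==> sgn_at x (Suc i) \<longleftrightarrow> (sgn_at x i \<longleftrightarrow> i \<notin> x)"
proof -
 assume fin: "finite x"
 have "x \<inter> {..<Suc i} = (if i \<in> x then insert i (x \<inter> {..<i}) else x \<inter> {..<i})"
  by (auto simp: less_Suc_eq)
 thus ?thesis using fin by (auto simp: sgn_at_def)
qed

lemma sgn_at_step:
 assumes "finite x" "arrow_target n a x = Some y"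
 shows "sgn_at y i \<longleftrightarrow> (sgn_at x i \<longleftrightarrow> even (if ix a = i then wt a else 0))"
proof (cases a)
 case (AR j)
 hence j: "1 \<le> j" "j - 1 \<in> x" "j \<notin> x" "y = insert j (x - {j - 1})" using assms(2) by (auto split: if_splits)
 have "(j - Suc 0 < i) = (j \<le> i)" using j(1) by arith
 hence "int (card (y \<inter> {..<i})) = int (card (x \<inter> {..<i})) - (if j = i then 1 else 0)"
  using card_below_insert[OF assms(1) j(3,2), of i] j(4) by (cases j i rule: linorder_cases) auto
 hence "even (int (card (y \<inter> {..<i}))) \<longleftrightarrow> (even (int (card (x \<inter> {..<i}))) \<longleftrightarrow> j \<noteq> i)" by auto
 thus ?thesis using AR by (auto simp: sgn_at_def)
next
 case (AL j)
 hence j: "1 \<le> j" "j - 1 \<notin> x" "j \<in> x" "y = insert (j - 1) (x - {j})" using assms(2) by (auto split: if_splits)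
 have "(j - Suc 0 < i) = (j \<le> i)" using j(1) by arith
 hence "int (card (y \<inter> {..<i})) = int (card (x \<inter> {..<i})) + (if j = i then 1 else 0)"
  using card_below_insert[OF assms(1) j(2,3), of i] j(4) by (cases j i rule: linorder_cases) auto
 hence "even (int (card (y \<inter> {..<i}))) \<longleftrightarrow> (even (int (card (x \<inter> {..<i}))) \<longleftrightarrow> j \<noteq> i)" by auto
 thus ?thesis using AL by (auto simp: sgn_at_def)
next
 case (AU j)
 thus ?thesis using assms(2) by (auto split: if_splits)
qed

text \<open>Each \<open>AR i\<close> or \<open>AL i\<close> moves one element past the threshold i
  and flips the sign there; \<open>AU i\<close> counts twice and flips nothing.\<close>

lemma sgn_at_walk:
 assumes "x \<in> vertices n k" "walk n x w = Some z"
 shows "sgn_at z i \<longleftrightarrow> (sgn_at x i \<longleftrightarrow> even (cnt w i))"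
 using assms
proof (induction w arbitrary: x)
 case (Cons a w)
 obtain y where y: "arrow_target n a x = Some y" "walk n y w = Some z" by (rule walk_Cons_Some[OF Cons.prems(2)])
 from Cons.IH[OF arrow_target_vertices[OF Cons.prems(1) y(1)] y(2)]
  sgn_at_step[OF vertices_finite[OF Cons.prems(1)] y(1), of i]
 show ?case by auto
qed simp

lemma sgn_at_eq_imp_eq:
 assumes "finite x" "finite z" "x \<subseteq> {..<n}" "z \<subseteq> {..<n}" "\<And>i. 1 \<le> i ==> i \<le> n ==> sgn_at x i = sgn_at z i"
 shows "x = z"
proof -
 have "sgn_at x i = sgn_at z i" if "i \<le> n" for i using assms(5)[of i] that by (cases "i = 0") auto
 hence "i \<in> x \<longleftrightarrow> i \<in> z" if "i < n" for i
  using sgn_at_Suc[OF assms(1), of i] sgn_at_Suc[OF assms(2), of i] that by (metis Suc_leI less_imp_le)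
 thus ?thesis using assms(3,4) by blast
qed

lemma ksubsets_vertices: "x \<in> ksubsets {0..<n} k \<longleftrightarrow> x \<in> vertices n k \<and> n \<notin> x"
proof -
 have "{0..n} = insert n {0..<n}" by auto
 thus ?thesis by (auto simp: ksubsets_def vertices_def)
qed

lemma cnt_bound: "walk n x w = Some z ==> 0 < cnt w i ==> 1 \<le> i \<and> i \<le> n"
proof (induction w arbitrary: x)
 case (Cons a w)
 obtain y where y: "arrow_target n a x = Some y" "walk n y w = Some z" by (rule walk_Cons_Some[OF Cons.prems(1)])
 thus ?case using Cons arrow_target_ix[OF y(1)] by (cases "ix a = i") auto
qed simp

text \<open>Unless it vanishes, a monomial is the product of a path and a monomial in the \<open>U\<^sub>i\<close>: some step where
 the signs of the end points differ must be possible, as otherwise the final vertex is too small.\<close>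

lemma path_exists:
 assumes "x \<in> ksubsets {0..<n} k" "z \<in> ksubsets {0..<n} k" "\<not> bad n x {i \<in> {1..n}. sgn_at x i \<noteq> sgn_at z i}"
 shows "\<exists>w. walk n x w = Some z \<and> cnt w = (\<lambda>i. if i \<in> {1..n} \<and> sgn_at x i \<noteq> sgn_at z i then 1 else 0)"
 using assms
proof (induction "card {i \<in> {1..n}. sgn_at x i \<noteq> sgn_at z i}" arbitrary: x)
 case 0
 have "sgn_at x i = sgn_at z i" if "1 \<le> i" "i \<le> n" for i using 0 that by auto
 moreover from this have "x = z"
  using 0 finite_subset[of _ "{0..<n}"] by (intro sgn_at_eq_imp_eq[of x z n]) (auto simp: ksubsets_def)
 ultimately show ?case by (intro exI[of _ "[]"]) auto
next
 case (Suc m)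
 define D where "D = {i \<in> {1..n}. sgn_at x i \<noteq> sgn_at z i}"
 have D: "card D = Suc m" "\<not> bad n x D" using Suc by (simp_all add: D_def)
 have fin: "finite x" "finite z" "x \<subseteq> {0..<n}" "z \<subseteq> {0..<n}" "card x = k" "card z = k"
  using Suc.prems finite_subset[of _ "{0..<n}"] by (auto simp: ksubsets_def)
 have "x \<inter> {..<n} = x" "z \<inter> {..<n} = z" using fin by auto
 \<comment> \<open>Both sets have k elements, all below n, so the signs at n agree.\<close>
 hence nD: "n \<notin> D" using fin by (simp add: D_def sgn_at_def)
 \<comment> \<open>Suppose that no step of \<open>D\<close> can be made. As \<open>D\<close> is not
   bad, both sides of each of its steps are occupied, so an unoccupied position touches no step of
   \<open>D\<close> and is also missing from \<open>z\<close>. Then \<open>z\<close> is contained in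
   \<open>x\<close>, and equality of cardinals contradicts that \<open>D\<close> is
   nonempty.\<close>
 have "\<exists>i\<in>D. (i - 1 \<in> x) \<noteq> (i \<in> x)"
 proof (rule ccontr)
  assume no: "\<not> (\<exists>i\<in>D. (i - 1 \<in> x) \<noteq> (i \<in> x))"
  have both: "i - 1 \<in> x \<and> i \<in> x" if "i \<in> D" for i
  proof (rule ccontr)
   assume "\<not> (i - 1 \<in> x \<and> i \<in> x)"
   hence "i - 1 \<notin> x" "i \<notin> x" using no that by auto
   moreover have "1 \<le> i" "i \<le> n" using that by (auto simp: D_def)
   moreover have "{i - 1<..i} = {i}" using \<open>1 \<le> i\<close> by auto
   ultimately have "bad n x D" using that by (intro badI[of "i - 1" i]) auto
   thus False using D by simp
  qed
  have "z \<subseteq> x"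
  proof
   fix e assume e: "e \<in> z"
   show "e \<in> x"
   proof (rule ccontr)
    assume ne: "e \<notin> x"
    have en: "e < n" using e fin by auto
    have "e \<notin> D" "Suc e \<notin> D" using both[of e] both[of "Suc e"] ne by auto
    hence "sgn_at x (Suc e) = sgn_at z (Suc e)" "sgn_at x e = sgn_at z e \<or> e = 0"
     using en unfolding D_def by auto
    hence "sgn_at x e = sgn_at z e" "sgn_at x (Suc e) = sgn_at z (Suc e)" by auto
    thus False using sgn_at_Suc[OF fin(1), of e] sgn_at_Suc[OF fin(2), of e] e ne by auto
   qed
  qed
  hence "z = x" using fin card_subset_eq by metis
  thus False using D(1) by (simp add: D_def)
 qed
 then obtain i where i: "i \<in> D" "(i - 1 \<in> x) \<noteq> (i \<in> x)" by blast
 have i1: "1 \<le> i" "i < n" using i(1) nD by (auto simp: D_def nat_less_le)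
 define a where "a = (if i - 1 \<in> x then AR i else AL i)"
 define y where "y = (if i - 1 \<in> x then insert i (x - {i - 1}) else insert (i - 1) (x - {i}))"
 have t: "arrow_target n a x = Some y" "ix a = i" "wt a = 1" using i i1 by (auto simp: a_def y_def)
 have xv: "x \<in> vertices n k" using Suc.prems(1) by (simp add: ksubsets_vertices)
 have yk: "y \<in> ksubsets {0..<n} k"
  using arrow_target_vertices[OF xv t(1)] fin(3) i1 unfolding ksubsets_vertices by (auto simp: y_def)
 have s: "sgn_at y j \<longleftrightarrow> (sgn_at x j \<longleftrightarrow> j \<noteq> i)" for j using sgn_at_step[OF fin(1) t(1), of j] t by auto
 have D': "{j \<in> {1..n}. sgn_at y j \<noteq> sgn_at z j} = D - {i}" using i(1) by (auto simp: D_def s)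
 have "\<not> bad n y (D - {i})" using bad_step[OF t(1), of D] t(2) i(1) D(2) bad_mono[of n y "D - {i}" D] by auto
 moreover have "m = card (D - {i})" using D(1) i(1) by simp
 ultimately obtain w where w: "walk n y w = Some z"
   "cnt w = (\<lambda>j. if j \<in> {1..n} \<and> sgn_at y j \<noteq> sgn_at z j then 1 else 0)"
  using Suc.hyps(1)[OF _ yk Suc.prems(2)] unfolding D' by blast
 have "cnt (a # w) = (\<lambda>j. if j \<in> {1..n} \<and> sgn_at x j \<noteq> sgn_at z j then 1 else 0)"
  using i(1) by (auto simp: fun_eq_iff w(2) t s D_def)
 thus ?case using w(1) t(1) by (intro exI[of _ "a # w"]) simp
qed

lemma visited_keep:
 assumes "walk n x w = Some z" "\<forall>a\<in>set w. \<not> isU a \<longrightarrow> ix a \<noteq> v \<and> ix a \<noteq> Suc v" "y \<in> set (visited n x w)"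
 shows "v \<in> y \<longleftrightarrow> v \<in> x"
 using assms
proof (induction w arbitrary: x)
 case (Cons a w)
 obtain x' where x': "arrow_target n a x = Some x'" "walk n x' w = Some z" by (rule walk_Cons_Some[OF Cons.prems(1)])
 have "v \<in> x' \<longleftrightarrow> v \<in> x" using x'(1) Cons.prems(2) by (cases a) (auto split: if_splits)
 thus ?case using Cons x' by auto
qed simp

text \<open>An identification is prescribed on arrows between vertices without n, whereas a path
  with such end points may visit n in between. After reduction it does not: the net displacement at
  step n is 0, and a reduced word crosses n at most once.\<close>

lemma eqv_avoiding_last:
 assumes x: "x \<in> ksubsets {0..<n} k" and z: "z \<in> ksubsets {0..<n} k" and w: "walk n x w = Some z"
 shows "zro n k x w \<or> (\<exists>w'. eqv n k x w w' \<and> (\<forall>y\<in>set (visited n x w'). n \<notin> y))"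
proof -
 have xv: "x \<in> vertices n k" "n \<notin> x" "n \<notin> z" using x z by (simp_all add: ksubsets_vertices)
 from reduce_word[OF xv(1), of w] show ?thesis
 proof
  assume "\<exists>us r. eqv n k x w (map AU us @ r) \<and> reduced r"
  then obtain us r where e: "eqv n k x w (map AU us @ r)" and r: "reduced r" by blast
  have w': "walk n x (map AU us @ r) = Some z" using w eqv_walk[OF e] by simp
  obtain y where y: "walk n x (map AU us) = Some y" "walk n y r = Some z" using w' by (rule walk_append_Some)
  have yx: "y = x" using walk_U_Some[OF y(1)] by simp
  have "ix a \<noteq> n" if a: "a \<in> set r" for a
  proof
   assume n: "ix a = n"
   have "x \<inter> {..<n} = x" "z \<inter> {..<n} = z" "card x = k" "card z = k" using x z by (auto simp: ksubsets_def)
   hence "count_list r (AL n) = count_list r (AR n)"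
    using displacement[OF xv(1) y(2)[unfolded yx], of n] by simp
   moreover have "a = AL n \<or> a = AR n" using r a n by (cases a) (auto simp: reduced_def)
   ultimately show False using count_list_reduced[OF r a, of "AL n"] count_list_reduced[OF r a, of "AR n"]
    by (elim disjE) (simp_all add: n)
  qed
  moreover have "ix a \<noteq> Suc n" if "a \<in> set r" for a
   using cnt_bound[OF y(2), of "ix a"] that by (auto simp: cnt_pos_iff)
  ultimately have "\<forall>a\<in>set (map AU us @ r). \<not> isU a \<longrightarrow> ix a \<noteq> n \<and> ix a \<noteq> Suc n" by auto
  from visited_keep[OF w' this] e xv(2) show ?thesis by blast
 qed blast
qed

section \<open>Monomials and monomial ideals\<close>

definition inU :: "nat => (nat \<Rightarrow>\<^sub>0 nat) => bool" where
 "inU n m \<longleftrightarrow> keys m \<subseteq> {1..n}"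

lemma Zu_carrier: "p \<in> carrier (Zu n) \<longleftrightarrow> (\<forall>m\<in>keys p. inU n m)"
 by (simp add: Zu_def inU_def)

lemma Zu_sel [simp]: "monoid.mult (Zu n) = (*)" "\<one>\<^bsub>Zu n\<^esub> = 1" "\<zero>\<^bsub>Zu n\<^esub> = 0" "add (Zu n) = (+)"
 by (simp_all add: Zu_def)

lemma keys_add_nat: "keys (a + b) = keys a \<union> keys b"
 for a b :: "nat \<Rightarrow>\<^sub>0 nat"
 by (auto simp: in_keys_iff lookup_add)

lemma inU_add: "inU n (a + b) \<longleftrightarrow> inU n a \<and> inU n b"
 unfolding inU_def keys_add_nat by (rule Un_subset_iff)

lemma keys_mult_zpoly:
 fixes p q :: zpoly
 assumes "m \<in> keys (p * q)"
 obtains a b where "a \<in> keys p" "b \<in> keys q" "m = a + b"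
 using keys_mult[of p q] assms by blast

lemma Zu_mult_closed:
 fixes p q :: zpoly
 assumes "p \<in> carrier (Zu n)" "q \<in> carrier (Zu n)" shows "p * q \<in> carrier (Zu n)"
 unfolding Zu_carrier
proof
 fix m assume "m \<in> keys (p * q)"
 then obtain a b where "a \<in> keys p" "b \<in> keys q" "m = a + b" by (rule keys_mult_zpoly)
 thus "inU n m" using assms unfolding Zu_carrier by (simp add: inU_add)
qed

lemma Zu_add_closed:
 fixes p q :: zpoly
 assumes "p \<in> carrier (Zu n)" "q \<in> carrier (Zu n)" shows "p + q \<in> carrier (Zu n)"
 using assms Poly_Mapping.keys_add[of p q] unfolding Zu_carrier by blast

lemma Zu_minus_closed: "p \<in> carrier (Zu n) ==> - p \<in> carrier (Zu n)"
 unfolding Zu_carrier keys_minus .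

lemma Zu_0_closed [simp]: "0 \<in> carrier (Zu n)" by (simp add: Zu_carrier)

lemma one_zpoly: "(1::zpoly) = frag_of 0" by (rule single_one[symmetric])

lemma Zu_frag [simp]: "frag_of m \<in> carrier (Zu n) \<longleftrightarrow> inU n m" by (simp add: Zu_carrier)

lemma Zu_one_closed [simp]: "1 \<in> carrier (Zu n)" unfolding one_zpoly Zu_frag by (simp add: inU_def)

lemma Zu_ring: "ring (Zu n)"
proof (rule ringI)
 show "abelian_group (Zu n)"
 proof (rule abelian_groupI)
  fix x assume "x \<in> carrier (Zu n)"
  thus "\<exists>y\<in>carrier (Zu n). y \<oplus>\<^bsub>Zu n\<^esub> x = \<zero>\<^bsub>Zu n\<^esub>"
   using Zu_minus_closed by (intro bexI[of _ "- x"]) simp_all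
 qed (simp_all add: Zu_add_closed add.assoc add.commute)
 show "Group.monoid (Zu n)"
  by (rule monoidI) (simp_all add: Zu_mult_closed mult.assoc)
qed (simp_all add: distrib_left distrib_right)

definition expo :: "nat set => nat \<Rightarrow>\<^sub>0 nat" where
 "expo S = (\<Sum>i\<in>S. single i 1)"

lemma lookup_expo: "finite S ==> lookup (expo S) i = (if i \<in> S then 1 else 0)"
 unfolding expo_def by (induction S rule: finite_induct) (auto simp: lookup_add lookup_single when_def)

lemma keys_expo: "finite S ==> keys (expo S) = S"
 by (simp add: set_eq_iff in_keys_iff lookup_expo)

lemma frag_of_mult: "frag_of (a::nat \<Rightarrow>\<^sub>0 nat) * frag_of b = frag_of (a + b)"
 by (simp add: mult_single)

lemma uprod_eq: "finite S ==> uprod S = frag_of (expo S)"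
 unfolding uprod_def expo_def
 by (induction S rule: finite_induct) (simp_all add: uvar_def frag_of_mult)

text \<open>\<open>Q\<close> is closed under enlarging the set, so membership depends only on the
  supports of the monomials, and each monomial is a multiple of the squarefree one with the same
  support.\<close>

lemma monomial_ideal:
 assumes mono: "\<And>S S'. S \<subseteq> S' ==> Q S ==> Q S'"
 shows "Idl\<^bsub>Zu n\<^esub> {uprod S | S. S \<subseteq> {1..n} \<and> Q S} =
  {p. \<forall>m\<in>keys p. inU n m \<and> Q (keys m)}" (is "Idl\<^bsub>_\<^esub> ?G = ?I")
proof
 interpret R: ring "Zu n" by (rule Zu_ring)
 have fin: "finite S" if "S \<subseteq> {1..n}" for S using that finite_subset by blast
 have G: "?G \<subseteq> ?I"
 proof
  fix g assume "g \<in> ?G"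
  then obtain S where S: "g = uprod S" "S \<subseteq> {1..n}" "Q S" by blast
  have "g = frag_of (expo S)" using S(1) uprod_eq[OF fin[OF S(2)]] by simp
  thus "g \<in> ?I" using S(2,3) keys_expo[OF fin[OF S(2)]] by (simp add: inU_def)
 qed
 have uminus: "\<ominus>\<^bsub>Zu n\<^esub> a = - a" if "a \<in> carrier (Zu n)" for a
  using that Zu_minus_closed by (intro R.minus_equality) simp_all
 have IC: "?I \<subseteq> carrier (Zu n)" unfolding Zu_carrier[abs_def] by (auto simp: Zu_carrier)
 have "ideal ?I (Zu n)"
 proof (rule idealI[OF Zu_ring])
  show "subgroup ?I (add_monoid (Zu n))"
  proof (rule R.add.subgroupI)
   show "?I \<subseteq> carrier (Zu n)" by (rule IC)
   show "?I \<noteq> {}" by (rule ccontr) (use keys_zero in auto)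
   fix a b assume ab: "a \<in> ?I"
   show "\<ominus>\<^bsub>Zu n\<^esub> a \<in> ?I" using ab uminus[OF subsetD[OF IC ab]] by simp
   assume b: "b \<in> ?I"
   have "a + b \<in> ?I" using ab b Poly_Mapping.keys_add[of a b] by blast
   thus "a \<oplus>\<^bsub>Zu n\<^esub> b \<in> ?I" by simp
  qed
 next
  fix a x assume a: "a \<in> ?I" and x: "x \<in> carrier (Zu n)"
  have "x * a \<in> ?I"
  proof (rule CollectI, rule ballI)
   fix m assume "m \<in> keys (x * a)"
   then obtain b c where bc: "b \<in> keys x" "c \<in> keys a" "m = b + c" by (rule keys_mult_zpoly)
   hence "inU n b" "inU n c" "Q (keys c)" using a x unfolding Zu_carrier by blast+
   thus "inU n m \<and> Q (keys m)"
    using mono[of "keys c" "keys b \<union> keys c"] by (simp add: keys_add_nat inU_add bc(3))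
  qed
  thus "x \<otimes>\<^bsub>Zu n\<^esub> a \<in> ?I" "a \<otimes>\<^bsub>Zu n\<^esub> x \<in> ?I" by (simp_all only: Zu_sel mult.commute[of a])
 qed
 thus "Idl\<^bsub>Zu n\<^esub> ?G \<subseteq> ?I" using G by (rule R.genideal_minimal)
 have GC: "?G \<subseteq> carrier (Zu n)" using G IC by (rule order_trans)
 interpret J: ideal "Idl\<^bsub>Zu n\<^esub> ?G" "Zu n" by (rule R.genideal_ideal[OF GC])
 show "?I \<subseteq> Idl\<^bsub>Zu n\<^esub> ?G"
 proof
  fix p assume "p \<in> ?I"
  hence "keys p \<subseteq> {m. inU n m \<and> Q (keys m)}" by blast
  thus "p \<in> Idl\<^bsub>Zu n\<^esub> ?G"
  proof (induction p rule: frag_induction)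
   case zero
   show ?case using additive_subgroup.zero_closed[OF J.is_additive_subgroup] by (simp only: Zu_sel)
  next
   case (one m)
   define S where "S = keys m"
   define m' where "m' = m - expo S"
   have S: "S \<subseteq> {1..n}" "Q S" "finite S" using one by (simp_all add: S_def inU_def)
   have "lookup m i \<ge> lookup (expo S) i" for i
    using S(3) by (simp add: lookup_expo S_def in_keys_iff)
   hence m: "m = m' + expo S"
    by (intro poly_mapping_eqI) (simp add: m'_def lookup_add lookup_minus)
   hence "frag_of m = frag_of m' \<otimes>\<^bsub>Zu n\<^esub> uprod S" by (simp only: uprod_eq[OF S(3)] frag_of_mult Zu_sel)
   moreover have "uprod S \<in> Idl\<^bsub>Zu n\<^esub> ?G" using R.genideal_self[OF GC] S by blast
   moreover have "frag_of m' \<in> carrier (Zu n)"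
    using one m by (simp add: inU_add)
   ultimately show ?case by (simp only: J.I_l_closed)
  next
   case (diff a b)
   have bC: "b \<in> carrier (Zu n)" by (rule J.Icarr[OF diff(2)])
   have "- b \<in> Idl\<^bsub>Zu n\<^esub> ?G"
    using additive_subgroup.a_inv_closed[OF J.is_additive_subgroup diff(2)] unfolding uminus[OF bC] .
   from additive_subgroup.a_closed[OF J.is_additive_subgroup diff(1) this] show ?case by (simp only: Zu_sel add_uminus_conv_diff)
  qed
 qed
qed

lemma hyp_mono: "S \<subseteq> S' ==> hyp A S' \<subseteq> hyp A S" by (auto simp: hyp_def)

definition gone :: "arrangement => signs => signs => nat set => bool" where
 "gone A \<alpha> \<beta> S \<longleftrightarrow> chamber A \<alpha> \<inter> chamber A \<beta> \<inter> hyp A S = {}"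

lemma gone_mono: "S \<subseteq> S' ==> gone A \<alpha> \<beta> S ==> gone A \<alpha> \<beta> S'"
 unfolding gone_def using hyp_mono[of S S' A] by blast

lemma Rideal_iff: "p \<in> Rideal n A \<alpha> \<beta> \<longleftrightarrow>
  (\<forall>m\<in>keys p. inU n m \<and> gone A \<alpha> \<beta> (keys m))"
proof -
 have "Idl\<^bsub>Zu n\<^esub> {uprod S | S. S \<subseteq> {1..n} \<and> gone A \<alpha> \<beta> S} =
  {p. \<forall>m\<in>keys p. inU n m \<and> gone A \<alpha> \<beta> (keys m)}"
  by (rule monomial_ideal) (rule gone_mono)
 thus ?thesis unfolding Rideal_def gone_def[symmetric] by (simp only: mem_Collect_eq)
qed

section \<open>The convolution algebra\<close>

lemma BF_length: "\<alpha> \<in> BF n A ==> length \<alpha> = n" by (simp add: BF_def)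

lemma finite_BF [simp]: "finite (BF n A)"
 by (rule finite_subset[OF _ finite_lists_length_eq[of UNIV n]]) (auto simp: BF_def)

lemma finite_sep [simp]: "finite (sep \<alpha> \<beta> \<gamma>)" by (simp add: sep_def)

lemma sep_subset: "length \<alpha> = n ==> sep \<alpha> \<beta> \<gamma> \<subseteq> {1..n}" by (auto simp: sep_def)

lemma uprod_sep_Zu: "length \<alpha> = n ==> uprod (sep \<alpha> \<beta> \<gamma>) \<in> carrier (Zu n)"
 using sep_subset[of \<alpha> n \<beta> \<gamma>] by (simp add: uprod_eq keys_expo inU_def)

text \<open>This cocycle identity is the associativity of the products of the basis elements. Every
  index contributes independently, and only the four signs there matter.\<close>

lemma sep_cocycle:
 assumes "length \<alpha> = n" "length \<beta> = n"
 shows "uprod (sep \<alpha> \<gamma> \<delta>) * uprod (sep \<alpha> \<beta> \<gamma>) = uprod (sep \<alpha> \<beta> \<delta>) * uprod (sep \<beta> \<gamma> \<delta>)"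
proof -
 have "expo (sep \<alpha> \<gamma> \<delta>) + expo (sep \<alpha> \<beta> \<gamma>) = expo (sep \<alpha> \<beta> \<delta>) + expo (sep \<beta> \<gamma> \<delta>)"
 proof (rule poly_mapping_eqI)
  fix i
  show "lookup (expo (sep \<alpha> \<gamma> \<delta>) + expo (sep \<alpha> \<beta> \<gamma>)) i =
    lookup (expo (sep \<alpha> \<beta> \<delta>) + expo (sep \<beta> \<gamma> \<delta>)) i"
   by (cases "i \<in> {1..n}"; cases "\<alpha> ! (i - 1)"; cases "\<beta> ! (i - 1)"; cases "\<gamma> ! (i - 1)"; cases "\<delta> ! (i - 1)";
     simp add: lookup_add lookup_expo sep_def assms)
 qed
 thus ?thesis by (simp add: uprod_eq frag_of_mult)
qed

lemma sep_trivial [simp]: "sep \<alpha> \<alpha> \<gamma> = {}" "sep \<alpha> \<gamma> \<gamma> = {}" by (auto simp: sep_def)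

lemma uprod_empty [simp]: "uprod {} = 1" by (simp add: uprod_def)

lemma BfreeD:
 assumes "M \<in> carrier (Bfree n A)"
 shows "M \<alpha> \<beta> \<in> carrier (Zu n)" "\<alpha> \<notin> BF n A ==> M \<alpha> \<beta> = 0" "\<beta> \<notin> BF n A ==> M \<alpha> \<beta> = 0"
 using assms unfolding Bfree_def by simp_all

lemma BfreeI:
 assumes "\<And>\<alpha> \<beta>. M \<alpha> \<beta> \<in> carrier (Zu n)" "\<And>\<alpha> \<beta>. \<alpha> \<notin> BF n A \<or> \<beta> \<notin> BF n A ==> M \<alpha> \<beta> = 0"
 shows "M \<in> carrier (Bfree n A)"
 using assms unfolding Bfree_def by simp

lemma Bfree_sel:
 "M \<otimes>\<^bsub>Bfree n A\<^esub> N = (\<lambda>\<alpha> \<gamma>. \<Sum>\<beta>\<in>BF n A. uprod (sep \<alpha> \<beta> \<gamma>) * M \<alpha> \<beta> * N \<beta> \<gamma>)"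
 "\<one>\<^bsub>Bfree n A\<^esub> = (\<lambda>\<alpha> \<beta>. if \<alpha> = \<beta> \<and> \<alpha> \<in> BF n A then 1 else 0)"
 "\<zero>\<^bsub>Bfree n A\<^esub> = (\<lambda>\<alpha> \<beta>. 0)" "M \<oplus>\<^bsub>Bfree n A\<^esub> N = (\<lambda>\<alpha> \<beta>. M \<alpha> \<beta> + N \<alpha> \<beta>)"
 by (simp_all add: Bfree_def)

lemma Zu_sum_closed: "(\<And>i. i \<in> I ==> f i \<in> carrier (Zu n)) ==> (\<Sum>i\<in>I. f i) \<in> carrier (Zu n)"
proof (induction I rule: infinite_finite_induct)
 case (insert i I)
 thus ?case using Zu_add_closed[of "f i" n "sum f I"] by simp
qed simp_all

lemma Bfree_mult_closed:
 assumes M: "M \<in> carrier (Bfree n A)" and N: "N \<in> carrier (Bfree n A)"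
 shows "M \<otimes>\<^bsub>Bfree n A\<^esub> N \<in> carrier (Bfree n A)"
proof (rule BfreeI)
 fix \<alpha> \<gamma>
 show "(M \<otimes>\<^bsub>Bfree n A\<^esub> N) \<alpha> \<gamma> \<in> carrier (Zu n)"
 proof (cases "\<alpha> \<in> BF n A")
  case True
  thus ?thesis unfolding Bfree_sel
   by (intro Zu_sum_closed Zu_mult_closed uprod_sep_Zu BfreeD(1)[OF M] BfreeD(1)[OF N] BF_length)
 qed (simp add: BfreeD(2)[OF M] Bfree_sel)
 show "(M \<otimes>\<^bsub>Bfree n A\<^esub> N) \<alpha> \<gamma> = 0" if "\<alpha> \<notin> BF n A \<or> \<gamma> \<notin> BF n A"
  using that by (auto simp: BfreeD(2)[OF M] BfreeD(3)[OF N] Bfree_sel)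
qed

lemma Bfree_assoc:
 assumes M: "M \<in> carrier (Bfree n A)" and L: "L \<in> carrier (Bfree n A)"
 shows "(M \<otimes>\<^bsub>Bfree n A\<^esub> N) \<otimes>\<^bsub>Bfree n A\<^esub> L = M \<otimes>\<^bsub>Bfree n A\<^esub> (N \<otimes>\<^bsub>Bfree n A\<^esub> L)"
proof (intro ext)
 fix \<alpha> \<delta>
 let ?P = "BF n A"
 have M0: "\<alpha> \<notin> ?P ==> M \<alpha> \<beta> = 0" for \<beta> by (rule BfreeD(2)[OF M])
 have "(\<Sum>\<gamma>\<in>?P. uprod (sep \<alpha> \<gamma> \<delta>) * (\<Sum>\<beta>\<in>?P. uprod (sep \<alpha> \<beta> \<gamma>) * M \<alpha> \<beta> * N \<beta> \<gamma>) * L \<gamma> \<delta>)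
  = (\<Sum>\<gamma>\<in>?P. \<Sum>\<beta>\<in>?P. (uprod (sep \<alpha> \<gamma> \<delta>) * uprod (sep \<alpha> \<beta> \<gamma>)) * M \<alpha> \<beta> * N \<beta> \<gamma> * L \<gamma> \<delta>)"
  by (simp add: sum_distrib_left sum_distrib_right mult.assoc)
 also have "\<dots> = (\<Sum>\<gamma>\<in>?P. \<Sum>\<beta>\<in>?P. (uprod (sep \<alpha> \<beta> \<delta>) * uprod (sep \<beta> \<gamma> \<delta>)) * M \<alpha> \<beta> * N \<beta> \<gamma> * L \<gamma> \<delta>)"
 proof (intro sum.cong refl, goal_cases)
  case (1 \<gamma> \<beta>)
  show ?case
  proof (cases "\<alpha> \<in> ?P")
   case True
   thus ?thesis using sep_cocycle[of \<alpha> n \<beta> \<gamma> \<delta>] 1 by (simp add: BF_length)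
  qed (simp add: M0)
 qed
 also have "\<dots> = (\<Sum>\<beta>\<in>?P. \<Sum>\<gamma>\<in>?P. (uprod (sep \<alpha> \<beta> \<delta>) * uprod (sep \<beta> \<gamma> \<delta>)) * M \<alpha> \<beta> * N \<beta> \<gamma> * L \<gamma> \<delta>)"
  by (rule sum.swap)
 also have "\<dots> = (\<Sum>\<beta>\<in>?P. uprod (sep \<alpha> \<beta> \<delta>) * M \<alpha> \<beta> * (\<Sum>\<gamma>\<in>?P. uprod (sep \<beta> \<gamma> \<delta>) * N \<beta> \<gamma> * L \<gamma> \<delta>))"
  by (simp add: sum_distrib_left mult_ac)
 finally show "((M \<otimes>\<^bsub>Bfree n A\<^esub> N) \<otimes>\<^bsub>Bfree n A\<^esub> L) \<alpha> \<delta> = (M \<otimes>\<^bsub>Bfree n A\<^esub> (N \<otimes>\<^bsub>Bfree n A\<^esub> L)) \<alpha> \<delta>"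
  by (simp only: Bfree_sel)
qed

lemma Bfree_one_closed: "\<one>\<^bsub>Bfree n A\<^esub> \<in> carrier (Bfree n A)"
 by (rule BfreeI) (auto simp: Bfree_sel)

lemma Bfree_uminus_closed: "M \<in> carrier (Bfree n A) ==> (\<lambda>\<alpha> \<beta>. - M \<alpha> \<beta>) \<in> carrier (Bfree n A)"
 by (rule BfreeI) (auto simp: BfreeD Zu_minus_closed)

lemma Bfree_ring: "ring (Bfree n A)"
proof (rule ringI)
 show "abelian_group (Bfree n A)"
 proof (rule abelian_groupI)
  fix M N assume MN: "M \<in> carrier (Bfree n A)" "N \<in> carrier (Bfree n A)"
  show "M \<oplus>\<^bsub>Bfree n A\<^esub> N \<in> carrier (Bfree n A)"
   unfolding Bfree_sel by (rule BfreeI) (auto simp: BfreeD[OF MN(1)] BfreeD[OF MN(2)] Zu_add_closed)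
 next
  fix M assume M: "M \<in> carrier (Bfree n A)"
  thus "\<exists>N\<in>carrier (Bfree n A). N \<oplus>\<^bsub>Bfree n A\<^esub> M = \<zero>\<^bsub>Bfree n A\<^esub>"
   using Bfree_uminus_closed[OF M] by (intro bexI[of _ "\<lambda>\<alpha> \<beta>. - M \<alpha> \<beta>"]) (simp_all add: Bfree_sel)
 next
  show "\<zero>\<^bsub>Bfree n A\<^esub> \<in> carrier (Bfree n A)" by (rule BfreeI) (simp_all add: Bfree_sel)
 qed (simp_all add: Bfree_sel add.assoc add.commute add.left_commute)
 show "Group.monoid (Bfree n A)"
 proof (rule monoidI)
  fix M N L assume M: "M \<in> carrier (Bfree n A)" and N: "N \<in> carrier (Bfree n A)" and L: "L \<in> carrier (Bfree n A)"
  show "M \<otimes>\<^bsub>Bfree n A\<^esub> N \<in> carrier (Bfree n A)" using M N by (rule Bfree_mult_closed)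
  show "M \<otimes>\<^bsub>Bfree n A\<^esub> N \<otimes>\<^bsub>Bfree n A\<^esub> L = M \<otimes>\<^bsub>Bfree n A\<^esub> (N \<otimes>\<^bsub>Bfree n A\<^esub> L)" by (rule Bfree_assoc[OF M L])
 next
  show "\<one>\<^bsub>Bfree n A\<^esub> \<in> carrier (Bfree n A)" by (rule Bfree_one_closed)
 next
  fix M assume M: "M \<in> carrier (Bfree n A)"
  hence 0: "\<alpha> \<notin> BF n A \<or> \<beta> \<notin> BF n A ==> M \<alpha> \<beta> = 0" for \<alpha> \<beta> using BfreeD[OF M] by blast
  have "(\<Sum>\<beta>\<in>BF n A. uprod (sep \<alpha> \<beta> \<gamma>) * (if \<alpha> = \<beta> \<and> \<alpha> \<in> BF n A then 1 else 0) * M \<beta> \<gamma>) = M \<alpha> \<gamma>" for \<alpha> \<gamma>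
  proof (cases "\<alpha> \<in> BF n A")
   case True
   have "(\<Sum>\<beta>\<in>BF n A. uprod (sep \<alpha> \<beta> \<gamma>) * (if \<alpha> = \<beta> \<and> \<alpha> \<in> BF n A then 1 else 0) * M \<beta> \<gamma>)
    = (\<Sum>\<beta>\<in>BF n A. if \<alpha> = \<beta> then M \<beta> \<gamma> else 0)"
    using True by (intro sum.cong) auto
   thus ?thesis using True by simp
  qed (auto simp: 0)
  thus "\<one>\<^bsub>Bfree n A\<^esub> \<otimes>\<^bsub>Bfree n A\<^esub> M = M" by (simp only: Bfree_sel)
  have "(\<Sum>\<beta>\<in>BF n A. uprod (sep \<alpha> \<beta> \<gamma>) * M \<alpha> \<beta> * (if \<beta> = \<gamma> \<and> \<beta> \<in> BF n A then 1 else 0)) = M \<alpha> \<gamma>" for \<alpha> \<gamma>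
  proof (cases "\<gamma> \<in> BF n A")
   case True
   have "(\<Sum>\<beta>\<in>BF n A. uprod (sep \<alpha> \<beta> \<gamma>) * M \<alpha> \<beta> * (if \<beta> = \<gamma> \<and> \<beta> \<in> BF n A then 1 else 0))
    = (\<Sum>\<beta>\<in>BF n A. if \<beta> = \<gamma> then M \<alpha> \<beta> else 0)"
    using True by (intro sum.cong) auto
   thus ?thesis using True by simp
  next
   case False
   hence "\<beta> \<in> BF n A ==> \<beta> \<noteq> \<gamma>" for \<beta> by auto
   thus ?thesis using False by (simp add: 0)
  qed
  thus "M \<otimes>\<^bsub>Bfree n A\<^esub> \<one>\<^bsub>Bfree n A\<^esub> = M" by (simp only: Bfree_sel)
 qed
qed (simp_all add: Bfree_sel fun_eq_iff sum.distrib distrib_left distrib_right)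

text \<open>Where \<beta> disagrees with both \<alpha> and \<gamma>, the index lies in
  \<open>sep \<alpha> \<beta> \<gamma>\<close> and the coordinate is 0; elsewhere the sign condition
  of \<beta> is one of the two given ones.\<close>

lemma chamber_sep:
 assumes "length \<alpha> = n" "length \<beta> = n" "length \<gamma> = n"
 shows "chamber A \<alpha> \<inter> chamber A \<gamma> \<inter> hyp A (sep \<alpha> \<beta> \<gamma>) \<subseteq> chamber A \<beta>"
proof
 fix x assume x: "x \<in> chamber A \<alpha> \<inter> chamber A \<gamma> \<inter> hyp A (sep \<alpha> \<beta> \<gamma>)"
 have "if \<beta> ! (i - 1) then x $ (i - 1) \<ge> 0 else x $ (i - 1) \<le> 0" if i: "i \<in> {1..n}" for i
 proof (cases "i \<in> sep \<alpha> \<beta> \<gamma>")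
  case True
  hence "x $ (i - 1) = 0" using x unfolding hyp_def by blast
  thus ?thesis by simp
 next
  case False
  hence "\<beta> ! (i - 1) = \<alpha> ! (i - 1) \<or> \<beta> ! (i - 1) = \<gamma> ! (i - 1)" using i assms unfolding sep_def by blast
  moreover have "if \<alpha> ! (i - 1) then x $ (i - 1) \<ge> 0 else x $ (i - 1) \<le> 0" "if \<gamma> ! (i - 1) then x $ (i - 1) \<ge> 0 else x $ (i - 1) \<le> 0"
   using x i unfolding chamber_def assms by blast+
  ultimately show ?thesis by metis
 qed
 moreover have "x \<in> aeta A" using x unfolding chamber_def by blast
 ultimately show "x \<in> chamber A \<beta>" unfolding chamber_def assms by blast
qed

lemma hyp_Un: "hyp A (S \<union> S') = hyp A S \<inter> hyp A S'" by (auto simp: hyp_def)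

text \<open>By \<open>chamber_sep\<close> the extra factor of the product confines points to the
  chamber of \<beta>, so a face that is empty for one of the inner pairs stays empty for the outer
  pair. Thus the product respects the ideals.\<close>

lemma gone_sep:
 assumes "length \<alpha> = n" "length \<beta> = n" "length \<gamma> = n"
 shows "gone A \<alpha> \<beta> S \<or> gone A \<beta> \<gamma> S ==> gone A \<alpha> \<gamma> (sep \<alpha> \<beta> \<gamma> \<union> S)"
 using chamber_sep[OF assms, of A] unfolding gone_def hyp_Un by blast

lemma Rideal_Zu: "p \<in> Rideal n A \<alpha> \<beta> ==> p \<in> carrier (Zu n)" by (simp add: Rideal_iff Zu_carrier)

lemma Rideal_add: "p \<in> Rideal n A \<alpha> \<beta> ==> q \<in> Rideal n A \<alpha> \<beta> ==> p + q \<in> Rideal n A \<alpha> \<beta>"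
 using Poly_Mapping.keys_add[of p q] unfolding Rideal_iff by blast

lemma Rideal_0 [simp]: "0 \<in> Rideal n A \<alpha> \<beta>" by (simp add: Rideal_iff)

lemma Rideal_sum: "(\<And>i. i \<in> I ==> f i \<in> Rideal n A \<alpha> \<beta>) ==> (\<Sum>i\<in>I. f i) \<in> Rideal n A \<alpha> \<beta>"
 by (induction I rule: infinite_finite_induct) (auto intro: Rideal_add)

lemma Rideal_mult:
 assumes p: "p \<in> Rideal n A \<alpha> \<beta>" and q: "q \<in> carrier (Zu n)"
 shows "p * q \<in> Rideal n A \<alpha> \<beta>"
 unfolding Rideal_iff
proof
 fix m assume "m \<in> keys (p * q)"
 then obtain a b where ab: "a \<in> keys p" "b \<in> keys q" "m = a + b" by (rule keys_mult_zpoly)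
 hence "inU n a" "gone A \<alpha> \<beta> (keys a)" "inU n b" using p q unfolding Rideal_iff Zu_carrier by blast+
 thus "inU n m \<and> gone A \<alpha> \<beta> (keys m)"
  using gone_mono[of "keys a" "keys m"] by (simp add: ab(3) inU_add keys_add_nat)
qed

lemma Rideal_sep:
 assumes "length \<alpha> = n" "length \<beta> = n" "length \<gamma> = n" "p \<in> Rideal n A \<alpha> \<beta> \<or> p \<in> Rideal n A \<beta> \<gamma>"
 shows "uprod (sep \<alpha> \<beta> \<gamma>) * p \<in> Rideal n A \<alpha> \<gamma>"
 unfolding Rideal_iff
proof
 fix m assume "m \<in> keys (uprod (sep \<alpha> \<beta> \<gamma>) * p)"
 then obtain a b where ab: "a \<in> keys (uprod (sep \<alpha> \<beta> \<gamma>))" "b \<in> keys p" "m = a + b" by (rule keys_mult_zpoly)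
 hence a: "a = expo (sep \<alpha> \<beta> \<gamma>)" by (simp add: uprod_eq)
 hence "keys m = sep \<alpha> \<beta> \<gamma> \<union> keys b" using ab(3) by (simp add: keys_add_nat keys_expo)
 moreover have "inU n a" using sep_subset[OF assms(1)] by (simp add: a inU_def keys_expo)
 moreover have "inU n b" "gone A \<alpha> \<beta> (keys b) \<or> gone A \<beta> \<gamma> (keys b)"
  using assms(4) ab(2) unfolding Rideal_iff by blast+
 ultimately show "inU n m \<and> gone A \<alpha> \<gamma> (keys m)"
  using gone_sep[OF assms(1-3), of A "keys b"] by (simp add: inU_add ab(3))
qed

lemma Bideal_iff: "M \<in> Bideal n A \<longleftrightarrow> M \<in> carrier (Bfree n A) \<and> (\<forall>\<alpha>\<in>BF n A. \<forall>\<beta>\<in>BF n A. M \<alpha> \<beta> \<in> Rideal n A \<alpha> \<beta>)"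
 by (simp only: Bideal_def mem_Collect_eq)

lemma Bideal_ideal: "ideal (Bideal n A) (Bfree n A)"
proof (rule idealI[OF Bfree_ring])
 interpret R: ring "Bfree n A" by (rule Bfree_ring)
 have uminus: "\<ominus>\<^bsub>Bfree n A\<^esub> M = (\<lambda>\<alpha> \<beta>. - M \<alpha> \<beta>)" if "M \<in> carrier (Bfree n A)" for M
  using that Bfree_uminus_closed[OF that] by (intro R.minus_equality) (simp_all add: Bfree_sel)
 show "subgroup (Bideal n A) (add_monoid (Bfree n A))"
 proof (rule R.add.subgroupI)
  have "\<zero>\<^bsub>Bfree n A\<^esub> \<in> Bideal n A" unfolding Bideal_iff using R.zero_closed by (simp add: Bfree_sel)
  thus "Bideal n A \<noteq> {}" by blast
  show "Bideal n A \<subseteq> carrier (Bfree n A)" unfolding Bideal_def by blast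
  fix a b assume a: "a \<in> Bideal n A"
  have aC: "a \<in> carrier (Bfree n A)" using a by (simp add: Bideal_iff)
  have "(\<lambda>\<alpha> \<beta>. - a \<alpha> \<beta>) \<in> Bideal n A"
   using a Bfree_uminus_closed[OF aC] unfolding Bideal_iff Rideal_iff keys_minus by blast
  thus "\<ominus>\<^bsub>Bfree n A\<^esub> a \<in> Bideal n A" unfolding uminus[OF aC] .
  assume b: "b \<in> Bideal n A"
  have bC: "b \<in> carrier (Bfree n A)" using b by (simp add: Bideal_iff)
  show "a \<oplus>\<^bsub>Bfree n A\<^esub> b \<in> Bideal n A"
   using a b R.a_closed[OF aC bC] unfolding Bideal_iff by (simp add: Bfree_sel(4) Rideal_add)
 qed
next
 fix M N assume M: "M \<in> Bideal n A" and N: "N \<in> carrier (Bfree n A)"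
 have MC: "M \<in> carrier (Bfree n A)" using M by (simp add: Bideal_iff)
 have NZ: "N \<alpha> \<beta> \<in> carrier (Zu n)" for \<alpha> \<beta> by (rule BfreeD(1)[OF N])
 have MR: "M \<alpha> \<beta> \<in> Rideal n A \<alpha> \<beta>" if "\<alpha> \<in> BF n A" "\<beta> \<in> BF n A" for \<alpha> \<beta> using M that by (simp add: Bideal_iff)
 have "uprod (sep \<alpha> \<beta> \<gamma>) * N \<alpha> \<beta> * M \<beta> \<gamma> \<in> Rideal n A \<alpha> \<gamma>" "uprod (sep \<alpha> \<beta> \<gamma>) * M \<alpha> \<beta> * N \<beta> \<gamma> \<in> Rideal n A \<alpha> \<gamma>"
  if "\<alpha> \<in> BF n A" "\<gamma> \<in> BF n A" "\<beta> \<in> BF n A" for \<alpha> \<beta> \<gamma>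
 proof -
  note len = BF_length[OF that(1)] BF_length[OF that(3)] BF_length[OF that(2)]
  have "uprod (sep \<alpha> \<beta> \<gamma>) * M \<beta> \<gamma> * N \<alpha> \<beta> \<in> Rideal n A \<alpha> \<gamma>"
   by (rule Rideal_mult[OF Rideal_sep[OF len] NZ]) (use MR that in blast)
  thus "uprod (sep \<alpha> \<beta> \<gamma>) * N \<alpha> \<beta> * M \<beta> \<gamma> \<in> Rideal n A \<alpha> \<gamma>" by (simp only: mult_ac)
  show "uprod (sep \<alpha> \<beta> \<gamma>) * M \<alpha> \<beta> * N \<beta> \<gamma> \<in> Rideal n A \<alpha> \<gamma>"
   by (rule Rideal_mult[OF Rideal_sep[OF len] NZ]) (use MR that in blast)
 qed
 thus "N \<otimes>\<^bsub>Bfree n A\<^esub> M \<in> Bideal n A" "M \<otimes>\<^bsub>Bfree n A\<^esub> N \<in> Bideal n A"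
  unfolding Bideal_iff using Bfree_mult_closed[OF N MC] Bfree_mult_closed[OF MC N]
  by (simp_all add: Bfree_sel(1) Rideal_sum)
qed

lemma Btilde_ring: "ring (Btilde n A)"
 unfolding Btilde_def by (rule ideal.quotient_is_ring[OF Bideal_ideal])

section \<open>Relabelling homomorphisms\<close>

lemma of_int_mult_zpoly: "(of_int c :: zpoly) * q = frag_cmul c q"
proof (induction c rule: int_induct[where k = 0])
 case (step1 i) thus ?case by (simp add: distrib_right frag_cmul_distrib)
next
 case (step2 i) thus ?case by (simp add: left_diff_distrib frag_cmul_diff_distrib)
qed simp

text \<open>Every substitution in use sends variables to monomials, so it is determined by an
  additive map on exponents. The inner sum is the \<open>lookup m i\<close>-fold multiple of
  \<open>e i\<close>.\<close>

definition esub :: "(nat => nat \<Rightarrow>\<^sub>0 nat) => (nat \<Rightarrow>\<^sub>0 nat) => nat \<Rightarrow>\<^sub>0 nat" where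
 "esub e m = (\<Sum>i\<in>keys m. \<Sum>_<lookup m i. e i)"

lemma esub_superset:
 assumes "finite K" "keys m \<subseteq> K"
 shows "esub e m = (\<Sum>i\<in>K. \<Sum>_<lookup m i. e i)"
 unfolding esub_def by (rule sum.mono_neutral_left) (use assms in \<open>auto simp: in_keys_iff\<close>)

lemma sum_const_add: "(\<Sum>_<k + l. x) = (\<Sum>_<k. x) + (\<Sum>_<(l::nat). x)" for x :: "'a::comm_monoid_add"
 by (induction l) (simp_all add: add.assoc)

lemma esub_add: "esub e (a + b) = esub e a + esub e b"
proof -
 let ?K = "keys a \<union> keys b"
 have "esub e (a + b) = (\<Sum>i\<in>?K. \<Sum>_<lookup (a + b) i. e i)"
  by (rule esub_superset) (simp_all add: keys_add_nat)
 also have "\<dots> = (\<Sum>i\<in>?K. \<Sum>_<lookup a i. e i) + (\<Sum>i\<in>?K. \<Sum>_<lookup b i. e i)"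
  by (simp add: lookup_add sum_const_add sum.distrib del: sum_constant)
 also have "\<dots> = esub e a + esub e b"
  by (simp add: esub_superset[of ?K a] esub_superset[of ?K b] del: sum_constant)
 finally show ?thesis .
qed

lemma keys_sum_nat: "finite I ==> keys (\<Sum>i\<in>I. f i) = (\<Union>i\<in>I. keys (f i))"
 for f :: "'a => nat \<Rightarrow>\<^sub>0 nat"
 by (induction I rule: finite_induct) (simp_all add: keys_add_nat)

lemma keys_esub: "keys (esub e m) = (\<Union>i\<in>keys m. keys (e i))"
proof -
 have "keys (\<Sum>_<lookup m i. e i) = keys (e i)" if "i \<in> keys m" for i
 proof -
  have "{..<lookup m i} \<noteq> {}" using that by (simp add: in_keys_iff lessThan_empty_iff)
  thus ?thesis by (simp add: keys_sum_nat del: sum_constant)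
 qed
 thus ?thesis unfolding esub_def by (simp add: keys_sum_nat del: sum_constant)
qed

lemma esub_expo: "finite S ==> esub e (expo S) = (\<Sum>i\<in>S. e i)"
 unfolding esub_def by (simp add: keys_expo lookup_expo)

lemma esub_0 [simp]: "esub e 0 = 0" by (simp add: esub_def)

abbreviation psub :: "(nat => nat \<Rightarrow>\<^sub>0 nat) => zpoly => zpoly" where
 "psub e \<equiv> frag_extend (\<lambda>m. frag_of (esub e m))"

lemma frag_of_power: "frag_of (x::nat \<Rightarrow>\<^sub>0 nat) ^ k = frag_of (\<Sum>_<k. x)"
 proof (induction k)
 case (Suc k)
 have "(\<Sum>_<Suc k. x) = x + (\<Sum>_<k. x)" by (simp add: add.commute del: sum_constant)
 thus ?case by (simp only: power_Suc Suc frag_of_mult)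
qed simp

lemma frag_of_prod: "finite I ==> (\<Prod>i\<in>I. frag_of (f i :: nat \<Rightarrow>\<^sub>0 nat)) = frag_of (\<Sum>i\<in>I. f i)"
 proof (induction I rule: finite_induct)
 case (insert i I)
 show ?case unfolding prod.insert[OF insert(1,2)] sum.insert[OF insert(1,2)] insert(3) by (rule frag_of_mult)
qed simp

lemma poly_subst_psub: "poly_subst (\<lambda>i. frag_of (e i)) p = psub e p"
 unfolding poly_subst_def frag_extend_def
 by (rule sum.cong[OF refl]) (simp only: of_int_mult_zpoly frag_of_power frag_of_prod[OF finite_keys] esub_def)

lemma psub_mult: "psub e (p * q) = psub e p * psub e q"
proof -
 have 1: "psub e (frag_of a * q) = frag_of (esub e a) * psub e q" for a
  using subset_UNIV[of "keys q"]
 proof (induction q rule: frag_induction)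
  case (one b) thus ?case by (simp only: frag_of_mult frag_extend_of esub_add)
 next
  case (diff a b) thus ?case by (simp only: right_diff_distrib frag_extend_diff)
 qed simp
 show ?thesis
  using subset_UNIV[of "keys p"]
 proof (induction p rule: frag_induction)
  case (one b) thus ?case by (simp only: 1 frag_extend_of)
 next
  case (diff a b) thus ?case by (simp only: left_diff_distrib frag_extend_diff)
 qed simp
qed

lemma psub_sum: "psub e (\<Sum>i\<in>I. f i) = (\<Sum>i\<in>I. psub e (f i))"
 by (induction I rule: infinite_finite_induct) (simp_all add: frag_extend_add)

text \<open>One frame for deletion, restriction and sign change. The assumption \<open>gone\<close>
  makes the map respect the ideals, \<open>sep\<close> matches the factors of the products, and
  \<open>sep_gone\<close> accounts for intermediate sign vectors that leave the set of bounded
  feasible ones.\<close>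

locale relabelling =
 fixes n m :: nat and A C :: arrangement and T :: "signs set" and \<tau> :: "signs => signs"
  and e :: "nat => nat \<Rightarrow>\<^sub>0 nat"
 assumes T: "T \<subseteq> BF n A" and inj: "inj_on \<tau> T"
  and e_inU: "\<And>i. 1 \<le> i ==> i \<le> n ==> inU m (e i)"
  and gone: "\<And>\<alpha> \<beta> S. \<alpha> \<in> T ==> \<beta> \<in> T ==> \<tau> \<alpha> \<in> BF m C ==> \<tau> \<beta> \<in> BF m C ==> S \<subseteq> {1..n} ==>
   gone A \<alpha> \<beta> S ==> gone C (\<tau> \<alpha>) (\<tau> \<beta>) (\<Union>i\<in>S. keys (e i))"
  and sep: "\<And>\<alpha> \<beta> \<gamma>. \<alpha> \<in> T ==> \<beta> \<in> T ==> \<gamma> \<in> T ==>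
   (\<Sum>i\<in>sep \<alpha> \<beta> \<gamma>. e i) = expo (sep (\<tau> \<alpha>) (\<tau> \<beta>) (\<tau> \<gamma>))"
  and sep_gone: "\<And>\<alpha> \<beta> \<gamma>. \<alpha> \<in> T ==> \<beta> \<in> T ==> \<gamma> \<in> T ==> \<tau> \<alpha> \<in> BF m C ==> \<tau> \<gamma> \<in> BF m C ==>
   \<tau> \<beta> \<notin> BF m C ==> gone C (\<tau> \<alpha>) (\<tau> \<gamma>) (sep (\<tau> \<alpha>) (\<tau> \<beta>) (\<tau> \<gamma>))"
begin

definition rl :: "(signs => signs => zpoly) => signs => signs => zpoly" where
 "rl = relabel m C T \<tau> (\<lambda>i. frag_of (e i))"

definition supp :: "(signs => signs => zpoly) => bool" where
 "supp M \<longleftrightarrow> (\<forall>\<alpha> \<beta>. \<alpha> \<notin> T \<or> \<beta> \<notin> T \<longrightarrow> M \<alpha> \<beta> = 0)"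

lemma finite_T: "finite T" using T finite_BF finite_subset by blast

lemma rl_apply:
 assumes "\<alpha> \<in> T" "\<beta> \<in> T"
 shows "rl M (\<tau> \<alpha>) (\<tau> \<beta>) = (if \<tau> \<alpha> \<in> BF m C \<and> \<tau> \<beta> \<in> BF m C then psub e (M \<alpha> \<beta>) else 0)"
proof -
 have eq: "\<tau> \<alpha> = \<tau> a \<longleftrightarrow> a = \<alpha>" "\<tau> \<beta> = \<tau> a \<longleftrightarrow> a = \<beta>" if "a \<in> T" for a
  using inj that assms by (auto simp: inj_on_def)
 have "rl M (\<tau> \<alpha>) (\<tau> \<beta>) = (\<Sum>a\<in>T. \<Sum>b\<in>T. if a = \<alpha> then if b = \<beta> then
   (if \<tau> \<alpha> \<in> BF m C \<and> \<tau> \<beta> \<in> BF m C then psub e (M \<alpha> \<beta>) else 0) else 0 else 0)"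
  unfolding rl_def relabel_def poly_subst_psub munit_def
  by (intro sum.cong refl) (auto simp: eq)
 also have "\<dots> = (\<Sum>a\<in>T. if a = \<alpha> then (\<Sum>b\<in>T. if b = \<beta> then
   (if \<tau> \<alpha> \<in> BF m C \<and> \<tau> \<beta> \<in> BF m C then psub e (M \<alpha> \<beta>) else 0) else 0) else 0)"
  by (intro sum.cong refl) simp
 also have "\<dots> = (if \<tau> \<alpha> \<in> BF m C \<and> \<tau> \<beta> \<in> BF m C then psub e (M \<alpha> \<beta>) else 0)"
  using assms finite_T by simp
 finally show ?thesis .
qed

lemma rl_out: "\<alpha>' \<notin> \<tau> ` T \<or> \<beta>' \<notin> \<tau> ` T ==> rl M \<alpha>' \<beta>' = 0"
 unfolding rl_def relabel_def munit_def by (intro sum.neutral ballI) auto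

lemma psub_Zu:
 assumes "p \<in> carrier (Zu n)" shows "psub e p \<in> carrier (Zu m)"
 unfolding Zu_carrier
proof
 fix k assume "k \<in> keys (psub e p)"
 then obtain a where a: "a \<in> keys p" "k = esub e a"
  using keys_frag_extend[of "\<lambda>m. frag_of (esub e m)" p] by auto
 hence "inU n a" using assms by (simp add: Zu_carrier)
 hence "inU m (e i)" if "i \<in> keys a" for i
 proof -
  have "i \<in> {1..n}" using \<open>inU n a\<close> that unfolding inU_def by (rule subsetD)
  thus ?thesis using e_inU[of i] by simp
 qed
 thus "inU m k" unfolding a(2) inU_def keys_esub by blast
qed

lemma psub_Rideal:
 assumes "p \<in> Rideal n A \<alpha> \<beta>" "\<alpha> \<in> T" "\<beta> \<in> T" "\<tau> \<alpha> \<in> BF m C" "\<tau> \<beta> \<in> BF m C"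
 shows "psub e p \<in> Rideal m C (\<tau> \<alpha>) (\<tau> \<beta>)"
 unfolding Rideal_iff
proof
 fix k assume k: "k \<in> keys (psub e p)"
 then obtain a where a: "a \<in> keys p" "k = esub e a"
  using keys_frag_extend[of "\<lambda>m. frag_of (esub e m)" p] by auto
 hence "keys a \<subseteq> {1..n}" "gone A \<alpha> \<beta> (keys a)"
  using assms(1) unfolding Rideal_iff inU_def by blast+
 hence "gone C (\<tau> \<alpha>) (\<tau> \<beta>) (keys k)" unfolding a(2) keys_esub by (rule gone[OF assms(2-5)])
 moreover have "inU m k" using psub_Zu[OF Rideal_Zu[OF assms(1)]] k unfolding Zu_carrier by blast
 ultimately show "inU m k \<and> gone C (\<tau> \<alpha>) (\<tau> \<beta>) (keys k)" by blast
qed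

lemma rl_cases:
 obtains (image) \<alpha> \<beta> where "\<alpha>' = \<tau> \<alpha>" "\<beta>' = \<tau> \<beta>" "\<alpha> \<in> T" "\<beta> \<in> T" "\<tau> \<alpha> \<in> BF m C" "\<tau> \<beta> \<in> BF m C"
  "\<And>M. rl M \<alpha>' \<beta>' = psub e (M \<alpha> \<beta>)"
 | (out) "\<And>M. rl M \<alpha>' \<beta>' = 0"
proof (cases "\<alpha>' \<in> \<tau> ` T \<and> \<beta>' \<in> \<tau> ` T")
 case True
 then obtain \<alpha> \<beta> where ab: "\<alpha>' = \<tau> \<alpha>" "\<beta>' = \<tau> \<beta>" "\<alpha> \<in> T" "\<beta> \<in> T" by blast
 show thesis
 proof (cases "\<tau> \<alpha> \<in> BF m C \<and> \<tau> \<beta> \<in> BF m C")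
  case True
  thus thesis using ab rl_apply[OF ab(3,4)] by (intro image[of \<alpha> \<beta>]) simp_all
 next
  case False
  show thesis using False by (intro out) (auto simp: ab rl_apply[OF ab(3,4)])
 qed
qed (use rl_out out in blast)

lemma rl_closed:
 assumes M: "M \<in> carrier (Bfree n A)" shows "rl M \<in> carrier (Bfree m C)"
proof (rule BfreeI)
 fix \<alpha>' \<beta>'
 show "rl M \<alpha>' \<beta>' \<in> carrier (Zu m)"
  by (cases rule: rl_cases[of \<alpha>' \<beta>']) (simp_all add: psub_Zu BfreeD(1)[OF M])
 show "rl M \<alpha>' \<beta>' = 0" if "\<alpha>' \<notin> BF m C \<or> \<beta>' \<notin> BF m C"
  by (cases rule: rl_cases[of \<alpha>' \<beta>']) (use that in auto)
qed

lemma rl_add: "rl (M \<oplus>\<^bsub>Bfree n A\<^esub> N) = rl M \<oplus>\<^bsub>Bfree m C\<^esub> rl N"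
proof (intro ext)
 fix \<alpha>' \<beta>'
 show "rl (M \<oplus>\<^bsub>Bfree n A\<^esub> N) \<alpha>' \<beta>' = (rl M \<oplus>\<^bsub>Bfree m C\<^esub> rl N) \<alpha>' \<beta>'"
  by (cases rule: rl_cases[of \<alpha>' \<beta>']) (simp_all add: Bfree_sel frag_extend_add)
qed

lemma rl_ideal:
 assumes "M \<in> Bideal n A" shows "rl M \<in> Bideal m C"
proof -
 have M: "M \<in> carrier (Bfree n A)" "\<And>\<alpha> \<beta>. \<alpha> \<in> T ==> \<beta> \<in> T ==> M \<alpha> \<beta> \<in> Rideal n A \<alpha> \<beta>"
  using assms T unfolding Bideal_iff by blast+
 have "rl M \<alpha>' \<beta>' \<in> Rideal m C \<alpha>' \<beta>'" for \<alpha>' \<beta>'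
  by (cases rule: rl_cases[of \<alpha>' \<beta>']) (simp_all add: psub_Rideal M(2))
 thus ?thesis unfolding Bideal_iff using rl_closed[OF M(1)] by blast
qed

text \<open>Vertices \<open>\<beta>\<close> that are lost under the relabelling contribute terms in the ideal.\<close>

lemma rl_mult:
 assumes M: "M \<in> carrier (Bfree n A)" and N: "N \<in> carrier (Bfree n A)" and s: "supp M" "supp N"
 shows "(\<lambda>\<alpha> \<beta>. rl (M \<otimes>\<^bsub>Bfree n A\<^esub> N) \<alpha> \<beta> - (rl M \<otimes>\<^bsub>Bfree m C\<^esub> rl N) \<alpha> \<beta>) \<in> Bideal m C" (is "?D \<in> _")
proof -
 have MN: "M \<otimes>\<^bsub>Bfree n A\<^esub> N \<in> carrier (Bfree n A)" by (rule Bfree_mult_closed[OF M N])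
 have c: "rl (M \<otimes>\<^bsub>Bfree n A\<^esub> N) \<in> carrier (Bfree m C)" "rl M \<otimes>\<^bsub>Bfree m C\<^esub> rl N \<in> carrier (Bfree m C)"
  using rl_closed[OF MN] Bfree_mult_closed[OF rl_closed[OF M] rl_closed[OF N]] .
 have DC: "?D \<in> carrier (Bfree m C)"
 proof (rule BfreeI)
  fix \<alpha> \<beta>
  show "?D \<alpha> \<beta> \<in> carrier (Zu m)"
   using Zu_add_closed[OF BfreeD(1)[OF c(1)] Zu_minus_closed[OF BfreeD(1)[OF c(2)]], of \<alpha> \<beta> \<alpha> \<beta>] by simp
  show "?D \<alpha> \<beta> = 0" if "\<alpha> \<notin> BF m C \<or> \<beta> \<notin> BF m C"
   using that BfreeD(2,3)[OF c(1)] BfreeD(2,3)[OF c(2)] by auto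
 qed
 have "?D \<alpha>' \<gamma>' \<in> Rideal m C \<alpha>' \<gamma>'" if BF': "\<alpha>' \<in> BF m C" "\<gamma>' \<in> BF m C" for \<alpha>' \<gamma>'
 proof (cases "\<alpha>' \<in> \<tau> ` T \<and> \<gamma>' \<in> \<tau> ` T")
  case False
  hence "rl M \<alpha>' \<beta> * rl N \<beta> \<gamma>' = 0" for \<beta> using rl_out by auto
  hence "(rl M \<otimes>\<^bsub>Bfree m C\<^esub> rl N) \<alpha>' \<gamma>' = 0" by (simp add: Bfree_sel mult.assoc)
  thus ?thesis using rl_out[of \<alpha>' \<gamma>'] False by simp
 next
  case True
  then obtain \<alpha> \<gamma> where ag: "\<alpha>' = \<tau> \<alpha>" "\<gamma>' = \<tau> \<gamma>" "\<alpha> \<in> T" "\<gamma> \<in> T" by blast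
  have agC: "\<tau> \<alpha> \<in> BF m C" "\<tau> \<gamma> \<in> BF m C" using BF' ag by simp_all
  have u: "psub e (uprod (sep \<alpha> \<beta> \<gamma>)) = uprod (sep (\<tau> \<alpha>) (\<tau> \<beta>) (\<tau> \<gamma>))" if "\<beta> \<in> T" for \<beta>
   by (simp add: uprod_eq esub_expo sep[OF ag(3) that ag(4)])
  have "(M \<otimes>\<^bsub>Bfree n A\<^esub> N) \<alpha> \<gamma> = (\<Sum>\<beta>\<in>T. uprod (sep \<alpha> \<beta> \<gamma>) * M \<alpha> \<beta> * N \<beta> \<gamma>)"
   unfolding Bfree_sel using T s by (intro sum.mono_neutral_right) (auto simp: supp_def)
  hence 1: "rl (M \<otimes>\<^bsub>Bfree n A\<^esub> N) \<alpha>' \<gamma>' =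
    (\<Sum>\<beta>\<in>T. uprod (sep (\<tau> \<alpha>) (\<tau> \<beta>) (\<tau> \<gamma>)) * psub e (M \<alpha> \<beta>) * psub e (N \<beta> \<gamma>))"
   using agC by (simp add: ag rl_apply psub_sum psub_mult u)
  have z: "rl M \<alpha>' i = 0" if "i \<in> BF m C" "i \<notin> \<tau> ` {\<beta> \<in> T. \<tau> \<beta> \<in> BF m C}" for i
   using that rl_out[of \<alpha>' i M] by blast
  have "(rl M \<otimes>\<^bsub>Bfree m C\<^esub> rl N) \<alpha>' \<gamma>' =
    (\<Sum>\<beta>'\<in>\<tau> ` {\<beta> \<in> T. \<tau> \<beta> \<in> BF m C}. uprod (sep \<alpha>' \<beta>' \<gamma>') * rl M \<alpha>' \<beta>' * rl N \<beta>' \<gamma>')"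
   unfolding Bfree_sel by (intro sum.mono_neutral_right) (auto simp: z)
  also have "\<dots> = (\<Sum>\<beta>\<in>{\<beta> \<in> T. \<tau> \<beta> \<in> BF m C}. uprod (sep \<alpha>' (\<tau> \<beta>) \<gamma>') * rl M \<alpha>' (\<tau> \<beta>) * rl N (\<tau> \<beta>) \<gamma>')"
   by (subst sum.reindex) (use inj in \<open>auto simp: inj_on_def\<close>)
  also have "\<dots> = (\<Sum>\<beta>\<in>{\<beta> \<in> T. \<tau> \<beta> \<in> BF m C}. uprod (sep (\<tau> \<alpha>) (\<tau> \<beta>) (\<tau> \<gamma>)) * psub e (M \<alpha> \<beta>) * psub e (N \<beta> \<gamma>))"
   using agC ag by (intro sum.cong refl) (simp add: rl_apply)
  finally have 2: "(rl M \<otimes>\<^bsub>Bfree m C\<^esub> rl N) \<alpha>' \<gamma>' = \<dots>" .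
  have 3: "(\<Sum>\<beta>\<in>T. F \<beta>) - (\<Sum>\<beta>\<in>{\<beta> \<in> T. \<tau> \<beta> \<in> BF m C}. F \<beta>) = (\<Sum>\<beta>\<in>{\<beta> \<in> T. \<tau> \<beta> \<notin> BF m C}. F \<beta>)" for F :: "signs => zpoly"
  proof -
   have "T - {\<beta> \<in> T. \<tau> \<beta> \<in> BF m C} = {\<beta> \<in> T. \<tau> \<beta> \<notin> BF m C}" by blast
   thus ?thesis using sum_diff[OF finite_T, of "{\<beta> \<in> T. \<tau> \<beta> \<in> BF m C}" F] by simp
  qed
  have "uprod (sep (\<tau> \<alpha>) (\<tau> \<beta>) (\<tau> \<gamma>)) * psub e (M \<alpha> \<beta>) * psub e (N \<beta> \<gamma>) \<in> Rideal m C (\<tau> \<alpha>) (\<tau> \<gamma>)"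
   if b: "\<beta> \<in> T" "\<tau> \<beta> \<notin> BF m C" for \<beta>
  proof (intro Rideal_mult psub_Zu BfreeD(1)[OF M] BfreeD(1)[OF N])
   show "uprod (sep (\<tau> \<alpha>) (\<tau> \<beta>) (\<tau> \<gamma>)) \<in> Rideal m C (\<tau> \<alpha>) (\<tau> \<gamma>)"
    unfolding Rideal_iff using sep_gone[OF ag(3) b(1) ag(4) agC b(2)] sep_subset[OF BF_length[OF agC(1)]]
    by (simp add: uprod_eq keys_expo inU_def)
  qed
  hence "(\<Sum>\<beta>\<in>{\<beta> \<in> T. \<tau> \<beta> \<notin> BF m C}. uprod (sep (\<tau> \<alpha>) (\<tau> \<beta>) (\<tau> \<gamma>)) * psub e (M \<alpha> \<beta>) * psub e (N \<beta> \<gamma>)) \<in> Rideal m C (\<tau> \<alpha>) (\<tau> \<gamma>)"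
   by (intro Rideal_sum) blast
  hence "rl (M \<otimes>\<^bsub>Bfree n A\<^esub> N) \<alpha>' \<gamma>' - (rl M \<otimes>\<^bsub>Bfree m C\<^esub> rl N) \<alpha>' \<gamma>' \<in> Rideal m C (\<tau> \<alpha>) (\<tau> \<gamma>)"
   unfolding 1 2 by (simp only: 3)
  thus ?thesis unfolding ag(1,2)[symmetric] .
 qed
 thus ?thesis unfolding Bideal_iff using DC by blast
qed

definition rh :: "conv => conv" where "rh = relabel_hom m C T \<tau> (\<lambda>i. frag_of (e i))"

lemma rh_coset: "M \<in> carrier (Bfree n A) ==> rh (Bideal n A +>\<^bsub>Bfree n A\<^esub> M) = Bideal m C +>\<^bsub>Bfree m C\<^esub> rl M"
 unfolding rh_def relabel_hom_def rl_def[symmetric]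
 by (rule quot_map_coset[OF Bideal_ideal Bideal_ideal]) (simp_all add: rl_closed rl_add rl_ideal)

end

section \<open>Classes in the convolution algebra and its plus part\<close>

abbreviation bcl :: "nat => arrangement => (signs => signs => zpoly) => conv" where
 "bcl n A M \<equiv> Bideal n A +>\<^bsub>Bfree n A\<^esub> M"

lemma Btilde_carrier: "X \<in> carrier (Btilde n A) \<longleftrightarrow> (\<exists>M\<in>carrier (Bfree n A). X = bcl n A M)"
 unfolding Btilde_def carrier_quot by blast

lemma bcl_simps:
 assumes "M \<in> carrier (Bfree n A)"
 shows "N \<in> carrier (Bfree n A) ==> bcl n A M \<otimes>\<^bsub>Btilde n A\<^esub> bcl n A N = bcl n A (M \<otimes>\<^bsub>Bfree n A\<^esub> N)"
  and "N \<in> carrier (Bfree n A) ==> bcl n A M \<oplus>\<^bsub>Btilde n A\<^esub> bcl n A N = bcl n A (M \<oplus>\<^bsub>Bfree n A\<^esub> N)"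
  and "bcl n A M \<in> carrier (Btilde n A)"
 unfolding Btilde_def using ideal.quot_simps[OF Bideal_ideal] assms by blast+

lemma bcl_eq:
 assumes M: "M \<in> carrier (Bfree n A)" and N: "N \<in> carrier (Bfree n A)"
 shows "bcl n A M = bcl n A N \<longleftrightarrow> (\<lambda>\<alpha> \<beta>. M \<alpha> \<beta> - N \<alpha> \<beta>) \<in> Bideal n A" (is "_ \<longleftrightarrow> ?D \<in> _")
proof
 interpret I: ideal "Bideal n A" "Bfree n A" by (rule Bideal_ideal)
 have *: "?D \<oplus>\<^bsub>Bfree n A\<^esub> N = M" by (simp add: Bfree_sel)
 show "bcl n A M = bcl n A N" if "?D \<in> Bideal n A"
  using I.coset_add_mem[OF that N] unfolding * .
 assume "bcl n A M = bcl n A N"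
 then obtain i where i: "i \<in> Bideal n A" "M = i \<oplus>\<^bsub>Bfree n A\<^esub> N" using I.coset_eqD M N by blast
 hence "i = ?D" by (simp add: Bfree_sel)
 thus "?D \<in> Bideal n A" using i(1) by simp
qed

definition diag :: "signs set => signs => signs => zpoly" where
 "diag S = (\<lambda>\<alpha> \<beta>. if \<alpha> = \<beta> \<and> \<alpha> \<in> S then 1 else 0)"

lemma diag_closed: "S \<subseteq> BF n A ==> diag S \<in> carrier (Bfree n A)"
 by (rule BfreeI) (auto simp: diag_def)

lemma diag_mult:
 assumes S: "S \<subseteq> BF n A"
 shows "diag S \<otimes>\<^bsub>Bfree n A\<^esub> M = (\<lambda>\<alpha> \<beta>. if \<alpha> \<in> S then M \<alpha> \<beta> else 0)"
  and "M \<otimes>\<^bsub>Bfree n A\<^esub> diag S = (\<lambda>\<alpha> \<beta>. if \<beta> \<in> S then M \<alpha> \<beta> else 0)"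
proof -
 have "(\<Sum>\<beta>\<in>BF n A. uprod (sep \<alpha> \<beta> \<gamma>) * diag S \<alpha> \<beta> * M \<beta> \<gamma>) = (\<Sum>\<beta>\<in>BF n A. if \<beta> = \<alpha> then if \<alpha> \<in> S then M \<alpha> \<gamma> else 0 else 0)" for \<alpha> \<gamma>
  by (intro sum.cong refl) (auto simp: diag_def)
 thus "diag S \<otimes>\<^bsub>Bfree n A\<^esub> M = (\<lambda>\<alpha> \<beta>. if \<alpha> \<in> S then M \<alpha> \<beta> else 0)"
  using S by (auto simp: Bfree_sel fun_eq_iff)
 have "(\<Sum>\<beta>\<in>BF n A. uprod (sep \<alpha> \<beta> \<gamma>) * M \<alpha> \<beta> * diag S \<beta> \<gamma>) = (\<Sum>\<beta>\<in>BF n A. if \<beta> = \<gamma> then if \<gamma> \<in> S then M \<alpha> \<gamma> else 0 else 0)" for \<alpha> \<gamma>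
  by (intro sum.cong refl) (auto simp: diag_def)
 thus "M \<otimes>\<^bsub>Bfree n A\<^esub> diag S = (\<lambda>\<alpha> \<beta>. if \<beta> \<in> S then M \<alpha> \<beta> else 0)"
  using S by (auto simp: Bfree_sel fun_eq_iff)
qed

lemma munit_closed: "p \<in> carrier (Zu n) ==> munit n A p \<alpha> \<beta> \<in> carrier (Bfree n A)"
 by (rule BfreeI) (auto simp: munit_def)

lemma finsum_f_elt:
 assumes "finite S" "S \<subseteq> BF n A"
 shows "(\<Oplus>\<^bsub>Btilde n A\<^esub>\<alpha>\<in>S. f_elt n A \<alpha> \<alpha>) = bcl n A (diag S)"
 using assms
proof (induction S rule: finite_induct)
 interpret B: ring "Btilde n A" by (rule Btilde_ring)
 case empty
 have "diag {} = \<zero>\<^bsub>Bfree n A\<^esub>" by (simp add: diag_def Bfree_sel)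
 moreover have "bcl n A \<zero>\<^bsub>Bfree n A\<^esub> = \<zero>\<^bsub>Btilde n A\<^esub>"
  unfolding Btilde_def using ideal.quot_simps(4)[OF Bideal_ideal] by simp
 ultimately show ?case by simp
next
 interpret B: ring "Btilde n A" by (rule Btilde_ring)
 case (insert \<alpha> S)
 have f: "f_elt n A \<beta> \<beta> \<in> carrier (Btilde n A)" for \<beta>
  unfolding pf_elt_def by (rule bcl_simps(3)[OF munit_closed[OF Zu_one_closed]])
 have "(\<Oplus>\<^bsub>Btilde n A\<^esub>\<alpha>\<in>insert \<alpha> S. f_elt n A \<alpha> \<alpha>) = f_elt n A \<alpha> \<alpha> \<oplus>\<^bsub>Btilde n A\<^esub> bcl n A (diag S)"
  using insert f by (subst B.finsum_insert) auto
 also have "\<dots> = bcl n A (munit n A 1 \<alpha> \<alpha> \<oplus>\<^bsub>Bfree n A\<^esub> diag S)"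
  unfolding pf_elt_def using insert(4) by (intro bcl_simps(2) munit_closed diag_closed) auto
 also have "munit n A 1 \<alpha> \<alpha> \<oplus>\<^bsub>Bfree n A\<^esub> diag S = diag (insert \<alpha> S)"
  using insert by (auto simp: Bfree_sel munit_def diag_def fun_eq_iff)
 finally show ?case .
qed

lemma Btilde_plus_eq: "Btilde_plus n A = corner (Btilde n A) (bcl n A (diag (BF_plus n A)))"
 unfolding Btilde_plus_def by (subst finsum_f_elt) auto

lemma diag_idem: "S \<subseteq> BF n A ==> bcl n A (diag S) \<otimes>\<^bsub>Btilde n A\<^esub> bcl n A (diag S) = bcl n A (diag S)"
proof -
 assume S: "S \<subseteq> BF n A"
 have "diag S \<otimes>\<^bsub>Bfree n A\<^esub> diag S = diag S"
  unfolding diag_mult(1)[OF S] by (simp add: diag_def fun_eq_iff)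
 thus ?thesis using bcl_simps(1)[OF diag_closed[OF S] diag_closed[OF S]] by simp
qed

lemma Btilde_plus_ring: "ring (Btilde_plus n A)"
 unfolding Btilde_plus_eq
 by (rule corner_ring[OF Btilde_ring bcl_simps(3)[OF diag_closed] diag_idem]) auto

text \<open>Multiplying by the idempotent on both sides erases all entries outside the plus
  vectors.\<close>

lemma Btilde_plus_carrier:
 "X \<in> carrier (Btilde_plus n A) \<longleftrightarrow> (\<exists>M\<in>carrier (Bfree n A). (\<forall>\<alpha> \<beta>. \<alpha> \<notin> BF_plus n A \<or> \<beta> \<notin> BF_plus n A \<longrightarrow> M \<alpha> \<beta> = 0) \<and> X = bcl n A M)"
proof -
 let ?S = "BF_plus n A"
 have S: "?S \<subseteq> BF n A" by auto
 note D = diag_closed[OF S]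
 have c: "carrier (Btilde_plus n A) = {bcl n A (diag ?S) \<otimes>\<^bsub>Btilde n A\<^esub> a \<otimes>\<^bsub>Btilde n A\<^esub> bcl n A (diag ?S) | a. a \<in> carrier (Btilde n A)}"
  unfolding Btilde_plus_eq by (simp add: corner_def)
 have e: "bcl n A (diag ?S) \<otimes>\<^bsub>Btilde n A\<^esub> bcl n A M \<otimes>\<^bsub>Btilde n A\<^esub> bcl n A (diag ?S)
   = bcl n A (\<lambda>\<alpha> \<beta>. if \<beta> \<in> ?S then if \<alpha> \<in> ?S then M \<alpha> \<beta> else 0 else 0)" if M: "M \<in> carrier (Bfree n A)" for M
 proof -
  have "bcl n A (diag ?S) \<otimes>\<^bsub>Btilde n A\<^esub> bcl n A M \<otimes>\<^bsub>Btilde n A\<^esub> bcl n A (diag ?S)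
   = bcl n A (diag ?S \<otimes>\<^bsub>Bfree n A\<^esub> M \<otimes>\<^bsub>Bfree n A\<^esub> diag ?S)"
   using bcl_simps(1)[OF D M] bcl_simps(1)[OF Bfree_mult_closed[OF D M] D] by simp
  thus ?thesis by (simp only: diag_mult[OF S])
 qed
 show ?thesis
 proof
  assume "X \<in> carrier (Btilde_plus n A)"
  then obtain M where M: "M \<in> carrier (Bfree n A)" "X = bcl n A (\<lambda>\<alpha> \<beta>. if \<beta> \<in> ?S then if \<alpha> \<in> ?S then M \<alpha> \<beta> else 0 else 0)"
   unfolding c Btilde_carrier[abs_def] using e by (auto simp: Btilde_carrier)
  have "(\<lambda>\<alpha> \<beta>. if \<beta> \<in> ?S then if \<alpha> \<in> ?S then M \<alpha> \<beta> else 0 else 0) \<in> carrier (Bfree n A)"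
   by (rule BfreeI) (auto simp: BfreeD[OF M(1)])
  with M(2) show "\<exists>M\<in>carrier (Bfree n A). (\<forall>\<alpha> \<beta>. \<alpha> \<notin> ?S \<or> \<beta> \<notin> ?S \<longrightarrow> M \<alpha> \<beta> = 0) \<and> X = bcl n A M"
   by (intro bexI) auto
 next
  assume "\<exists>M\<in>carrier (Bfree n A). (\<forall>\<alpha> \<beta>. \<alpha> \<notin> ?S \<or> \<beta> \<notin> ?S \<longrightarrow> M \<alpha> \<beta> = 0) \<and> X = bcl n A M"
  then obtain M where M: "M \<in> carrier (Bfree n A)" "\<And>\<alpha> \<beta>. \<alpha> \<notin> ?S \<or> \<beta> \<notin> ?S ==> M \<alpha> \<beta> = 0" "X = bcl n A M" by blast
  have "(\<lambda>\<alpha> \<beta>. if \<beta> \<in> ?S then if \<alpha> \<in> ?S then M \<alpha> \<beta> else 0 else 0) = M" using M(2) by (intro ext) metis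
  hence "X = bcl n A (diag ?S) \<otimes>\<^bsub>Btilde n A\<^esub> X \<otimes>\<^bsub>Btilde n A\<^esub> bcl n A (diag ?S)" using e[OF M(1)] M(3) by simp
  moreover have "X \<in> carrier (Btilde n A)" using M bcl_simps(3) by blast
  ultimately show "X \<in> carrier (Btilde_plus n A)" unfolding c by blast
 qed
qed

section \<open>Minors\<close>

text \<open>\<open>pick K\<close> lists \<open>K\<close> increasingly from index 0; its inverse is
  the rank, the number of smaller elements of \<open>K\<close>. All signs in the expansions below
  are expressed through ranks.\<close>

lemma pick_eqI: "x \<in> K ==> card (K \<inter> {..<x}) = j ==> pick K j = x"
 using pick_card_in_set[of x K] by (simp add: Int_def)

lemma card_lessThan_pick: "j < card K ==> card (K \<inter> {..<pick K j}) = j"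
 using card_pick[of j K] by (simp add: Int_def)

lemma card_below_less:
 assumes "finite (K :: nat set)" "x \<in> K" shows "card (K \<inter> {..<x}) < card K"
 by (rule psubset_card_mono) (use assms in auto)

lemma bij_betw_pick:
 assumes "finite K" shows "bij_betw (pick K) {..<card K} K"
proof (rule bij_betw_byWitness[where f' = "\<lambda>x. card (K \<inter> {..<x})"])
 show "pick K ` {..<card K} \<subseteq> K" using pick_in_set by auto
 show "(\<lambda>x. card (K \<inter> {..<x})) ` K \<subseteq> {..<card K}" using card_below_less[OF assms] by auto
qed (auto simp: card_lessThan_pick intro: pick_eqI)

lemma pick_remove:
 assumes K: "finite K" and p: "p < card K" and j: "Suc j < card K"
 shows "pick (K - {pick K p}) j = pick K (if j < p then j else Suc j)"
proof (rule pick_eqI)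
 let ?j = "if j < p then j else Suc j"
 have jK: "?j < card K" using j by simp
 have ne: "pick K ?j \<noteq> pick K p"
 proof
  assume "pick K ?j = pick K p"
  hence "?j = p" by (rule inj_onD[OF bij_betw_imp_inj_on[OF bij_betw_pick[OF K]]]) (use jK p in simp_all)
  thus False by (simp split: if_splits)
 qed
 show "pick K ?j \<in> K - {pick K p}" using ne pick_in_set[of ?j K] jK by blast
 have lt: "pick K p < pick K ?j \<longleftrightarrow> p < ?j"
  using pick_mono[of ?j K p] pick_mono[of p K ?j] jK p ne by (metis linorder_neqE_nat not_less_iff_gr_or_eq)
 have eq: "(K - {pick K p}) \<inter> {..<pick K ?j} = (K \<inter> {..<pick K ?j}) - {pick K p}" by blast
 have pK: "pick K p \<in> K" using p pick_in_set by blast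
 have "card ((K - {pick K p}) \<inter> {..<pick K ?j}) = (if p < ?j then ?j - 1 else ?j)"
 proof (cases "p < ?j")
  case True
  hence "pick K p \<in> K \<inter> {..<pick K ?j}" using lt pK by blast
  thus ?thesis unfolding eq using True card_Diff_singleton[of "pick K p" "K \<inter> {..<pick K ?j}"] card_lessThan_pick[OF jK] by presburger
 next
  case False
  hence "pick K p \<notin> K \<inter> {..<pick K ?j}" using lt by blast
  thus ?thesis unfolding eq using False card_lessThan_pick[OF jK] by simp
 qed
 thus "card ((K - {pick K p}) \<inter> {..<pick K ?j}) = j" by (simp split: if_splits)
qed

lemma pick_lessThan: "j < k ==> pick {..<k} j = j"
 by (rule pick_eqI) (simp_all add: Int_absorb1)

text \<open>A maximal minor with columns \<open>K\<close>. Matrices are plain functions here, so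
  that shifting columns, bordering by a row or changing one column needs no bookkeeping of
  dimensions.\<close>

definition mnr :: "(nat => nat => real) => nat => nat set => real" where
 "mnr a k K = det (mat k k (\<lambda>(i, j). a i (pick K j)))"

lemma mnr_cong: "(\<And>i j. i < k ==> j \<in> K ==> a i j = b i j) ==> card K = k ==> mnr a k K = mnr b k K"
 unfolding mnr_def by (intro arg_cong[where f = det] cong_mat) (auto simp: pick_in_set)

lemma mnr_0 [simp]: "mnr a 0 K = 1" by (simp add: mnr_def)

lemma pick_image:
 assumes f: "strict_mono f" and j: "j < card K" shows "pick (f ` K) j = f (pick K j)"
proof (rule pick_eqI)
 show "f (pick K j) \<in> f ` K" using j pick_in_set by blast
 have "f ` K \<inter> {..<f (pick K j)} = f ` (K \<inter> {..<pick K j})" using strict_mono_less[OF f] by auto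
 thus "card (f ` K \<inter> {..<f (pick K j)}) = j"
  using card_lessThan_pick[OF j] card_image[OF strict_mono_imp_inj_on[OF f]] by simp
qed

lemma mnr_image: "strict_mono f ==> card K = k ==> mnr a k (f ` K) = mnr (\<lambda>i j. a i (f j)) k K"
 unfolding mnr_def by (intro arg_cong[where f = det] cong_mat) (auto simp: pick_image)

lemma mnr_Suc_image: "card K = k ==> mnr a k (Suc ` K) = mnr (\<lambda>i j. a i (Suc j)) k K"
 by (rule mnr_image) (simp_all add: strict_mono_def)

lemma cofactor_mnr:
 assumes "finite K" "card K = Suc k" "p < Suc k" "r < Suc k"
 shows "cofactor (mat (Suc k) (Suc k) (\<lambda>(i, j). a i (pick K j))) r p
  = (-1) ^ (r + p) * mnr (\<lambda>i. a (if i < r then i else Suc i)) k (K - {pick K p})"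
proof -
 have "mat_delete (mat (Suc k) (Suc k) (\<lambda>(i, j). a i (pick K j))) r p
  = mat k k (\<lambda>(i, j). a (if i < r then i else Suc i) (pick (K - {pick K p}) j))"
  by (rule eq_matI) (simp_all add: mat_delete_def pick_remove[OF assms(1)] assms)
 thus ?thesis unfolding cofactor_def mnr_def by simp
qed

lemma mnr_column:
 assumes "finite K" "card K = Suc k" "x \<in> K"
 shows "mnr a (Suc k) K = (\<Sum>r<Suc k. a r x * ((-1) ^ (r + card (K \<inter> {..<x})) * mnr (\<lambda>i. a (if i < r then i else Suc i)) k (K - {x})))"
proof -
 let ?p = "card (K \<inter> {..<x})"
 have p: "?p < Suc k" using card_below_less[OF assms(1,3)] assms(2) by simp
 have px: "pick K ?p = x" by (rule pick_eqI[OF assms(3) refl])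
 have "mnr a (Suc k) K = (\<Sum>r<Suc k. mat (Suc k) (Suc k) (\<lambda>(i, j). a i (pick K j)) $$ (r, ?p) * cofactor (mat (Suc k) (Suc k) (\<lambda>(i, j). a i (pick K j))) r ?p)"
  unfolding mnr_def by (rule laplace_expansion_column) (use p in auto)
 also have "\<dots> = (\<Sum>r<Suc k. a r x * ((-1) ^ (r + ?p) * mnr (\<lambda>i. a (if i < r then i else Suc i)) k (K - {x})))"
  by (intro sum.cong refl) (use p in \<open>simp add: cofactor_mnr[OF assms(1,2)] px del: sum.lessThan_Suc\<close>)
 finally show ?thesis .
qed

lemma mnr_unit_column:
 assumes "finite K" "card K = Suc k" "x \<in> K" "r < Suc k" "\<And>i. i < Suc k ==> a i x = (if i = r then 1 else 0)"
 shows "mnr a (Suc k) K = (-1) ^ (r + card (K \<inter> {..<x})) * mnr (\<lambda>i. a (if i < r then i else Suc i)) k (K - {x})"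
proof -
 have "mnr a (Suc k) K = (\<Sum>i<Suc k. if i = r then (-1) ^ (r + card (K \<inter> {..<x})) * mnr (\<lambda>i. a (if i < r then i else Suc i)) k (K - {x}) else 0)"
  unfolding mnr_column[OF assms(1-3)] by (intro sum.cong refl) (simp add: assms(5) del: sum.lessThan_Suc)
 thus ?thesis using assms(4) by (simp del: sum.lessThan_Suc)
qed

lemma mnr_uminus_column:
 assumes "finite K" "card K = k" "x \<in> K"
 shows "mnr (\<lambda>i j. if j = x then - a i j else a i j) k K = - mnr a k K"
proof (cases k)
 case 0 thus ?thesis using assms by auto
next
 case (Suc d)
 have c: "card K = Suc d" using assms Suc by simp
 have "mnr (\<lambda>i j. if j = x then - a (if i < r then i else Suc i) j else a (if i < r then i else Suc i) j) d (K - {x})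
  = mnr (\<lambda>i. a (if i < r then i else Suc i)) d (K - {x})" for r
  by (rule mnr_cong) (use c assms in auto)
 thus ?thesis
  unfolding Suc mnr_column[OF assms(1) c assms(3)] by (simp add: sum_negf[symmetric] del: sum.lessThan_Suc)
qed

text \<open>Laplace expansion along the top row \<open>w\<close>. The coefficients form a covector
  attached to \<open>K\<close>, named \<open>cov\<close> later, on which the sign arguments for the
  affine space rest.\<close>

lemma mnr_border:
 assumes "finite K" "card K = Suc k"
 shows "mnr (\<lambda>i j. case i of 0 => w j | Suc i => a i j) (Suc k) K
  = (\<Sum>x\<in>K. (-1) ^ card (K \<inter> {..<x}) * mnr a k (K - {x}) * w x)"
proof -
 let ?b = "\<lambda>i j. case i of 0 => w j | Suc i => a i j"
 have "mnr ?b (Suc k) K = (\<Sum>p<Suc k. mat (Suc k) (Suc k) (\<lambda>(i, j). ?b i (pick K j)) $$ (0, p) * cofactor (mat (Suc k) (Suc k) (\<lambda>(i, j). ?b i (pick K j))) 0 p)"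
  unfolding mnr_def by (rule laplace_expansion_row) auto
 also have "\<dots> = (\<Sum>p<card K. (-1) ^ card (K \<inter> {..<pick K p}) * mnr a k (K - {pick K p}) * w (pick K p))"
  unfolding assms(2)
  by (intro sum.cong refl) (use cofactor_mnr[OF assms, of _ 0 ?b] in \<open>simp add: card_lessThan_pick assms(2) del: sum.lessThan_Suc\<close>)
 also have "\<dots> = (\<Sum>x\<in>K. (-1) ^ card (K \<inter> {..<x}) * mnr a k (K - {x}) * w x)"
  by (rule sum.reindex_bij_betw[OF bij_betw_pick[OF assms(1)]])
 finally show ?thesis .
qed

text \<open>Bordering by one of the rows repeats that row, so the determinant is 0. These are the
  circuit relations of the row space.\<close>

lemma mnr_border_row:
 assumes "finite K" "card K = Suc k" "r < k"
 shows "(\<Sum>x\<in>K. (-1) ^ card (K \<inter> {..<x}) * mnr a k (K - {x}) * a r x) = 0"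
proof -
 let ?A = "mat (Suc k) (Suc k) (\<lambda>(i, j). (case i of 0 => a r | Suc i => a i) (pick K j))"
 have "det ?A = 0"
  by (rule det_identical_rows[of _ "Suc k" 0 "Suc r"]) (use assms(3) in \<open>auto intro!: eq_vecI\<close>)
 moreover have "mnr (\<lambda>i j. case i of 0 => a r j | Suc i => a i j) (Suc k) K = det ?A"
  unfolding mnr_def by (intro arg_cong[where f = det] cong_mat) (auto split: nat.splits)
 ultimately show ?thesis using mnr_border[OF assms(1,2), of "a r" a] by simp
qed

lemma mnr_basis_change:
 assumes T: "T \<in> carrier_mat k k"
 shows "mnr (\<lambda>i j. \<Sum>l<k. T $$ (i, l) * a l j) k K = det T * mnr a k K"
proof -
 have "mat k k (\<lambda>(i, j). \<Sum>l<k. T $$ (i, l) * a l (pick K j)) = T * mat k k (\<lambda>(i, j). a i (pick K j))"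
  by (rule eq_matI) (use T in \<open>auto simp: scalar_prod_def lessThan_atLeast0\<close>)
 thus ?thesis unfolding mnr_def using det_mult[OF T, of "mat k k (\<lambda>(i, j). a i (pick K j))"] by simp
qed

section \<open>Row spaces\<close>

definition lin :: "nat => (nat => nat => real) => (nat => real) => nat => real" where
 "lin k a y j = (\<Sum>i<k. y i * a i j)"

definition rsp :: "nat => nat => (nat => nat => real) => real vec set" where
 "rsp n k a = {vec n (lin k a y) | y. True}"

lemma row_space_rsp:
 assumes M: "M \<in> carrier_mat k n" shows "vec_space.row_space n M = rsp n k (\<lambda>i j. M $$ (i, j))"
proof -
 interpret vec_space "TYPE(real)" n .
 have *: "M\<^sup>T *\<^sub>v y = vec n (lin k (\<lambda>i j. M $$ (i, j)) (\<lambda>i. y $ i))" if "y \<in> carrier_vec k" for y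
  by (rule eq_vecI) (use M that in \<open>auto simp: scalar_prod_def lin_def lessThan_atLeast0 mult.commute\<close>)
 have v: "lin k (\<lambda>i j. M $$ (i, j)) (\<lambda>i. vec k y $ i) = lin k (\<lambda>i j. M $$ (i, j)) y" for y
  by (auto simp: lin_def)
 have "vec n (lin k (\<lambda>i j. M $$ (i, j)) y) \<in> row_space M" for y
  unfolding row_space_eq[OF M] using M *[of "vec k y"] v[of y] by (intro CollectI conjI bexI[of _ "vec k y"]) auto
 moreover have "row_space M \<subseteq> rsp n k (\<lambda>i j. M $$ (i, j))"
  unfolding row_space_eq[OF M] rsp_def using M * by auto
 ultimately show ?thesis unfolding rsp_def by blast
qed

lemma submatrix_mnr:
 assumes "M \<in> carrier_mat k n" "K \<subseteq> {..<n}" "card K = k"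
 shows "det (submatrix M UNIV K) = mnr (\<lambda>i j. M $$ (i, j)) k K"
proof -
 have "{j. j < n \<and> j \<in> K} = K" using assms(2) by auto
 thus ?thesis using assms unfolding submatrix_def mnr_def by (simp add: pick_UNIV)
qed

lemma subspace_dim_le:
 assumes "subspace_dim n k W" shows "k \<le> n"
proof -
 interpret vec_space "TYPE(real)" n .
 show ?thesis using assms subspace_dim[of W] fin_dim dim_is_n unfolding subspace_dim_def by auto
qed

lemma subspace_dim_rsp:
 assumes K: "K \<subseteq> {..<n}" "card K = k" and nz: "mnr a k K \<noteq> 0"
 shows "subspace_dim n k (rsp n k a)"
proof -
 interpret vec_space "TYPE(real)" n .
 define M where "M = mat k n (\<lambda>(i, j). a i j)"
 have M: "M \<in> carrier_mat k n" and Mt: "M\<^sup>T \<in> carrier_mat n k" by (simp_all add: M_def)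
 have "mnr (\<lambda>i j. M $$ (i, j)) k K = mnr a k K" by (rule mnr_cong) (use K in \<open>auto simp: M_def\<close>)
 hence nzM: "det (submatrix M UNIV K) \<noteq> 0" using submatrix_mnr[OF M K] nz by simp
 have Keq: "{j. j < n \<and> j \<in> K} = K" using K by auto
 have sq: "submatrix M UNIV K \<in> carrier_mat k k" by (rule carrier_matI) (use K(2) Keq M in \<open>simp_all add: dim_submatrix\<close>)
 have "submatrix (M\<^sup>T) K UNIV = (submatrix M UNIV K)\<^sup>T"
 proof (rule eq_matI)
  fix i j assume "i < dim_row (submatrix M UNIV K)\<^sup>T" "j < dim_col (submatrix M UNIV K)\<^sup>T"
  hence ij: "i < k" "j < k" using sq by auto
  have "pick K i \<in> K" using ij K(2) pick_in_set by blast
  hence "pick K i < n" using K(1) by auto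
  thus "submatrix M\<^sup>T K UNIV $$ (i, j) = (submatrix M UNIV K)\<^sup>T $$ (i, j)"
   using M K Keq ij unfolding submatrix_def by (simp add: pick_UNIV)
 qed (use M K Keq in \<open>simp_all add: dim_submatrix\<close>)
 hence "det (submatrix (M\<^sup>T) K UNIV) \<noteq> 0" using det_transpose[OF sq] nzM by simp
 hence "k = rank (M\<^sup>T)" using rank_gt_minor[OF Mt] rank_le_nc[OF Mt] by fastforce
 moreover have "rsp n k a = rsp n k (\<lambda>i j. M $$ (i, j))"
 proof -
  have "vec n (lin k a y) = vec n (lin k (\<lambda>i j. M $$ (i, j)) y)" for y
   by (rule eq_vecI) (auto simp: lin_def M_def)
  thus ?thesis unfolding rsp_def by simp
 qed
 moreover have "set (rows M) \<subseteq> carrier_vec n" using M by (auto simp: rows_def)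
 ultimately show ?thesis
  unfolding subspace_dim_def row_space_rsp[OF M, symmetric] row_space_eq_col_space_transpose col_space_def
  using fin_dim_span_cols[OF Mt] span_is_subspace[of "set (cols M\<^sup>T)"] Mt
  by (simp add: rank_def)
qed

definition tpos :: "nat => nat => (nat => nat => real) => bool" where
 "tpos n k a \<longleftrightarrow> (\<forall>K. K \<subseteq> {..<n} \<and> card K = k \<longrightarrow> 0 < mnr a k K)"

lemma tposD: "tpos n k a ==> K \<subseteq> {..<n} ==> card K = k ==> 0 < mnr a k K"
 by (simp add: tpos_def)

lemma subspace_dim_tpos: "tpos n k a ==> k \<le> n ==> subspace_dim n k (rsp n k a)"
 using subspace_dim_rsp[of "{..<k}" n k a] tposD[of n k a "{..<k}"] by auto

lemma Gr_posI:
 assumes a: "tpos n k a" "k \<le> n" shows "rsp n k a \<in> Gr_pos k n"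
proof -
 define M where "M = mat k n (\<lambda>(i, j). a i j)"
 have M: "M \<in> carrier_mat k n" by (simp add: M_def)
 have "vec n (lin k a y) = vec n (lin k (\<lambda>i j. M $$ (i, j)) y)" for y
  by (rule eq_vecI) (auto simp: lin_def M_def)
 hence "vec_space.row_space n M = rsp n k a" unfolding row_space_rsp[OF M] rsp_def by simp
 moreover have "det (submatrix M UNIV K) > 0" if "K \<subseteq> {..<n}" "card K = k" for K
 proof -
  have "mnr (\<lambda>i j. M $$ (i, j)) k K = mnr a k K" by (rule mnr_cong) (use that in \<open>auto simp: M_def\<close>)
  thus ?thesis unfolding submatrix_mnr[OF M that] using tposD[OF a(1) that] by simp
 qed
 ultimately show ?thesis unfolding Gr_pos_def using M subspace_dim_tpos[OF a] by blast
qed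

text \<open>Negating one row reverses the sign of all maximal minors, so they may be taken positive.
  For k = 0 there is no row to negate, but the only minor is 1.\<close>

lemma Gr_posE:
 assumes "W \<in> Gr_pos k n"
 obtains a where "k \<le> n" "W = rsp n k a" "tpos n k a"
proof -
 from assms obtain M where M: "M \<in> carrier_mat k n" "vec_space.row_space n M = W" "k \<le> n" and
  s: "(\<forall>I. I \<subseteq> {..<n} \<and> card I = k \<longrightarrow> det (submatrix M UNIV I) > 0) \<or>
     (\<forall>I. I \<subseteq> {..<n} \<and> card I = k \<longrightarrow> det (submatrix M UNIV I) < 0)"
  unfolding Gr_pos_def using subspace_dim_le by blast
 define a where "a = (\<lambda>i j. M $$ (i, j))"
 have W: "W = rsp n k a" using M(2) row_space_rsp[OF M(1)] by (simp add: a_def)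
 have s: "tpos n k a \<or> (\<forall>I. I \<subseteq> {..<n} \<and> card I = k \<longrightarrow> mnr a k I < 0)"
  using s submatrix_mnr[OF M(1)] unfolding tpos_def a_def by fastforce
 show thesis
 proof (cases "tpos n k a")
  case True
  thus thesis using that M(3) W by blast
 next
  case False
  hence neg: "mnr a k I < 0" if "I \<subseteq> {..<n}" "card I = k" for I using s that by blast
  have "k \<noteq> 0" using neg[of "{}"] by (cases k) auto
  then obtain d where k: "k = Suc d" by (cases k) auto
  let ?b = "\<lambda>i j. case i of 0 => - a 0 j | Suc i => a (Suc i) j"
  have "lin k ?b y = lin k a (\<lambda>i. case i of 0 => - y 0 | Suc i => y (Suc i))"
   "lin k a y = lin k ?b (\<lambda>i. case i of 0 => - y 0 | Suc i => y (Suc i))" for y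
   unfolding lin_def by (intro ext sum.cong refl; simp split: nat.split)+
  hence "rsp n k ?b = rsp n k a" unfolding rsp_def by (auto, metis)
  moreover have "mnr ?b k K = - mnr a k K" if K: "K \<subseteq> {..<n}" "card K = k" for K
  proof -
   have fin: "finite K" using K(1) finite_subset by blast
   have "a = (\<lambda>i j. case i of 0 => a 0 j | Suc i => a (Suc i) j)" by (intro ext) (simp split: nat.split)
   hence "mnr a k K = mnr (\<lambda>i j. case i of 0 => a 0 j | Suc i => a (Suc i) j) k K" by (rule arg_cong)
   thus ?thesis using K(2) unfolding k by (simp add: mnr_border[OF fin] sum_negf)
  qed
  hence "tpos n k ?b" using neg unfolding tpos_def by simp
  ultimately show thesis using that M(3) W by blast
 qed
qed

text \<open>Multiplying by the inverse of the block on the columns \<open>K\<close> turns this block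
  into the identity, keeps the row space and divides all maximal minors by the same number.\<close>

lemma normal_form:
 assumes K: "finite K" "card K = k" and nz: "mnr a k K \<noteq> 0"
 obtains b where "\<And>n. rsp n k b = rsp n k a" "\<And>i x. i < k ==> x \<in> K ==> b i x = (if i = card (K \<inter> {..<x}) then 1 else 0)"
  "\<And>I. mnr b k I = mnr a k I / mnr a k K"
proof -
 define S where "S = mat k k (\<lambda>(i, j). a i (pick K j))"
 have S: "S \<in> carrier_mat k k" by (simp add: S_def)
 have "det S \<noteq> 0" using nz by (simp add: S_def mnr_def)
 then obtain T where T: "T \<in> carrier_mat k k" "T * S = 1\<^sub>m k" "S * T = 1\<^sub>m k"
  using det_non_zero_imp_unit[OF S, of undefined] unfolding Units_def by (auto simp: ring_mat_def)
 have ST: "(\<Sum>l<k. S $$ (i, l) * T $$ (l, j)) = (if i = j then 1 else 0)"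
  "(\<Sum>l<k. T $$ (i, l) * S $$ (l, j)) = (if i = j then 1 else 0)" if "i < k" "j < k" for i j
 proof -
  have "(S * T) $$ (i, j) = (\<Sum>l<k. S $$ (i, l) * T $$ (l, j))" "(T * S) $$ (i, j) = (\<Sum>l<k. T $$ (i, l) * S $$ (l, j))"
   using that S T(1) by (simp_all add: scalar_prod_def lessThan_atLeast0)
  thus "(\<Sum>l<k. S $$ (i, l) * T $$ (l, j)) = (if i = j then 1 else 0)"
   "(\<Sum>l<k. T $$ (i, l) * S $$ (l, j)) = (if i = j then 1 else 0)" using T(2,3) that by simp_all
 qed
 define b where "b = (\<lambda>i j. \<Sum>l<k. T $$ (i, l) * a l j)"
 have lb: "lin k b y = lin k a (\<lambda>l. \<Sum>i<k. y i * T $$ (i, l))" for y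
  unfolding lin_def b_def sum_distrib_left sum_distrib_right
  by (intro ext, subst sum.swap) (simp add: mult.assoc)
 have la: "lin k a y = lin k b (\<lambda>i. \<Sum>j<k. y j * S $$ (j, i))" for y
 proof -
  have "lin k a (\<lambda>l. \<Sum>i<k. (\<Sum>j<k. y j * S $$ (j, i)) * T $$ (i, l)) = lin k a y"
  proof -
   have "(\<Sum>i<k. (\<Sum>j<k. y j * S $$ (j, i)) * T $$ (i, l)) = y l" if l: "l < k" for l
   proof -
    have "(\<Sum>i<k. (\<Sum>j<k. y j * S $$ (j, i)) * T $$ (i, l)) = (\<Sum>j<k. y j * (\<Sum>i<k. S $$ (j, i) * T $$ (i, l)))"
     unfolding sum_distrib_left sum_distrib_right by (subst sum.swap) (simp add: mult.assoc)
    also have "\<dots> = (\<Sum>j<k. if j = l then y j else 0)" by (intro sum.cong refl) (use l ST(1) in simp)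
    finally show ?thesis using l by simp
   qed
   thus ?thesis unfolding lin_def by (intro ext sum.cong refl) simp
  qed
  thus ?thesis unfolding lb by simp
 qed
 show thesis
 proof (rule that[of b])
  show "rsp n k b = rsp n k a" for n
  proof
   show "rsp n k b \<subseteq> rsp n k a" unfolding rsp_def using lb by fastforce
   show "rsp n k a \<subseteq> rsp n k b" unfolding rsp_def using la by fastforce
  qed
  show "b i x = (if i = card (K \<inter> {..<x}) then 1 else 0)" if "i < k" "x \<in> K" for i x
  proof -
   have "card (K \<inter> {..<x}) < k" using card_below_less[OF K(1) that(2)] K(2) by simp
   thus ?thesis using ST(2)[OF that(1), of "card (K \<inter> {..<x})"] pick_eqI[OF that(2) refl] by (simp add: b_def S_def)
  qed
  have "mnr b k K = det (T * S)"
   unfolding b_def mnr_basis_change[OF T(1)] using det_mult[OF T(1) S] by (simp add: S_def mnr_def)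
  hence "det T * mnr a k K = 1" unfolding b_def mnr_basis_change[OF T(1)] T(2) by simp
  thus "mnr b k I = mnr a k I / mnr a k K" for I
   unfolding b_def mnr_basis_change[OF T(1)] using nz by (simp add: field_simps)
 qed
qed

text \<open>Once the columns \<open>K\<close> are normalised to the identity, the coefficients of
  the required combination are the prescribed values themselves.\<close>

lemma interpolation:
 assumes K: "finite K" "card K = k" "K \<subseteq> {..<n}" and nz: "mnr a k K \<noteq> 0"
 obtains v where "v \<in> rsp n k a" "\<And>x. x \<in> K ==> v $ x = t x"
proof -
 obtain b where b: "\<And>n. rsp n k b = rsp n k a" "\<And>i x. i < k ==> x \<in> K ==> b i x = (if i = card (K \<inter> {..<x}) then 1 else 0)"
  using normal_form[OF K(1,2) nz] by metis
 show thesis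
 proof (rule that)
  show "vec n (lin k b (\<lambda>i. t (pick K i))) \<in> rsp n k a" by (subst b(1)[symmetric]) (auto simp: rsp_def)
  fix x assume x: "x \<in> K"
  have "card (K \<inter> {..<x}) < k" using card_below_less[OF K(1) x] K(2) by simp
  moreover have "(\<Sum>i<k. t (pick K i) * b i x) = (\<Sum>i<k. if i = card (K \<inter> {..<x}) then t x else 0)"
   by (intro sum.cong refl) (auto simp: b(2)[OF _ x] pick_eqI[OF x refl])
  ultimately have "(\<Sum>i<k. t (pick K i) * b i x) = t x" by simp
  thus "vec n (lin k b (\<lambda>i. t (pick K i))) $ x = t x" using x K(3) by (auto simp: lin_def)
 qed
qed

lemma rsp_relation:
 assumes v: "v \<in> rsp n k a" and K: "K \<subseteq> {..<n}" "card K = Suc k"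
 shows "(\<Sum>x\<in>K. (-1) ^ card (K \<inter> {..<x}) * mnr a k (K - {x}) * v $ x) = 0"
proof -
 have fin: "finite K" using K(1) finite_subset by blast
 obtain y where y: "v = vec n (lin k a y)" using v unfolding rsp_def by blast
 have "(\<Sum>x\<in>K. (-1) ^ card (K \<inter> {..<x}) * mnr a k (K - {x}) * v $ x)
  = (\<Sum>x\<in>K. \<Sum>i<k. y i * ((-1) ^ card (K \<inter> {..<x}) * mnr a k (K - {x}) * a i x))"
  using K(1) by (intro sum.cong refl) (auto simp: y lin_def sum_distrib_left mult_ac)
 also have "\<dots> = (\<Sum>i<k. y i * (\<Sum>x\<in>K. (-1) ^ card (K \<inter> {..<x}) * mnr a k (K - {x}) * a i x))"
  by (subst sum.swap) (simp add: sum_distrib_left)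
 also have "\<dots> = 0" by (simp add: mnr_border_row[OF fin K(2)])
 finally show ?thesis .
qed

section \<open>Sign patterns of totally positive subspaces\<close>

abbreviation sg :: "nat => real" where "sg c \<equiv> (-1) ^ c"

lemma sg_nonneg: "0 \<le> sg c * x \<longleftrightarrow> (if even c then 0 \<le> x else x \<le> 0)"
 by (simp add: uminus_power_if)

lemma sg_sg [simp]: "sg c * (sg c * x) = x"
 by (simp add: mult.assoc[symmetric] power_add[symmetric] mult_2[symmetric])

lemma sum_single:
 assumes "finite K" "j \<in> K" "\<And>x. x \<in> K ==> x \<noteq> j ==> f x = (0::real)" shows "sum f K = f j"
 using sum.remove[OF assms(1,2), of f] sum.neutral[of "K - {j}" f] assms(3) by simp

lemma sprod: "v \<in> carrier_vec n ==> p \<bullet> v = (\<Sum>i<n. p $ i * v $ i)"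
 by (simp add: scalar_prod_def lessThan_atLeast0)

lemma rsp_carrier: "v \<in> rsp n k a ==> v \<in> carrier_vec n"
 by (auto simp: rsp_def)

lemma lin_add: "lin k a (\<lambda>i. y i + z i) j = lin k a y j + lin k a z j"
 by (simp add: lin_def distrib_right sum.distrib)

lemma lin_smult: "lin k a (\<lambda>i. c * y i) j = c * lin k a y j"
 by (simp add: lin_def sum_distrib_left mult.assoc)

lemma rsp_add: "u \<in> rsp n k a ==> v \<in> rsp n k a ==> u + v \<in> rsp n k a"
proof -
 assume "u \<in> rsp n k a" "v \<in> rsp n k a"
 then obtain y z where "u = vec n (lin k a y)" "v = vec n (lin k a z)" unfolding rsp_def by blast
 hence "u + v = vec n (lin k a (\<lambda>i. y i + z i))" by (intro eq_vecI) (simp_all add: lin_add)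
 thus ?thesis unfolding rsp_def by blast
qed

lemma rsp_smult: "u \<in> rsp n k a ==> c \<cdot>\<^sub>v u \<in> rsp n k a"
proof -
 assume "u \<in> rsp n k a"
 then obtain y where "u = vec n (lin k a y)" unfolding rsp_def by blast
 hence "c \<cdot>\<^sub>v u = vec n (lin k a (\<lambda>i. c * y i))" by (intro eq_vecI) (simp_all add: lin_smult)
 thus ?thesis unfolding rsp_def by blast
qed

lemma initial_segment:
 assumes X: "finite (X :: nat set)" "d \<le> card X"
 obtains P where "P \<subseteq> X" "card P = d" "\<And>x. x \<in> P ==> P \<inter> {..<x} = X \<inter> {..<x}"
proof (rule that)
 let ?P = "{x \<in> X. card (X \<inter> {..<x}) < d}"
 have "?P = pick X ` {..<d}"
 proof (intro equalityI subsetI)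
  fix x assume "x \<in> ?P"
  thus "x \<in> pick X ` {..<d}" using pick_eqI[of x X] by (intro image_eqI[of _ _ "card (X \<inter> {..<x})"]) auto
 next
  fix x assume "x \<in> pick X ` {..<d}"
  then obtain j where "x = pick X j" "j < d" by auto
  thus "x \<in> ?P" using card_lessThan_pick[of j X] pick_in_set[of j X] X(2) by simp
 qed
 moreover have "inj_on (pick X) {..<d}"
  using inj_on_subset[OF bij_betw_imp_inj_on[OF bij_betw_pick[OF X(1)]]] X(2) by simp
 ultimately show "card ?P = d" by (simp add: card_image)
 have mono: "card (X \<inter> {..<y}) \<le> card (X \<inter> {..<x})" if "y < x" for x y
  by (rule card_mono) (use X(1) that in auto)
 show "?P \<inter> {..<x} = X \<inter> {..<x}" if "x \<in> ?P" for x
 proof -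
  have "card (X \<inter> {..<y}) < d" if "y < x" for y using mono[OF that] \<open>x \<in> ?P\<close> by simp
  thus ?thesis by auto
 qed
qed auto

text \<open>\<open>X\<close> is the set of sign changes of a sign vector, and \<open>I\<close> will
  be the zero set of a vector whose sign at j is (-1) to the number of elements of \<open>I\<close>
  below j; the last clause says that the two patterns agree. Take \<open>X\<close> below a threshold
  m and all positions from m on. As m grows, the size falls from n to \<open>card X\<close> in steps
  of at most 1, so it takes the value d.\<close>

lemma complementary_set:
 assumes X: "X \<subseteq> {..<n}" "card X \<le> d" "d \<le> n"
 obtains I where "I \<subseteq> {..<n}" "card I = d" "\<And>j. j < n ==> j \<notin> I ==> card (X \<inter> {..j}) = card (I \<inter> {..<j})"
proof -
 define I where "I m = (X \<inter> {..<m}) \<union> {m..<n}" for m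
 have fX: "finite X" using X(1) finite_subset by blast
 have c: "card (I m) = card (X \<inter> {..<m}) + (n - m)" for m
  unfolding I_def by (subst card_Un_disjoint) (use fX in auto)
 have "X \<inter> {..<n} = X" using X(1) by blast
 hence n: "card (I n) \<le> d" using X(2) by (simp add: c)
 define m where "m = (LEAST m. card (I m) \<le> d)"
 have m: "card (I m) \<le> d" "\<And>m'. m' < m ==> d < card (I m')"
  unfolding m_def using LeastI[of "\<lambda>m. card (I m) \<le> d", OF n] not_less_Least by (auto simp: not_le[symmetric])
 have mn: "m \<le> n" unfolding m_def by (rule Least_le) (rule n)
 have "card (I m) = d"
 proof (cases m)
  case 0
  thus ?thesis using m(1) X(3) by (simp add: c)
 next
  case (Suc m')
  have "card (X \<inter> {..<m'}) \<le> card (X \<inter> {..<m})" by (rule card_mono) (use fX Suc in auto)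
  hence "card (I m') \<le> Suc (card (I m))" unfolding c using Suc by simp
  thus ?thesis using m(1) m(2)[of m'] Suc by simp
 qed
 moreover have "X \<inter> {..j} = I m \<inter> {..<j}" if j: "j < n" "j \<notin> I m" for j
 proof -
  have "j < m" "j \<notin> X" using j unfolding I_def by auto
  thus ?thesis unfolding I_def by (auto simp: le_less)
 qed
 moreover have "I m \<subseteq> {..<n}" unfolding I_def using X(1) by auto
 ultimately show thesis using that by metis
qed

text \<open>The circuit relation on the zeros, column 0 and one further column has only two nonzero
  terms. Positivity of the minors fixes the sign of the further coordinate relative to the
  first.\<close>

lemma graph_vector:
 assumes C: "tpos (Suc n) k C" and I: "I \<subseteq> {..<n}" "Suc (card I) = k"
 obtains u where "u \<in> rsp (Suc n) k C" "u $ 0 = 1" "\<And>i. i \<in> I ==> u $ Suc i = 0"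
  "\<And>j. j < n ==> j \<notin> I ==> 0 < sg (card (I \<inter> {..<j})) * u $ Suc j"
proof -
 let ?K = "insert 0 (Suc ` I)"
 have fI: "finite I" using I(1) finite_subset by blast
 have K: "finite ?K" "card ?K = k" "?K \<subseteq> {..<Suc n}" using I fI by (auto simp: card_image)
 have "mnr C k ?K \<noteq> 0" using tposD[OF C K(3,2)] by simp
 from interpolation[OF K this, of "\<lambda>x. if x = 0 then 1 else 0"] obtain u where
  u: "u \<in> rsp (Suc n) k C" "\<And>x. x \<in> ?K ==> u $ x = (if x = 0 then 1 else 0)" by metis
 show thesis
 proof (rule that[OF u(1)])
  show "u $ 0 = 1" "i \<in> I ==> u $ Suc i = 0" for i using u(2) by auto
  fix j assume j: "j < n" "j \<notin> I"
  let ?L = "insert (Suc j) ?K"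
  have L: "?L \<subseteq> {..<Suc n}" "card ?L = Suc k" "finite ?L" using K j by (auto simp: card_insert_if)
  have pos: "0 < mnr C k (?L - {x})" if "x \<in> ?L" for x
   by (rule tposD[OF C]) (use L that in \<open>auto simp: card_Diff_singleton\<close>)
  have "(\<Sum>x\<in>?L. sg (card (?L \<inter> {..<x})) * mnr C k (?L - {x}) * u $ x)
   = (\<Sum>x\<in>{0, Suc j}. sg (card (?L \<inter> {..<x})) * mnr C k (?L - {x}) * u $ x)"
   by (rule sum.mono_neutral_right) (use L u(2) in auto)
  moreover have "?L \<inter> {..<Suc j} = insert 0 (Suc ` (I \<inter> {..<j}))" by auto
  hence "card (?L \<inter> {..<Suc j}) = Suc (card (I \<inter> {..<j}))" using fI by (simp add: card_image)
  ultimately have "mnr C k (?L - {0}) - mnr C k (?L - {Suc j}) * (sg (card (I \<inter> {..<j})) * u $ Suc j) = 0"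
   using rsp_relation[OF u(1) L(1,2)] u(2)[of 0] by (simp add: mult_ac)
  hence "0 < mnr C k (?L - {Suc j}) * (sg (card (I \<inter> {..<j})) * u $ Suc j)" using pos[of 0] by simp
  thus "0 < sg (card (I \<inter> {..<j})) * u $ Suc j" using pos[of "Suc j"] by (simp add: zero_less_mult_iff)
 qed
qed

text \<open>A vector orthogonal to a totally positive space of dimension \<open>k\<close> changes sign at least
 \<open>k\<close> times.\<close>

lemma orthogonal_alternates:
 assumes B: "tpos n k B" "Suc k \<le> n" and p: "p \<in> carrier_vec n" "\<And>v. v \<in> rsp n k B ==> p \<bullet> v = 0" "0 \<le> p $ 0"
 obtains K where "K \<subseteq> {..<n}" "card K = Suc k"
  "\<And>\<mu>. (\<And>x. x \<in> K ==> 0 < \<mu> x) ==> 0 \<le> (\<Sum>x\<in>K. sg (card (K \<inter> {..<x})) * \<mu> x * p $ x)"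
  "\<And>\<mu>. (\<And>x. x \<in> K ==> 0 < \<mu> x) ==> 0 < p $ 0 ==> 0 < (\<Sum>x\<in>K. sg (card (K \<inter> {..<x})) * \<mu> x * p $ x)"
proof -
 \<comment> \<open>\<open>s\<close> is the running sign of \<open>p\<close>: a zero coordinate
   inherits the sign of its predecessor, and the start counts as positive. \<open>X\<close> collects
   the places where it changes.\<close>
 define s where "s = rec_nat True (\<lambda>j b. if p $ Suc j = 0 then b else 0 < p $ Suc j)"
 have s0: "s 0" and sS: "s (Suc j) = (if p $ Suc j = 0 then s j else 0 < p $ Suc j)" for j by (simp_all add: s_def)
 define X where "X = Suc ` {j. Suc j < n \<and> s (Suc j) \<noteq> s j}"
 have X: "X \<subseteq> {..<n}" "0 \<notin> X" "finite X" unfolding X_def by (auto intro: finite_subset[of _ "{..<n}"])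
 have atS: "X \<inter> {..Suc j} = (if Suc j \<in> X then insert (Suc j) (X \<inter> {..j}) else X \<inter> {..j})" for j
  by (auto simp: le_Suc_eq)
 have se: "s j \<longleftrightarrow> even (card (X \<inter> {..j}))" if "j < n" for j using that
 proof (induction j)
  case 0
  have "X \<inter> {..0} = {}" using X(2) by auto
  thus ?case using s0 by simp
 next
  case (Suc j)
  have "Suc j \<in> X \<longleftrightarrow> s (Suc j) \<noteq> s j" unfolding X_def using Suc.prems by auto
  thus ?case unfolding atS using Suc X(3) by (auto simp: card_insert_if)
 qed
 have sp: "0 \<le> sg (card (X \<inter> {..j})) * p $ j" if "j < n" for j
  unfolding sg_nonneg using se[OF that] sS p(3) s0 by (cases j) (auto split: if_splits)
 have sX: "0 < sg (card (X \<inter> {..j})) * p $ j" if jX: "j \<in> X" for j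
 proof -
  obtain i where i: "j = Suc i" "s (Suc i) \<noteq> s i" "Suc i < n" using jX unfolding X_def by blast
  hence "p $ j \<noteq> 0" using sS[of i] by metis
  thus ?thesis using sp[of j] i by (simp add: less_le)
 qed
 show thesis
 proof (cases "k \<le> card X")
  \<comment> \<open>With at least k changes, 0 and the first k of them are k + 1 places where the
    signs of \<open>p\<close> alternate as required; only at 0 may the coordinate vanish.\<close>
  case True
  from initial_segment[OF X(3) True] obtain P where P: "P \<subseteq> X" "card P = k" "\<And>x. x \<in> P ==> P \<inter> {..<x} = X \<inter> {..<x}" by blast
  have fP: "finite P" "0 \<notin> P" using P(1) X finite_subset by blast+
  let ?K = "insert 0 P"
  have c: "card (?K \<inter> {..<x}) = card (X \<inter> {..x})" if "x \<in> P" for x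
  proof -
   have x: "x \<in> X" "0 < x" using that P(1) X(2) by (auto intro: gr0I)
   have "?K \<inter> {..<x} = insert 0 (P \<inter> {..<x})" using x(2) by auto
   moreover have "X \<inter> {..x} = insert x (X \<inter> {..<x})" using x(1) by (auto simp: le_less)
   ultimately show ?thesis using X P(3)[OF that] by simp
  qed
  have t: "0 < sg (card (?K \<inter> {..<x})) * \<mu> x * p $ x" if "0 < \<mu> x" "x \<in> P" for \<mu> x
   using mult_pos_pos[OF that(1) sX[of x]] that P(1) c by (auto simp: mult_ac)
  have eq: "(\<Sum>x\<in>?K. sg (card (?K \<inter> {..<x})) * \<mu> x * p $ x) = \<mu> 0 * p $ 0 + (\<Sum>x\<in>P. sg (card (?K \<inter> {..<x})) * \<mu> x * p $ x)" for \<mu>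
   using fP by simp
  have nn: "0 \<le> (\<Sum>x\<in>P. sg (card (?K \<inter> {..<x})) * \<mu> x * p $ x)" if "\<And>x. x \<in> P ==> 0 < \<mu> x" for \<mu>
   by (rule sum_nonneg) (rule less_imp_le[OF t[OF that]])
  show thesis
  proof (rule that[of ?K])
   show "?K \<subseteq> {..<n}" "card ?K = Suc k" using P X fP B(2) by auto
   fix \<mu> :: "nat => real" assume m: "\<And>x. x \<in> ?K ==> 0 < \<mu> x"
   have m0: "0 < \<mu> 0" "0 \<le> \<mu> 0 * p $ 0" using m[of 0] p(3) by auto
   have "0 \<le> (\<Sum>x\<in>P. sg (card (?K \<inter> {..<x})) * \<mu> x * p $ x)" by (rule nn) (simp add: m)
   thus "0 \<le> (\<Sum>x\<in>?K. sg (card (?K \<inter> {..<x})) * \<mu> x * p $ x)"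
    "0 < p $ 0 ==> 0 < (\<Sum>x\<in>?K. sg (card (?K \<inter> {..<x})) * \<mu> x * p $ x)"
    unfolding eq using m0 mult_pos_pos[of "\<mu> 0" "p $ 0"] by linarith+
  qed
 next
  case False
  \<comment> \<open>With fewer than k changes some \<open>u\<close> in the space has signs
    compatible with those of \<open>p\<close>, so orthogonality makes \<open>p\<close> vanish
    outside the zeros of \<open>u\<close>. These are k - 1 in number, so some \<open>v\<close> in
    the space agrees with \<open>p\<close> on them, and p \<bullet> v = 0 gives p = 0.\<close>
  obtain d where k1: "k = Suc d" using False by (cases k) simp_all
  hence k: "k = Suc d" "card X \<le> d" using False by simp_all
  obtain N where N: "n = Suc N" using B(2) by (cases n) auto
  let ?X = "{j. Suc j \<in> X}"
  have XS: "X \<inter> {..Suc j} = Suc ` (?X \<inter> {..j})" for j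
  proof -
   have "x \<in> Suc ` (?X \<inter> {..j})" if "x \<in> X" "x \<le> Suc j" for x using that X(2) by (cases x) auto
   hence "X \<inter> {..Suc j} \<subseteq> Suc ` (?X \<inter> {..j})" by blast
   moreover have "Suc ` (?X \<inter> {..j}) \<subseteq> X \<inter> {..Suc j}" by auto
   ultimately show ?thesis by (rule equalityI)
  qed
  have "X = Suc ` ?X" unfolding X_def by auto
  hence "card ?X \<le> d" "?X \<subseteq> {..<N}" using k(2) X(1) card_image[of Suc ?X] by (auto simp: N)
  then obtain I where I: "I \<subseteq> {..<N}" "card I = d" "\<And>j. j < N ==> j \<notin> I ==> card (?X \<inter> {..j}) = card (I \<inter> {..<j})"
   using complementary_set[of ?X N d] B(2) k(1) N by (metis Suc_leD Suc_le_mono)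
  obtain u where u: "u \<in> rsp n k B" "u $ 0 = 1" "\<And>i. i \<in> I ==> u $ Suc i = 0"
   "\<And>j. j < N ==> j \<notin> I ==> 0 < sg (card (I \<inter> {..<j})) * u $ Suc j"
   using graph_vector[of N k B I] B(1) I(1,2) k(1) N by metis
  have cX: "card (X \<inter> {..Suc j}) = card (I \<inter> {..<j})" if "j < N" "j \<notin> I" for j
   unfolding XS using I(3)[OF that] by (simp add: card_image)
  have sgpq: "0 \<le> a * b" if "0 \<le> sg c * a" "0 \<le> sg c * b" for a b c
   using mult_nonneg_nonneg[OF that] by (simp add: uminus_power_if split: if_splits)
  have nonneg: "0 \<le> p $ x * u $ x" if "x < n" for x
  proof (cases x)
   case (Suc j)
   show ?thesis
   proof (cases "j \<in> I")
    case False
    hence "0 \<le> sg (card (X \<inter> {..x})) * u $ x" using u(4)[of j] cX[of j] Suc that N by simp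
    thus ?thesis using sgpq sp[OF that] by blast
   qed (simp add: Suc u(3))
  qed (simp add: u(2) p(3))
  have "(\<Sum>x<n. p $ x * u $ x) = 0" using p(2)[OF u(1)] sprod[OF rsp_carrier[OF u(1)]] by simp
  hence "\<forall>x\<in>{..<n}. p $ x * u $ x = 0" by (subst (asm) sum_nonneg_eq_0_iff) (use nonneg in auto)
  hence z: "p $ x = 0" if "x < n" "x \<notin> Suc ` I" for x
  proof (cases x)
   case 0
   thus ?thesis using \<open>\<forall>x\<in>{..<n}. p $ x * u $ x = 0\<close> u(2) that by force
  next
   case (Suc j)
   hence "j < N" "j \<notin> I" using that N by auto
   hence "u $ x \<noteq> 0" using u(4)[of j] Suc by auto
   thus ?thesis using \<open>\<forall>x\<in>{..<n}. p $ x * u $ x = 0\<close> that by auto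
  qed
  let ?K = "insert 0 (Suc ` I)"
  have K: "finite ?K" "card ?K = k" "?K \<subseteq> {..<n}"
   using I finite_subset[OF I(1)] k(1) N by (auto simp: card_image)
  have "mnr B k ?K \<noteq> 0" using tposD[OF B(1) K(3,2)] by simp
  from interpolation[OF K this, of "\<lambda>x. p $ x"] obtain v where v: "v \<in> rsp n k B" "\<And>x. x \<in> ?K ==> v $ x = p $ x" by metis
  have "p $ x * v $ x = p $ x * p $ x" if "x < n" for x using z[OF that] v(2)[of x] by (cases "x \<in> Suc ` I") auto
  hence "(\<Sum>x<n. p $ x * v $ x) = (\<Sum>x<n. p $ x * p $ x)" by (intro sum.cong refl) (simp only: lessThan_iff)
  hence "(\<Sum>x<n. p $ x * p $ x) = (\<Sum>x<n. p $ x * v $ x)" by (rule sym)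
  hence "(\<Sum>x<n. p $ x * p $ x) = 0" using p(2)[OF v(1)] sprod[OF rsp_carrier[OF v(1)], of p] by simp
  hence "\<forall>x\<in>{..<n}. p $ x * p $ x = 0" by (subst (asm) sum_nonneg_eq_0_iff) auto
  hence p0: "p $ x = 0" if "x < n" for x using that by simp
  show thesis
   by (rule that[of "{..<Suc k}"]) (use B(2) p0 in auto)
 qed
qed

text \<open>The Gram matrix of the rows is invertible: its kernel consists of combinations of length
  0, and the rows are independent by their leading minor. The normal equations are solved by
  \<open>interpolation\<close> with the Gram matrix in place of the basis.\<close>

lemma orthogonal_projection_exists:
 assumes B: "tpos n k B" "k \<le> n" and w: "w \<in> carrier_vec n"
 obtains v where "v \<in> rsp n k B" "\<And>u. u \<in> rsp n k B ==> (w - v) \<bullet> u = 0"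
proof -
 let ?G = "\<lambda>i j. \<Sum>x<n. B i x * B j x"
 let ?M = "mat k k (\<lambda>(i, j). ?G i j)"
 have lsum: "(\<Sum>j<k. ?G i j * y j) = (\<Sum>x<n. B i x * lin k B y x)" for i y
  unfolding lin_def sum_distrib_left sum_distrib_right by (subst sum.swap) (simp add: mult_ac)
 have "det ?M \<noteq> 0"
 proof
  assume "det ?M = 0"
  then obtain y where y: "y \<in> carrier_vec k" "y \<noteq> 0\<^sub>v k" "?M *\<^sub>v y = 0\<^sub>v k"
   using det_0_iff_vec_prod_zero_field[of ?M k] by auto
  have "(\<Sum>j<k. ?G i j * y $ j) = (?M *\<^sub>v y) $ i" if "i < k" for i
   using that y(1) by (simp add: scalar_prod_def lessThan_atLeast0)
  hence "(\<Sum>x<n. B i x * lin k B (\<lambda>i. y $ i) x) = 0" if "i < k" for i using that y(3) lsum[of i "\<lambda>i. y $ i"] by simp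
  hence "(\<Sum>i<k. y $ i * (\<Sum>x<n. B i x * lin k B (\<lambda>i. y $ i) x)) = 0" by simp
  also have "(\<Sum>i<k. y $ i * (\<Sum>x<n. B i x * lin k B (\<lambda>i. y $ i) x)) = (\<Sum>x<n. lin k B (\<lambda>i. y $ i) x * lin k B (\<lambda>i. y $ i) x)"
  proof -
   have "(\<Sum>i<k. y $ i * (\<Sum>x<n. B i x * lin k B (\<lambda>i. y $ i) x)) = (\<Sum>x<n. \<Sum>i<k. y $ i * B i x * lin k B (\<lambda>i. y $ i) x)"
    unfolding sum_distrib_left by (subst sum.swap) (simp add: mult.assoc)
   thus ?thesis by (simp only: lin_def[of k B "\<lambda>i. y $ i"] sum_distrib_right)
  qed
  finally have "\<forall>x\<in>{..<n}. lin k B (\<lambda>i. y $ i) x * lin k B (\<lambda>i. y $ i) x = 0"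
   by (subst (asm) sum_nonneg_eq_0_iff) auto
  hence l0: "lin k B (\<lambda>i. y $ i) x = 0" if "x < n" for x using that by simp
  let ?A = "mat k k (\<lambda>(i, j). B i j)"
  have "mnr B k {..<k} = det ?A" unfolding mnr_def by (intro arg_cong[where f = det] cong_mat) (auto simp: pick_lessThan)
  hence dA: "det ?A \<noteq> 0" using tposD[OF B(1), of "{..<k}"] B(2) by auto
  have "?A\<^sup>T *\<^sub>v y = 0\<^sub>v k"
   by (rule eq_vecI) (use y(1) l0 B(2) in \<open>auto simp: scalar_prod_def lin_def lessThan_atLeast0 mult.commute\<close>)
  hence "det (?A\<^sup>T) = 0" using det_0_iff_vec_prod_zero_field[of "?A\<^sup>T" k] y by auto
  thus False using dA det_transpose[of ?A k] by simp
 qed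
 have "mnr ?G k {..<k} = det ?M" unfolding mnr_def by (intro arg_cong[where f = det] cong_mat) (auto simp: pick_lessThan)
 hence "mnr ?G k {..<k} \<noteq> 0" using \<open>det ?M \<noteq> 0\<close> by simp
 from interpolation[of "{..<k}" k k ?G "\<lambda>i. \<Sum>x<n. B i x * w $ x", OF _ _ _ this]
 obtain g where g: "g \<in> rsp k k ?G" "\<And>i. i < k ==> g $ i = (\<Sum>x<n. B i x * w $ x)" by auto
 then obtain y where y: "g = vec k (lin k ?G y)" unfolding rsp_def by blast
 define v where "v = vec n (lin k B y)"
 have Gw: "(\<Sum>x<n. B i x * v $ x) = (\<Sum>x<n. B i x * w $ x)" if "i < k" for i
 proof -
  have "lin k ?G y i = (\<Sum>x<n. B i x * w $ x)" using g(2)[OF that] that by (simp add: y)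
  moreover have "lin k ?G y i = (\<Sum>j<k. ?G i j * y j)" unfolding lin_def by (intro sum.cong refl) (simp add: mult.commute)
  ultimately show ?thesis unfolding lsum by (simp add: v_def)
 qed
 show thesis
 proof (rule that)
  show "v \<in> rsp n k B" unfolding v_def rsp_def by blast
  fix u assume "u \<in> rsp n k B"
  then obtain z where z: "u = vec n (lin k B z)" unfolding rsp_def by blast
  have *: "(\<Sum>x<n. q $ x * u $ x) = (\<Sum>i<k. z i * (\<Sum>x<n. B i x * q $ x))" for q :: "real vec"
  proof -
   have "(\<Sum>x<n. q $ x * u $ x) = (\<Sum>x<n. \<Sum>i<k. z i * (B i x * q $ x))"
    by (intro sum.cong refl) (auto simp: z lin_def sum_distrib_left mult_ac)
   thus ?thesis by (subst (asm) sum.swap) (simp add: sum_distrib_left)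
  qed
  have "(w - v) \<bullet> u = (\<Sum>x<n. w $ x * u $ x) - (\<Sum>x<n. v $ x * u $ x)"
  proof -
   have "(w - v) \<bullet> u = (\<Sum>x<n. (w - v) $ x * u $ x)" by (rule sprod) (simp add: z)
   also have "\<dots> = (\<Sum>x<n. w $ x * u $ x - v $ x * u $ x)"
    by (intro sum.cong refl) (simp add: v_def left_diff_distrib)
   finally show ?thesis by (simp only: sum_subtractf)
  qed
  thus "(w - v) \<bullet> u = 0" unfolding * using Gw by simp
 qed
qed

section \<open>Left cyclic arrangements\<close>

abbreviation tail_cols :: "(nat => nat => real) => nat => nat => real" where
 "tail_cols C \<equiv> \<lambda>i j. C i (Suc j)"

definition brd :: "(nat => real) => (nat => nat => real) => nat => nat => real" where
 "brd w a = (\<lambda>i j. case i of 0 => w j | Suc i => a i j)"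

lemma brd_simps [simp]: "brd w a 0 = w" "brd w a (Suc i) = a i"
 by (simp_all add: brd_def)

lemma mnr_brd:
 "finite K ==> card K = Suc k ==> mnr (brd w a) (Suc k) K = (\<Sum>x\<in>K. sg (card (K \<inter> {..<x})) * mnr a k (K - {x}) * w x)"
 unfolding brd_def by (rule mnr_border)

lemma vec_graph: "vec (Suc n) (lin k C y) = vCons (lin k C y 0) (vec n (lin k (tail_cols C) y))"
proof -
 have "lin k C y \<circ> Suc = lin k (tail_cols C) y" by (simp add: lin_def fun_eq_iff)
 thus ?thesis unfolding vec_Suc by simp
qed

lemma rspI: "vec n (lin k a y) \<in> rsp n k a" unfolding rsp_def by blast

lemma rsp_row: "i < k ==> vec n (a i) \<in> rsp n k a"
proof -
 assume i: "i < k"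
 have "lin k a (\<lambda>l. if l = i then 1 else 0) j = a i j" for j
 proof -
  have "lin k a (\<lambda>l. if l = i then 1 else 0) j = (\<Sum>l<k. if l = i then a i j else 0)"
   unfolding lin_def by (intro sum.cong refl) auto
  thus ?thesis using i by simp
 qed
 hence "lin k a (\<lambda>l. if l = i then 1 else 0) = a i" by (rule ext)
 thus ?thesis using rspI[of n k a "\<lambda>l. if l = i then 1 else 0"] by simp
qed

lemma zero_rsp: "0\<^sub>v n \<in> rsp n k a"
proof -
 have "vec n (lin k a (\<lambda>_. 0)) = 0\<^sub>v n" by (intro eq_vecI) (simp_all add: lin_def)
 thus ?thesis using rspI by metis
qed

text \<open>The circuit covector of \<open>K\<close>: orthogonal to the row space by
  \<open>cov_rsp\<close>, while by \<open>cov_brd\<close> its pairing with \<open>w\<close> is the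
  minor bordered by \<open>w\<close>.\<close>

definition cov :: "nat => nat => (nat => nat => real) => nat set => real vec" where
 "cov n k a K = vec n (\<lambda>x. if x \<in> K then sg (card (K \<inter> {..<x})) * mnr a k (K - {x}) else 0)"

lemma cov_sprod:
 assumes "K \<subseteq> {..<n}" "u \<in> carrier_vec n"
 shows "cov n k a K \<bullet> u = (\<Sum>x\<in>K. sg (card (K \<inter> {..<x})) * mnr a k (K - {x}) * u $ x)"
proof -
 have "cov n k a K \<bullet> u = (\<Sum>x<n. if x \<in> K then sg (card (K \<inter> {..<x})) * mnr a k (K - {x}) * u $ x else 0)"
  unfolding sprod[OF assms(2)] by (intro sum.cong refl) (simp add: cov_def)
 also have "\<dots> = (\<Sum>x\<in>K. sg (card (K \<inter> {..<x})) * mnr a k (K - {x}) * u $ x)"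
  by (intro sum.mono_neutral_cong_right) (use assms in auto)
 finally show ?thesis .
qed

lemma cov_carrier [simp]: "cov n k a K \<in> carrier_vec n" by (simp add: cov_def)

lemma cov_rsp: "K \<subseteq> {..<n} ==> card K = Suc k ==> v \<in> rsp n k a ==> cov n k a K \<bullet> v = 0"
 using cov_sprod[of K n v k a] rsp_carrier[of v n k a] rsp_relation[of v n k a K] by simp

lemma cov_brd:
 assumes "K \<subseteq> {..<n}" "card K = Suc k" shows "cov n k a K \<bullet> vec n w = mnr (brd w a) (Suc k) K"
proof -
 have "finite K" using assms(1) finite_subset by blast
 hence "mnr (brd w a) (Suc k) K = (\<Sum>x\<in>K. sg (card (K \<inter> {..<x})) * mnr a k (K - {x}) * vec n w $ x)"
  unfolding mnr_brd[OF \<open>finite K\<close> assms(2)] using assms(1) by (intro sum.cong refl) auto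
 thus ?thesis using cov_sprod[OF assms(1), of "vec n w" k a] by simp
qed

text \<open>Coordinates for a left cyclic arrangement. The rows of \<open>C\<close> span the graph
  of \<xi>, with column 0 carrying the value of \<xi>; the basis is the one that restricts to the
  identity on the first k coordinates, and \<open>w\<close> is the representative of \<eta> that
  vanishes on them. Positivity of the bordered minors, rather than a common sign, encodes the
  condition on the orthogonal projection.\<close>

locale cyc =
 fixes n k :: nat and A :: arrangement and C :: "nat => nat => real" and w :: "nat => real"
 assumes kn: "Suc k \<le> n" and C: "tpos (Suc n) k C"
  and normalized: "\<And>i j. i < k ==> j < k ==> C i (Suc j) = (if i = j then 1 else 0)"
  and w0: "\<And>j. j < k ==> w j = 0"
  and N: "tpos n (Suc k) (brd w (tail_cols C))"
  and V: "aspace A = rsp n k (tail_cols C)" and ext: "axi A \<in> extensional (aspace A)"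
  and xi: "\<And>y. axi A (vec n (lin k (tail_cols C) y)) = lin k C y 0"
  and eta: "aeta A = {vec n w + v | v. v \<in> aspace A}"
begin

abbreviation "B \<equiv> tail_cols C"

lemma B: "tpos n k B"
 unfolding tpos_def
proof (intro allI impI, elim conjE)
 fix K assume K: "K \<subseteq> {..<n}" "card K = k"
 have "0 < mnr C k (Suc ` K)" by (rule tposD[OF C]) (use K in \<open>auto simp: card_image\<close>)
 thus "0 < mnr B k K" using mnr_Suc_image[OF K(2), of C] by simp
qed

lemma graph: "{vCons (axi A v) v | v. v \<in> aspace A} = rsp (Suc n) k C"
 unfolding V rsp_def vec_graph using xi by fastforce

lemma eta_w: "vec n w \<in> aeta A"
 unfolding eta V using zero_rsp[of n k B] by (intro CollectI exI[of _ "0\<^sub>v n"]) auto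

lemma V_carrier: "v \<in> aspace A ==> v \<in> carrier_vec n" unfolding V by (rule rsp_carrier)

lemma eta_carrier: "x \<in> aeta A ==> x \<in> carrier_vec n" unfolding eta using V_carrier by auto

lemma eta_add: "x \<in> aeta A ==> v \<in> aspace A ==> x + v \<in> aeta A"
proof -
 assume "x \<in> aeta A" "v \<in> aspace A"
 then obtain u where u: "x = vec n w + u" "u \<in> aspace A" unfolding eta by blast
 hence "x + v = vec n w + (u + v)" using V_carrier \<open>v \<in> aspace A\<close> by (intro eq_vecI) auto
 thus ?thesis unfolding eta using rsp_add u(2) \<open>v \<in> aspace A\<close> unfolding V by blast
qed

text \<open>A circuit covector kills \<open>aspace A\<close>, so it is constant on the affine space,
  and the constant is a bordered minor, which is positive. This identity controls both infeasibility
  and the signs at the vertices.\<close>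

lemma eta_cov:
 assumes K: "K \<subseteq> {..<n}" "card K = Suc k" and x: "x \<in> aeta A"
 shows "(\<Sum>i\<in>K. sg (card (K \<inter> {..<i})) * mnr B k (K - {i}) * x $ i) = mnr (brd w B) (Suc k) K"
proof -
 obtain v where v: "x = vec n w + v" "v \<in> aspace A" using x unfolding eta by blast
 have "cov n k B K \<bullet> x = cov n k B K \<bullet> vec n w + cov n k B K \<bullet> v"
  unfolding v(1) by (rule scalar_prod_add_distrib[of _ n]) (use V_carrier v in auto)
 also have "cov n k B K \<bullet> v = 0" using v(2) unfolding V by (rule cov_rsp[OF K])
 finally show ?thesis unfolding cov_sprod[OF K(1) eta_carrier[OF x]] cov_brd[OF K] by simp
qed

lemma minor_pos: "K \<subseteq> {..<n} ==> card K = Suc k ==> i \<in> K ==> 0 < mnr B k (K - {i})"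
 by (rule tposD[OF B]) (auto simp: card_Diff_singleton)

lemma border_pos: "K \<subseteq> {..<n} ==> card K = Suc k ==> 0 < mnr (brd w B) (Suc k) K"
 by (rule tposD[OF N])

text \<open>The vertex where the hyperplanes of \<open>I\<close> meet. On \<open>I\<close> with j
  added, the circuit covector has a single surviving term, which determines the sign of coordinate
  j.\<close>

lemma eta_point:
 assumes I: "I \<subseteq> {..<n}" "card I = k"
 obtains x where "x \<in> aeta A" "\<And>i. i \<in> I ==> x $ i = 0" "\<And>j. j < n ==> j \<notin> I ==> 0 < sg (card (I \<inter> {..<j})) * x $ j"
proof -
 have fI: "finite I" using I(1) finite_subset by blast
 have "mnr B k I \<noteq> 0" using tposD[OF B I] by simp
 from interpolation[OF fI I(2,1) this, of "\<lambda>x. - w x"] obtain v where v: "v \<in> rsp n k B" "\<And>x. x \<in> I ==> v $ x = - w x" by metis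
 have x: "vec n w + v \<in> aeta A" unfolding eta V using v(1) by blast
 have xI: "(vec n w + v) $ i = 0" if "i \<in> I" for i using that v I rsp_carrier[OF v(1)] by auto
 show thesis
 proof (rule that[OF x xI])
  fix j assume j: "j < n" "j \<notin> I"
  let ?K = "insert j I"
  have K: "?K \<subseteq> {..<n}" "card ?K = Suc k" "finite ?K" using I j fI by auto
  have "(\<Sum>i\<in>?K. sg (card (?K \<inter> {..<i})) * mnr B k (?K - {i}) * (vec n w + v) $ i)
   = sg (card (?K \<inter> {..<j})) * mnr B k (?K - {j}) * (vec n w + v) $ j"
   by (rule sum_single) (use K xI in auto)
  hence "0 < sg (card (?K \<inter> {..<j})) * mnr B k (?K - {j}) * (vec n w + v) $ j"
   using eta_cov[OF K(1,2) x] border_pos[OF K(1,2)] by simp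
  moreover have "?K \<inter> {..<j} = I \<inter> {..<j}" by auto
  ultimately have "0 < mnr B k (?K - {j}) * (sg (card (I \<inter> {..<j})) * (vec n w + v) $ j)" by (simp add: mult_ac)
  thus "0 < sg (card (I \<inter> {..<j})) * (vec n w + v) $ j"
   using minor_pos[OF K(1,2), of j] by (simp add: zero_less_mult_iff)
 qed
qed

text \<open>The direction of the line cut out by k - 1 hyperplanes, scaled by \<xi>; it is
  \<open>graph_vector\<close> read off from the graph of \<xi>.\<close>

lemma xi_direction:
 assumes I: "I \<subseteq> {..<n}" "Suc (card I) = k"
 obtains v where "v \<in> aspace A" "axi A v = 1" "\<And>i. i \<in> I ==> v $ i = 0" "\<And>j. j < n ==> j \<notin> I ==> 0 < sg (card (I \<inter> {..<j})) * v $ j"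
proof -
 from graph_vector[OF C I] obtain u where u: "u \<in> rsp (Suc n) k C" "u $ 0 = 1" "\<And>i. i \<in> I ==> u $ Suc i = 0"
  "\<And>j. j < n ==> j \<notin> I ==> 0 < sg (card (I \<inter> {..<j})) * u $ Suc j" by metis
 then obtain v where v: "v \<in> aspace A" "u = vCons (axi A v) v" unfolding graph[symmetric] by blast
 have us: "u $ Suc j = v $ j" if "j < n" for j unfolding v(2) using that V_carrier[OF v(1)] by simp
 show thesis
 proof (rule that[OF v(1)])
  show "axi A v = 1" using u(2) v(2) by simp
  show "v $ i = 0" if "i \<in> I" for i using u(3)[OF that] us[of i] that I(1) by auto
  show "0 < sg (card (I \<inter> {..<j})) * v $ j" if "j < n" "j \<notin> I" for j using u(4)[OF that] us[OF that(1)] by simp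
 qed
qed

lemma xi_add: "u \<in> aspace A ==> v \<in> aspace A ==> axi A (u + v) = axi A u + axi A v"
proof -
 assume "u \<in> aspace A" "v \<in> aspace A"
 then obtain y z where u: "u = vec n (lin k B y)" "v = vec n (lin k B z)" unfolding V rsp_def by blast
 hence "u + v = vec n (lin k B (\<lambda>i. y i + z i))" by (intro eq_vecI) (simp_all add: lin_add)
 thus ?thesis by (simp only: u xi lin_add)
qed

lemma xi_smult: "u \<in> aspace A ==> axi A (c \<cdot>\<^sub>v u) = c * axi A u"
proof -
 assume "u \<in> aspace A"
 then obtain y where u: "u = vec n (lin k B y)" unfolding V rsp_def by blast
 hence "c \<cdot>\<^sub>v u = vec n (lin k B (\<lambda>i. c * y i))" by (intro eq_vecI) (simp_all add: lin_smult)
 thus ?thesis by (simp only: u xi lin_smult)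
qed

text \<open>If k + 1 coordinates of a point vanished, the circuit covector on them would be 0
  instead of positive. A representative of \<xi> with fewer than k nonzero entries would vanish on
  some direction where \<xi> is 1.\<close>

lemma polarized: "polarized_arrangement n k A"
 unfolding polarized_arrangement_def
proof (intro conjI ballI allI impI)
 show "subspace_dim n k (aspace A)" unfolding V using subspace_dim_tpos[OF B] kn by simp
 show "\<exists>w\<in>carrier_vec n. aeta A = {w + v | v. v \<in> aspace A}" using eta by (intro bexI[of _ "vec n w"]) auto
 show "n - k \<le> card {i. i < n \<and> x $ i \<noteq> 0}" if x: "x \<in> aeta A" for x
 proof (rule ccontr)
  assume less: "\<not> ?thesis"
  let ?Z = "{i. i < n \<and> x $ i = 0}"
  have "{i. i < n \<and> x $ i \<noteq> 0} \<union> ?Z = {..<n}" by auto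
  hence "n = card {i. i < n \<and> x $ i \<noteq> 0} + card ?Z"
   using card_Un_disjoint[of "{i. i < n \<and> x $ i \<noteq> 0}" ?Z] by auto
  hence "Suc k \<le> card ?Z" using less by linarith
  then obtain K where K: "K \<subseteq> ?Z" "card K = Suc k" by (meson obtain_subset_with_card_n)
  hence Kn: "K \<subseteq> {..<n}" by auto
  have "(\<Sum>i\<in>K. sg (card (K \<inter> {..<i})) * mnr B k (K - {i}) * x $ i) = 0" by (rule sum.neutral) (use K in auto)
  thus False using eta_cov[OF Kn K(2) x] border_pos[OF Kn K(2)] by simp
 qed
 show "axi A \<in> extensional (aspace A)" by (rule ext)
 show "k \<le> card {i. i < n \<and> c $ i \<noteq> 0}" if c: "c \<in> carrier_vec n" "\<forall>v\<in>aspace A. c \<bullet> v = axi A v" for c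
 proof (rule ccontr)
  assume less: "\<not> ?thesis"
  then obtain d where d: "k = Suc d" "card {i. i < n \<and> c $ i \<noteq> 0} \<le> d" by (cases k) auto
  then obtain I where I: "{i. i < n \<and> c $ i \<noteq> 0} \<subseteq> I" "I \<subseteq> {..<n}" "card I = d"
   using exists_subset_between[of "{i. i < n \<and> c $ i \<noteq> 0}" d "{..<n}"] kn by auto
  obtain v where v: "v \<in> aspace A" "axi A v = 1" "\<And>i. i \<in> I ==> v $ i = 0"
   using xi_direction[of I] I d(1) by metis
  have "c $ i * v $ i = 0" if "i < n" for i using v(3)[of i] I(1) that by auto
  hence "c \<bullet> v = 0" unfolding sprod[OF V_carrier[OF v(1)]] by (intro sum.neutral) auto
  thus False using c(2) v by auto
 qed
qed (simp_all add: xi_add xi_smult)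

lemma span_border: "{v + c \<cdot>\<^sub>v x | v c x. v \<in> aspace A \<and> x \<in> aeta A} = rsp n (Suc k) (brd w B)" (is "?L = _")
proof -
 have l: "vec n (lin (Suc k) (brd w B) y) = vec n (lin k B (\<lambda>i. y (Suc i))) + y 0 \<cdot>\<^sub>v vec n w" for y
  by (intro eq_vecI) (simp_all add: lin_def sum.lessThan_Suc_shift del: sum.lessThan_Suc)
 show ?thesis
 proof (intro equalityI subsetI)
  fix u assume "u \<in> ?L"
  then obtain v c x where u: "u = v + c \<cdot>\<^sub>v x" "v \<in> aspace A" "x \<in> aeta A" by blast
  then obtain v' where v': "x = vec n w + v'" "v' \<in> aspace A" unfolding eta by blast
  have "v + c \<cdot>\<^sub>v v' \<in> rsp n k B" using u(2) v'(2) unfolding V by (intro rsp_add rsp_smult)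
  then obtain y where y: "v + c \<cdot>\<^sub>v v' = vec n (lin k B y)" unfolding rsp_def by blast
  have "u = (v + c \<cdot>\<^sub>v v') + c \<cdot>\<^sub>v vec n w"
   using V_carrier[OF u(2)] V_carrier[OF v'(2)] by (intro eq_vecI) (auto simp: u(1) v'(1) distrib_left)
  also have "\<dots> = vec n (lin (Suc k) (brd w B) (case_nat c y))" unfolding y l by simp
  finally show "u \<in> rsp n (Suc k) (brd w B)" using rspI by metis
 next
  fix u assume "u \<in> rsp n (Suc k) (brd w B)"
  then obtain y where "u = vec n (lin (Suc k) (brd w B) y)" unfolding rsp_def by blast
  thus "u \<in> ?L" using eta_w unfolding l V using rspI by blast
 qed
qed

lemma left_cyclic: "left_cyclic n k A"
 unfolding left_cyclic_def
proof (intro conjI)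
 show "polarized_arrangement n k A" by (rule polarized)
 show "{v + c \<cdot>\<^sub>v x | v c x. v \<in> aspace A \<and> x \<in> aeta A} \<in> Gr_pos (k + 1) n"
  unfolding span_border using Gr_posI[OF N] kn by simp
 show "{vCons (axi A v) v | v. v \<in> aspace A} \<in> Gr_pos k (n + 1)"
  unfolding graph using Gr_posI[OF C] kn by simp
 obtain v where v: "v \<in> rsp n k B" "\<And>u. u \<in> rsp n k B ==> (vec n w - v) \<bullet> u = 0"
  using orthogonal_projection_exists[OF B, of "vec n w"] kn by auto
 have vc: "v \<in> carrier_vec n" by (rule rsp_carrier[OF v(1)])
 have p: "vec n w - v \<in> vec_module.orthogonal_complement n (aspace A)"
  unfolding vec_module.orthogonal_complement_def V using v vc by auto
 have "(vec n w - (vec n w - v)) \<bullet> q = 0" if "q \<in> vec_module.orthogonal_complement n (aspace A)" for q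
 proof -
  have q: "q \<in> carrier_vec n" "q \<bullet> v = 0" using that v(1) unfolding vec_module.orthogonal_complement_def V by auto
  have "vec n w - (vec n w - v) = v" using vc by (intro eq_vecI) auto
  thus ?thesis using q comm_scalar_prod[OF q(1) vc] by simp
 qed
 hence proj: "is_orth_projection (vec_module.orthogonal_complement n (aspace A)) (vec n w) (vec n w - v)"
  unfolding is_orth_projection_def using p by blast
 \<comment> \<open>Otherwise minus the projection is orthogonal to the space with nonnegative first
   coordinate, so \<open>orthogonal_alternates\<close> gives a set whose covector is nonnegative on
   it. But there the covector takes minus its value at \<open>w\<close>, a negative number.\<close>
 have "0 < (vec n w - v) $ 0"
 proof (rule ccontr)
  assume "\<not> ?thesis"
  hence le: "0 \<le> (- (vec n w - v)) $ 0" using kn vc by simp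
  have orth: "- (vec n w - v) \<bullet> u = 0" if "u \<in> rsp n k B" for u
   using v(2)[OF that] uminus_scalar_prod[of "vec n w - v" n u] vc rsp_carrier[OF that] by simp
  have cr: "- (vec n w - v) \<in> carrier_vec n" using vc by simp
  obtain K where K: "K \<subseteq> {..<n}" "card K = Suc k"
   "\<And>\<mu>. (\<And>x. x \<in> K ==> 0 < \<mu> x) ==> 0 \<le> (\<Sum>x\<in>K. sg (card (K \<inter> {..<x})) * \<mu> x * (- (vec n w - v)) $ x)"
   "\<And>\<mu>. (\<And>x. x \<in> K ==> 0 < \<mu> x) ==> 0 < (- (vec n w - v)) $ 0 ==> 0 < (\<Sum>x\<in>K. sg (card (K \<inter> {..<x})) * \<mu> x * (- (vec n w - v)) $ x)"
   by (rule orthogonal_alternates[OF B kn cr orth le]; (assumption | (rule that; blast)))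
  have "0 \<le> cov n k B K \<bullet> (- (vec n w - v))"
   using K(3)[of "\<lambda>x. mnr B k (K - {x})"] minor_pos[OF K(1,2)] cov_sprod[OF K(1), of "- (vec n w - v)" k B] vc by simp
  moreover have "- (vec n w - v) = v + (-1) \<cdot>\<^sub>v vec n w" using vc by (intro eq_vecI) auto
  moreover have "cov n k B K \<bullet> (v + (-1) \<cdot>\<^sub>v vec n w) = cov n k B K \<bullet> v - cov n k B K \<bullet> vec n w"
   using scalar_prod_add_distrib[of "cov n k B K" n v "(-1) \<cdot>\<^sub>v vec n w"] vc by simp
  ultimately show False using cov_rsp[OF K(1,2) v(1)] cov_brd[OF K(1,2), of B w] border_pos[OF K(1,2)] by simp
 qed
 thus "\<exists>x\<in>aeta A. \<exists>p. is_orth_projection (vec_module.orthogonal_complement n (aspace A)) x p \<and> p $ 0 > 0"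
  using proj eta_w by blast
qed

end

text \<open>The bordered matrix formed from \<open>w\<close> and \<open>C\<close> spans the same
  space as a totally positive basis \<open>M\<close>, so its minors are positive up to the sign of
  one determinant. The projection condition makes one of them positive and thereby all.\<close>

lemma left_cyclic_cyc:
 assumes lc: "left_cyclic n k A"
 obtains C w where "cyc n k A C w"
proof -
 from lc have pol: "polarized_arrangement n k A" and G1: "{v + c \<cdot>\<^sub>v w | v c w. v \<in> aspace A \<and> w \<in> aeta A} \<in> Gr_pos (Suc k) n"
  and G2: "{vCons (axi A v) v | v. v \<in> aspace A} \<in> Gr_pos k (Suc n)"
  and G3: "\<exists>w\<in>aeta A. \<exists>p. is_orth_projection (vec_module.orthogonal_complement n (aspace A)) w p \<and> p $ 0 > 0"
  unfolding left_cyclic_def by simp_all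
 obtain M where M: "Suc k \<le> n" "{v + c \<cdot>\<^sub>v w | v c w. v \<in> aspace A \<and> w \<in> aeta A} = rsp n (Suc k) M" "tpos n (Suc k) M"
  by (rule Gr_posE[OF G1])
 obtain C0 where "k \<le> Suc n" and C0: "{vCons (axi A v) v | v. v \<in> aspace A} = rsp (Suc n) k C0" "tpos (Suc n) k C0"
  by (rule Gr_posE[OF G2])
 let ?K = "Suc ` {..<k}"
 have K: "finite ?K" "card ?K = k" "?K \<subseteq> {..<Suc n}" using M(1) by (auto simp: card_image)
 have K0: "0 < mnr C0 k ?K" by (rule tposD[OF C0(2) K(3,2)])
 have K0': "mnr C0 k ?K \<noteq> 0" using K0 by simp
 obtain C where C: "\<And>n. rsp n k C = rsp n k C0" "\<And>i x. i < k ==> x \<in> ?K ==> C i x = (if i = card (?K \<inter> {..<x}) then 1 else 0)"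
  "\<And>I. mnr C k I = mnr C0 k I / mnr C0 k ?K"
  by (rule normal_form[OF K(1,2) K0']) (rule that; blast)
 have tC: "tpos (Suc n) k C" using C0(2) K0 unfolding tpos_def C(3) by simp
 have nC: "C i (Suc j) = (if i = j then 1 else 0)" if "i < k" "j < k" for i j
 proof -
  have "?K \<inter> {..<Suc j} = Suc ` {..<j}" using that by auto
  hence "card (?K \<inter> {..<Suc j}) = j" by (simp add: card_image)
  thus ?thesis using C(2)[OF that(1), of "Suc j"] that by auto
 qed
 let ?B = "tail_cols C"
 have gr: "{vCons (axi A v) v | v. v \<in> aspace A} = rsp (Suc n) k C" using C0(1) C(1) by simp
 have VI: "vec n (lin k ?B y) \<in> aspace A \<and> axi A (vec n (lin k ?B y)) = lin k C y 0" for y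
 proof -
  have "vec (Suc n) (lin k C y) \<in> {vCons (axi A v) v | v. v \<in> aspace A}" unfolding gr by (rule rspI)
  then obtain v where "vCons (lin k C y 0) (vec n (lin k ?B y)) = vCons (axi A v) v" "v \<in> aspace A" unfolding vec_graph by blast
  thus ?thesis by simp
 qed
 have V: "aspace A = rsp n k ?B"
 proof (intro equalityI subsetI)
  fix v assume "v \<in> aspace A"
  hence "vCons (axi A v) v \<in> rsp (Suc n) k C" unfolding gr[symmetric] by blast
  then obtain y where "vCons (axi A v) v = vCons (lin k C y 0) (vec n (lin k ?B y))" unfolding rsp_def vec_graph by blast
  hence "v = vec n (lin k ?B y)" by simp
  thus "v \<in> rsp n k ?B" using rspI by simp
 next
  fix v assume "v \<in> rsp n k ?B"
  thus "v \<in> aspace A" unfolding rsp_def using VI by blast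
 qed
 obtain u where u: "u \<in> carrier_vec n" "aeta A = {u + v | v. v \<in> aspace A}" using pol unfolding polarized_arrangement_def by blast
 \<comment> \<open>Subtracting from \<open>u\<close> the vector of the space with the same first k
   coordinates makes the representative of \<eta> vanish there.\<close>
 define w where "w j = u $ j - lin k ?B (\<lambda>i. u $ i) j" for j
 have w0: "w j = 0" if "j < k" for j
 proof -
  have "lin k ?B (\<lambda>i. u $ i) j = (\<Sum>i<k. if i = j then u $ i else 0)" unfolding lin_def by (intro sum.cong refl) (use nC that in auto)
  thus ?thesis using that by (simp add: w_def)
 qed
 let ?d = "vec n (lin k ?B (\<lambda>i. u $ i))"
 have uw: "u + v = vec n w + (v + ?d)" "vec n w + v = u + (v + (-1) \<cdot>\<^sub>v ?d)" if "v \<in> aspace A" for v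
  using rsp_carrier[of v n k ?B] that u(1) unfolding V by (intro eq_vecI; auto simp: w_def)+
 have dV: "?d \<in> aspace A" unfolding V by (rule rspI)
 have eta: "aeta A = {vec n w + v | v. v \<in> aspace A}"
 proof (intro equalityI subsetI)
  fix x assume "x \<in> aeta A"
  then obtain v where v: "x = u + v" "v \<in> aspace A" unfolding u(2) by blast
  moreover have "v + ?d \<in> aspace A" using v(2) dV unfolding V by (rule rsp_add)
  ultimately show "x \<in> {vec n w + v | v. v \<in> aspace A}" using uw(1) by blast
 next
  fix x assume "x \<in> {vec n w + v | v. v \<in> aspace A}"
  then obtain v where v: "x = vec n w + v" "v \<in> aspace A" by blast
  moreover have "v + (-1) \<cdot>\<^sub>v ?d \<in> aspace A" using v(2) dV unfolding V by (intro rsp_add rsp_smult)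
  ultimately show "x \<in> aeta A" unfolding u(2) using uw(2) by blast
 qed
 have z: "0\<^sub>v n \<in> aspace A" unfolding V by (rule zero_rsp)
 have weta: "vec n w \<in> aeta A" unfolding eta using z by (intro CollectI exI[of _ "0\<^sub>v n"]) auto
 have "vec n (brd w ?B i) \<in> rsp n (Suc k) M" if "i < Suc k" for i
  unfolding M(2)[symmetric]
 proof (cases i)
  case 0
  have "vec n (brd w ?B i) = 0\<^sub>v n + 1 \<cdot>\<^sub>v vec n w" by (rule eq_vecI) (auto simp: 0)
  thus "vec n (brd w ?B i) \<in> {v + c \<cdot>\<^sub>v w | v c w. v \<in> aspace A \<and> w \<in> aeta A}" using z weta by blast
 next
  case (Suc j)
  hence "vec n (?B j) \<in> aspace A" unfolding V using that by (intro rsp_row) simp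
  moreover have "vec n (brd w ?B i) = vec n (?B j) + 0 \<cdot>\<^sub>v vec n w" by (rule eq_vecI) (auto simp: Suc)
  ultimately show "vec n (brd w ?B i) \<in> {v + c \<cdot>\<^sub>v w | v c w. v \<in> aspace A \<and> w \<in> aeta A}" using weta by blast
 qed
 hence "\<forall>i. \<exists>y. i < Suc k \<longrightarrow> vec n (brd w ?B i) = vec n (lin (Suc k) M y)" unfolding rsp_def by blast
 then obtain t where t: "\<And>i. i < Suc k ==> vec n (brd w ?B i) = vec n (lin (Suc k) M (t i))" by metis
 \<comment> \<open>Expressed in the basis \<open>M\<close>, all bordered minors are those of
   \<open>M\<close> times \<open>det T\<close>.\<close>
 define T where "T = mat (Suc k) (Suc k) (\<lambda>(i, l). t i l)"
 have T: "T \<in> carrier_mat (Suc k) (Suc k)" by (simp add: T_def)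
 have NT: "mnr (brd w ?B) (Suc k) I = det T * mnr M (Suc k) I" if I: "I \<subseteq> {..<n}" "card I = Suc k" for I
 proof -
  have "brd w ?B i j = (\<Sum>l<Suc k. T $$ (i, l) * M l j)" if "i < Suc k" "j \<in> I" for i j
  proof -
   have "j < n" using that I(1) by auto
   have "vec n (brd w ?B i) $ j = vec n (lin (Suc k) M (t i)) $ j" using t[OF that(1)] by simp
   hence "brd w ?B i j = lin (Suc k) M (t i) j" using \<open>j < n\<close> by simp
   also have "\<dots> = (\<Sum>l<Suc k. T $$ (i, l) * M l j)" unfolding lin_def T_def by (intro sum.cong refl) (use that in simp)
   finally show ?thesis .
  qed
  hence "mnr (brd w ?B) (Suc k) I = mnr (\<lambda>i j. \<Sum>l<Suc k. T $$ (i, l) * M l j) (Suc k) I" by (rule mnr_cong[OF _ I(2)])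
  thus ?thesis unfolding mnr_basis_change[OF T] .
 qed
 have B: "tpos n k ?B"
  unfolding tpos_def
 proof (intro allI impI, elim conjE)
  fix I assume I: "I \<subseteq> {..<n}" "card I = k"
  have "0 < mnr C k (Suc ` I)" by (rule tposD[OF tC]) (use I in \<open>auto simp: card_image\<close>)
  thus "0 < mnr ?B k I" using mnr_Suc_image[OF I(2), of C] by simp
 qed
 obtain x p where x: "x \<in> aeta A" and p: "p \<in> carrier_vec n" "\<And>v. v \<in> aspace A ==> p \<bullet> v = 0" "0 < p $ 0"
  and xp: "\<And>q. q \<in> carrier_vec n ==> (\<And>v. v \<in> aspace A ==> q \<bullet> v = 0) ==> (x - p) \<bullet> q = 0"
  using G3 unfolding is_orth_projection_def vec_module.orthogonal_complement_def by blast
 have p': "p \<bullet> v = 0" if "v \<in> rsp n k ?B" for v using p(2) that unfolding V .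
 obtain I where I: "I \<subseteq> {..<n}" "card I = Suc k"
  "\<And>\<mu>. (\<And>x. x \<in> I ==> 0 < \<mu> x) ==> 0 \<le> (\<Sum>x\<in>I. sg (card (I \<inter> {..<x})) * \<mu> x * p $ x)"
  "\<And>\<mu>. (\<And>x. x \<in> I ==> 0 < \<mu> x) ==> 0 < p $ 0 ==> 0 < (\<Sum>x\<in>I. sg (card (I \<inter> {..<x})) * \<mu> x * p $ x)"
  by (rule orthogonal_alternates[OF B M(1) p(1) p' less_imp_le[OF p(3)]]; (assumption | (rule that; blast)))
 \<comment> \<open>The projection \<open>p\<close> pairs with this covector as \<open>w\<close>
   does, and by the choice of \<open>I\<close> the pairing is positive: this is the one minor that
   decides the sign.\<close>
 let ?q = "cov n k ?B I"
 have "0 < ?q \<bullet> p"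
  unfolding cov_sprod[OF I(1) p(1)]
  by (rule I(4)[OF _ p(3)], rule tposD[OF B]) (use I in \<open>auto simp: card_Diff_singleton\<close>)
 moreover have "(x - p) \<bullet> ?q = 0" by (rule xp) (simp_all add: V cov_rsp[OF I(1,2)])
 moreover obtain v where v: "x = vec n w + v" "v \<in> rsp n k ?B" using x unfolding eta V by blast
 have xc: "x \<in> carrier_vec n" using v rsp_carrier[OF v(2)] by simp
 have "?q \<bullet> x = ?q \<bullet> vec n w"
  using scalar_prod_add_distrib[of ?q n "vec n w" v] rsp_carrier[OF v(2)] cov_rsp[OF I(1,2) v(2)] by (simp add: v(1))
 moreover have "(x - p) \<bullet> ?q = ?q \<bullet> x - ?q \<bullet> p"
  using minus_scalar_prod_distrib[OF xc p(1), of ?q] comm_scalar_prod[of x n ?q] comm_scalar_prod[of p n ?q] xc p(1) by simp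
 ultimately have "0 < det T * mnr M (Suc k) I" using cov_brd[OF I(1,2), of ?B w] NT[OF I(1,2)] by simp
 hence "0 < det T" using tposD[OF M(3) I(1,2)] by (simp add: zero_less_mult_iff)
 hence N: "tpos n (Suc k) (brd w ?B)" using M(3) NT unfolding tpos_def by simp
 have "cyc n k A C w"
 proof
  show "axi A \<in> extensional (aspace A)" using pol unfolding polarized_arrangement_def by blast
 qed (use M(1) tC nC w0 N V VI eta in blast)+
 thus thesis by (rule that)
qed

section \<open>Bounded feasible sign vectors\<close>

lemma sign_changes_Suc: "Suc j < length \<alpha> ==> Suc j \<in> sc \<alpha> \<longleftrightarrow> \<alpha> ! j \<noteq> \<alpha> ! Suc j"
 by (simp add: sign_changes_def)

lemma sign_changes_0: "0 < length \<alpha> ==> 0 \<in> sc \<alpha> \<longleftrightarrow> \<not> \<alpha> ! 0"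
 by (simp add: sign_changes_def)

lemma sign_changes_subset: "sc \<alpha> \<subseteq> {..<length \<alpha>}"
 by (auto simp: sign_changes_def)

lemma finite_sign_changes [simp]: "finite (sc \<alpha>)"
 using finite_subset[OF sign_changes_subset] by blast

lemma nth_sign:
 assumes "j < length \<alpha>" shows "\<alpha> ! j \<longleftrightarrow> even (card (sc \<alpha> \<inter> {..j}))"
 using assms
proof (induction j)
 case 0
 have "sc \<alpha> \<inter> {..0} = (if \<alpha> ! 0 then {} else {0})" using sign_changes_0[of \<alpha>] 0 by auto
 thus ?case by simp
next
 case (Suc j)
 have "sc \<alpha> \<inter> {..Suc j} = (if Suc j \<in> sc \<alpha> then insert (Suc j) (sc \<alpha> \<inter> {..j}) else sc \<alpha> \<inter> {..j})"
  by (auto simp: le_Suc_eq)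
 thus ?case using Suc sign_changes_Suc[OF Suc.prems] by (auto simp: card_insert_if)
qed

text \<open>With zero-based coordinates the sign at j counts the changes at positions up to and
  including j, as a change at 0 already makes the first sign negative.\<close>

lemma chamber_iff:
 assumes "length \<alpha> = n"
 shows "x \<in> chamber A \<alpha> \<longleftrightarrow> x \<in> aeta A \<and> (\<forall>j<n. 0 \<le> sg (card (sc \<alpha> \<inter> {..j})) * x $ j)"
proof -
 have "(\<forall>i\<in>{1..n}. if \<alpha> ! (i - 1) then x $ (i - 1) \<ge> 0 else x $ (i - 1) \<le> 0) \<longleftrightarrow>
  (\<forall>j<n. if \<alpha> ! j then x $ j \<ge> 0 else x $ j \<le> 0)" (is "?L \<longleftrightarrow> ?R")
 proof
  assume ?L
  show ?R
  proof (intro allI impI)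
   fix j assume "j < n"
   thus "if \<alpha> ! j then x $ j \<ge> 0 else x $ j \<le> 0" using \<open>?L\<close>[rule_format, of "Suc j"] by (cases "\<alpha> ! j") simp_all
  qed
 qed auto
 also have "\<dots> \<longleftrightarrow> (\<forall>j<n. 0 \<le> sg (card (sc \<alpha> \<inter> {..j})) * x $ j)"
  unfolding sg_nonneg using nth_sign[of _ \<alpha>] assms by simp
 finally show ?thesis using assms unfolding chamber_def by simp
qed

lemma card_atMost_lessThan: "finite X ==> i \<in> X ==> card (X \<inter> {..i}) = Suc (card (X \<inter> {..<i :: nat}))"
proof -
 assume "finite X" "i \<in> X"
 moreover from this have "X \<inter> {..i} = insert i (X \<inter> {..<i})" by (auto simp: le_less)
 ultimately show ?thesis by simp
qed

context cyc
begin

text \<open>At the first k + 1 sign changes the coordinates of a point of the chamber have signs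
  opposite to those of the circuit covector, so its value would be at most 0, although it is a
  positive constant.\<close>

lemma infeasible:
 assumes l: "length \<alpha> = n" and c: "Suc k \<le> card (sc \<alpha>)"
 shows "chamber A \<alpha> = {}"
proof (rule ccontr)
 let ?X = "sc \<alpha>"
 assume "chamber A \<alpha> \<noteq> {}"
 then obtain x where x: "x \<in> aeta A" "\<And>j. j < n ==> 0 \<le> sg (card (?X \<inter> {..j})) * x $ j" using chamber_iff[OF l] by blast
 obtain P where P: "P \<subseteq> ?X" "card P = Suc k" "\<And>x. x \<in> P ==> P \<inter> {..<x} = ?X \<inter> {..<x}"
  using initial_segment[OF finite_sign_changes c] by blast
 have Pn: "P \<subseteq> {..<n}" using P(1) sign_changes_subset[of \<alpha>] l by blast
 have "sg (card (P \<inter> {..<i})) * mnr B k (P - {i}) * x $ i \<le> 0" if i: "i \<in> P" for i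
 proof -
  have "card (?X \<inter> {..i}) = Suc (card (P \<inter> {..<i}))" using card_atMost_lessThan[of ?X i] P i by auto
  hence "sg (card (P \<inter> {..<i})) * x $ i \<le> 0" using x(2)[of i] Pn i by auto
  hence "mnr B k (P - {i}) * (sg (card (P \<inter> {..<i})) * x $ i) \<le> 0"
   using minor_pos[OF Pn P(2) i] by (simp add: mult_le_0_iff)
  thus ?thesis by (simp only: mult_ac)
 qed
 hence "(\<Sum>i\<in>P. sg (card (P \<inter> {..<i})) * mnr B k (P - {i}) * x $ i) \<le> 0" by (rule sum_nonpos)
 thus False using eta_cov[OF Pn P(2) x(1)] border_pos[OF Pn P(2)] by simp
qed

text \<open>\<open>complementary_set\<close> yields k hyperplanes whose common vertex has the signs
  of \<alpha> at all other coordinates.\<close>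

lemma feasible:
 assumes l: "length \<alpha> = n" and c: "card (sc \<alpha>) \<le> k"
 shows "chamber A \<alpha> \<noteq> {}"
proof -
 let ?X = "sc \<alpha>"
 obtain I where I: "I \<subseteq> {..<n}" "card I = k" "\<And>j. j < n ==> j \<notin> I ==> card (?X \<inter> {..j}) = card (I \<inter> {..<j})"
  using complementary_set[of ?X n k] sign_changes_subset[of \<alpha>] l c kn by auto
 obtain x where x: "x \<in> aeta A" "\<And>i. i \<in> I ==> x $ i = 0" "\<And>j. j < n ==> j \<notin> I ==> 0 < sg (card (I \<inter> {..<j})) * x $ j"
  using eta_point[OF I(1,2)] by blast
 have "0 \<le> sg (card (?X \<inter> {..j})) * x $ j" if "j < n" for j
  using x(2)[of j] x(3)[OF that] I(3)[OF that] by (cases "j \<in> I") (auto intro: less_imp_le)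
 thus ?thesis using x(1) chamber_iff[OF l] by blast
qed

text \<open>The circuit relation of the graph of \<xi> on column 0 and the k sign changes expresses
  \<xi> as a negative combination of the coordinates at the changes, taken with the signs of
  \<alpha>. On the chamber these are nonnegative, so the resulting affine function is at most
  0.\<close>

lemma bounded:
 assumes l: "length \<alpha> = n" and c: "card (sc \<alpha>) = k"
 shows "bounded_signs A \<alpha>"
proof -
 let ?X = "sc \<alpha>"
 let ?K = "insert 0 (Suc ` ?X)"
 have K: "?K \<subseteq> {..<Suc n}" "card ?K = Suc k" "finite ?K" using sign_changes_subset[of \<alpha>] l c by (auto simp: card_image)
 have pos: "0 < mnr C k (?K - {i})" if "i \<in> ?K" for i
  by (rule tposD[OF C]) (use K that in \<open>auto simp: card_Diff_singleton\<close>)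
 have cK: "card (?K \<inter> {..<Suc i}) = card (?X \<inter> {..i})" if "i \<in> ?X" for i
 proof -
  have "?K \<inter> {..<Suc i} = insert 0 (Suc ` (?X \<inter> {..<i}))" by auto
  thus ?thesis using card_atMost_lessThan[OF finite_sign_changes that] by (simp add: card_image)
 qed
 define g where "g x = (\<Sum>i\<in>?X. mnr C k (?K - {Suc i}) * (sg (card (?X \<inter> {..i})) * x $ i))" for x :: "real vec"
 have rel: "mnr C k (?K - {0}) * axi A v + g v = 0" if v: "v \<in> aspace A" for v
 proof -
  have u: "vCons (axi A v) v \<in> rsp (Suc n) k C" unfolding graph[symmetric] using v by blast
  have t: "(\<Sum>i\<in>?X. sg (card (?K \<inter> {..<Suc i})) * mnr C k (?K - {Suc i}) * vCons (axi A v) v $ Suc i) = g v"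
   unfolding g_def
  proof (intro sum.cong refl)
   fix i assume i: "i \<in> ?X"
   hence "i < n" using sign_changes_subset[of \<alpha>] l by auto
   hence "vCons (axi A v) v $ Suc i = v $ i" using V_carrier[OF v] by simp
   thus "sg (card (?K \<inter> {..<Suc i})) * mnr C k (?K - {Suc i}) * vCons (axi A v) v $ Suc i =
     mnr C k (?K - {Suc i}) * (sg (card (?X \<inter> {..i})) * v $ i)" unfolding cK[OF i] by (simp only: mult_ac)
  qed
  have "(\<Sum>x\<in>?K. sg (card (?K \<inter> {..<x})) * mnr C k (?K - {x}) * vCons (axi A v) v $ x)
   = mnr C k (?K - {0}) * axi A v + (\<Sum>i\<in>?X. sg (card (?K \<inter> {..<Suc i})) * mnr C k (?K - {Suc i}) * vCons (axi A v) v $ Suc i)"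
   by (subst sum.insert) (simp_all add: sum.reindex del: vec_index_vCons_Suc)
  thus ?thesis using rsp_relation[OF u K(1,2)] unfolding t by simp
 qed
 have gadd: "g (x + v) = g x + g v" if "x \<in> aeta A" "v \<in> aspace A" for x v
  unfolding g_def sum.distrib[symmetric]
 proof (intro sum.cong refl)
  fix i assume "i \<in> ?X"
  hence "i < n" using sign_changes_subset[of \<alpha>] l by auto
  hence "(x + v) $ i = x $ i + v $ i" using V_carrier[OF that(2)] by simp
  thus "mnr C k (?K - {Suc i}) * (sg (card (?X \<inter> {..i})) * (x + v) $ i) =
   mnr C k (?K - {Suc i}) * (sg (card (?X \<inter> {..i})) * x $ i) + mnr C k (?K - {Suc i}) * (sg (card (?X \<inter> {..i})) * v $ i)"
   by (simp add: distrib_left)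
 qed
 let ?f = "\<lambda>x. - g x / mnr C k (?K - {0})"
 have "?f (x + v) = ?f x + axi A v" if "x \<in> aeta A" "v \<in> aspace A" for x v
  using gadd[OF that] rel[OF that(2)] pos[of 0] by (simp add: field_simps)
 moreover have "?f x \<le> 0" if "x \<in> chamber A \<alpha>" for x
 proof -
  have "0 \<le> g x" unfolding g_def
  proof (rule sum_nonneg)
   fix i assume i: "i \<in> ?X"
   hence "i < n" using sign_changes_subset[of \<alpha>] l by auto
   hence "0 \<le> sg (card (?X \<inter> {..i})) * x $ i" using that chamber_iff[OF l] by blast
   moreover have "0 \<le> mnr C k (?K - {Suc i})" using pos[of "Suc i"] i by simp
   ultimately show "0 \<le> mnr C k (?K - {Suc i}) * (sg (card (?X \<inter> {..i})) * x $ i)" by (rule mult_nonneg_nonneg[rotated])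
  qed
  thus ?thesis using pos[of 0] by (simp add: divide_nonneg_pos)
 qed
 ultimately show ?thesis unfolding bounded_signs_def by (intro exI[of _ ?f] conjI bdd_aboveI2[of _ _ 0]) auto
qed

text \<open>With fewer changes there is a direction on which \<xi> is 1 and whose signs are
  compatible with \<alpha>, so a ray in this direction stays in the chamber.\<close>

lemma unbounded:
 assumes l: "length \<alpha> = n" and c: "card (sc \<alpha>) < k"
 shows "\<not> bounded_signs A \<alpha>"
proof
 let ?X = "sc \<alpha>"
 obtain d where d: "k = Suc d" "card ?X \<le> d" using c by (cases k) auto
 obtain I where I: "I \<subseteq> {..<n}" "card I = d" "\<And>j. j < n ==> j \<notin> I ==> card (?X \<inter> {..j}) = card (I \<inter> {..<j})"
  using complementary_set[of ?X n d] sign_changes_subset[of \<alpha>] l d kn by auto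
 obtain v where v: "v \<in> aspace A" "axi A v = 1" "\<And>i. i \<in> I ==> v $ i = 0" "\<And>j. j < n ==> j \<notin> I ==> 0 < sg (card (I \<inter> {..<j})) * v $ j"
  using xi_direction[of I] I(1,2) d(1) by metis
 have vs: "0 \<le> sg (card (?X \<inter> {..j})) * v $ j" if "j < n" for j
  using v(3)[of j] v(4)[OF that] I(3)[OF that] by (cases "j \<in> I") (auto intro: less_imp_le)
 obtain x where x: "x \<in> chamber A \<alpha>" using feasible[OF l] c by fastforce
 have xA: "x \<in> aeta A" using x chamber_iff[OF l] by blast
 assume "bounded_signs A \<alpha>"
 then obtain f where f: "\<And>x v. x \<in> aeta A ==> v \<in> aspace A ==> f (x + v) = f x + axi A v" "bdd_above (f ` chamber A \<alpha>)"
  unfolding bounded_signs_def by blast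
 then obtain M where M: "\<And>y. y \<in> chamber A \<alpha> ==> f y \<le> M" unfolding bdd_above_def by blast
 \<comment> \<open>Large enough that \<open>f x + t\<close> exceeds the bound
   \<open>M\<close>.\<close>
 define t where "t = \<bar>M - f x\<bar> + 1"
 have tv: "t \<cdot>\<^sub>v v \<in> aspace A" using v(1) unfolding V by (rule rsp_smult)
 have t0: "0 \<le> t" by (simp add: t_def)
 have "0 \<le> sg (card (?X \<inter> {..j})) * (x + t \<cdot>\<^sub>v v) $ j" if "j < n" for j
 proof -
  have "(x + t \<cdot>\<^sub>v v) $ j = x $ j + t * v $ j" using that V_carrier[OF v(1)] by simp
  moreover have "0 \<le> sg (card (?X \<inter> {..j})) * x $ j" using x chamber_iff[OF l] that by blast
  moreover have "0 \<le> t * (sg (card (?X \<inter> {..j})) * v $ j)" using vs[OF that] t0 by (rule mult_nonneg_nonneg[rotated])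
  moreover have "sg (card (?X \<inter> {..j})) * (x $ j + t * v $ j) = sg (card (?X \<inter> {..j})) * x $ j + t * (sg (card (?X \<inter> {..j})) * v $ j)"
   by (simp only: distrib_left mult.left_commute[of t])
  ultimately show ?thesis by simp
 qed
 hence "x + t \<cdot>\<^sub>v v \<in> chamber A \<alpha>" using chamber_iff[OF l] eta_add[OF xA tv] by blast
 hence "f x + t \<le> M" using M f(1)[OF xA tv] xi_smult[OF v(1)] v(2) by fastforce
 thus False unfolding t_def by linarith
qed

lemma BF_iff: "\<alpha> \<in> BF n A \<longleftrightarrow> length \<alpha> = n \<and> card (sc \<alpha>) = k"
proof (cases "length \<alpha> = n")
 case True
 consider "card (sc \<alpha>) < k" | "card (sc \<alpha>) = k" | "Suc k \<le> card (sc \<alpha>)" by linarith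
 thus ?thesis
 proof cases
  case 1
  thus ?thesis using unbounded[OF True] unfolding BF_def by blast
 next
  case 2
  thus ?thesis using feasible[OF True] bounded[OF True] True unfolding BF_def by blast
 next
  case 3
  thus ?thesis using infeasible[OF True] unfolding BF_def by auto
 qed
qed (simp add: BF_def)

end

text \<open>The set \<open>D\<close> is the greedy choice of vertices \<open>v\<close> of \<open>X\<close> that are matched with the edge on
 their left, i.e. with \<open>v\<close> instead of \<open>Suc v\<close>.\<close>

lemma matching:
 assumes X: "X \<subseteq> {..<n}" and nb: "\<not> bad n X Z" and Z: "Z \<subseteq> {1..n}"
 obtains I where "I \<subseteq> {..<n}" "card I = card X" "\<And>j. Suc j \<in> Z ==> j \<in> I"
  "\<And>j. j < n ==> j \<notin> I ==> card (X \<inter> {..j}) = card (I \<inter> {..<j})"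
proof -
 define D where "D = rec_nat False (\<lambda>v d. Suc v \<in> X \<and> Suc v \<in> Z \<and> \<not> (v \<in> X \<and> \<not> d))"
 have D0: "\<not> D 0" and DS: "D (Suc v) \<longleftrightarrow> Suc v \<in> X \<and> Suc v \<in> Z \<and> \<not> (v \<in> X \<and> \<not> D v)" for v
  by (simp_all add: D_def)
 define I where "I = {j. j < n \<and> ((Suc j \<in> X \<and> D (Suc j)) \<or> (j \<in> X \<and> \<not> D j))}"
 have fX: "finite X" using X finite_subset by blast
 have fI: "finite I" unfolding I_def by simp
 have lS: "card (I \<inter> {..<Suc j}) = card (I \<inter> {..<j}) + (if j \<in> I then 1 else 0)" for j
 proof -
  have "I \<inter> {..<Suc j} = (if j \<in> I then insert j (I \<inter> {..<j}) else I \<inter> {..<j})" by (auto simp: less_Suc_eq)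
  thus ?thesis using fI by simp
 qed
 have aS: "card (X \<inter> {..Suc j}) = card (X \<inter> {..j}) + (if Suc j \<in> X then 1 else 0)" for j
 proof -
  have "X \<inter> {..Suc j} = (if Suc j \<in> X then insert (Suc j) (X \<inter> {..j}) else X \<inter> {..j})" by (auto simp: le_Suc_eq)
  thus ?thesis using fX by simp
 qed
 have inv: "card (I \<inter> {..<j}) + (if j \<in> X \<and> \<not> D j then 1 else 0) = card (X \<inter> {..j})" if "j \<le> n" for j
  using that
 proof (induction j)
  case 0
  have "X \<inter> {..0} = (if 0 \<in> X then {0} else {})" by auto
  thus ?case using D0 by simp
 next
  case (Suc j)
  hence IH: "card (I \<inter> {..<j}) + (if j \<in> X \<and> \<not> D j then 1 else 0) = card (X \<inter> {..j})" and j: "j < n" by simp_all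
  have jI: "j \<in> I \<longleftrightarrow> (Suc j \<in> X \<and> D (Suc j)) \<or> (j \<in> X \<and> \<not> D j)" unfolding I_def using j by blast
  have ex: "D (Suc j) ==> \<not> (j \<in> X \<and> \<not> D j)" unfolding DS by blast
  show ?case unfolding lS aS using IH jI ex by (cases "D (Suc j)"; cases "j \<in> X \<and> \<not> D j"; cases "Suc j \<in> X") simp_all
 qed
 \<comment> \<open>An element matched to its left has an unbroken run of steps in \<open>Z\<close>
   back to an unoccupied position, the potential start of a bad interval.\<close>
 have chain: "\<exists>a<v. a \<notin> X \<and> {a<..v} \<subseteq> Z" if "D v" for v
  using that
 proof (induction v)
  case (Suc v)
  show ?case
  proof (cases "v \<in> X")
   case True
   then obtain a where "a < v" "a \<notin> X" "{a<..v} \<subseteq> Z" using Suc DS by blast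
   moreover have "{a<..Suc v} \<subseteq> insert (Suc v) {a<..v}" by auto
   ultimately show ?thesis using Suc.prems DS[of v] by (intro exI[of _ a]) auto
  next
   case False
   moreover have "{v<..Suc v} = {Suc v}" by auto
   ultimately show ?thesis using Suc.prems DS[of v] by auto
  qed
 qed (use D0 in simp)
 show thesis
 proof (rule that[of I])
  show "I \<subseteq> {..<n}" unfolding I_def by blast
  have "n \<notin> X" "X \<inter> {..n} = X" "I \<inter> {..<n} = I" using X unfolding I_def by auto
  thus "card I = card X" using inv[of n] by simp
  show "card (X \<inter> {..j}) = card (I \<inter> {..<j})" if "j < n" "j \<notin> I" for j
  proof -
   have "\<not> (j \<in> X \<and> \<not> D j)" using that unfolding I_def by blast
   thus ?thesis using inv[OF less_imp_le[OF that(1)]] by (auto split: if_splits)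
  qed
  \<comment> \<open>An uncovered step j + 1 of \<open>Z\<close> has an unoccupied right end, and
    steps of \<open>Z\<close> lead left from it to another unoccupied position; together they bound
    a bad interval.\<close>
  show "j \<in> I" if j: "Suc j \<in> Z" for j
  proof (rule ccontr)
   assume n: "j \<notin> I"
   have jn: "j < n" using j Z by auto
   hence 1: "\<not> (Suc j \<in> X \<and> D (Suc j))" "\<not> (j \<in> X \<and> \<not> D j)" using n unfolding I_def by blast+
   hence SX: "Suc j \<notin> X" using j DS by blast
   have "\<exists>a<Suc j. a \<notin> X \<and> {a<..Suc j} \<subseteq> Z"
   proof (cases "j \<in> X")
    case True
    then obtain a where "a < j" "a \<notin> X" "{a<..j} \<subseteq> Z" using chain[of j] 1 by blast
    moreover have "{a<..Suc j} \<subseteq> insert (Suc j) {a<..j}" by auto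
    ultimately show ?thesis using j by (intro exI[of _ a]) auto
   next
    case False
    moreover have "{j<..Suc j} = {Suc j}" by auto
    ultimately show ?thesis using j by auto
   qed
   then obtain a where "a < Suc j" "a \<notin> X" "{a<..Suc j} \<subseteq> Z" by blast
   hence "bad n X Z" unfolding bad_def using SX jn by (intro exI[of _ a] exI[of _ "Suc j"]) simp
   thus False using nb by blast
  qed
 qed
qed

section \<open>Empty faces of chambers\<close>

definition diff_signs :: "signs => signs => nat set" where
 "diff_signs \<alpha> \<beta> = {i \<in> {1..length \<alpha>}. \<alpha> ! (i - 1) \<noteq> \<beta> ! (i - 1)}"

text \<open>Two chambers meet where the coordinates on which they disagree vanish, so the second
  chamber can be traded for further hyperplanes.\<close>

lemma chamber_Int_hyp:
 assumes "length \<alpha> = n" "length \<beta> = n"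
 shows "chamber A \<alpha> \<inter> chamber A \<beta> \<inter> hyp A S = chamber A \<alpha> \<inter> hyp A (S \<union> diff_signs \<alpha> \<beta>)"
proof (intro equalityI subsetI)
 fix x assume x: "x \<in> chamber A \<alpha> \<inter> chamber A \<beta> \<inter> hyp A S"
 have "x $ (i - 1) = 0" if i: "i \<in> diff_signs \<alpha> \<beta>" for i
 proof -
  have i: "i \<in> {1..n}" "\<alpha> ! (i - 1) \<noteq> \<beta> ! (i - 1)" using i assms unfolding diff_signs_def by blast+
  have "if \<alpha> ! (i - 1) then x $ (i - 1) \<ge> 0 else x $ (i - 1) \<le> 0" "if \<beta> ! (i - 1) then x $ (i - 1) \<ge> 0 else x $ (i - 1) \<le> 0"
   using x i(1) unfolding chamber_def assms by blast+
  thus ?thesis using i(2) by (auto split: if_splits)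
 qed
 thus "x \<in> chamber A \<alpha> \<inter> hyp A (S \<union> diff_signs \<alpha> \<beta>)" using x unfolding hyp_def by blast
next
 fix x assume x: "x \<in> chamber A \<alpha> \<inter> hyp A (S \<union> diff_signs \<alpha> \<beta>)"
 have "if \<beta> ! (i - 1) then x $ (i - 1) \<ge> 0 else x $ (i - 1) \<le> 0" if i: "i \<in> {1..n}" for i
 proof (cases "\<alpha> ! (i - 1) = \<beta> ! (i - 1)")
  case True
  have "if \<alpha> ! (i - 1) then x $ (i - 1) \<ge> 0 else x $ (i - 1) \<le> 0" using x i unfolding chamber_def assms by blast
  thus ?thesis unfolding True .
 next
  case False
  hence "i \<in> diff_signs \<alpha> \<beta>" using i unfolding diff_signs_def assms by blast
  hence "x $ (i - 1) = 0" using x unfolding hyp_def by blast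
  thus ?thesis by simp
 qed
 hence "x \<in> chamber A \<beta>" using x unfolding chamber_def assms by blast
 thus "x \<in> chamber A \<alpha> \<inter> chamber A \<beta> \<inter> hyp A S" using x unfolding hyp_def by blast
qed

context cyc
begin

text \<open>If \<open>Z\<close> covers an interval between unoccupied positions a and b, reversing
  the signs of \<alpha> there keeps its changes and adds one at a, so the new sign vector is
  infeasible; yet every point of the face would lie in its chamber. Without such an interval,
  \<open>matching\<close> puts \<open>Z\<close> inside k hyperplanes whose vertex lies in the
  face.\<close>

lemma face_empty_iff:
 assumes l: "length \<alpha> = n" and c: "card (sc \<alpha>) = k" and Z: "Z \<subseteq> {1..n}"
 shows "chamber A \<alpha> \<inter> hyp A Z = {} \<longleftrightarrow> bad n (sc \<alpha>) Z"
proof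
 let ?X = "sc \<alpha>"
 assume "bad n ?X Z"
 then obtain a b where ab: "a < b" "b \<le> n" "a \<notin> ?X" "b \<notin> ?X" "{a<..b} \<subseteq> Z" unfolding bad_def by blast
 define \<beta> where "\<beta> = map (\<lambda>j. if a \<le> j \<and> j < b then \<not> \<alpha> ! j else \<alpha> ! j) [0..<n]"
 have lb: "length \<beta> = n" and nth: "j < n ==> \<beta> ! j = (if a \<le> j \<and> j < b then \<not> \<alpha> ! j else \<alpha> ! j)" for j
  by (simp_all add: \<beta>_def)
 have "insert a ?X \<subseteq> sc \<beta>"
 proof
  fix i assume i: "i \<in> insert a ?X"
  hence "i < n" using ab sign_changes_subset[of \<alpha>] l by auto
  show "i \<in> sc \<beta>"
  proof (cases i)
   case 0
   thus ?thesis using i ab \<open>i < n\<close> sign_changes_0[of \<alpha>] sign_changes_0[of \<beta>] nth[of 0] l lb by auto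
  next
   case (Suc j)
   hence j: "Suc j < n" "j < n" using \<open>i < n\<close> by simp_all
   have ne: "Suc j \<in> ?X ==> Suc j \<noteq> a \<and> Suc j \<noteq> b" using ab by auto
   have "\<beta> ! j \<noteq> \<beta> ! Suc j"
   proof (cases "Suc j \<in> ?X")
    case True
    hence "\<alpha> ! j \<noteq> \<alpha> ! Suc j" using sign_changes_Suc[of j \<alpha>] j l by simp
    moreover have "a \<le> j \<and> j < b \<longleftrightarrow> a \<le> Suc j \<and> Suc j < b" using ne[OF True] ab(1) by auto
    ultimately show ?thesis unfolding nth[OF j(1)] nth[OF j(2)] by auto
   next
    case False
    hence "a = Suc j" using i Suc by auto
    moreover have "\<alpha> ! j = \<alpha> ! Suc j" using False sign_changes_Suc[of j \<alpha>] j l by simp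
    ultimately show ?thesis unfolding nth[OF j(1)] nth[OF j(2)] using ab(1) by auto
   qed
   thus ?thesis using sign_changes_Suc[of j \<beta>] j lb Suc by simp
  qed
 qed
 hence "card (insert a ?X) \<le> card (sc \<beta>)" by (intro card_mono) auto
 hence empty: "chamber A \<beta> = {}" using infeasible[OF lb] c ab(3) by simp
 have "x \<in> chamber A \<beta>" if x: "x \<in> chamber A \<alpha> \<inter> hyp A Z" for x
 proof -
  have "diff_signs \<alpha> \<beta> \<subseteq> Z"
  proof
   fix i assume i: "i \<in> diff_signs \<alpha> \<beta>"
   then obtain j where j: "i = Suc j" "j < n" "\<alpha> ! j \<noteq> \<beta> ! j" unfolding diff_signs_def l by (cases i) auto
   hence "a \<le> j \<and> j < b" unfolding nth[OF j(2)] by presburger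
   hence "i \<in> {a<..b}" using j(1) by auto
   thus "i \<in> Z" using ab(5) by blast
  qed
  hence "Z \<union> diff_signs \<alpha> \<beta> = Z" by blast
  thus ?thesis using chamber_Int_hyp[OF l lb, of A Z] x by auto
 qed
 thus "chamber A \<alpha> \<inter> hyp A Z = {}" using empty by blast
next
 let ?X = "sc \<alpha>"
 assume empty: "chamber A \<alpha> \<inter> hyp A Z = {}"
 show "bad n ?X Z"
 proof (rule ccontr)
  assume nb: "\<not> bad n ?X Z"
  have Xn: "?X \<subseteq> {..<n}" using sign_changes_subset[of \<alpha>] l by simp
  obtain I where I: "I \<subseteq> {..<n}" "card I = card ?X" "\<And>j. Suc j \<in> Z ==> j \<in> I"
   "\<And>j. j < n ==> j \<notin> I ==> card (?X \<inter> {..j}) = card (I \<inter> {..<j})"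
   using matching[OF Xn nb Z] by blast
  obtain x where x: "x \<in> aeta A" "\<And>i. i \<in> I ==> x $ i = 0" "\<And>j. j < n ==> j \<notin> I ==> 0 < sg (card (I \<inter> {..<j})) * x $ j"
   using eta_point[of I] I(1,2) c by metis
  have "0 \<le> sg (card (?X \<inter> {..j})) * x $ j" if "j < n" for j
   using x(2)[of j] x(3)[OF that] I(4)[OF that] by (cases "j \<in> I") (auto intro: less_imp_le)
  hence "x \<in> chamber A \<alpha>" using x(1) chamber_iff[OF l] by blast
  moreover have "x $ (i - 1) = 0" if "i \<in> Z" for i
  proof -
   have "Suc (i - 1) = i" using subsetD[OF Z that] by simp
   thus ?thesis using I(3)[of "i - 1"] x(2) that by simp
  qed
  hence "x \<in> hyp A Z" unfolding hyp_def using x(1) by blast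
  ultimately show False using empty by blast
 qed
qed

lemma gone_iff:
 assumes "\<alpha> \<in> BF n A" "\<beta> \<in> BF n A" "S \<subseteq> {1..n}"
 shows "gone A \<alpha> \<beta> S \<longleftrightarrow> bad n (sc \<alpha>) (S \<union> diff_signs \<alpha> \<beta>)"
proof -
 have l: "length \<alpha> = n" "card (sc \<alpha>) = k" "length \<beta> = n" using assms BF_iff by blast+
 have "S \<union> diff_signs \<alpha> \<beta> \<subseteq> {1..n}" using assms(3) l(1) unfolding diff_signs_def by blast
 thus ?thesis unfolding gone_def chamber_Int_hyp[OF l(1,3)] by (rule face_empty_iff[OF l(1,2)])
qed

end

section \<open>The restricted arrangement\<close>

lemma lin_Suc: "lin (Suc k) a y j = y 0 * a 0 j + lin k (\<lambda>i. a (Suc i)) (\<lambda>i. y (Suc i)) j"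
 by (simp add: lin_def sum.lessThan_Suc_shift del: sum.lessThan_Suc)

lemma lin_tail: "lin k a y (Suc j) = lin k (tail_cols a) y j"
 by (simp add: lin_def)

lemma vec_Suc_vCons: "vec (Suc n) f = vCons (f 0) (vec n (\<lambda>j. f (Suc j)))"
 unfolding vec_Suc by (simp add: o_def)

text \<open>The normalisation makes the first coordinate of the space a unit column, so restriction
  removes one row and one column. In the graph of \<xi> this column stands right after column 0,
  which costs a sign for the minors that use column 0; in the bordered matrix its entry 1 lies in
  row 1, which costs a sign for all minors. Negating \<xi> and \<eta> cancels these signs; this is
  why the restriction is replaced by its opposite.\<close>

lemma restriction_cyc:
 assumes "cyc (Suc n) (Suc k) A C w"
 shows "cyc n k (opposite (first_restriction A))
  (\<lambda>i j. if j = 0 then - C (Suc i) 0 else C (Suc i) (Suc j)) (\<lambda>j. - w (Suc j))" (is "cyc n k ?A ?C ?w")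
proof -
 interpret A: cyc "Suc n" "Suc k" A C w by (rule assms)
 let ?D = "\<lambda>i j. C (Suc i) (if j = 0 then 0 else Suc j)"
 let ?B = "\<lambda>i j. C (Suc i) (Suc (Suc j))"
 have kn: "Suc k \<le> n" using A.kn by simp
 have tB: "tail_cols ?C = ?B" by simp
 have C: "tpos (Suc n) k ?C"
  unfolding tpos_def
 proof (intro allI impI, elim conjE)
  fix K assume K: "K \<subseteq> {..<Suc n}" "card K = k"
  have fK: "finite K" using K(1) finite_subset by blast
  let ?f = "\<lambda>j. if j = 0 then 0 else Suc j"
  have f: "strict_mono ?f" by (rule strict_monoI) auto
  let ?K = "insert 1 (?f ` K)"
  have 1: "1 \<notin> ?f ` K" by auto
  have "card (?f ` K) = k" using card_image[OF strict_mono_imp_inj_on[OF f]] K(2) by simp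
  hence cK: "card ?K = Suc k" "finite ?K" using card_insert_disjoint[OF finite_imageI[OF fK] 1] fK by (simp_all only: finite_insert finite_imageI)
  have sK: "?K \<subseteq> {..<Suc (Suc n)}" using K(1) kn by auto
  have u: "C i 1 = (if i = 0 then 1 else 0)" if "i < Suc k" for i using A.normalized[OF that, of 0] by simp
  have "mnr C (Suc k) ?K = sg (0 + card (?K \<inter> {..<1})) * mnr (\<lambda>i. C (if i < 0 then i else Suc i)) k (?K - {1})"
   by (rule mnr_unit_column[OF cK(2,1)]) (use u in auto)
  moreover have "?K - {1} = ?f ` K" using 1 by blast
  moreover have "mnr (\<lambda>i. C (Suc i)) k (?f ` K) = mnr ?D k K" using mnr_image[OF f K(2)] by simp
  moreover have "?K \<inter> {..<1} = (if 0 \<in> K then {0} else {})" by auto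
  ultimately have eq: "mnr C (Suc k) ?K = (if 0 \<in> K then -1 else 1) * mnr ?D k K" by auto
  have "mnr ?C k K = (if 0 \<in> K then -1 else 1) * mnr ?D k K"
  proof (cases "0 \<in> K")
   case True
   have "mnr ?C k K = mnr (\<lambda>i j. if j = 0 then - ?D i j else ?D i j) k K" by (rule mnr_cong[OF _ K(2)]) auto
   thus ?thesis using mnr_uminus_column[OF fK K(2) True, of ?D] True by simp
  next
   case False
   have "mnr ?C k K = mnr ?D k K" by (rule mnr_cong[OF _ K(2)]) (use False in \<open>auto split: if_splits\<close>)
   thus ?thesis using False by simp
  qed
  thus "0 < mnr ?C k K" using eq tposD[OF A.C sK cK(1)] by simp
 qed
 have N: "tpos n (Suc k) (brd ?w ?B)"
  unfolding tpos_def
 proof (intro allI impI, elim conjE)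
  fix K assume K: "K \<subseteq> {..<n}" "card K = Suc k"
  have fK: "finite K" using K(1) finite_subset by blast
  let ?K = "insert 0 (Suc ` K)"
  have K': "finite ?K" "card ?K = Suc (Suc k)" "?K \<subseteq> {..<Suc n}" using fK K by (auto simp: card_image)
  have u: "brd w A.B i 0 = (if i = 1 then 1 else 0)" if "i < Suc (Suc k)" for i
  proof (cases i)
   case 0 thus ?thesis using A.w0[of 0] by simp
  next
   case (Suc i') thus ?thesis using A.normalized[of i' 0] that by simp
  qed
  have "mnr (brd w A.B) (Suc (Suc k)) ?K = sg (1 + card (?K \<inter> {..<0})) * mnr (\<lambda>i. brd w A.B (if i < 1 then i else Suc i)) (Suc k) (?K - {0})"
   by (rule mnr_unit_column[OF K'(1,2)]) (use u in auto)
  moreover have "?K - {0} = Suc ` K" by auto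
  moreover have "mnr (\<lambda>i. brd w A.B (if i < 1 then i else Suc i)) (Suc k) (Suc ` K) = mnr (brd (\<lambda>j. w (Suc j)) ?B) (Suc k) K"
   unfolding mnr_Suc_image[OF K(2)] by (rule mnr_cong[OF _ K(2)]) (auto simp: brd_def split: nat.splits)
  ultimately have "mnr (brd w A.B) (Suc (Suc k)) ?K = - mnr (brd (\<lambda>j. w (Suc j)) ?B) (Suc k) K" by simp
  also have "\<dots> = mnr (brd ?w ?B) (Suc k) K" unfolding mnr_brd[OF fK K(2)] by (simp add: sum_negf)
  finally show "0 < mnr (brd ?w ?B) (Suc k) K" using A.border_pos[OF K'(3,2)] by simp
 qed
 have l0: "lin (Suc k) A.B y 0 = y 0" for y
  unfolding lin_Suc using A.normalized[of 0 0] A.normalized[of "Suc _" 0] by (simp add: lin_def)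
 have lv: "vec (Suc n) (lin (Suc k) A.B y) = vCons (y 0) (vec n (\<lambda>j. y 0 * C 0 (Suc (Suc j)) + lin k ?B (\<lambda>i. y (Suc i)) j))" for y
  unfolding vec_Suc_vCons l0 by (simp add: lin_Suc lin_tail)
 have V: "aspace ?A = rsp n k ?B"
 proof -
  have "vCons 0 v \<in> rsp (Suc n) (Suc k) A.B \<longleftrightarrow> v \<in> rsp n k ?B" for v
  proof
   assume "vCons 0 v \<in> rsp (Suc n) (Suc k) A.B"
   then obtain y where "vCons 0 v = vCons (y 0) (vec n (\<lambda>j. y 0 * C 0 (Suc (Suc j)) + lin k ?B (\<lambda>i. y (Suc i)) j))"
    unfolding rsp_def lv by blast
   hence "v = vec n (lin k ?B (\<lambda>i. y (Suc i)))" by simp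
   thus "v \<in> rsp n k ?B" using rspI by simp
  next
   assume "v \<in> rsp n k ?B"
   then obtain y where "v = vec n (lin k ?B y)" unfolding rsp_def by blast
   hence "vCons 0 v = vec (Suc n) (lin (Suc k) A.B (case_nat 0 y))" unfolding lv by simp
   thus "vCons 0 v \<in> rsp (Suc n) (Suc k) A.B" using rspI by metis
  qed
  thus ?thesis unfolding opposite_def first_restriction_def by (auto simp: A.V)
 qed
 have V0: "aspace (first_restriction A) = rsp n k ?B" using V by (simp add: opposite_def)
 have xi: "axi ?A (vec n (lin k ?B y)) = lin k ?C y 0" for y
 proof -
  have "vCons 0 (vec n (lin k ?B y)) = vec (Suc n) (lin (Suc k) A.B (case_nat 0 y))" unfolding lv by simp
  hence "axi A (vCons 0 (vec n (lin k ?B y))) = lin (Suc k) C (case_nat 0 y) 0" using A.xi by simp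
  also have "\<dots> = - lin k ?C y 0" unfolding lin_Suc by (simp add: lin_def sum_negf)
  finally have 1: "axi A (vCons 0 (vec n (lin k ?B y))) = - lin k ?C y 0" .
  have m: "vec n (lin k ?B y) \<in> aspace (first_restriction A)" unfolding V0 by (rule rspI)
  hence "vec n (lin k ?B y) \<in> vCons 0 -` aspace A" by (simp add: first_restriction_def)
  hence "axi (first_restriction A) (vec n (lin k ?B y)) = - lin k ?C y 0" using 1 by (simp add: first_restriction_def)
  thus ?thesis using m by (simp add: opposite_def)
 qed
 have r: "x \<in> aeta (first_restriction A) \<longleftrightarrow> (\<exists>v\<in>rsp n k ?B. x = vec n (\<lambda>j. w (Suc j)) + v)" for x
 proof
  assume "x \<in> aeta (first_restriction A)"
  hence "vCons 0 x \<in> aeta A" by (simp add: first_restriction_def)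
  then obtain y where y: "vCons 0 x = vec (Suc n) w + vec (Suc n) (lin (Suc k) A.B y)" unfolding A.eta A.V rsp_def by blast
  have "y 0 = 0" using arg_cong[OF y, of "\<lambda>v. v $ 0"] A.w0[of 0] l0[of y] by simp
  have "x = vec n (\<lambda>j. w (Suc j)) + vec n (lin k ?B (\<lambda>i. y (Suc i)))"
  proof (rule eq_vecI)
   show "dim_vec x = dim_vec (vec n (\<lambda>j. w (Suc j)) + vec n (lin k ?B (\<lambda>i. y (Suc i))))"
    using arg_cong[OF y, of dim_vec] by simp
   fix j assume "j < dim_vec (vec n (\<lambda>j. w (Suc j)) + vec n (lin k ?B (\<lambda>i. y (Suc i))))"
   hence j: "j < n" by simp
   thus "x $ j = (vec n (\<lambda>j. w (Suc j)) + vec n (lin k ?B (\<lambda>i. y (Suc i)))) $ j"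
    using arg_cong[OF y, of "\<lambda>v. v $ Suc j"] arg_cong[OF y, of dim_vec] \<open>y 0 = 0\<close> by (simp add: lin_Suc lin_tail)
  qed
  thus "\<exists>v\<in>rsp n k ?B. x = vec n (\<lambda>j. w (Suc j)) + v" using rspI by blast
 next
  assume "\<exists>v\<in>rsp n k ?B. x = vec n (\<lambda>j. w (Suc j)) + v"
  then obtain v where v: "v \<in> aspace (first_restriction A)" "x = vec n (\<lambda>j. w (Suc j)) + v" unfolding V0 by blast
  have vc: "v \<in> carrier_vec n" using v(1) unfolding V0 by (rule rsp_carrier)
  have "vCons 0 x = vec (Suc n) w + vCons 0 v"
  proof (rule eq_vecI)
   fix j assume "j < dim_vec (vec (Suc n) w + vCons 0 v)"
   thus "vCons 0 x $ j = (vec (Suc n) w + vCons 0 v) $ j" using A.w0[of 0] vc v(2) by (cases j) simp_all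
  qed (use vc v(2) in simp)
  moreover have "vCons 0 v \<in> aspace A" using v(1) by (simp add: first_restriction_def)
  ultimately have "vCons 0 x \<in> aeta A" unfolding A.eta by blast
  thus "x \<in> aeta (first_restriction A)" by (simp add: first_restriction_def)
 qed
 have eta: "aeta ?A = {vec n ?w + v | v. v \<in> aspace ?A}"
 proof (intro equalityI subsetI)
  fix x assume "x \<in> aeta ?A"
  then obtain x' where x': "x = - x'" "x' \<in> aeta (first_restriction A)" by (auto simp: opposite_def)
  then obtain v where v: "v \<in> rsp n k ?B" "x' = vec n (\<lambda>j. w (Suc j)) + v" unfolding r by blast
  have "x = vec n ?w + (-1) \<cdot>\<^sub>v v" using x'(1) v(2) rsp_carrier[OF v(1)] by (intro eq_vecI) auto
  thus "x \<in> {vec n ?w + v | v. v \<in> aspace ?A}" unfolding V using rsp_smult[OF v(1)] by blast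
 next
  fix x assume "x \<in> {vec n ?w + v | v. v \<in> aspace ?A}"
  then obtain v where v: "v \<in> rsp n k ?B" "x = vec n ?w + v" unfolding V by blast
  have "vec n (\<lambda>j. w (Suc j)) + (-1) \<cdot>\<^sub>v v \<in> aeta (first_restriction A)" unfolding r using rsp_smult[OF v(1)] by blast
  moreover have "x = - (vec n (\<lambda>j. w (Suc j)) + (-1) \<cdot>\<^sub>v v)" using v(2) rsp_carrier[OF v(1)] by (intro eq_vecI) auto
  ultimately show "x \<in> aeta ?A" by (simp add: opposite_def)
 qed
 show ?thesis
 proof
  show "axi ?A \<in> extensional (aspace ?A)" by (simp add: opposite_def)
  show "(if Suc j = 0 then - C (Suc i) 0 else C (Suc i) (Suc (Suc j))) = (if i = j then 1 else 0)" if "i < k" "j < k" for i j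
   using A.normalized[of "Suc i" "Suc j"] that by simp
  show "- w (Suc j) = 0" if "j < k" for j using A.w0[of "Suc j"] that by simp
  show "aspace ?A = rsp n k (tail_cols ?C)" unfolding tB by (rule V)
  show "tpos n (Suc k) (brd ?w (tail_cols ?C))" unfolding tB by (rule N)
  show "axi ?A (vec n (lin k (tail_cols ?C) y)) = lin k ?C y 0" for y unfolding tB by (rule xi)
 qed (use kn C eta in blast)+
qed

section \<open>Deletion, restriction and sign change\<close>

lemma uvar_frag: "uvar i = frag_of (single i 1)" by (simp add: uvar_def)

lemma sep_memI: "i \<in> sep \<alpha> \<beta> \<gamma> \<longleftrightarrow> i \<in> {1..length \<alpha>} \<and> \<alpha> ! (i - 1) = \<gamma> ! (i - 1) \<and> \<alpha> ! (i - 1) \<noteq> \<beta> ! (i - 1)"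
 by (simp add: sep_def)

lemma sep_Cons: "sep (True # \<alpha>) (True # \<beta>) (True # \<gamma>) = Suc ` sep \<alpha> \<beta> \<gamma>"
proof (rule Set.set_eqI)
 fix i
 show "i \<in> sep (True # \<alpha>) (True # \<beta>) (True # \<gamma>) \<longleftrightarrow> i \<in> Suc ` sep \<alpha> \<beta> \<gamma>"
 proof (cases i)
  case (Suc j)
  have "Suc j \<in> Suc ` sep \<alpha> \<beta> \<gamma> \<longleftrightarrow> j \<in> sep \<alpha> \<beta> \<gamma>" by auto
  thus ?thesis unfolding Suc sep_memI by (cases j) simp_all
 qed (auto simp: sep_def)
qed

lemma sep_map_Not:
 "length \<alpha> = n ==> length \<beta> = n ==> length \<gamma> = n ==> sep (map Not \<alpha>) (map Not \<beta>) (map Not \<gamma>) = sep \<alpha> \<beta> \<gamma>"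
 by (auto simp: sep_def)

lemma chamber_D: "x \<in> chamber A \<alpha> ==> j < length \<alpha> ==> if \<alpha> ! j then x $ j \<ge> 0 else x $ j \<le> 0"
proof -
 assume x: "x \<in> chamber A \<alpha>" and j: "j < length \<alpha>"
 hence "Suc j \<in> {1..length \<alpha>}" by auto
 hence "if \<alpha> ! (Suc j - 1) then x $ (Suc j - 1) \<ge> 0 else x $ (Suc j - 1) \<le> 0" using x unfolding chamber_def by blast
 thus ?thesis by (simp only: diff_Suc_1)
qed

lemma chamber_I:
 assumes x: "x \<in> aeta A" and j: "\<And>j. j < length \<alpha> ==> if \<alpha> ! j then x $ j \<ge> 0 else x $ j \<le> 0" shows "x \<in> chamber A \<alpha>"
proof -
 have "if \<alpha> ! (i - 1) then x $ (i - 1) \<ge> 0 else x $ (i - 1) \<le> 0" if "i \<in> {1..length \<alpha>}" for i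
  by (rule j) (use that in auto)
 thus ?thesis using x unfolding chamber_def by blast
qed

lemma chamber_aeta: "x \<in> chamber A \<alpha> ==> x \<in> aeta A" by (simp add: chamber_def)

lemma opposite_chamber:
 assumes "length \<alpha> = n" "\<And>x. x \<in> aeta A ==> x \<in> carrier_vec n"
 shows "x \<in> chamber A \<alpha> ==> - x \<in> chamber (opposite A) (map Not \<alpha>)"
proof (rule chamber_I)
 assume x: "x \<in> chamber A \<alpha>"
 hence xA: "x \<in> aeta A" "x \<in> carrier_vec n" using assms(2) chamber_aeta by blast+
 thus "- x \<in> aeta (opposite A)" by (simp add: opposite_def)
 show "if map Not \<alpha> ! j then (- x) $ j \<ge> 0 else (- x) $ j \<le> 0" if "j < length (map Not \<alpha>)" for j
  using chamber_D[OF x, of j] that xA(2) assms(1) by (cases "\<alpha> ! j") auto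
qed

lemma bounded_signsI:
 assumes "\<And>x v. x \<in> aeta A ==> v \<in> aspace A ==> f (x + v) = f x + axi A v" "f ` chamber A \<alpha> \<subseteq> D" "bdd_above D"
 shows "bounded_signs A \<alpha>"
 unfolding bounded_signs_def using assms(1) bdd_above_mono[OF assms(3,2)] by blast

text \<open>Restriction and sign change both turn feasible and bounded sign vectors into such by pulling
 back the affine functional.\<close>

lemma opposite_bounded:
 assumes c: "\<And>x. x \<in> aeta A ==> x \<in> carrier_vec n" and a: "\<And>v. v \<in> aspace A ==> v \<in> carrier_vec n \<and> - v \<in> aspace A \<and> axi A (- v) = - axi A v"
  and l: "length \<alpha> = n" and b: "bounded_signs (opposite A) (map Not \<alpha>)"
 shows "bounded_signs A \<alpha>"
proof -
 obtain f where f: "\<And>x v. x \<in> aeta (opposite A) ==> v \<in> aspace (opposite A) ==> f (x + v) = f x + axi (opposite A) v"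
  and bd: "bdd_above (f ` chamber (opposite A) (map Not \<alpha>))" using b unfolding bounded_signs_def by blast
 have "f (- (x + v)) = f (- x) + axi A v" if x: "x \<in> aeta A" and v: "v \<in> aspace A" for x v
 proof -
  have "- (x + v) = - x + - v" using c[OF x] a[OF v] by (intro eq_vecI) auto
  moreover have "axi (opposite A) (- v) = axi A v" using a[OF v] by (simp add: opposite_def)
  moreover have "- x \<in> aeta (opposite A)" "- v \<in> aspace (opposite A)" using x a[OF v] by (simp_all add: opposite_def)
  ultimately show ?thesis using f[of "- x" "- v"] by simp
 qed
 moreover have "(\<lambda>x. f (- x)) ` chamber A \<alpha> \<subseteq> f ` chamber (opposite A) (map Not \<alpha>)"
  using opposite_chamber[OF l c] by blast
 ultimately show ?thesis by (intro bounded_signsI[where f = "\<lambda>x. f (- x)", OF _ _ bd])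
qed

locale restriction_data =
 fixes n k :: nat and V Vh :: arrangement
 assumes lcV: "left_cyclic n (k + 1) V" and lcVh: "left_cyclic (n + 1) (k + 1) Vh" and del: "first_deletion Vh = V"
begin

abbreviation "V' \<equiv> first_restriction Vh"

lemma left_cyclic_V'': "left_cyclic n k (V'' Vh)"
proof -
 obtain C w where "cyc (Suc n) (Suc k) Vh C w" using left_cyclic_cyc[OF lcVh] by auto
 from restriction_cyc[OF this] show ?thesis by (rule cyc.left_cyclic)
qed

lemma BF_V: "\<alpha> \<in> BF n V \<longleftrightarrow> length \<alpha> = n \<and> card (sc \<alpha>) = k + 1"
 using left_cyclic_cyc[OF lcV] cyc.BF_iff by metis

lemma BF_Vh: "\<alpha> \<in> BF (n + 1) Vh \<longleftrightarrow> length \<alpha> = n + 1 \<and> card (sc \<alpha>) = k + 1"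
 using left_cyclic_cyc[OF lcVh] cyc.BF_iff by metis

lemma BF_V'': "\<alpha> \<in> BF n (V'' Vh) \<longleftrightarrow> length \<alpha> = n \<and> card (sc \<alpha>) = k"
 using left_cyclic_cyc[OF left_cyclic_V''] cyc.BF_iff by metis

lemma aeta_Vh: "x \<in> aeta Vh ==> x \<in> carrier_vec (n + 1)"
 using left_cyclic_cyc[OF lcVh] cyc.eta_carrier by metis

lemma aeta_V': "x \<in> aeta V' ==> x \<in> carrier_vec n"
 using aeta_Vh[of "vCons 0 x"] by (simp add: first_restriction_def)

lemma aspace_Vh: "v \<in> aspace Vh ==> v \<in> carrier_vec (n + 1)"
 using left_cyclic_cyc[OF lcVh] cyc.V_carrier by metis

lemma aspace_V': "v \<in> aspace V' ==> v \<in> carrier_vec n \<and> - v \<in> aspace V' \<and> axi V' (- v) = - axi V' v"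
proof -
 obtain C w where "cyc (n + 1) (k + 1) Vh C w" using left_cyclic_cyc[OF lcVh] by auto
 then interpret cyc "n + 1" "k + 1" Vh C w .
 assume v: "v \<in> aspace V'"
 hence v': "vCons 0 v \<in> aspace Vh" by (simp add: first_restriction_def)
 have vc: "v \<in> carrier_vec n" using aspace_Vh[OF v'] by simp
 have "vCons 0 (- v) = (-1) \<cdot>\<^sub>v vCons 0 v"
 proof (rule eq_vecI)
  fix i assume "i < dim_vec ((-1) \<cdot>\<^sub>v vCons 0 v)"
  thus "vCons 0 (- v) $ i = ((-1) \<cdot>\<^sub>v vCons 0 v) $ i" by (cases i) simp_all
 qed simp
 moreover have "(-1) \<cdot>\<^sub>v vCons 0 v \<in> aspace Vh" using v' unfolding V by (rule rsp_smult)
 ultimately have "- v \<in> aspace V'" "axi Vh (vCons 0 (- v)) = - axi Vh (vCons 0 v)"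
  using xi_smult[OF v', of "-1"] by (simp_all add: first_restriction_def)
 thus ?thesis using v vc by (simp add: first_restriction_def)
qed

lemma chamber_vCons:
 "x \<in> chamber V' \<alpha> ==> length \<alpha> = n ==> vCons 0 x \<in> chamber Vh (b # \<alpha>)"
proof (rule chamber_I)
 assume x: "x \<in> chamber V' \<alpha>" and l: "length \<alpha> = n"
 have xA: "x \<in> aeta V'" "x \<in> carrier_vec n" using chamber_aeta[OF x] aeta_V' by blast+
 thus "vCons 0 x \<in> aeta Vh" by (simp add: first_restriction_def)
 show "if (b # \<alpha>) ! j then vCons 0 x $ j \<ge> 0 else vCons 0 x $ j \<le> 0" if "j < length (b # \<alpha>)" for j
 proof (cases j)
  case (Suc i)
  thus ?thesis using chamber_D[OF x, of i] that xA(2) l by simp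
 qed simp
qed

lemma bounded_V':
 assumes "length \<alpha> = n" "bounded_signs Vh (b # \<alpha>)" shows "bounded_signs V' \<alpha>"
proof -
 obtain f where f: "\<And>x v. x \<in> aeta Vh ==> v \<in> aspace Vh ==> f (x + v) = f x + axi Vh v"
  and bd: "bdd_above (f ` chamber Vh (b # \<alpha>))" using assms(2) unfolding bounded_signs_def by blast
 have "f (vCons 0 (x + v)) = f (vCons 0 x) + axi V' v" if x: "x \<in> aeta V'" and v: "v \<in> aspace V'" for x v
 proof -
  have "vCons 0 (x + v) = vCons 0 x + vCons 0 v"
  proof (rule eq_vecI)
   fix i assume "i < dim_vec (vCons 0 x + vCons 0 v)"
   thus "vCons 0 (x + v) $ i = (vCons 0 x + vCons 0 v) $ i" using aeta_V'[OF x] aspace_V'[OF v] by (cases i) simp_all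
  qed simp
  thus ?thesis using f[of "vCons 0 x" "vCons 0 v"] x v by (simp add: first_restriction_def)
 qed
 moreover have "(\<lambda>x. f (vCons 0 x)) ` chamber V' \<alpha> \<subseteq> f ` chamber Vh (b # \<alpha>)" using chamber_vCons assms(1) by blast
 ultimately show ?thesis by (intro bounded_signsI[where f = "\<lambda>x. f (vCons 0 x)", OF _ _ bd])
qed

lemma aeta_opp: "x \<in> aeta (V'' Vh) ==> - x \<in> aeta V'"
 using aeta_V' by (auto simp: opposite_def)

lemma chamber_opp: "x \<in> chamber (V'' Vh) (map Not \<alpha>) ==> length \<alpha> = n ==> - x \<in> chamber V' \<alpha>"
proof (rule chamber_I)
 assume x: "x \<in> chamber (V'' Vh) (map Not \<alpha>)" and l: "length \<alpha> = n"
 show "- x \<in> aeta V'" using chamber_aeta[OF x] by (rule aeta_opp)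
 hence "x \<in> carrier_vec n" using aeta_V'[of "- x"] by (metis carrier_vecD carrier_vecI index_uminus_vec(2))
 thus "if \<alpha> ! j then (- x) $ j \<ge> 0 else (- x) $ j \<le> 0" if "j < length \<alpha>" for j
  using chamber_D[OF x, of j] that l by (cases "\<alpha> ! j") auto
qed

lemma BF_opp: "length \<alpha> = n ==> \<alpha> \<in> BF n V' \<longleftrightarrow> map Not \<alpha> \<in> BF n (V'' Vh)"
proof
 assume l: "length \<alpha> = n" and "\<alpha> \<in> BF n V'"
 hence a: "chamber V' \<alpha> \<noteq> {}" "bounded_signs V' \<alpha>" unfolding BF_def by blast+
 have "chamber (V'' Vh) (map Not \<alpha>) \<noteq> {}" using a(1) opposite_chamber[OF l aeta_V'] by blast
 moreover have "bounded_signs (V'' Vh) (map Not \<alpha>)"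
 proof -
  obtain f where f: "\<And>x v. x \<in> aeta V' ==> v \<in> aspace V' ==> f (x + v) = f x + axi V' v"
   and bd: "bdd_above (f ` chamber V' \<alpha>)" using a(2) unfolding bounded_signs_def by blast
  have "f (- (x + v)) = f (- x) + axi (V'' Vh) v" if x: "x \<in> aeta (V'' Vh)" and v: "v \<in> aspace (V'' Vh)" for x v
  proof -
   have v': "v \<in> aspace V'" using v by (simp add: opposite_def)
   have "x \<in> carrier_vec n" using aeta_V'[OF aeta_opp[OF x]] by (metis carrier_vecD carrier_vecI index_uminus_vec(2))
   hence "- (x + v) = - x + - v" using aspace_V'[OF v'] by (intro eq_vecI) auto
   thus ?thesis using f[OF aeta_opp[OF x], of "- v"] aspace_V'[OF v'] v' by (simp add: opposite_def)
  qed
  moreover have "(\<lambda>x. f (- x)) ` chamber (V'' Vh) (map Not \<alpha>) \<subseteq> f ` chamber V' \<alpha>" using chamber_opp l by blast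
  ultimately show ?thesis by (intro bounded_signsI[where f = "\<lambda>x. f (- x)", OF _ _ bd])
 qed
 ultimately show "map Not \<alpha> \<in> BF n (V'' Vh)" using l unfolding BF_def by simp
next
 assume l: "length \<alpha> = n" and "map Not \<alpha> \<in> BF n (V'' Vh)"
 hence a: "chamber (V'' Vh) (map Not \<alpha>) \<noteq> {}" "bounded_signs (V'' Vh) (map Not \<alpha>)" unfolding BF_def by blast+
 have "chamber V' \<alpha> \<noteq> {}" using a(1) chamber_opp l by blast
 moreover have "bounded_signs V' \<alpha>" by (rule opposite_bounded[OF aeta_V' aspace_V' l a(2)])
 ultimately show "\<alpha> \<in> BF n V'" using l unfolding BF_def by simp
qed

lemma sign_changes_Cons: "sc (True # \<alpha>) = Suc ` sc \<alpha>"
proof (rule Set.set_eqI)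
 fix i show "i \<in> sc (True # \<alpha>) \<longleftrightarrow> i \<in> Suc ` sc \<alpha>"
  by (cases i) (auto simp: sign_changes_def)
qed

text \<open>A prepended plus only shifts the sign changes by 1, and both arrangements live in
  dimension k + 1; so deletion loses no sign vector.\<close>

lemma BF_Cons: "\<alpha> \<in> BF n V \<longleftrightarrow> True # \<alpha> \<in> BF (n + 1) Vh"
 unfolding BF_V BF_Vh sign_changes_Cons by (simp add: card_image)

lemma BF_plus_Cons:
 assumes "\<alpha> \<in> BF_plus (n + 1) Vh" obtains \<alpha>' where "\<alpha> = True # \<alpha>'" "\<alpha>' \<in> BF n V"
proof -
 have "length \<alpha> = n + 1" "\<alpha> ! 0" using assms BF_Vh by blast+
 hence "\<alpha> = True # tl \<alpha>" by (cases \<alpha>) auto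
 thus thesis using that[of "tl \<alpha>"] assms BF_Cons[of "tl \<alpha>"] by simp
qed

definition e_del :: "nat => nat \<Rightarrow>\<^sub>0 nat" where "e_del j = single (j + 1) 1"
definition e_rest :: "nat => nat \<Rightarrow>\<^sub>0 nat" where "e_rest j = (if j = 1 then 0 else single (j - 1) 1)"
definition e_sign :: "nat => nat \<Rightarrow>\<^sub>0 nat" where "e_sign j = single j 1"

sublocale D: relabelling n "n + 1" V Vh "BF n V" "\<lambda>\<alpha>. True # \<alpha>" e_del
proof
 show "inj_on ((#) True) (BF n V)" by (rule inj_onI) simp
 show "inU (n + 1) (e_del i)" if "1 \<le> i" "i \<le> n" for i using that by (simp add: e_del_def inU_def)
 show "(\<Sum>i\<in>sep \<alpha> \<beta> \<gamma>. e_del i) = expo (sep (True # \<alpha>) (True # \<beta>) (True # \<gamma>))" for \<alpha> \<beta> \<gamma>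
  unfolding sep_Cons expo_def by (simp add: sum.reindex e_del_def)
 show "gone Vh (True # \<alpha>) (True # \<beta>) (\<Union>i\<in>S. keys (e_del i))"
  if a: "\<alpha> \<in> BF n V" "\<beta> \<in> BF n V" and S: "S \<subseteq> {1..n}" and g: "gone V \<alpha> \<beta> S" for \<alpha> \<beta> S
  unfolding gone_def
 proof (rule ccontr)
  assume "chamber Vh (True # \<alpha>) \<inter> chamber Vh (True # \<beta>) \<inter> hyp Vh (\<Union>i\<in>S. keys (e_del i)) \<noteq> {}"
  then obtain x where x: "x \<in> chamber Vh (True # \<alpha>)" "x \<in> chamber Vh (True # \<beta>)" "x \<in> hyp Vh (\<Union>i\<in>S. keys (e_del i))" by blast
  have xc: "x \<in> carrier_vec (n + 1)" by (rule aeta_Vh[OF chamber_aeta[OF x(1)]])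
  have ix: "forget_first x $ j = x $ Suc j" if "j < n" for j using xc that by (simp add: forget_first_def)
  have fV: "forget_first x \<in> aeta V" using chamber_aeta[OF x(1)] del by (auto simp: first_deletion_def)
  have ch: "forget_first x \<in> chamber V \<gamma>" if "x \<in> chamber Vh (True # \<gamma>)" "\<gamma> \<in> BF n V" for \<gamma>
  proof (rule chamber_I[OF fV])
   fix j assume "j < length \<gamma>"
   thus "if \<gamma> ! j then forget_first x $ j \<ge> 0 else forget_first x $ j \<le> 0"
    using chamber_D[OF that(1), of "Suc j"] ix[of j] that(2) BF_length by simp
  qed
  have "forget_first x $ (i - 1) = 0" if i: "i \<in> S" for i
  proof -
   have "i \<in> {1..n}" using S i by blast
   then obtain j where j: "i = Suc j" "j < n" by (cases i) auto
   have "x $ (i + 1 - 1) = 0" using x(3) i unfolding hyp_def e_del_def by force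
   thus ?thesis using ix[OF j(2)] j(1) by simp
  qed
  hence "forget_first x \<in> hyp V S" using fV unfolding hyp_def by blast
  thus False using g ch[OF x(1) a(1)] ch[OF x(2) a(2)] unfolding gone_def by blast
 qed
qed (use BF_Cons in blast)+

sublocale R: relabelling "n + 1" n Vh V' "BF_plus (n + 1) Vh" tl e_rest
proof
 show "inj_on tl (BF_plus (n + 1) Vh)" by (rule inj_onI) (metis BF_plus_Cons list.sel(3))
 show "inU n (e_rest i)" if "1 \<le> i" "i \<le> n + 1" for i using that by (auto simp: e_rest_def inU_def)
 fix \<alpha> \<beta> assume a: "\<alpha> \<in> BF_plus (n + 1) Vh" "\<beta> \<in> BF_plus (n + 1) Vh"
 obtain \<alpha>' where a': "\<alpha> = True # \<alpha>'" "\<alpha>' \<in> BF n V" using BF_plus_Cons[OF a(1)] .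
 obtain \<beta>' where b': "\<beta> = True # \<beta>'" "\<beta>' \<in> BF n V" using BF_plus_Cons[OF a(2)] .
 have l: "length \<alpha>' = n" "length \<beta>' = n" using a'(2) b'(2) BF_length by blast+
 {
  fix S assume "S \<subseteq> {1..n + 1}" and g: "gone Vh \<alpha> \<beta> S"
  show "gone V' (tl \<alpha>) (tl \<beta>) (\<Union>i\<in>S. keys (e_rest i))"
   unfolding gone_def a'(1) b'(1) list.sel
  proof (rule ccontr)
   assume "chamber V' \<alpha>' \<inter> chamber V' \<beta>' \<inter> hyp V' (\<Union>i\<in>S. keys (e_rest i)) \<noteq> {}"
   then obtain x where x: "x \<in> chamber V' \<alpha>'" "x \<in> chamber V' \<beta>'" "x \<in> hyp V' (\<Union>i\<in>S. keys (e_rest i))" by blast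
   have xc: "x \<in> carrier_vec n" by (rule aeta_V'[OF chamber_aeta[OF x(1)]])
   have "vCons 0 x $ (i - 1) = 0" if i: "i \<in> S" for i
   proof (cases "i = 1")
    case False
    have "i \<in> {1..n + 1}" using i \<open>S \<subseteq> {1..n + 1}\<close> by blast
    hence "i - 1 = Suc (i - 2)" "i - 2 < n" using False by auto
    moreover have "i - 1 \<in> keys (e_rest i)" using False by (simp add: e_rest_def)
    hence "x $ (i - 1 - 1) = 0" using x(3) i unfolding hyp_def by blast
    ultimately show ?thesis using xc by simp
   qed simp
   hence "vCons 0 x \<in> hyp Vh S" using chamber_aeta[OF x(1)] unfolding hyp_def by (simp add: first_restriction_def)
   thus False using g chamber_vCons[OF x(1) l(1), of True] chamber_vCons[OF x(2) l(2), of True] a'(1) b'(1) unfolding gone_def by blast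
  qed
 }
 fix \<gamma> assume c: "\<gamma> \<in> BF_plus (n + 1) Vh"
 obtain \<gamma>' where c': "\<gamma> = True # \<gamma>'" "\<gamma>' \<in> BF n V" using BF_plus_Cons[OF c] .
 have lc: "length \<gamma>' = n" using c'(2) BF_length by blast
 have "(\<Sum>i\<in>sep \<alpha>' \<beta>' \<gamma>'. e_rest (Suc i)) = expo (sep \<alpha>' \<beta>' \<gamma>')"
  unfolding expo_def by (intro sum.cong refl) (auto simp: e_rest_def sep_def)
 thus "(\<Sum>i\<in>sep \<alpha> \<beta> \<gamma>. e_rest i) = expo (sep (tl \<alpha>) (tl \<beta>) (tl \<gamma>))"
  unfolding a'(1) b'(1) c'(1) sep_Cons by (simp add: sum.reindex)
 \<comment> \<open>Restriction can lose sign vectors, but only infeasible ones, since boundedness is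
   inherited. By \<open>chamber_sep\<close> a point of the face would lie in the lost
   chamber.\<close>
 assume out: "tl \<beta> \<notin> BF n V'"
 show "gone V' (tl \<alpha>) (tl \<gamma>) (sep (tl \<alpha>) (tl \<beta>) (tl \<gamma>))"
  unfolding gone_def a'(1) b'(1) c'(1) list.sel
 proof (rule ccontr)
  assume "chamber V' \<alpha>' \<inter> chamber V' \<gamma>' \<inter> hyp V' (sep \<alpha>' \<beta>' \<gamma>') \<noteq> {}"
  hence "chamber V' \<beta>' \<noteq> {}" using chamber_sep[OF l lc, of V'] by blast
  moreover have "bounded_signs Vh (True # \<beta>')" using a(2) b'(1) unfolding BF_def by simp
  hence "bounded_signs V' \<beta>'" by (rule bounded_V'[OF l(2)])
  ultimately show False using out l(2) b'(1) unfolding BF_def by simp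
 qed
qed blast

sublocale N: relabelling n n V' "V'' Vh" "BF n V'" "map Not" e_sign
proof
 show "inj_on (map Not) (BF n V')" by (rule inj_onI) (simp add: inj_map_eq_map inj_def)
 show "inU n (e_sign i)" if "1 \<le> i" "i \<le> n" for i using that by (simp add: e_sign_def inU_def)
 fix \<alpha> \<beta> assume a: "\<alpha> \<in> BF n V'" "\<beta> \<in> BF n V'"
 have l: "length \<alpha> = n" "length \<beta> = n" using a BF_length by blast+
 {
  fix S assume g: "gone V' \<alpha> \<beta> S" and S: "S \<subseteq> {1..n}"
  have "(\<Union>i\<in>S. keys (e_sign i)) = S" by (auto simp: e_sign_def)
  moreover have "gone (V'' Vh) (map Not \<alpha>) (map Not \<beta>) S"
   unfolding gone_def
  proof (rule ccontr)
   assume "chamber (V'' Vh) (map Not \<alpha>) \<inter> chamber (V'' Vh) (map Not \<beta>) \<inter> hyp (V'' Vh) S \<noteq> {}"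
   then obtain x where x: "x \<in> chamber (V'' Vh) (map Not \<alpha>)" "x \<in> chamber (V'' Vh) (map Not \<beta>)" "x \<in> hyp (V'' Vh) S" by blast
   have "- x \<in> aeta V'" by (rule aeta_opp[OF chamber_aeta[OF x(1)]])
   moreover from this have "dim_vec x = n" using aeta_V'[of "- x"] carrier_vecD by fastforce
   hence "(- x) $ (i - 1) = 0" if "i \<in> S" for i
   proof -
    have "i - 1 < n" using subsetD[OF S that] by auto
    thus ?thesis using \<open>dim_vec x = n\<close> x(3) that unfolding hyp_def by simp
   qed
   ultimately have "- x \<in> hyp V' S" unfolding hyp_def by blast
   thus False using g chamber_opp[OF x(1) l(1)] chamber_opp[OF x(2) l(2)] unfolding gone_def by blast
  qed
  ultimately show "gone (V'' Vh) (map Not \<alpha>) (map Not \<beta>) (\<Union>i\<in>S. keys (e_sign i))" by simp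
 }
 fix \<gamma> assume c: "\<gamma> \<in> BF n V'"
 show "(\<Sum>i\<in>sep \<alpha> \<beta> \<gamma>. e_sign i) = expo (sep (map Not \<alpha>) (map Not \<beta>) (map Not \<gamma>))"
  unfolding sep_map_Not[OF l BF_length[OF c]] by (simp add: expo_def e_sign_def)
 assume "map Not \<beta> \<notin> BF n (V'' Vh)"
 thus "gone (V'' Vh) (map Not \<alpha>) (map Not \<gamma>) (sep (map Not \<alpha>) (map Not \<beta>) (map Not \<gamma>))"
  using BF_opp[OF l(2)] a(2) by blast
qed blast

section \<open>The composite of deletion, restriction and sign change\<close>

lemma del_hom_rh: "del_hom n V Vh = D.rh"
 unfolding del_hom_def D.rh_def e_del_def uvar_frag ..

lemma rest_hom_rh: "rest_hom n Vh = R.rh"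
 unfolding rest_hom_def R.rh_def e_rest_def uvar_frag
 by (rule arg_cong[where f = "relabel_hom n V' (BF_plus (n + 1) Vh) tl"]) (auto simp: fun_eq_iff)

lemma sign_change_hom_rh: "sign_change_hom n V' = N.rh"
 unfolding sign_change_hom_def N.rh_def e_sign_def uvar_frag ..

lemma bcl_mult_rl:
 assumes "relabelling n' m A C T \<tau> e" "M \<in> carrier (Bfree n' A)" "N \<in> carrier (Bfree n' A)"
  "relabelling.supp T M" "relabelling.supp T N"
 shows "bcl m C (relabelling.rl m C T \<tau> e (M \<otimes>\<^bsub>Bfree n' A\<^esub> N)) =
  bcl m C (relabelling.rl m C T \<tau> e M \<otimes>\<^bsub>Bfree m C\<^esub> relabelling.rl m C T \<tau> e N)"
proof -
 interpret r: relabelling n' m A C T \<tau> e by (rule assms(1))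
 show ?thesis
  using bcl_eq[OF r.rl_closed[OF Bfree_mult_closed[OF assms(2,3)]] Bfree_mult_closed[OF r.rl_closed[OF assms(2)] r.rl_closed[OF assms(3)]]]
   r.rl_mult[OF assms(2-5)] by blast
qed

definition psi :: "conv => conv" where "psi = del_hom n V Vh"
definition phi :: "conv => conv" where "phi = sign_change_hom n V' \<circ> rest_hom n Vh"

lemma psi_bcl: "M \<in> carrier (Bfree n V) ==> psi (bcl n V M) = bcl (n + 1) Vh (D.rl M)"
 unfolding psi_def del_hom_rh by (rule D.rh_coset)

lemma phi_bcl: "M \<in> carrier (Bfree (n + 1) Vh) ==> phi (bcl (n + 1) Vh M) = bcl n (V'' Vh) (N.rl (R.rl M))"
proof -
 assume M: "M \<in> carrier (Bfree (n + 1) Vh)"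
 show ?thesis
  unfolding phi_def rest_hom_rh sign_change_hom_rh o_apply R.rh_coset[OF M] N.rh_coset[OF R.rl_closed[OF M]] ..
qed

lemma D_supp: "M \<in> carrier (Bfree n V) ==> D.supp M" unfolding D.supp_def using BfreeD by blast
lemma N_supp: "M \<in> carrier (Bfree n V') ==> N.supp M" unfolding N.supp_def using BfreeD by blast

lemma D_rl_plus: "R.supp (D.rl M)"
 unfolding R.supp_def
proof (intro allI impI)
 fix \<alpha> \<beta> assume o: "\<alpha> \<notin> BF_plus (n + 1) Vh \<or> \<beta> \<notin> BF_plus (n + 1) Vh"
 have "\<alpha> \<notin> (\<lambda>\<alpha>. True # \<alpha>) ` BF n V \<or> \<beta> \<notin> (\<lambda>\<alpha>. True # \<alpha>) ` BF n V"
  using o BF_Cons by auto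
 thus "D.rl M \<alpha> \<beta> = 0" by (rule D.rl_out)
qed

lemma plus_carrier: "X \<in> carrier (Btilde_plus (n + 1) Vh) \<longleftrightarrow> (\<exists>M\<in>carrier (Bfree (n + 1) Vh). R.supp M \<and> X = bcl (n + 1) Vh M)"
 unfolding Btilde_plus_carrier R.supp_def ..

lemma psi_closed: "X \<in> carrier (Btilde n V) ==> psi X \<in> carrier (Btilde_plus (n + 1) Vh)"
 unfolding Btilde_carrier plus_carrier using psi_bcl D.rl_closed D_rl_plus by blast

lemma plus_mult: "X \<otimes>\<^bsub>Btilde_plus m A\<^esub> Y = X \<otimes>\<^bsub>Btilde m A\<^esub> Y" "X \<oplus>\<^bsub>Btilde_plus m A\<^esub> Y = X \<oplus>\<^bsub>Btilde m A\<^esub> Y"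
 unfolding Btilde_plus_def by simp_all

lemma psi_mult:
 assumes "X \<in> carrier (Btilde n V)" "Y \<in> carrier (Btilde n V)"
 shows "psi (X \<otimes>\<^bsub>Btilde n V\<^esub> Y) = psi X \<otimes>\<^bsub>Btilde_plus (n + 1) Vh\<^esub> psi Y"
proof -
 obtain M N where M: "M \<in> carrier (Bfree n V)" "X = bcl n V M" and N: "N \<in> carrier (Bfree n V)" "Y = bcl n V N"
  using assms unfolding Btilde_carrier by blast
 have "psi (X \<otimes>\<^bsub>Btilde n V\<^esub> Y) = bcl (n + 1) Vh (D.rl (M \<otimes>\<^bsub>Bfree n V\<^esub> N))"
  unfolding M(2) N(2) bcl_simps(1)[OF M(1) N(1)] by (rule psi_bcl[OF Bfree_mult_closed[OF M(1) N(1)]])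
 also have "\<dots> = bcl (n + 1) Vh (D.rl M \<otimes>\<^bsub>Bfree (n + 1) Vh\<^esub> D.rl N)"
  by (rule bcl_mult_rl[OF D.relabelling_axioms M(1) N(1) D_supp[OF M(1)] D_supp[OF N(1)]])
 also have "\<dots> = psi X \<otimes>\<^bsub>Btilde_plus (n + 1) Vh\<^esub> psi Y"
  unfolding plus_mult M(2) N(2) psi_bcl[OF M(1)] psi_bcl[OF N(1)] by (rule bcl_simps(1)[OF D.rl_closed[OF M(1)] D.rl_closed[OF N(1)], symmetric])
 finally show ?thesis .
qed

lemma phi_closed: "X \<in> carrier (Btilde_plus (n + 1) Vh) ==> phi X \<in> carrier (Btilde n (V'' Vh))"
 unfolding Btilde_carrier plus_carrier using phi_bcl R.rl_closed N.rl_closed by blast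

lemma phi_add:
 assumes "X \<in> carrier (Btilde_plus (n + 1) Vh)" "Y \<in> carrier (Btilde_plus (n + 1) Vh)"
 shows "phi (X \<oplus>\<^bsub>Btilde_plus (n + 1) Vh\<^esub> Y) = phi X \<oplus>\<^bsub>Btilde n (V'' Vh)\<^esub> phi Y"
proof -
 obtain M N where M: "M \<in> carrier (Bfree (n + 1) Vh)" "X = bcl (n + 1) Vh M" and N: "N \<in> carrier (Bfree (n + 1) Vh)" "Y = bcl (n + 1) Vh N"
  using assms unfolding plus_carrier by blast
 have c: "M \<oplus>\<^bsub>Bfree (n + 1) Vh\<^esub> N \<in> carrier (Bfree (n + 1) Vh)"
  by (rule ring.ring_simprules(1)[OF Bfree_ring M(1) N(1)])
 have "phi (X \<oplus>\<^bsub>Btilde_plus (n + 1) Vh\<^esub> Y) = bcl n (V'' Vh) (N.rl (R.rl (M \<oplus>\<^bsub>Bfree (n + 1) Vh\<^esub> N)))"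
  unfolding plus_mult M(2) N(2) bcl_simps(2)[OF M(1) N(1)] by (rule phi_bcl[OF c])
 also have "\<dots> = phi X \<oplus>\<^bsub>Btilde n (V'' Vh)\<^esub> phi Y"
  unfolding M(2) N(2) phi_bcl[OF M(1)] phi_bcl[OF N(1)] R.rl_add N.rl_add
  by (rule bcl_simps(2)[OF N.rl_closed[OF R.rl_closed[OF M(1)]] N.rl_closed[OF R.rl_closed[OF N(1)]], symmetric])
 finally show ?thesis .
qed

lemma phi_mult:
 assumes "X \<in> carrier (Btilde_plus (n + 1) Vh)" "Y \<in> carrier (Btilde_plus (n + 1) Vh)"
 shows "phi (X \<otimes>\<^bsub>Btilde_plus (n + 1) Vh\<^esub> Y) = phi X \<otimes>\<^bsub>Btilde n (V'' Vh)\<^esub> phi Y"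
proof -
 obtain M N where M: "M \<in> carrier (Bfree (n + 1) Vh)" "R.supp M" "X = bcl (n + 1) Vh M"
  and N: "N \<in> carrier (Bfree (n + 1) Vh)" "R.supp N" "Y = bcl (n + 1) Vh N"
  using assms unfolding plus_carrier by blast
 note rM = R.rl_closed[OF M(1)] note rN = R.rl_closed[OF N(1)]
 note MN = Bfree_mult_closed[OF M(1) N(1)]
 have "phi (X \<otimes>\<^bsub>Btilde_plus (n + 1) Vh\<^esub> Y) = N.rh (R.rh (bcl (n + 1) Vh (M \<otimes>\<^bsub>Bfree (n + 1) Vh\<^esub> N)))"
  unfolding plus_mult M(3) N(3) bcl_simps(1)[OF M(1) N(1)] phi_def rest_hom_rh sign_change_hom_rh by simp
 also have "\<dots> = N.rh (bcl n V' (R.rl M \<otimes>\<^bsub>Bfree n V'\<^esub> R.rl N))"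
  unfolding R.rh_coset[OF MN] bcl_mult_rl[OF R.relabelling_axioms M(1) N(1) M(2) N(2)] ..
 also have "\<dots> = bcl n (V'' Vh) (N.rl (R.rl M) \<otimes>\<^bsub>Bfree n (V'' Vh)\<^esub> N.rl (R.rl N))"
  unfolding N.rh_coset[OF Bfree_mult_closed[OF rM rN]]
  by (rule bcl_mult_rl[OF N.relabelling_axioms rM rN N_supp[OF rM] N_supp[OF rN]])
 also have "\<dots> = phi X \<otimes>\<^bsub>Btilde n (V'' Vh)\<^esub> phi Y"
  unfolding M(3) N(3) phi_bcl[OF M(1)] phi_bcl[OF N(1)]
  by (rule bcl_simps(1)[OF N.rl_closed[OF rM] N.rl_closed[OF rN], symmetric])
 finally show ?thesis .
qed

definition comp_rl :: "(signs => signs => zpoly) => signs => signs => zpoly" where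
 "comp_rl M = N.rl (R.rl (D.rl M))"

lemma phi_psi: "M \<in> carrier (Bfree n V) ==> phi (psi (bcl n V M)) = bcl n (V'' Vh) (comp_rl M)"
 unfolding comp_rl_def psi_bcl by (rule phi_bcl[OF D.rl_closed])

text \<open>Deletion raises the index of every variable by 1 and restriction lowers it again; the
  first variable, which restriction sends to 1, is not in the image of deletion.\<close>

lemma psub_comp:
 assumes p: "p \<in> carrier (Zu n)" shows "psub e_sign (psub e_rest (psub e_del p)) = p"
proof -
 have e: "esub e_sign (esub e_rest (esub e_del m)) = m" if m: "inU n m" for m
 proof -
  have 1: "esub e (single i 1) = e i" for e and i :: nat
   by (simp add: esub_def)
  have s: "esub e (\<Sum>i\<in>I. f i) = (\<Sum>i\<in>I. esub e (f i))" for e f and I :: "nat set"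
   by (induction I rule: infinite_finite_induct) (simp_all add: esub_add)
  have s': "esub e (\<Sum>i<(c::nat). x) = (\<Sum>i<c. esub e x)" for e x c by (rule s)
  have "esub e_sign (esub e_rest (esub e_del m)) = (\<Sum>i\<in>keys m. \<Sum>_<lookup m i. single i 1)"
   unfolding esub_def[of e_del m] s s'
  proof (intro sum.cong refl)
   fix i assume "i \<in> keys m"
   hence "1 \<le> i" using m unfolding inU_def by auto
   thus "esub e_sign (esub e_rest (e_del i)) = single i 1"
    unfolding e_del_def 1 by (simp add: e_rest_def 1[unfolded One_nat_def] e_sign_def)
  qed
  also have "\<dots> = m"
  proof (rule poly_mapping_eqI)
   fix j
   have l: "lookup (\<Sum>_<(c::nat). single i (1::nat)) j = (if j = i then c else 0)" for c and i :: nat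
    by (induction c) (auto simp: lookup_add lookup_single when_def simp del: sum_constant)
   have "lookup (\<Sum>i\<in>keys m. \<Sum>_<lookup m i. single i (1::nat)) j
    = (\<Sum>i\<in>keys m. if j = i then lookup m i else 0)"
    by (subst lookup_sum) (simp only: l)
   also have "\<dots> = lookup m j" by (simp add: in_keys_iff)
   finally show "lookup (\<Sum>i\<in>keys m. \<Sum>_<lookup m i. single i (1::nat)) j = lookup m j" .
  qed
  finally show ?thesis .
 qed
 have "keys p \<subseteq> {m. inU n m}" using p unfolding Zu_carrier by blast
 thus ?thesis
 proof (induction p rule: frag_induction)
  case (one m) thus ?case by (simp add: e)
 next
  case (diff a b) thus ?case by (simp only: frag_extend_diff)
 qed simp
qed

text \<open>By \<open>psub_comp\<close> the coefficients survive unchanged, so only the reversal of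
  signs remains. Where a reversed vector is not bounded and feasible for \<open>V\<close>, both
  sides are 0.\<close>

lemma comp_rl_apply:
 assumes M: "M \<in> carrier (Bfree n V)"
 shows "comp_rl M \<alpha> \<beta> = (if \<alpha> \<in> BF n (V'' Vh) \<and> \<beta> \<in> BF n (V'' Vh) then M (map Not \<alpha>) (map Not \<beta>) else 0)"
proof (cases "\<alpha> \<in> BF n (V'' Vh) \<and> \<beta> \<in> BF n (V'' Vh)")
 case False
 have "comp_rl M \<in> carrier (Bfree n (V'' Vh))" unfolding comp_rl_def by (intro N.rl_closed R.rl_closed D.rl_closed M)
 thus ?thesis using False BfreeD by auto
next
 case True
 let ?a = "map Not \<alpha>" let ?b = "map Not \<beta>"
 have NN: "map Not (map Not \<gamma>) = \<gamma>" for \<gamma> by (induction \<gamma>) auto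
 have l: "length ?a = n" "length ?b = n" using True BF_length by auto
 have ab: "?a \<in> BF n V'" "?b \<in> BF n V'" using True BF_opp[OF l(1)] BF_opp[OF l(2)] unfolding NN by blast+
 have "comp_rl M \<alpha> \<beta> = psub e_sign (R.rl (D.rl M) ?a ?b)"
  using N.rl_apply[OF ab, of "R.rl (D.rl M)"] True unfolding comp_rl_def NN by simp
 also have "\<dots> = M ?a ?b"
 proof (cases "?a \<in> BF n V \<and> ?b \<in> BF n V")
  case True
  hence p: "True # ?a \<in> BF_plus (n + 1) Vh" "True # ?b \<in> BF_plus (n + 1) Vh" using BF_Cons by auto
  have "R.rl (D.rl M) ?a ?b = psub e_rest (D.rl M (True # ?a) (True # ?b))"
   using R.rl_apply[OF p, of "D.rl M"] ab by simp
  also have "D.rl M (True # ?a) (True # ?b) = psub e_del (M ?a ?b)"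
   using D.rl_apply[of ?a ?b M] True p by simp
  finally show ?thesis using psub_comp[OF BfreeD(1)[OF M]] by simp
 next
  case False
  have "?a \<notin> tl ` BF_plus (n + 1) Vh \<or> ?b \<notin> tl ` BF_plus (n + 1) Vh"
  proof (rule ccontr)
   assume "\<not> ?thesis"
   then obtain \<gamma> \<delta> where "?a = tl \<gamma>" "\<gamma> \<in> BF_plus (n + 1) Vh" "?b = tl \<delta>" "\<delta> \<in> BF_plus (n + 1) Vh" by blast
   thus False using False by (metis BF_plus_Cons list.sel(3))
  qed
  hence "R.rl (D.rl M) ?a ?b = 0" by (rule R.rl_out)
  moreover have "M ?a ?b = 0" using False BfreeD(2,3)[OF M] by blast
  ultimately show ?thesis by simp
 qed
 finally show ?thesis using True by simp
qed

end

section \<open>Truncations of the path algebra\<close>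

abbreviation pcl :: "nat => nat => (path \<Rightarrow>\<^sub>0 int) => strand" where
 "pcl n k g \<equiv> path_ideal n k +>\<^bsub>path_alg n k\<^esub> g"

lemma Bquiv_ring: "ring (Bquiv n k)"
 unfolding Bquiv_def by (rule ideal.quotient_is_ring[OF path_ideal_ideal])

lemma Bquiv_carrier: "X \<in> carrier (Bquiv n k) \<longleftrightarrow> (\<exists>g. keys g \<subseteq> paths n k \<and> X = pcl n k g)"
 unfolding Bquiv_def carrier_quot by auto

lemma pcl_simps:
 assumes "keys g \<subseteq> paths n k"
 shows "keys h \<subseteq> paths n k ==> pcl n k g \<otimes>\<^bsub>Bquiv n k\<^esub> pcl n k h = pcl n k (pmult n g h)"
  and "keys h \<subseteq> paths n k ==> pcl n k g \<oplus>\<^bsub>Bquiv n k\<^esub> pcl n k h = pcl n k (g + h)"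
  and "pcl n k g \<in> carrier (Bquiv n k)"
 unfolding Bquiv_def
 using ideal.quot_simps(1,2)[OF path_ideal_ideal, of g n k h] ideal.quot_simps(5)[OF path_ideal_ideal, of g n k] assms by simp_all

lemma pcl_eq:
 assumes g: "keys g \<subseteq> paths n k" and h: "keys h \<subseteq> paths n k"
 shows "pcl n k g = pcl n k h \<longleftrightarrow> g - h \<in> path_ideal n k"
proof
 interpret I: ideal "path_ideal n k" "path_alg n k" by (rule path_ideal_ideal)
 show "pcl n k g = pcl n k h" if "g - h \<in> path_ideal n k"
  using I.coset_add_mem[OF that, of h] h by simp
 assume "pcl n k g = pcl n k h"
 then obtain i where "i \<in> path_ideal n k" "g = i \<oplus>\<^bsub>path_alg n k\<^esub> h" using I.coset_eqD[of g h] g h by auto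
 thus "g - h \<in> path_ideal n k" by simp
qed

text \<open>Only the ends of the paths are confined to \<open>T\<close>, as in an idempotent
  truncation; the vertices in between are arbitrary.\<close>

definition TP :: "nat => nat => nat set set => path set" where
 "TP n k T = {(x, w). (x, w) \<in> paths n k \<and> x \<in> T \<and> the (walk n x w) \<in> T}"

lemma TP_paths: "TP n k T \<subseteq> paths n k" by (auto simp: TP_def)

lemma TP_mem: "(x, w) \<in> TP n k T \<longleftrightarrow> x \<in> vertices n k \<and> x \<in> T \<and> (\<exists>z\<in>T. walk n x w = Some z)"
 by (auto simp: TP_def paths_def)

definition eT :: "nat set set => path \<Rightarrow>\<^sub>0 int" where "eT T = (\<Sum>x\<in>T. frag_of (x, []))"

lemma finite_subset_vertices: "T \<subseteq> vertices n k ==> finite T"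
 using finite_subset finite_vertices by blast

lemma eT_keys: "T \<subseteq> vertices n k ==> keys (eT T) \<subseteq> TP n k T"
proof -
 assume T: "T \<subseteq> vertices n k"
 have "keys (eT T) \<subseteq> (\<Union>x\<in>T. keys (frag_of (x, [])))" unfolding eT_def by (rule keys_sum)
 also have "\<dots> \<subseteq> TP n k T" using T by (auto simp: TP_mem)
 finally show ?thesis .
qed

lemma frag_extend_frag_extend: "frag_extend f (frag_extend h c) = frag_extend (\<lambda>x. frag_extend f (h x)) c"
 using subset_UNIV[of "keys c"]
 by (induction c rule: frag_induction) (simp_all add: frag_extend_diff)

lemma frag_extend_same: "(\<And>p. p \<in> keys g ==> f p = frag_of p) ==> frag_extend f g = g"
 using frag_extend_eq[of g f frag_of] frag_expansion[of g] by metis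

lemma pmult_eT:
 assumes T: "T \<subseteq> vertices n k" and g: "keys g \<subseteq> paths n k"
 shows "pmult n (eT T) g = frag_extend (\<lambda>p. if fst p \<in> T then frag_of p else 0) g"
  and "pmult n g (eT T) = frag_extend (\<lambda>p. if the (walk n (fst p) (snd p)) \<in> T then frag_of p else 0) g"
proof -
 note fin = finite_subset_vertices[OF T]
 have s: "frag_extend f (\<Sum>x\<in>S. frag_of (x, [])) = (\<Sum>x\<in>S. f (x, []))" if "finite S" for f :: "path => path \<Rightarrow>\<^sub>0 int" and S
  using that by (induction S rule: finite_induct) (simp_all add: frag_extend_add)
 show "pmult n (eT T) g = frag_extend (\<lambda>p. if fst p \<in> T then frag_of p else 0) g"
  using g
 proof (induction g rule: frag_induction)
  case (one p)
  have "pmult n (eT T) (frag_of p) = (\<Sum>x\<in>T. if fst p = x then frag_of p else 0)"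
   unfolding eT_def s[OF fin] by (intro sum.cong refl) (auto simp: path_comp_def)
  thus ?case using fin by simp
 next
  case (diff a b)
  show ?case unfolding pmult_diff(2) diff by (simp only: frag_extend_diff)
 qed simp
 show "pmult n g (eT T) = frag_extend (\<lambda>p. if the (walk n (fst p) (snd p)) \<in> T then frag_of p else 0) g"
  using g
 proof (induction g rule: frag_induction)
  case (one p)
  then obtain z where z: "walk n (fst p) (snd p) = Some z" unfolding paths_def by auto
  have "pmult n (frag_of p) (eT T) = (\<Sum>x\<in>T. path_comp n p (x, []))" unfolding eT_def by (simp add: s[OF fin])
  also have "\<dots> = (\<Sum>x\<in>T. if z = x then frag_of p else 0)" by (intro sum.cong refl) (auto simp: path_comp_def z)
  finally show ?case using fin z by simp
 next
  case (diff a b)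
  show ?case unfolding pmult_diff(1) diff by (simp only: frag_extend_diff)
 qed simp
qed

lemma eT_TP:
 assumes T: "T \<subseteq> vertices n k" and g: "keys g \<subseteq> TP n k T"
 shows "pmult n (eT T) g = g" "pmult n g (eT T) = g"
proof -
 have "keys g \<subseteq> paths n k" using g TP_paths by blast
 thus "pmult n (eT T) g = g" "pmult n g (eT T) = g"
  unfolding pmult_eT[OF T \<open>keys g \<subseteq> paths n k\<close>]
  using g by (auto intro!: frag_extend_same simp: TP_def)
qed

lemma eT_compress:
 assumes T: "T \<subseteq> vertices n k" and g: "keys g \<subseteq> paths n k"
 shows "keys (pmult n (pmult n (eT T) g) (eT T)) \<subseteq> TP n k T"
proof -
 have "keys (pmult n (eT T) g) \<subseteq> paths n k" using pmult_keys eT_keys[OF T] TP_paths g by blast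
 from pmult_eT(2)[OF T this] have "pmult n (pmult n (eT T) g) (eT T) =
  frag_extend (\<lambda>p. frag_extend (\<lambda>p. if the (walk n (fst p) (snd p)) \<in> T then frag_of p else 0) (if fst p \<in> T then frag_of p else 0)) g"
  unfolding pmult_eT(1)[OF T g] frag_extend_frag_extend .
 also have "\<dots> = frag_extend (\<lambda>p. if fst p \<in> T then if the (walk n (fst p) (snd p)) \<in> T then frag_of p else 0 else 0) g"
  by (intro frag_extend_eq) simp
 finally have eq: "pmult n (pmult n (eT T) g) (eT T) =
  frag_extend (\<lambda>p. if fst p \<in> T then if the (walk n (fst p) (snd p)) \<in> T then frag_of p else 0 else 0) g" .
 show ?thesis unfolding eq by (rule keys_frag_extend_subset) (use g in \<open>auto simp: TP_def\<close>)
qed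

lemma path_class_pcl: "x \<in> vertices n k ==> walk n x w = Some z ==> path_class n k x w = pcl n k (frag_of (x, w))"
 unfolding path_class_def path_elt_def paths_def by simp

lemma finsum_path_class:
 assumes "T \<subseteq> vertices n k"
 shows "(\<Oplus>\<^bsub>Bquiv n k\<^esub>x\<in>T. path_class n k x []) = pcl n k (eT T)"
 using finite_subset_vertices[OF assms] assms
proof (induction T rule: finite_induct)
 interpret B: ring "Bquiv n k" by (rule Bquiv_ring)
 case empty
 have "pcl n k 0 = \<zero>\<^bsub>Bquiv n k\<^esub>" unfolding Bquiv_def using ideal.quot_simps(4)[OF path_ideal_ideal, of n k] by simp
 thus ?case by (simp add: eT_def)
next
 interpret B: ring "Bquiv n k" by (rule Bquiv_ring)
 case (insert x T)
 have c: "path_class n k y [] = pcl n k (frag_of (y, []))" "pcl n k (frag_of (y, [])) \<in> carrier (Bquiv n k)" if "y \<in> insert x T" for y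
 proof -
  have y: "y \<in> vertices n k" using that insert(4) by blast
  show "path_class n k y [] = pcl n k (frag_of (y, []))" by (rule path_class_pcl[OF y, of "[]" y]) simp
  show "pcl n k (frag_of (y, [])) \<in> carrier (Bquiv n k)" by (rule pcl_simps(3)) (use y in \<open>simp add: paths_def\<close>)
 qed
 have "(\<Oplus>\<^bsub>Bquiv n k\<^esub>y\<in>insert x T. path_class n k y []) = path_class n k x [] \<oplus>\<^bsub>Bquiv n k\<^esub> pcl n k (eT T)"
  using insert c by (subst B.finsum_insert) auto
 also have "\<dots> = pcl n k (frag_of (x, []) + eT T)"
  unfolding c(1)[OF insertI1] using insert(4) eT_keys[of T n k] TP_paths[of n k T] by (intro pcl_simps(2)) (auto simp: paths_def)
 also have "frag_of (x, []) + eT T = eT (insert x T)" unfolding eT_def using insert by simp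
 finally show ?case .
qed

context
 fixes n k :: nat and T :: "nat set set"
 assumes T: "T \<subseteq> vertices n k"
begin

lemma truncation_eq: "truncation n k T = corner (Bquiv n k) (pcl n k (eT T))"
 unfolding truncation_def finsum_path_class[OF T] ..

lemma truncation_sel: "X \<otimes>\<^bsub>truncation n k T\<^esub> Y = X \<otimes>\<^bsub>Bquiv n k\<^esub> Y" "X \<oplus>\<^bsub>truncation n k T\<^esub> Y = X \<oplus>\<^bsub>Bquiv n k\<^esub> Y"
 "\<one>\<^bsub>truncation n k T\<^esub> = pcl n k (eT T)" "\<zero>\<^bsub>truncation n k T\<^esub> = \<zero>\<^bsub>Bquiv n k\<^esub>"
 unfolding truncation_eq by simp_all

lemma eT_paths: "keys (eT T) \<subseteq> paths n k" using eT_keys[OF T] TP_paths by blast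

lemma eT_idem: "pcl n k (eT T) \<otimes>\<^bsub>Bquiv n k\<^esub> pcl n k (eT T) = pcl n k (eT T)"
 unfolding pcl_simps(1)[OF eT_paths eT_paths] eT_TP(1)[OF T eT_keys[OF T]] ..

lemma truncation_ring: "ring (truncation n k T)"
 unfolding truncation_eq by (rule corner_ring[OF Bquiv_ring pcl_simps(3)[OF eT_paths] eT_idem])

lemma truncation_carrier: "X \<in> carrier (truncation n k T) \<longleftrightarrow> (\<exists>g. keys g \<subseteq> TP n k T \<and> X = pcl n k g)"
proof
 have c: "carrier (truncation n k T) = {pcl n k (eT T) \<otimes>\<^bsub>Bquiv n k\<^esub> a \<otimes>\<^bsub>Bquiv n k\<^esub> pcl n k (eT T) | a. a \<in> carrier (Bquiv n k)}"
  unfolding truncation_eq by (simp add: corner_def)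
 have e: "pcl n k (eT T) \<otimes>\<^bsub>Bquiv n k\<^esub> pcl n k g \<otimes>\<^bsub>Bquiv n k\<^esub> pcl n k (eT T) = pcl n k (pmult n (pmult n (eT T) g) (eT T))"
  if g: "keys g \<subseteq> paths n k" for g
  unfolding pcl_simps(1)[OF eT_paths g] by (rule pcl_simps(1)[OF pmult_keys[OF eT_paths g] eT_paths])
 {
  assume "X \<in> carrier (truncation n k T)"
  then obtain g where g: "keys g \<subseteq> paths n k" "X = pcl n k (pmult n (pmult n (eT T) g) (eT T))"
   unfolding c using e by (auto simp: Bquiv_carrier)
  thus "\<exists>g. keys g \<subseteq> TP n k T \<and> X = pcl n k g" using eT_compress[OF T g(1)] by blast
 next
  assume "\<exists>g. keys g \<subseteq> TP n k T \<and> X = pcl n k g"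
  then obtain g where g: "keys g \<subseteq> TP n k T" "X = pcl n k g" by blast
  have gp: "keys g \<subseteq> paths n k" using g(1) TP_paths by blast
  have "X = pcl n k (eT T) \<otimes>\<^bsub>Bquiv n k\<^esub> X \<otimes>\<^bsub>Bquiv n k\<^esub> pcl n k (eT T)"
   unfolding g(2) e[OF gp] eT_TP(1)[OF T g(1)] eT_TP(2)[OF T g(1)] ..
  moreover have "X \<in> carrier (Bquiv n k)" unfolding g(2) by (rule pcl_simps(3)[OF gp])
  ultimately show "X \<in> carrier (truncation n k T)" unfolding c by blast
 }
qed

end

lemma ksub_vertices: "ksubsets {0..<n} k \<subseteq> vertices n k" using ksubsets_vertices by blast
lemma ksub1_vertices: "ksubsets {1..<n} k \<subseteq> vertices n k" unfolding ksubsets_def vertices_def by auto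

section \<open>From paths to the convolution algebra\<close>

lemma nth_sgn_at: "i \<in> {1..length \<alpha>} ==> \<alpha> ! (i - 1) \<longleftrightarrow> sgn_at (sc \<alpha>) i"
proof -
 assume i: "i \<in> {1..length \<alpha>}"
 hence e: "{..i - 1} = {..<i}" and "i - 1 < length \<alpha>" by auto
 from nth_sign[OF this(2)] show ?thesis unfolding e sgn_at_def .
qed

lemma diff_signs_sgn: "length \<alpha> = n ==> length \<beta> = n ==>
  diff_signs \<alpha> \<beta> = {i \<in> {1..n}. sgn_at (sc \<alpha>) i \<noteq> sgn_at (sc \<beta>) i}"
proof -
 assume l: "length \<alpha> = n" "length \<beta> = n"
 have "i \<in> {1..n} ==> \<alpha> ! (i - 1) \<longleftrightarrow> sgn_at (sc \<alpha>) i" "i \<in> {1..n} ==> \<beta> ! (i - 1) \<longleftrightarrow> sgn_at (sc \<beta>) i" for i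
  using nth_sgn_at[of i \<alpha>] nth_sgn_at[of i \<beta>] unfolding l by blast+
 thus ?thesis unfolding diff_signs_def l by blast
qed

lemma sign_changes_inj:
 assumes "length \<alpha> = n" "length \<beta> = n" "sc \<alpha> = sc \<beta>" shows "\<alpha> = \<beta>"
 by (rule nth_equalityI) (use assms nth_sign[of _ \<alpha>] nth_sign[of _ \<beta>] in auto)

lemma signs_of_sign_changes: "length \<alpha> = n ==> signs_of n (sc \<alpha>) = \<alpha>"
 unfolding signs_of_def by (rule the_equality) (use sign_changes_inj in auto)

lemma sign_changes_exists:
 assumes "x \<subseteq> {..<n}" obtains \<alpha> where "length \<alpha> = n" "sc \<alpha> = x"
proof (rule that)
 let ?a = "map (\<lambda>j. sgn_at x (Suc j)) [0..<n]"
 show "length ?a = n" by simp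
 have fin: "finite x" using assms finite_subset by blast
 show "sc ?a = x"
 proof (rule Set.set_eqI)
  fix i show "i \<in> sc ?a \<longleftrightarrow> i \<in> x"
  proof (cases "i < n")
   case True
   have nth: "(True # ?a) ! j = sgn_at x j" if "j \<le> n" for j using that by (cases j) simp_all
   have "i \<in> sc ?a \<longleftrightarrow> sgn_at x i \<noteq> sgn_at x (Suc i)"
    using True nth[of i] nth[of "Suc i"] unfolding sign_changes_def by simp
   thus ?thesis using sgn_at_Suc[OF fin, of i] by blast
  next
   case False
   moreover have "sc ?a \<subseteq> {..<n}" using sign_changes_subset[of ?a] by simp
   ultimately show ?thesis using assms by blast
  qed
 qed
qed

lemma signs_of:
 assumes "x \<in> ksubsets {0..<n} k" shows "length (signs_of n x) = n" "sc (signs_of n x) = x"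
proof -
 have "x \<subseteq> {..<n}" using assms unfolding ksubsets_def by auto
 then obtain \<alpha> where "length \<alpha> = n" "sc \<alpha> = x" by (rule sign_changes_exists)
 thus "length (signs_of n x) = n" "sc (signs_of n x) = x" using signs_of_sign_changes by auto
qed

text \<open>Rounding down is deliberate: the crossing number is odd exactly when the signs of the
  two ends differ at i, and the odd crossing is already carried by the basis element
  \<open>f_elt\<close>.\<close>

definition half :: "nat => (nat => nat) => nat \<Rightarrow>\<^sub>0 nat" where
 "half n c = (\<Sum>i\<in>{1..n}. single i (c i div 2))"

lemma lookup_half: "lookup (half n c) i = (if i \<in> {1..n} then c i div 2 else 0)"
 unfolding half_def lookup_sum by (simp add: lookup_single when_def)

lemma inU_half: "inU n (half n c)"
 unfolding inU_def by (auto simp: in_keys_iff lookup_half split: if_splits)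

definition phf :: "nat => arrangement => signs => signs => path => zpoly" where
 "phf n A \<alpha> \<beta> = (\<lambda>(x, w). if \<alpha> \<in> BF n A \<and> \<beta> \<in> BF n A \<and> sc \<alpha> = x \<and> sc \<beta> = the (walk n x w)
   then frag_of (half n (cnt w)) else 0)"

definition PhiT :: "nat => arrangement => (path \<Rightarrow>\<^sub>0 int) => signs => signs => zpoly" where
 "PhiT n A g \<alpha> \<beta> = frag_extend (phf n A \<alpha> \<beta>) g"

definition Phi :: "nat => arrangement => strand => conv" where
 "Phi n A = quot_map (Bfree n A) (Bideal n A) (PhiT n A)"

lemma Rideal_diff: "p \<in> Rideal n A \<alpha> \<beta> ==> q \<in> Rideal n A \<alpha> \<beta> ==> p - q \<in> Rideal n A \<alpha> \<beta>"
 unfolding Rideal_iff using keys_diff[of p q] by blast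

lemma Rideal_frag: "frag_of m \<in> Rideal n A \<alpha> \<beta> \<longleftrightarrow> inU n m \<and> gone A \<alpha> \<beta> (keys m)"
 by (simp add: Rideal_iff)

locale cyclic_arrangement =
 fixes n k :: nat and A :: arrangement
 assumes left_cyclic: "left_cyclic n k A"
begin

lemma BF_iff: "\<alpha> \<in> BF n A \<longleftrightarrow> length \<alpha> = n \<and> card (sc \<alpha>) = k"
 using left_cyclic_cyc[OF left_cyclic] cyc.BF_iff by metis

lemma gone_bad: "\<alpha> \<in> BF n A ==> \<beta> \<in> BF n A ==> S \<subseteq> {1..n} ==> gone A \<alpha> \<beta> S \<longleftrightarrow> bad n (sc \<alpha>) (S \<union> diff_signs \<alpha> \<beta>)"
 using left_cyclic_cyc[OF left_cyclic] cyc.gone_iff by metis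

abbreviation "TT \<equiv> ksubsets {0..<n} k"

lemma sc_TT: "\<alpha> \<in> BF n A ==> sc \<alpha> \<in> TT"
 using sign_changes_subset[of \<alpha>] unfolding BF_iff ksubsets_def by auto

lemma signs_BF: "x \<in> TT ==> signs_of n x \<in> BF n A"
 unfolding BF_iff using signs_of[of x n k] unfolding ksubsets_def by auto

lemma BF_eqI: "\<alpha> \<in> BF n A ==> \<beta> \<in> BF n A ==> sc \<alpha> = sc \<beta> ==> \<alpha> = \<beta>"
 using sign_changes_inj BF_iff by blast

lemma PhiT_closed: "PhiT n A g \<in> carrier (Bfree n A)"
proof (rule BfreeI)
 fix \<alpha> \<beta>
 show "PhiT n A g \<alpha> \<beta> \<in> carrier (Zu n)"
  unfolding PhiT_def Zu_carrier
 proof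
  fix m assume "m \<in> keys (frag_extend (phf n A \<alpha> \<beta>) g)"
  then obtain x w where "m \<in> keys (phf n A \<alpha> \<beta> (x, w))" using keys_frag_extend[of "phf n A \<alpha> \<beta>" g] by auto
  hence "m = half n (cnt w)" unfolding phf_def by (simp split: if_splits)
  thus "inU n m" using inU_half by simp
 qed
 show "PhiT n A g \<alpha> \<beta> = 0" if "\<alpha> \<notin> BF n A \<or> \<beta> \<notin> BF n A"
 proof -
  have "phf n A \<alpha> \<beta> = (\<lambda>p. 0)" using that by (auto simp: phf_def fun_eq_iff)
  thus ?thesis unfolding PhiT_def by simp
 qed
qed

lemma PhiT_add: "PhiT n A (g + h) = PhiT n A g \<oplus>\<^bsub>Bfree n A\<^esub> PhiT n A h"
 by (simp add: PhiT_def fun_eq_iff Bfree_sel frag_extend_add)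

definition nfm :: "signs => signs => nat set \<times> nat set \<times> (nat => nat) => zpoly" where
 "nfm \<alpha> \<beta> = (\<lambda>(x, z, c). if x = sc \<alpha> \<and> z = sc \<beta> then frag_of (half n c) else 0)"

lemma sc_vertices: "\<alpha> \<in> BF n A ==> sc \<alpha> \<in> vertices n k" using sc_TT ksub_vertices by blast

lemma parity:
 assumes "\<alpha> \<in> BF n A" "\<beta> \<in> BF n A" "walk n (sc \<alpha>) w = Some (sc \<beta>)" "i \<in> {1..n}"
 shows "i \<in> diff_signs \<alpha> \<beta> \<longleftrightarrow> odd (cnt w i)" "odd (cnt w i) \<longleftrightarrow> \<alpha> ! (i - 1) \<noteq> \<beta> ! (i - 1)"
proof -
 have l: "length \<alpha> = n" "length \<beta> = n" using assms BF_iff by blast+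
 show "i \<in> diff_signs \<alpha> \<beta> \<longleftrightarrow> odd (cnt w i)"
  unfolding diff_signs_sgn[OF l] using sgn_at_walk[OF sc_vertices[OF assms(1)] assms(3), of i] assms(4) by blast
 thus "odd (cnt w i) \<longleftrightarrow> \<alpha> ! (i - 1) \<noteq> \<beta> ! (i - 1)" using assms(4) l unfolding diff_signs_def by blast
qed

text \<open>A single crossing makes the signs disagree, and two or more give a positive exponent. So
  the interval condition for paths and the one for faces refer to the same set.\<close>

lemma support:
 assumes "\<alpha> \<in> BF n A" "\<beta> \<in> BF n A" "walk n (sc \<alpha>) w = Some (sc \<beta>)"
 shows "keys (half n (cnt w)) \<union> diff_signs \<alpha> \<beta> = ix ` set w"
proof (rule Set.set_eqI)
 fix i
 have l: "length \<alpha> = n" using assms BF_iff by blast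
 show "i \<in> keys (half n (cnt w)) \<union> diff_signs \<alpha> \<beta> \<longleftrightarrow> i \<in> ix ` set w"
 proof (cases "i \<in> {1..n}")
  case True
  have "i \<in> keys (half n (cnt w)) \<longleftrightarrow> 2 \<le> cnt w i" using True by (auto simp: in_keys_iff lookup_half)
  thus ?thesis using parity(1)[OF assms True] unfolding cnt_pos_iff[symmetric] by (auto elim: oddE)
 next
  case False
  thus ?thesis using cnt_bound[OF assms(3), of i] l unfolding cnt_pos_iff[symmetric]
   by (auto simp: in_keys_iff lookup_half diff_signs_def)
 qed
qed

lemma half_gone:
 assumes "\<alpha> \<in> BF n A" "\<beta> \<in> BF n A" "walk n (sc \<alpha>) w = Some (sc \<beta>)"
 shows "frag_of (half n (cnt w)) \<in> Rideal n A \<alpha> \<beta> \<longleftrightarrow> bad n (sc \<alpha>) (ix ` set w)"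
 using gone_bad[OF assms(1,2), of "keys (half n (cnt w))"] inU_half[of n "cnt w"]
 unfolding Rideal_frag support[OF assms] inU_def by blast

text \<open>Modulo the ideals the entries depend only on the normal form, because by
  \<open>half_gone\<close> a path over a bad interval contributes an element of
  \<open>Rideal n A \<alpha> \<beta>\<close>. Hence the path ideal is sent into
  \<open>Bideal n A\<close>.\<close>

lemma PhiT_nf:
 assumes g: "keys g \<subseteq> paths n k" and ab: "\<alpha> \<in> BF n A" "\<beta> \<in> BF n A"
 shows "PhiT n A g \<alpha> \<beta> - frag_extend (nfm \<alpha> \<beta>) (nfe n g) \<in> Rideal n A \<alpha> \<beta>"
 using g
proof (induction g rule: frag_induction)
 case (one p)
 obtain x w z where p: "p = (x, w)" "walk n x w = Some z" using one unfolding paths_def by auto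
 show ?case
 proof (cases "bad n x (ix ` set w)")
  case True
  hence "nf n p = 0" by (simp add: nf_def p(1))
  moreover have "phf n A \<alpha> \<beta> p \<in> Rideal n A \<alpha> \<beta>"
   using half_gone[OF ab, of w] True p(2) unfolding p(1) phf_def by auto
  ultimately show ?thesis by (simp add: PhiT_def)
 next
  case False
  hence "frag_extend (nfm \<alpha> \<beta>) (nf n p) = phf n A \<alpha> \<beta> p"
   using ab p(2) by (auto simp: nf_def p(1) phf_def nfm_def)
  thus ?thesis by (simp add: PhiT_def)
 qed
next
 case (diff a b)
 have "PhiT n A (a - b) \<alpha> \<beta> - frag_extend (nfm \<alpha> \<beta>) (nfe n (a - b)) =
  (PhiT n A a \<alpha> \<beta> - frag_extend (nfm \<alpha> \<beta>) (nfe n a)) - (PhiT n A b \<alpha> \<beta> - frag_extend (nfm \<alpha> \<beta>) (nfe n b))"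
  by (simp add: PhiT_def frag_extend_diff)
 thus ?case using Rideal_diff[OF diff] by simp
qed (simp add: PhiT_def)

lemma PhiT_ideal: "g \<in> path_ideal n k ==> PhiT n A g \<in> Bideal n A"
proof -
 assume "g \<in> path_ideal n k"
 hence g: "keys g \<subseteq> paths n k" "nfe n g = 0" unfolding path_ideal_eq nf_ideal_def by blast+
 show ?thesis unfolding Bideal_iff using PhiT_closed PhiT_nf[OF g(1)] g(2) by simp
qed

lemma Phi_pcl: "keys g \<subseteq> paths n k ==> Phi n A (pcl n k g) = bcl n A (PhiT n A g)"
 unfolding Phi_def
 by (rule quot_map_coset[OF path_ideal_ideal Bideal_ideal]) (simp_all add: PhiT_closed PhiT_add PhiT_ideal)

text \<open>For fixed ends the halved exponents determine the crossing numbers, since the parities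
  are given by the signs of the ends. Distinct normal forms thus yield distinct monomials, none of
  which lies in the ideal.\<close>

lemma PhiT_inj:
 assumes g: "keys g \<subseteq> TP n k TT" and I: "PhiT n A g \<in> Bideal n A"
 shows "g \<in> path_ideal n k"
proof -
 have gp: "keys g \<subseteq> paths n k" using g TP_paths by blast
 let ?G = "nfe n g"
 have keysG: "\<exists>w. (x, w) \<in> TP n k TT \<and> \<not> bad n x (ix ` set w) \<and> z = the (walk n x w) \<and> c = cnt w"
  if xzc: "(x, z, c) \<in> keys ?G" for x z c
 proof -
  obtain p where p: "p \<in> keys g" "(x, z, c) \<in> keys (nf n p)"
   using keys_frag_extend[of "nf n" g] xzc by blast
  obtain x' w where xw: "p = (x', w)" by (cases p)
  have "\<not> bad n x' (ix ` set w) \<and> x = x' \<and> z = the (walk n x' w) \<and> c = cnt w"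
   using p(2) unfolding xw nf_def by (simp split: if_splits)
  thus ?thesis using p(1) g xw by blast
 qed
 have "keys ?G = {}"
 proof (rule ccontr)
  assume "keys ?G \<noteq> {}"
  then obtain x z c where xzc: "(x, z, c) \<in> keys ?G" by (metis equals0I prod_cases3)
  obtain w where w: "(x, w) \<in> TP n k TT" "\<not> bad n x (ix ` set w)" "z = the (walk n x w)" "c = cnt w"
   using keysG[OF xzc] by blast
  have T: "x \<in> TT" "z \<in> TT" "walk n x w = Some z" using w(1,3) unfolding TP_mem by auto
  define \<alpha> where "\<alpha> = signs_of n x"
  define \<beta> where "\<beta> = signs_of n z"
  have ab: "\<alpha> \<in> BF n A" "\<beta> \<in> BF n A" "sc \<alpha> = x" "sc \<beta> = z"
   unfolding \<alpha>_def \<beta>_def using signs_BF T signs_of by blast+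
  have wk: "walk n (sc \<alpha>) w = Some (sc \<beta>)" using T(3) ab by simp
  have "PhiT n A g \<alpha> \<beta> \<in> Rideal n A \<alpha> \<beta>" using I ab unfolding Bideal_iff by blast
  hence "PhiT n A g \<alpha> \<beta> - (PhiT n A g \<alpha> \<beta> - frag_extend (nfm \<alpha> \<beta>) ?G) \<in> Rideal n A \<alpha> \<beta>"
   by (rule Rideal_diff[OF _ PhiT_nf[OF gp ab(1,2)]])
  hence R: "frag_extend (nfm \<alpha> \<beta>) ?G \<in> Rideal n A \<alpha> \<beta>" by simp
  have uniq: "lookup (nfm \<alpha> \<beta> t) (half n c) = (if t = (x, z, c) then 1 else 0)" if t: "t \<in> keys ?G" for t
  proof -
   obtain x' z' c' where t': "t = (x', z', c')" by (cases t)
   obtain w' where w': "(x', w') \<in> TP n k TT" "z' = the (walk n x' w')" "c' = cnt w'" using keysG t t' by blast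
   show ?thesis
   proof (cases "x' = x \<and> z' = z")
    case True
    have wk': "walk n (sc \<alpha>) w' = Some (sc \<beta>)" using w' True ab unfolding TP_mem by auto
    have "c' = c" if h: "half n c' = half n c"
    proof
     fix i
     show "c' i = c i"
     proof (cases "i \<in> {1..n}")
      case True
      have "c' i div 2 = c i div 2" using arg_cong[OF h, of "\<lambda>m. lookup m i"] True by (simp add: lookup_half)
      moreover have "odd (c' i) \<longleftrightarrow> odd (c i)"
       using parity(1)[OF ab(1,2) wk True] parity(1)[OF ab(1,2) wk' True] w'(3) w(4) by simp
      ultimately show ?thesis by presburger
     next
      case False
      hence "\<not> 0 < c i" "\<not> 0 < c' i" using cnt_bound[OF wk, of i] cnt_bound[OF wk', of i] w(4) w'(3) by auto
      thus ?thesis by simp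
     qed
    qed
    hence "half n c' = half n c \<longleftrightarrow> c' = c" "half n c = half n c' \<longleftrightarrow> c' = c" by auto
    thus ?thesis using True ab by (auto simp: t' nfm_def lookup_single when_def)
   next
    case False
    thus ?thesis using ab by (auto simp: t' nfm_def)
   qed
  qed
  have "lookup (frag_extend (nfm \<alpha> \<beta>) ?G) (half n c)
   = (\<Sum>t\<in>keys ?G. lookup ?G t * lookup (nfm \<alpha> \<beta> t) (half n c))"
   unfolding frag_extend_def lookup_sum by simp
  also have "\<dots> = (\<Sum>t\<in>keys ?G. if t = (x, z, c) then lookup ?G t else 0)"
   by (intro sum.cong refl) (simp add: uniq)
  also have "\<dots> = lookup ?G (x, z, c)" using xzc by simp
  finally have "half n c \<in> keys (frag_extend (nfm \<alpha> \<beta>) ?G)" using xzc by (simp add: in_keys_iff)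
  hence "frag_of (half n c) \<in> Rideal n A \<alpha> \<beta>" using R unfolding Rideal_iff by simp
  thus False using half_gone[OF ab(1,2) wk] w(2,4) ab(3) by simp
 qed
 hence "?G = 0" by simp
 thus ?thesis unfolding path_ideal_eq nf_ideal_def using gp by simp
qed

text \<open>Halving is additive up to 1 where both crossing numbers are odd. These are the indices
  where the middle sign differs from both outer ones, so the defect is the factor
  \<open>uprod (sep \<alpha> \<beta> \<gamma>)\<close> of the product.\<close>

lemma PhiT_mult:
 assumes g: "keys g \<subseteq> TP n k TT" and h: "keys h \<subseteq> TP n k TT"
 shows "PhiT n A (pmult n g h) = PhiT n A g \<otimes>\<^bsub>Bfree n A\<^esub> PhiT n A h"
proof (intro ext)
 fix \<alpha> \<gamma>
 let ?R = "\<lambda>g h. \<Sum>\<beta>\<in>BF n A. uprod (sep \<alpha> \<beta> \<gamma>) * PhiT n A g \<alpha> \<beta> * PhiT n A h \<beta> \<gamma>"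
 have path: "PhiT n A (path_comp n p q) \<alpha> \<gamma> = ?R (frag_of p) (frag_of q)"
  if p: "p \<in> TP n k TT" and q: "q \<in> TP n k TT" for p q
 proof -
  obtain x u z where xu: "p = (x, u)" "walk n x u = Some z" "z \<in> TT" using p unfolding TP_def paths_def by auto
  obtain y v t where yv: "q = (y, v)" "walk n y v = Some t" using q unfolding TP_def paths_def by auto
  let ?b = "signs_of n z"
  have b: "?b \<in> BF n A" "sc ?b = z" using signs_BF signs_of xu(3) by blast+
  have "?R (frag_of p) (frag_of q) = (\<Sum>\<beta>\<in>BF n A. if \<beta> = ?b then uprod (sep \<alpha> ?b \<gamma>) * phf n A \<alpha> ?b p * phf n A ?b \<gamma> q else 0)"
  proof (intro sum.cong refl)
   fix \<beta> assume "\<beta> \<in> BF n A"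
   hence "\<beta> \<noteq> ?b ==> phf n A \<alpha> \<beta> p = 0" using BF_eqI[of \<beta> ?b] b xu(2) by (auto simp: phf_def xu(1))
   thus "uprod (sep \<alpha> \<beta> \<gamma>) * PhiT n A (frag_of p) \<alpha> \<beta> * PhiT n A (frag_of q) \<beta> \<gamma>
    = (if \<beta> = ?b then uprod (sep \<alpha> ?b \<gamma>) * phf n A \<alpha> ?b p * phf n A ?b \<gamma> q else 0)" by (simp add: PhiT_def)
  qed
  also have "\<dots> = uprod (sep \<alpha> ?b \<gamma>) * phf n A \<alpha> ?b p * phf n A ?b \<gamma> q" using b(1) by simp
  also have "\<dots> = PhiT n A (path_comp n p q) \<alpha> \<gamma>"
  proof (cases "y = z \<and> \<alpha> \<in> BF n A \<and> \<gamma> \<in> BF n A \<and> sc \<alpha> = x \<and> sc \<gamma> = t")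
   case True
   have w: "walk n (sc \<alpha>) u = Some (sc ?b)" "walk n (sc ?b) v = Some (sc \<gamma>)"
    using True xu yv b by auto
   have l: "length \<alpha> = n" using True BF_length by blast
   have hm: "half n (\<lambda>i. cnt u i + cnt v i) = expo (sep \<alpha> ?b \<gamma>) + half n (cnt u) + half n (cnt v)"
   proof (rule poly_mapping_eqI)
    fix i
    show "lookup (half n (\<lambda>i. cnt u i + cnt v i)) i = lookup (expo (sep \<alpha> ?b \<gamma>) + half n (cnt u) + half n (cnt v)) i"
    proof (cases "i \<in> {1..n}")
     case i: True
     have "i \<in> sep \<alpha> ?b \<gamma> \<longleftrightarrow> odd (cnt u i) \<and> odd (cnt v i)"
      using parity(2)[OF _ b(1) w(1) i] parity(2)[OF b(1) _ w(2) i] True i l unfolding sep_def by blast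
     moreover have "(a + b) div 2 = (if odd a \<and> odd b then 1 else 0) + a div 2 + b div 2" for a b :: nat by presburger
     ultimately show ?thesis using i by (simp add: lookup_add lookup_half lookup_expo)
    next
     case False
     hence "i \<notin> sep \<alpha> ?b \<gamma>" using l unfolding sep_def by blast
     thus ?thesis by (simp only: lookup_add lookup_half lookup_expo[OF finite_sep] False if_False add_0)
    qed
   qed
   have "path_comp n p q = frag_of (x, u @ v)" using True xu yv by (simp add: path_comp_def)
   moreover have "walk n x (u @ v) = Some t" using True xu yv by (simp add: walk_append)
   ultimately have "PhiT n A (path_comp n p q) \<alpha> \<gamma> = frag_of (half n (\<lambda>i. cnt u i + cnt v i))"
    using True by (simp add: PhiT_def phf_def cnt_append)
   also have "\<dots> = uprod (sep \<alpha> ?b \<gamma>) * frag_of (half n (cnt u)) * frag_of (half n (cnt v))"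
    unfolding hm uprod_eq[OF finite_sep] frag_of_mult ..
   finally show ?thesis using True xu yv b by (simp add: phf_def)
  next
   case False
   hence 1: "phf n A \<alpha> ?b p = 0 \<or> phf n A ?b \<gamma> q = 0" using xu yv b by (auto simp: phf_def)
   have "PhiT n A (path_comp n p q) \<alpha> \<gamma> = 0"
   proof (cases "y = z")
    case True
    have "path_comp n p q = frag_of (x, u @ v)" "walk n x (u @ v) = Some t" using True xu yv by (simp_all add: path_comp_def walk_append)
    thus ?thesis using False True by (auto simp: PhiT_def phf_def)
   next
    case False
    hence "path_comp n p q = 0" using xu yv by (simp add: path_comp_def)
    thus ?thesis by (simp add: PhiT_def)
   qed
   thus ?thesis using 1 by auto
  qed
  finally show ?thesis by simp
 qed
 have Rd: "?R (a - b) h = ?R a h - ?R b h" "?R g (a - b) = ?R g a - ?R g b" for a b g h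
  unfolding PhiT_def frag_extend_diff by (simp_all only: right_diff_distrib left_diff_distrib sum_subtractf)
 have R0: "?R 0 h = 0" "?R g 0 = 0" for g h unfolding PhiT_def by simp_all
 have one: "PhiT n A (pmult n (frag_of p) h) \<alpha> \<gamma> = ?R (frag_of p) h" if p: "p \<in> TP n k TT" for p
  using h
 proof (induction h rule: frag_induction)
  case (one q)
  thus ?case unfolding pmult_frag by (rule path[OF p])
 next
  case (diff a b)
  thus ?case unfolding Rd pmult_diff by (simp only: PhiT_def frag_extend_diff)
 qed (simp add: R0, simp add: PhiT_def)
 have "PhiT n A (pmult n g h) \<alpha> \<gamma> = ?R g h"
  using g
 proof (induction g rule: frag_induction)
  case (one p)
  thus ?case using \<open>\<And>p. p \<in> TP n k TT ==> PhiT n A (pmult n (frag_of p) h) \<alpha> \<gamma> = ?R (frag_of p) h\<close> by blast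
 next
  case (diff a b)
  thus ?case unfolding Rd pmult_diff by (simp only: PhiT_def frag_extend_diff)
 qed (simp add: R0, simp add: PhiT_def)
 thus "PhiT n A (pmult n g h) \<alpha> \<gamma> = (PhiT n A g \<otimes>\<^bsub>Bfree n A\<^esub> PhiT n A h) \<alpha> \<gamma>" unfolding Bfree_sel .
qed

text \<open>A monomial outside the ideal comes from a path that crosses each disagreeing index once,
  given by \<open>path_exists\<close>, preceded by one loop \<open>AU i\<close> for every factor of
  the monomial.\<close>

lemma path_lift:
 assumes "\<alpha> \<in> BF n A" "\<beta> \<in> BF n A" "inU n m" "\<not> gone A \<alpha> \<beta> (keys m)"
 shows "\<exists>w. walk n (sc \<alpha>) w = Some (sc \<beta>) \<and> half n (cnt w) = m"
proof -
 have mU: "keys m \<subseteq> {1..n}" using assms(3) unfolding inU_def .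
 have l: "length \<alpha> = n" "length \<beta> = n" using assms BF_length by blast+
 let ?D = "{i \<in> {1..n}. sgn_at (sc \<alpha>) i \<noteq> sgn_at (sc \<beta>) i}"
 have "\<not> bad n (sc \<alpha>) (keys m \<union> ?D)"
  using assms(4) gone_bad[OF assms(1,2) mU] unfolding diff_signs_sgn[OF l] by blast
 hence "\<not> bad n (sc \<alpha>) ?D" using bad_mono[of n "sc \<alpha>" ?D "keys m \<union> ?D"] by blast
 then obtain w where w: "walk n (sc \<alpha>) w = Some (sc \<beta>)"
  "cnt w = (\<lambda>i. if i \<in> {1..n} \<and> sgn_at (sc \<alpha>) i \<noteq> sgn_at (sc \<beta>) i then 1 else 0)"
  using path_exists[OF sc_TT[OF assms(1)] sc_TT[OF assms(2)]] by blast
 obtain us where us: "mset us = Abs_multiset (lookup m)" by (metis ex_mset)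
 have cm: "count_list us i = lookup m i" for i
  unfolding count_mset[symmetric] us by (rule fun_cong[OF count_Abs_multiset]) (simp add: in_keys_iff[symmetric])
 have mk: "i \<in> {1..n}" if "lookup m i \<noteq> 0" for i
  using subsetD[OF mU, of i] that unfolding in_keys_iff by blast
 have "i \<in> {1..n}" if "i \<in> set us" for i
  using that mk[of i] cm[of i] count_list_0_iff[of us i] by metis
 hence "walk n (sc \<alpha>) (map AU us) = Some (sc \<alpha>)" by (intro walk_U) auto
 hence 1: "walk n (sc \<alpha>) (map AU us @ w) = Some (sc \<beta>)" using w(1) by (simp add: walk_append)
 have "half n (cnt (map AU us @ w)) = m"
 proof (rule poly_mapping_eqI)
  fix i
  show "lookup (half n (cnt (map AU us @ w))) i = lookup m i"
   using mk[of i] by (cases "i \<in> {1..n}") (auto simp: lookup_half cnt_U cm w(2))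
 qed
 thus ?thesis using 1 by blast
qed

text \<open>The set \<open>T'\<close> is left open because the result serves twice: for the whole
  algebra, and for the truncation to vertices without 0 that corresponds to the plus part. Monomials
  in the ideal are dropped, the others lifted by \<open>path_lift\<close>.\<close>

lemma PhiT_surj:
 assumes M: "M \<in> carrier (Bfree n A)" and T': "\<And>\<alpha> \<beta>. M \<alpha> \<beta> \<noteq> 0 ==> sc \<alpha> \<in> T' \<and> sc \<beta> \<in> T'"
 shows "\<exists>g. keys g \<subseteq> TP n k T' \<and> bcl n A (PhiT n A g) = bcl n A M"
proof -
 obtain s where s: "\<And>\<alpha> \<beta> m. \<alpha> \<in> BF n A ==> \<beta> \<in> BF n A ==> inU n m ==> \<not> gone A \<alpha> \<beta> (keys m) ==>
   walk n (sc \<alpha>) (s \<alpha> \<beta> m) = Some (sc \<beta>) \<and> half n (cnt (s \<alpha> \<beta> m)) = m"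
  using path_lift by metis
 define F where "F \<alpha> \<beta> = frag_extend (\<lambda>m. if gone A \<alpha> \<beta> (keys m) then 0 else frag_of (sc \<alpha>, s \<alpha> \<beta> m)) (M \<alpha> \<beta>)" for \<alpha> \<beta>
 define g where "g = (\<Sum>\<alpha>\<in>BF n A. \<Sum>\<beta>\<in>BF n A. F \<alpha> \<beta>)"
 have inU: "inU n m" if "m \<in> keys (M \<alpha> \<beta>)" for m \<alpha> \<beta> using BfreeD(1)[OF M, of \<alpha> \<beta>] that unfolding Zu_carrier by blast
 have FT: "keys (F \<alpha> \<beta>) \<subseteq> TP n k T'" if ab: "\<alpha> \<in> BF n A" "\<beta> \<in> BF n A" for \<alpha> \<beta>
  unfolding F_def
 proof (rule keys_frag_extend_subset)
  fix m assume m: "m \<in> keys (M \<alpha> \<beta>)"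
  hence "M \<alpha> \<beta> \<noteq> 0" by auto
  thus "keys (if gone A \<alpha> \<beta> (keys m) then 0 else frag_of (sc \<alpha>, s \<alpha> \<beta> m)) \<subseteq> TP n k T'"
  proof (cases "gone A \<alpha> \<beta> (keys m)")
   case False
   have "(sc \<alpha>, s \<alpha> \<beta> m) \<in> TP n k T'"
    unfolding TP_mem using s[OF ab inU[OF m] False] T'[OF \<open>M \<alpha> \<beta> \<noteq> 0\<close>] sc_vertices[OF ab(1)] by blast
   thus ?thesis using False by simp
  qed simp
 qed
 have g: "keys g \<subseteq> TP n k T'"
 proof -
  have "keys g \<subseteq> (\<Union>\<alpha>\<in>BF n A. keys (\<Sum>\<beta>\<in>BF n A. F \<alpha> \<beta>))" unfolding g_def by (rule keys_sum)
  also have "\<dots> \<subseteq> (\<Union>\<alpha>\<in>BF n A. \<Union>\<beta>\<in>BF n A. keys (F \<alpha> \<beta>))" by (intro UN_mono order_refl keys_sum)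
  finally show ?thesis using FT by blast
 qed
 have FP: "frag_extend (phf n A \<alpha>' \<beta>') (F \<alpha> \<beta>) = (if \<alpha> = \<alpha>' then if \<beta> = \<beta>' then
   frag_extend (\<lambda>m. if gone A \<alpha>' \<beta>' (keys m) then 0 else frag_of m) (M \<alpha>' \<beta>') else 0 else 0)"
  if ab: "\<alpha> \<in> BF n A" "\<beta> \<in> BF n A" and ab': "\<alpha>' \<in> BF n A" "\<beta>' \<in> BF n A" for \<alpha> \<beta> \<alpha>' \<beta>'
 proof -
  have "frag_extend (phf n A \<alpha>' \<beta>') (F \<alpha> \<beta>) = frag_extend (\<lambda>m. if \<alpha> = \<alpha>' then if \<beta> = \<beta>' then
    if gone A \<alpha>' \<beta>' (keys m) then 0 else frag_of m else 0 else 0) (M \<alpha> \<beta>)"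
   unfolding F_def frag_extend_frag_extend
  proof (rule frag_extend_eq)
   fix m assume m: "m \<in> keys (M \<alpha> \<beta>)"
   show "frag_extend (phf n A \<alpha>' \<beta>') (if gone A \<alpha> \<beta> (keys m) then 0 else frag_of (sc \<alpha>, s \<alpha> \<beta> m))
    = (if \<alpha> = \<alpha>' then if \<beta> = \<beta>' then if gone A \<alpha>' \<beta>' (keys m) then 0 else frag_of m else 0 else 0)"
   proof (cases "gone A \<alpha> \<beta> (keys m)")
    case True
    thus ?thesis by (cases "\<alpha> = \<alpha>' \<and> \<beta> = \<beta>'") auto
   next
    case False
    have w: "walk n (sc \<alpha>) (s \<alpha> \<beta> m) = Some (sc \<beta>)" "half n (cnt (s \<alpha> \<beta> m)) = m"
     using s[OF ab inU[OF m] False] by blast+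
    have "sc \<alpha>' = sc \<alpha> \<longleftrightarrow> \<alpha> = \<alpha>'" "sc \<beta>' = sc \<beta> \<longleftrightarrow> \<beta> = \<beta>'"
     using BF_eqI[OF ab(1) ab'(1)] BF_eqI[OF ab(2) ab'(2)] by metis+
    hence "phf n A \<alpha>' \<beta>' (sc \<alpha>, s \<alpha> \<beta> m) = (if \<alpha> = \<alpha>' \<and> \<beta> = \<beta>' then frag_of m else 0)"
    proof (cases "\<alpha> = \<alpha>' \<and> \<beta> = \<beta>'")
     case True
     thus ?thesis using w ab' by (auto simp: phf_def)
    next
     case False
     hence "\<not> (sc \<alpha>' = sc \<alpha> \<and> sc \<beta>' = sc \<beta>)"
      using \<open>sc \<alpha>' = sc \<alpha> \<longleftrightarrow> \<alpha> = \<alpha>'\<close> \<open>sc \<beta>' = sc \<beta> \<longleftrightarrow> \<beta> = \<beta>'\<close> by blast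
     thus ?thesis using w False by (auto simp: phf_def)
    qed
    thus ?thesis using False by (cases "\<alpha> = \<alpha>' \<and> \<beta> = \<beta>'") auto
   qed
  qed
  thus ?thesis by auto
 qed
 have P: "PhiT n A g \<alpha> \<beta> = frag_extend (\<lambda>m. if gone A \<alpha> \<beta> (keys m) then 0 else frag_of m) (M \<alpha> \<beta>)"
  if ab: "\<alpha> \<in> BF n A" "\<beta> \<in> BF n A" for \<alpha> \<beta>
 proof -
  have fs: "frag_extend f (\<Sum>i\<in>I. h i) = (\<Sum>i\<in>I. frag_extend f (h i))" for f :: "path => zpoly" and h :: "signs => (path \<Rightarrow>\<^sub>0 int)" and I
   by (induction I rule: infinite_finite_induct) (simp_all add: frag_extend_add)
  have "PhiT n A g \<alpha> \<beta> = (\<Sum>\<alpha>'\<in>BF n A. \<Sum>\<beta>'\<in>BF n A. if \<alpha>' = \<alpha> then if \<beta>' = \<beta> then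
   frag_extend (\<lambda>m. if gone A \<alpha> \<beta> (keys m) then 0 else frag_of m) (M \<alpha> \<beta>) else 0 else 0)"
   unfolding PhiT_def g_def fs by (intro sum.cong refl) (use FP ab in blast)
  also have "\<dots> = (\<Sum>\<alpha>'\<in>BF n A. if \<alpha>' = \<alpha> then \<Sum>\<beta>'\<in>BF n A. if \<beta>' = \<beta> then
   frag_extend (\<lambda>m. if gone A \<alpha> \<beta> (keys m) then 0 else frag_of m) (M \<alpha> \<beta>) else 0 else 0)"
   by (intro sum.cong refl) simp
  finally show ?thesis using ab by simp
 qed
 have "bcl n A (PhiT n A g) = bcl n A M"
  unfolding bcl_eq[OF PhiT_closed M] Bideal_iff
 proof (intro conjI ballI)
  show "(\<lambda>\<alpha> \<beta>. PhiT n A g \<alpha> \<beta> - M \<alpha> \<beta>) \<in> carrier (Bfree n A)"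
  proof (rule BfreeI)
   fix \<alpha> \<beta>
   show "PhiT n A g \<alpha> \<beta> - M \<alpha> \<beta> \<in> carrier (Zu n)"
    using Zu_add_closed[OF BfreeD(1)[OF PhiT_closed] Zu_minus_closed[OF BfreeD(1)[OF M]], of g \<alpha> \<beta> \<alpha> \<beta>] by simp
   show "PhiT n A g \<alpha> \<beta> - M \<alpha> \<beta> = 0" if "\<alpha> \<notin> BF n A \<or> \<beta> \<notin> BF n A"
    using that BfreeD(2,3)[OF M] BfreeD(2,3)[OF PhiT_closed[of g]] by auto
  qed
  fix \<alpha> \<beta> assume ab: "\<alpha> \<in> BF n A" "\<beta> \<in> BF n A"
  have "PhiT n A g \<alpha> \<beta> - M \<alpha> \<beta> = frag_extend (\<lambda>m. if gone A \<alpha> \<beta> (keys m) then 0 else frag_of m) (M \<alpha> \<beta>) - frag_extend frag_of (M \<alpha> \<beta>)"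
   unfolding P[OF ab] by (simp only: frag_expansion[symmetric])
  also have "\<dots> = frag_extend (\<lambda>m. if gone A \<alpha> \<beta> (keys m) then - frag_of m else 0) (M \<alpha> \<beta>)"
   unfolding frag_extend_diff_fun[symmetric] by (rule frag_extend_eq) simp
  also have "\<dots> \<in> Rideal n A \<alpha> \<beta>"
   unfolding Rideal_iff
  proof
   fix m assume "m \<in> keys (frag_extend (\<lambda>m. if gone A \<alpha> \<beta> (keys m) then - frag_of m else 0) (M \<alpha> \<beta>))"
   then obtain m' where m': "m' \<in> keys (M \<alpha> \<beta>)" "m \<in> keys (if gone A \<alpha> \<beta> (keys m') then - frag_of m' else 0)"
    using keys_frag_extend[of "\<lambda>m. if gone A \<alpha> \<beta> (keys m) then - frag_of m else 0" "M \<alpha> \<beta>"] by blast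
   hence "m = m' \<and> gone A \<alpha> \<beta> (keys m')" by (simp add: keys_minus split: if_splits)
   thus "inU n m \<and> gone A \<alpha> \<beta> (keys m)" using inU[OF m'(1)] by blast
  qed
  finally show "PhiT n A g \<alpha> \<beta> - M \<alpha> \<beta> \<in> Rideal n A \<alpha> \<beta>" .
 qed
 thus ?thesis using g by blast
qed

lemma PhiT_path:
 assumes "x \<in> TT" "walk n x w = Some z" "z \<in> TT"
 shows "PhiT n A (frag_of (x, w)) = munit n A (frag_of (half n (cnt w))) (signs_of n x) (signs_of n z)"
proof (intro ext)
 fix \<alpha> \<beta>
 have "\<gamma> \<in> BF n A \<and> sc \<gamma> = y \<longleftrightarrow> \<gamma> = signs_of n y" if "y \<in> TT" for \<gamma> y
  using signs_of(2)[OF that] signs_BF[OF that] signs_of_sign_changes[of \<gamma> n] BF_length[of \<gamma> n A] by metis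
 from this[OF assms(1), of \<alpha>] this[OF assms(3), of \<beta>]
 have "\<alpha> \<in> BF n A \<and> \<beta> \<in> BF n A \<and> sc \<alpha> = x \<and> sc \<beta> = z \<longleftrightarrow> \<alpha> = signs_of n x \<and> \<beta> = signs_of n z" by blast
 thus "PhiT n A (frag_of (x, w)) \<alpha> \<beta> = munit n A (frag_of (half n (cnt w))) (signs_of n x) (signs_of n z) \<alpha> \<beta>"
  unfolding PhiT_def frag_extend_of phf_def munit_def using signs_BF[OF assms(1)] signs_BF[OF assms(3)] assms(2) by simp
qed

end

section \<open>The identifications\<close>

lemmas Bl_carrier = truncation_carrier[OF ksub_vertices, folded Bl_def]
 and Bl_sel = truncation_sel[OF ksub_vertices, folded Bl_def]
 and Bl_ring = truncation_ring[OF ksub_vertices, folded Bl_def]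

lemma pmult_TP:
 assumes g: "keys g \<subseteq> TP n k T" and h: "keys h \<subseteq> TP n k T"
 shows "keys (pmult n g h) \<subseteq> TP n k T"
proof (intro keys_frag_extend_subset)
 fix p q assume "p \<in> keys g" "q \<in> keys h"
 hence "p \<in> TP n k T" "q \<in> TP n k T" using g h by blast+
 then obtain x u y v where pq: "p = (x, u)" "q = (y, v)" "(x, u) \<in> TP n k T" "(y, v) \<in> TP n k T" by (cases p; cases q) blast
 show "keys (path_comp n p q) \<subseteq> TP n k T"
  using pq(3,4) unfolding TP_mem pq(1,2) path_comp_def by (auto simp: walk_append TP_mem)
qed

lemma half_arrow:
 "i \<in> {1..n} ==> half n (cnt [AR i]) = 0" "i \<in> {1..n} ==> half n (cnt [AL i]) = 0"
 "i \<in> {1..n} ==> half n (cnt [AU i]) = single i 1" "half n (cnt []) = 0"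
 by (rule poly_mapping_eqI; simp add: lookup_half lookup_single when_def)+

lemma ring_hom_uminus_eq:
 assumes "ring S" "h \<in> Ring.ring_hom R S" "h' \<in> Ring.ring_hom R S" "a \<in> carrier R" "b \<in> carrier R" "c \<in> carrier R"
  "c \<oplus>\<^bsub>R\<^esub> b = a" "h a = h' a" "h b = h' b"
 shows "h c = h' c"
proof -
 interpret S: ring S by (rule assms(1))
 have "h c \<oplus>\<^bsub>S\<^esub> h b = h' c \<oplus>\<^bsub>S\<^esub> h b"
  using ring_hom_add[OF assms(2,6,5)] ring_hom_add[OF assms(3,6,5)] assms(7-9) by simp
 thus ?thesis
  using S.add.right_cancel[of "h b" "h c" "h' c"] ring_hom_closed[OF assms(2)] ring_hom_closed[OF assms(3)] assms(5,6) by simp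
qed

context cyclic_arrangement
begin

lemma TP_sub: "keys g \<subseteq> TP n k T ==> keys g \<subseteq> paths n k" using TP_paths by blast

lemma Phi_path_class:
 assumes "x \<in> TT" "walk n x w = Some z" "z \<in> TT"
 shows "Phi n A (path_class n k x w) = pf_elt n A (frag_of (half n (cnt w))) (signs_of n x) (signs_of n z)"
proof -
 have x: "x \<in> vertices n k" using assms(1) ksub_vertices by blast
 have "keys (frag_of (x, w)) \<subseteq> paths n k" using x assms(2) by (simp add: paths_def)
 thus ?thesis unfolding path_class_pcl[OF x assms(2)] pf_elt_def PhiT_path[OF assms, symmetric] by (rule Phi_pcl)
qed

lemma Phi_mult:
 assumes g: "keys g \<subseteq> TP n k TT" and h: "keys h \<subseteq> TP n k TT"
 shows "Phi n A (pcl n k g \<otimes>\<^bsub>Bl n k\<^esub> pcl n k h) = Phi n A (pcl n k g) \<otimes>\<^bsub>Btilde n A\<^esub> Phi n A (pcl n k h)"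
 unfolding Bl_sel pcl_simps(1)[OF TP_sub[OF g] TP_sub[OF h]] Phi_pcl[OF TP_sub[OF g]] Phi_pcl[OF TP_sub[OF h]]
  Phi_pcl[OF TP_sub[OF pmult_TP[OF g h]]] PhiT_mult[OF g h] bcl_simps(1)[OF PhiT_closed PhiT_closed] ..

lemma Phi_surj: "Phi n A ` carrier (Bl n k) = carrier (Btilde n A)"
proof (intro equalityI subsetI)
 fix Y assume "Y \<in> Phi n A ` carrier (Bl n k)"
 then obtain g where "keys g \<subseteq> TP n k TT" "Y = Phi n A (pcl n k g)" unfolding image_iff Bex_def Bl_carrier by blast
 thus "Y \<in> carrier (Btilde n A)" using Phi_pcl[OF TP_sub] PhiT_closed unfolding Btilde_carrier by blast
next
 fix Y assume "Y \<in> carrier (Btilde n A)"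
 then obtain M where M: "M \<in> carrier (Bfree n A)" "Y = bcl n A M" unfolding Btilde_carrier by blast
 have "sc \<alpha> \<in> TT \<and> sc \<beta> \<in> TT" if "M \<alpha> \<beta> \<noteq> 0" for \<alpha> \<beta>
  using that BfreeD(2,3)[OF M(1)] sc_TT by blast
 from PhiT_surj[OF M(1) this] obtain g where g: "keys g \<subseteq> TP n k TT" "bcl n A (PhiT n A g) = Y" unfolding M(2) by blast
 hence "Phi n A (pcl n k g) = Y" using Phi_pcl[OF TP_sub[OF g(1)]] by simp
 moreover have "pcl n k g \<in> carrier (Bl n k)" unfolding Bl_carrier using g(1) by blast
 ultimately show "Y \<in> Phi n A ` carrier (Bl n k)" by blast
qed

lemma Phi_inj: "inj_on (Phi n A) (carrier (Bl n k))"
proof (rule inj_onI)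
 fix X Y assume "X \<in> carrier (Bl n k)" "Y \<in> carrier (Bl n k)" and e: "Phi n A X = Phi n A Y"
 then obtain g h where g: "keys g \<subseteq> TP n k TT" "X = pcl n k g" and h: "keys h \<subseteq> TP n k TT" "Y = pcl n k h"
  unfolding Bl_carrier by blast
 have "(\<lambda>\<alpha> \<beta>. PhiT n A g \<alpha> \<beta> - PhiT n A h \<alpha> \<beta>) \<in> Bideal n A"
  using e bcl_eq[OF PhiT_closed PhiT_closed] unfolding g(2) h(2) Phi_pcl[OF TP_sub[OF g(1)]] Phi_pcl[OF TP_sub[OF h(1)]] by blast
 hence "PhiT n A (g - h) \<in> Bideal n A" by (simp add: PhiT_def[abs_def] frag_extend_diff)
 hence "g - h \<in> path_ideal n k" using keys_diff_subset[OF g(1) h(1)] by (intro PhiT_inj)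
 thus "X = Y" unfolding g(2) h(2) pcl_eq[OF TP_sub[OF g(1)] TP_sub[OF h(1)]] .
qed

lemma Phi_iso: "Phi n A \<in> ring_iso (Bl n k) (Btilde n A)"
proof -
 interpret L: ring "Bl n k" by (rule Bl_ring)
 interpret B: ring "Btilde n A" by (rule Btilde_ring)
 have c: "Phi n A X \<in> carrier (Btilde n A)" if "X \<in> carrier (Bl n k)" for X using Phi_surj that by blast
 have m: "Phi n A (X \<otimes>\<^bsub>Bl n k\<^esub> Y) = Phi n A X \<otimes>\<^bsub>Btilde n A\<^esub> Phi n A Y" if "X \<in> carrier (Bl n k)" "Y \<in> carrier (Bl n k)" for X Y
  using that Phi_mult unfolding Bl_carrier by blast
 have "Phi n A \<in> Ring.ring_hom (Bl n k) (Btilde n A)"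
 proof (rule ring_hom_memI)
  fix X Y assume "X \<in> carrier (Bl n k)" "Y \<in> carrier (Bl n k)"
  then obtain g h where g: "keys g \<subseteq> TP n k TT" "X = pcl n k g" and h: "keys h \<subseteq> TP n k TT" "Y = pcl n k h"
   unfolding Bl_carrier by blast
  show "Phi n A (X \<oplus>\<^bsub>Bl n k\<^esub> Y) = Phi n A X \<oplus>\<^bsub>Btilde n A\<^esub> Phi n A Y"
   unfolding g(2) h(2) Bl_sel pcl_simps(2)[OF TP_sub[OF g(1)] TP_sub[OF h(1)]] Phi_pcl[OF TP_sub[OF g(1)]] Phi_pcl[OF TP_sub[OF h(1)]]
    Phi_pcl[OF keys_add_subset[OF TP_sub[OF g(1)] TP_sub[OF h(1)]]] PhiT_add bcl_simps(2)[OF PhiT_closed PhiT_closed] ..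
 next
  \<comment> \<open>Preservation of the unit follows from multiplicativity and surjectivity.\<close>
  have "\<one>\<^bsub>Btilde n A\<^esub> \<in> Phi n A ` carrier (Bl n k)" unfolding Phi_surj by (rule B.one_closed)
  then obtain Y where Y: "Y \<in> carrier (Bl n k)" "Phi n A Y = \<one>\<^bsub>Btilde n A\<^esub>" by force
  have "Phi n A \<one>\<^bsub>Bl n k\<^esub> \<otimes>\<^bsub>Btilde n A\<^esub> Phi n A Y = Phi n A Y" using m[OF L.one_closed Y(1)] L.l_one[OF Y(1)] by simp
  thus "Phi n A \<one>\<^bsub>Bl n k\<^esub> = \<one>\<^bsub>Btilde n A\<^esub>" unfolding Y(2) using B.r_one[OF c[OF L.one_closed]] by simp
 qed (use c m in blast)+
 thus ?thesis using Phi_inj Phi_surj by (simp add: ring_iso_def bij_betw_def)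
qed

lemma Phi_is_identification: "is_identification n k A (Phi n A)"
 unfolding is_identification_def
proof (intro conjI ballI impI)
 show "Phi n A \<in> ring_iso (Bl n k) (Btilde n A)" by (rule Phi_iso)
 fix x assume x: "x \<in> TT"
 show "Phi n A (path_class n k x []) = f_elt n A (signs_of n x) (signs_of n x)"
  using Phi_path_class[OF x _ x, of "[]"] by (simp add: half_arrow)
 show "Phi n A (path_class n k x [AU i]) = pf_elt n A (uvar i) (signs_of n x) (signs_of n x)" if "i \<in> {1..n}" for i
 proof -
  have "walk n x [AU i] = Some x" using that by simp
  from Phi_path_class[OF x this x] show ?thesis unfolding half_arrow(3)[OF that] uvar_frag .
 qed
 fix y i a assume y: "y \<in> TT" and i: "i \<in> {1..n}" and a: "a \<in> {AR i, AL i}" "arrow_target n a x = Some y"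
 have "walk n x [a] = Some y" using a(2) by simp
 moreover have "half n (cnt [a]) = 0" using a(1) half_arrow(1,2)[OF i] by blast
 ultimately show "Phi n A (path_class n k x [a]) = f_elt n A (signs_of n x) (signs_of n y)"
  using Phi_path_class[OF x _ y] unfolding one_zpoly by metis
qed

text \<open>Along a word whose vertices all omit n every arrow has a prescribed value, and
  multiplicativity determines the rest.\<close>

lemma identification_avoiding:
 assumes id: "is_identification n k A \<Phi>"
 shows "x \<in> TT ==> walk n x w = Some z ==> \<forall>y\<in>set (visited n x w). n \<notin> y ==>
  \<Phi> (pcl n k (frag_of (x, w))) = Phi n A (pcl n k (frag_of (x, w)))"
proof (induction w arbitrary: x)
 case Nil
 have x: "x \<in> vertices n k" using Nil(1) ksub_vertices by blast
 have "\<Psi> (path_class n k x []) = f_elt n A (signs_of n x) (signs_of n x)" if "is_identification n k A \<Psi>" for \<Psi>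
  using that Nil(1) unfolding is_identification_def by blast
 thus ?case using id Phi_is_identification path_class_pcl[OF x, of "[]" x] by (metis walk.simps(1))
next
 case (Cons a w)
 have x: "x \<in> vertices n k" using Cons.prems(1) ksub_vertices by blast
 obtain y where y: "arrow_target n a x = Some y" "walk n y w = Some z" using walk_Cons_Some[OF Cons.prems(2)] by metis
 have yv: "y \<in> vertices n k" by (rule arrow_target_vertices[OF x y(1)])
 have av: "\<forall>y'\<in>set (visited n y w). n \<notin> y'" using Cons.prems(3) y(1) by simp
 have "y \<in> set (visited n y w)" by (cases w) simp_all
 hence yT: "y \<in> TT" unfolding ksubsets_vertices using yv av by blast
 have "z \<in> set (visited n x w)" if "walk n x w = Some z" for x w
  using that by (induction w arbitrary: x) (auto split: option.splits)
 hence "n \<notin> z" using Cons.prems(2,3) by blast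
 hence zT: "z \<in> TT" unfolding ksubsets_vertices using walk_vertices[OF x Cons.prems(2)] by blast
 have IH: "\<Phi> (pcl n k (frag_of (y, w))) = Phi n A (pcl n k (frag_of (y, w)))"
  by (rule Cons.IH[OF yT y(2) av])
 have wa: "walk n x [a] = Some y" using y(1) by simp
 have i: "1 \<le> ix a \<and> ix a \<le> n" by (rule arrow_target_ix[OF y(1)])
 have A: "\<Phi> (path_class n k x [a]) = Phi n A (path_class n k x [a])"
 proof (cases a)
  case (AU j)
  hence j: "j \<in> {1..n}" using i by auto
  have "\<Psi> (path_class n k x [AU j]) = pf_elt n A (uvar j) (signs_of n x) (signs_of n x)" if "is_identification n k A \<Psi>" for \<Psi>
   using that j Cons.prems(1) unfolding is_identification_def by blast
  thus ?thesis unfolding AU using id Phi_is_identification by metis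
 next
  case (AR j)
  hence j: "j \<in> {1..n}" "a \<in> {AR j, AL j}" using i by auto
  have "\<Psi> (path_class n k x [a]) = f_elt n A (signs_of n x) (signs_of n y)" if "is_identification n k A \<Psi>" for \<Psi>
   using that j y(1) Cons.prems(1) yT unfolding is_identification_def by blast
  thus ?thesis using id Phi_is_identification by metis
 next
  case (AL j)
  hence j: "j \<in> {1..n}" "a \<in> {AR j, AL j}" using i by auto
  have "\<Psi> (path_class n k x [a]) = f_elt n A (signs_of n x) (signs_of n y)" if "is_identification n k A \<Psi>" for \<Psi>
   using that j y(1) Cons.prems(1) yT unfolding is_identification_def by blast
  thus ?thesis using id Phi_is_identification by metis
 qed
 have T: "keys (frag_of (x, [a])) \<subseteq> TP n k TT" "keys (frag_of (y, w)) \<subseteq> TP n k TT"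
  using x yv yT zT Cons.prems(1) wa y(2) by (simp_all add: TP_mem del: walk.simps)
 have "pmult n (frag_of (x, [a])) (frag_of (y, w)) = frag_of (x, a # w)"
  unfolding pmult_frag path_comp_def using wa by (simp del: walk.simps)
 hence eq: "pcl n k (frag_of (x, a # w)) = path_class n k x [a] \<otimes>\<^bsub>Bl n k\<^esub> pcl n k (frag_of (y, w))"
  unfolding path_class_pcl[OF x wa] Bl_sel pcl_simps(1)[OF TP_sub[OF T(1)] TP_sub[OF T(2)]] by simp
 have c: "path_class n k x [a] \<in> carrier (Bl n k)" "pcl n k (frag_of (y, w)) \<in> carrier (Bl n k)"
  unfolding path_class_pcl[OF x wa] Bl_carrier using T by blast+
 have hom: "\<Phi> \<in> Ring.ring_hom (Bl n k) (Btilde n A)" "Phi n A \<in> Ring.ring_hom (Bl n k) (Btilde n A)"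
  using id Phi_iso unfolding is_identification_def ring_iso_def by blast+
 show ?case unfolding eq using ring_hom_mult[OF hom(1) c] ring_hom_mult[OF hom(2) c] A IH by simp
qed

text \<open>\<open>identification\<close> is an arbitrary choice, so computing with it requires that
  every choice agrees with the explicit \<open>Phi\<close>. A path that does not vanish is first
  replaced by an equivalent one that avoids n, using \<open>eqv_avoiding_last\<close>.\<close>

lemma identification_unique:
 assumes id: "is_identification n k A \<Phi>" and X: "X \<in> carrier (Bl n k)"
 shows "\<Phi> X = Phi n A X"
proof -
 have hom: "\<Phi> \<in> Ring.ring_hom (Bl n k) (Btilde n A)" "Phi n A \<in> Ring.ring_hom (Bl n k) (Btilde n A)"
  using id Phi_iso unfolding is_identification_def ring_iso_def by blast+
 have z: "pcl n k 0 = \<zero>\<^bsub>Bl n k\<^esub>" unfolding Bl_sel Bquiv_def using ideal.quot_simps(4)[OF path_ideal_ideal, of n k] by simp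
 have z0: "\<Phi> (pcl n k 0) = Phi n A (pcl n k 0)"
  unfolding z using ring_hom_zero[OF hom(1) Bl_ring Btilde_ring] ring_hom_zero[OF hom(2) Bl_ring Btilde_ring] by simp
 obtain g where g: "keys g \<subseteq> TP n k TT" "X = pcl n k g" using X unfolding Bl_carrier by blast
 have "keys g \<subseteq> TP n k TT \<and> \<Phi> (pcl n k g) = Phi n A (pcl n k g)"
  using g(1)
 proof (induction g rule: frag_induction)
  case (one p)
  then obtain x w where p: "p = (x, w)" "(x, w) \<in> TP n k TT" by (cases p) blast
  then obtain z where xz: "x \<in> vertices n k" "x \<in> TT" "z \<in> TT" "walk n x w = Some z" unfolding TP_mem by blast
  have pe: "path_elt n k x w = frag_of (x, w)" using xz by (simp add: path_elt_def paths_def)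
  have kp: "keys (frag_of (x, w)) \<subseteq> paths n k" using xz by (simp add: paths_def)
  from eqv_avoiding_last[OF xz(2,3,4)] have "\<Phi> (pcl n k (frag_of (x, w))) = Phi n A (pcl n k (frag_of (x, w)))"
  proof
   assume "zro n k x w"
   hence "pcl n k (frag_of (x, w)) = pcl n k 0" using pcl_eq[OF kp, of 0] unfolding zro_def pe by simp
   thus ?thesis using z0 by simp
  next
   assume "\<exists>w'. eqv n k x w w' \<and> (\<forall>y\<in>set (visited n x w'). n \<notin> y)"
   then obtain w' where w': "eqv n k x w w'" "\<forall>y\<in>set (visited n x w'). n \<notin> y" by blast
   have wk: "walk n x w' = Some z" using eqv_walk[OF w'(1)] xz(4) by simp
   hence pe': "path_elt n k x w' = frag_of (x, w')" and kp': "keys (frag_of (x, w')) \<subseteq> paths n k"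
    using xz by (simp_all add: path_elt_def paths_def)
   have "pcl n k (frag_of (x, w)) = pcl n k (frag_of (x, w'))" using w'(1) unfolding pcl_eq[OF kp kp'] eqv_def pe pe' by blast
   thus ?thesis using identification_avoiding[OF id xz(2) wk w'(2)] by simp
  qed
  thus ?case using p by simp
 next
  case (diff a b)
  hence ab: "keys a \<subseteq> TP n k TT" "keys b \<subseteq> TP n k TT" by blast+
  note d = keys_diff_subset[OF ab]
  have c: "pcl n k a \<in> carrier (Bl n k)" "pcl n k b \<in> carrier (Bl n k)" "pcl n k (a - b) \<in> carrier (Bl n k)"
   unfolding Bl_carrier using ab d by blast+
  have "pcl n k (a - b) \<oplus>\<^bsub>Bl n k\<^esub> pcl n k b = pcl n k a"
   unfolding Bl_sel pcl_simps(2)[OF TP_sub[OF d] TP_sub[OF ab(2)]] by simp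
  thus ?case using ring_hom_uminus_eq[OF Btilde_ring hom c] diff d by blast
 qed (use z0 in simp)
 thus ?thesis unfolding g(2) by blast
qed

lemma identification: "is_identification n k A (identification n k A)"
 unfolding identification_def by (rule someI[where P = "is_identification n k A"]) (rule Phi_is_identification)

lemma identification_eq: "X \<in> carrier (Bl n k) ==> identification n k A X = Phi n A X"
 by (rule identification_unique[OF identification])

lemma PhiT_nonzero:
 assumes "PhiT n A g \<alpha> \<beta> \<noteq> 0"
 obtains w where "(sc \<alpha>, w) \<in> keys g" "sc \<beta> = the (walk n (sc \<alpha>) w)" "\<alpha> \<in> BF n A" "\<beta> \<in> BF n A"
proof -
 have "\<exists>p\<in>keys g. phf n A \<alpha> \<beta> p \<noteq> 0"
 proof (rule ccontr)
  assume "\<not> ?thesis"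
  hence "frag_extend (phf n A \<alpha> \<beta>) g = frag_extend (\<lambda>p. 0) g" by (intro frag_extend_eq) blast
  thus False using assms by (simp add: PhiT_def)
 qed
 then obtain x w where "(x, w) \<in> keys g" "phf n A \<alpha> \<beta> (x, w) \<noteq> 0" by auto
 thus thesis using that[of w] by (simp add: phf_def split: if_splits)
qed

end

section \<open>The quotient map of strands algebras\<close>

lemma arrow_target_remove_0:
 assumes "arrow_target n a x = Some y" "0 \<in> x" "0 \<in> y" shows "arrow_target n a (x - {0}) = Some (y - {0})"
proof (cases a)
 case (AR i)
 hence i: "1 \<le> i" "i \<le> n" "i - 1 \<in> x" "i \<notin> x" "y = insert i (x - {i - 1})"
  using assms(1) unfolding AR arrow_target_move by (auto split: if_splits)
 hence "i - 1 \<noteq> 0" using assms(3) by auto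
 moreover from this have "insert i (x - {0} - {i - 1}) = y - {0}" using i by auto
 ultimately show ?thesis unfolding AR arrow_target_move using i by simp
next
 case (AL i)
 hence i: "1 \<le> i" "i \<le> n" "i - 1 \<notin> x" "i \<in> x" "y = insert (i - 1) (x - {i})"
  using assms(1) unfolding AL arrow_target_move by (auto split: if_splits)
 hence "i - 1 \<noteq> 0" using assms(2) by metis
 moreover from this have "insert (i - 1) (x - {0} - {i}) = y - {0}" using i by auto
 ultimately show ?thesis unfolding AL arrow_target_move using i by simp
next
 case (AU i)
 thus ?thesis using assms(1) by (auto split: if_splits)
qed

lemma walk_remove_0:
 "walk n x w = Some z ==> \<forall>y\<in>set (visited n x w). 0 \<in> y ==> walk n (x - {0}) w = Some (z - {0}) \<and> 0 \<in> x \<and> 0 \<in> z"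
proof (induction w arbitrary: x)
 case (Cons a w)
 obtain y where y: "arrow_target n a x = Some y" "walk n y w = Some z" using walk_Cons_Some[OF Cons.prems(1)] by metis
 have v: "0 \<in> x" "\<forall>y'\<in>set (visited n y w). 0 \<in> y'" using Cons.prems(2) y(1) by simp_all
 have IH: "walk n (y - {0}) w = Some (z - {0}) \<and> 0 \<in> y \<and> 0 \<in> z" by (rule Cons.IH[OF y(2) v(2)])
 thus ?case using IH v(1) arrow_target_remove_0[OF y(1)] by simp
qed simp

text \<open>The path first leaves 0 by \<open>AR 1\<close>, from a vertex without 1. After the
  removal of 0 both 0 and 1 are unoccupied there, and step 1 is crossed; \<open>bad_step\<close>
  carries this back to the start.\<close>

lemma leaving_0_bad:
 "walk n x w = Some z ==> 0 \<in> x ==> \<not> (\<forall>y\<in>set (visited n x w). 0 \<in> y) ==> bad n (x - {0}) (ix ` set w)"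
proof (induction w arbitrary: x)
 case (Cons a w)
 obtain y where y: "arrow_target n a x = Some y" "walk n y w = Some z" using walk_Cons_Some[OF Cons.prems(1)] by metis
 have v: "\<not> (\<forall>y'\<in>set (visited n y w). 0 \<in> y')" using Cons.prems(2,3) y(1) by simp
 show ?case
 proof (cases "0 \<in> y")
  case True
  have "bad n (y - {0}) (ix ` set w)" by (rule Cons.IH[OF y(2) True v])
  hence "bad n (y - {0}) (ix ` set (a # w))" by (rule bad_mono) auto
  thus ?thesis using bad_step[OF arrow_target_remove_0[OF y(1) Cons.prems(2) True], of "ix ` set (a # w)"] by simp
 next
  case False
  have "a = AR 1 \<and> 1 \<le> n \<and> 1 \<notin> x"
  proof (cases a)
   case (AR i)
   hence i: "1 \<le> i" "i \<le> n" "i - 1 \<in> x" "i \<notin> x" "y = insert i (x - {i - 1})"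
    using y(1) unfolding AR arrow_target_move by (auto split: if_splits)
   hence "i - 1 = 0" using False Cons.prems(2) by auto
   hence "i = 1" using i(1) by simp
   thus ?thesis using i AR by simp
  next
   case (AL i)
   hence i: "1 \<le> i" "y = insert (i - 1) (x - {i})"
    using y(1) unfolding AL arrow_target_move by (auto split: if_splits)
   thus ?thesis using False Cons.prems(2) by auto
  next
   case (AU i)
   thus ?thesis using y(1) False Cons.prems(2) by (auto split: if_splits)
  qed
  moreover have "{0<..1} = {1::nat}" by auto
  ultimately show ?thesis by (intro badI[of 0 1]) auto
 qed
qed simp

lemma bad_remove: "bad n x Z ==> bad n (x - {0}) Z" unfolding bad_def by blast

lemma paths_remove_0:
 assumes "(x, w) \<in> paths n (k + 1)" "\<forall>y\<in>set (visited n x w). 0 \<in> y" shows "(x - {0}, w) \<in> paths n k"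
proof -
 obtain z where z: "walk n x w = Some z" "x \<in> vertices n (k + 1)" using assms(1) unfolding paths_def by auto
 have "walk n (x - {0}) w \<noteq> None" "0 \<in> x" using walk_remove_0[OF z(1) assms(2)] by simp_all
 moreover from this have "x - {0} \<in> vertices n k" using z(2) vertices_finite[OF z(2)] unfolding vertices_def by auto
 ultimately show ?thesis unfolding paths_def by blast
qed

lemma F_path_keys: "p \<in> paths n (k + 1) ==> keys (F_path n p) \<subseteq> paths n k"
 using paths_remove_0 by (cases p) (auto simp: F_path_def)

text \<open>Whether a path leaves 0 is not visible in its normal form: \<open>AU 1\<close> and
  \<open>AR 1\<close> followed by \<open>AL 1\<close> can agree. Vanishing after the removal of 0 is
  visible, and by \<open>leaving_0_bad\<close> it includes this case.\<close>

definition drop0 :: "nat => nat set \<times> nat set \<times> (nat => nat) => (nat set \<times> nat set \<times> (nat => nat)) \<Rightarrow>\<^sub>0 int" where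
 "drop0 n = (\<lambda>(x, z, c). if 0 \<in> x \<and> 0 \<in> z \<and> \<not> bad n (x - {0}) {i. 0 < c i} then frag_of (x - {0}, z - {0}, c) else 0)"

lemma F_path_nf:
 assumes "p \<in> paths n (k + 1)" shows "nfe n (F_path n p) = frag_extend (drop0 n) (nf n p)"
proof -
 obtain x w z where p: "p = (x, w)" "walk n x w = Some z" using assms unfolding paths_def by auto
 have c: "{i. 0 < cnt w i} = ix ` set w" using cnt_pos_iff by blast
 show ?thesis
 proof (cases "\<forall>y\<in>set (visited n x w). 0 \<in> y")
  case True
  note r = walk_remove_0[OF p(2) True]
  show ?thesis
   using True r p(2) bad_remove[of n x "ix ` set w"] by (auto simp: F_path_def nf_def drop0_def p(1) c)
 next
  case False
  hence "0 \<in> x ==> bad n (x - {0}) (ix ` set w)" using leaving_0_bad[OF p(2)] by blast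
  moreover have "F_path n p = 0" using False by (auto simp: F_path_def p(1))
  ultimately show ?thesis by (auto simp: nf_def drop0_def p c)
 qed
qed

lemma F_keys:
 "keys g \<subseteq> paths n (k + 1) ==> keys (frag_extend (F_path n) g) \<subseteq> paths n k"
 by (rule keys_frag_extend_subset) (use F_path_keys in blast)

lemma F_ideal:
 assumes "g \<in> path_ideal n (k + 1)" shows "frag_extend (F_path n) g \<in> path_ideal n k"
proof -
 have g: "keys g \<subseteq> paths n (k + 1)" "nfe n g = 0" using assms unfolding path_ideal_eq nf_ideal_def by blast+
 have "nfe n (frag_extend (F_path n) g) = frag_extend (\<lambda>p. frag_extend (drop0 n) (nf n p)) g"
  unfolding frag_extend_frag_extend by (rule frag_extend_eq) (use F_path_nf g(1) in blast)
 also have "\<dots> = 0" unfolding frag_extend_frag_extend[symmetric] g(2) by simp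
 finally show ?thesis unfolding path_ideal_eq nf_ideal_def using F_keys[OF g(1)] by blast
qed

lemma F_hom_pcl:
 "keys g \<subseteq> paths n (k + 1) ==> F_hom n k (pcl n (k + 1) g) = pcl n k (frag_extend (F_path n) g)"
 unfolding F_hom_def
 by (rule quot_map_coset[OF path_ideal_ideal path_ideal_ideal]) (use F_keys F_ideal in \<open>auto simp: frag_extend_add\<close>)

lemma F_TP:
 assumes "keys g \<subseteq> TP n (k + 1) (ksubsets {0..<n} (k + 1))"
 shows "keys (frag_extend (F_path n) g) \<subseteq> TP n k (ksubsets {0..<n} k)"
proof (rule keys_frag_extend_subset)
 fix p assume "p \<in> keys g"
 then obtain x w where p: "p = (x, w)" "(x, w) \<in> TP n (k + 1) (ksubsets {0..<n} (k + 1))" using assms by (cases p) blast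
 then obtain z where xz: "x \<in> vertices n (k + 1)" "x \<in> ksubsets {0..<n} (k + 1)" "z \<in> ksubsets {0..<n} (k + 1)" "walk n x w = Some z"
  unfolding TP_mem by blast
 have r: "y - {0} \<in> ksubsets {0..<n} k" if "y \<in> ksubsets {0..<n} (k + 1)" "0 \<in> y" for y
 proof -
  have "finite y" using that(1) finite_subset unfolding ksubsets_def by blast
  thus ?thesis using that unfolding ksubsets_def by auto
 qed
 show "keys (F_path n p) \<subseteq> TP n k (ksubsets {0..<n} k)"
 proof (cases "\<forall>y\<in>set (visited n x w). 0 \<in> y")
  case True
  note w = walk_remove_0[OF xz(4) True]
  have "(x - {0}, w) \<in> TP n k (ksubsets {0..<n} k)"
   unfolding TP_mem using w r[OF xz(2)] r[OF xz(3)] ksub_vertices by blast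
  thus ?thesis using True by (auto simp: F_path_def p(1))
 qed (auto simp: F_path_def p(1))
qed

lemma F_hom_closed: "X \<in> carrier (Bl n (k + 1)) ==> F_hom n k X \<in> carrier (Bl n k)"
proof -
 assume "X \<in> carrier (Bl n (k + 1))"
 then obtain g where g: "keys g \<subseteq> TP n (k + 1) (ksubsets {0..<n} (k + 1))" "X = pcl n (k + 1) g" unfolding Bl_carrier by blast
 have "keys g \<subseteq> paths n (k + 1)" using g(1) TP_paths by (rule order_trans)
 thus ?thesis unfolding Bl_carrier g(2) F_hom_pcl[OF \<open>keys g \<subseteq> paths n (k + 1)\<close>] using F_TP[OF g(1)] by blast
qed

section \<open>Comparison of the bimodules\<close>

text \<open>The bimodules are the left ideals generated by the images of the units, so an
  isomorphism of the left rings that intertwines the two homomorphisms carries one onto the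
  other.\<close>

lemma hom_bimodule_transport:
 fixes S :: "'s ring" and T :: "'t ring" and A :: "'a ring" and C :: "'c ring"
 assumes S: "ring S" and T: "ring T" and iso: "h \<in> ring_iso S C"
  and F: "\<And>t. t \<in> carrier T ==> F t \<in> carrier S" and r1: "r \<one>\<^bsub>T\<^esub> = \<one>\<^bsub>A\<^esub>"
  and comm: "\<And>t. t \<in> carrier T ==> h (F t) = f (r t)"
 shows "bimodule_isomorphic S T (hom_bimodule T S F) (restrict_scalars h r (hom_bimodule A C f))"
proof -
 interpret S: ring S by (rule S)
 interpret T: ring T by (rule T)
 have hom: "h \<in> Ring.ring_hom S C" and bij: "bij_betw h (carrier S) (carrier C)" using iso unfolding ring_iso_def by blast+
 have h1: "h (F \<one>\<^bsub>T\<^esub>) = f \<one>\<^bsub>A\<^esub>" using comm[OF T.one_closed] r1 by simp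
 have Fc: "b \<otimes>\<^bsub>S\<^esub> F \<one>\<^bsub>T\<^esub> \<in> carrier S" if "b \<in> carrier S" for b using that F[OF T.one_closed] by simp
 let ?M = "{b \<otimes>\<^bsub>S\<^esub> F \<one>\<^bsub>T\<^esub> | b. b \<in> carrier S}"
 have MS: "?M \<subseteq> carrier S" using Fc by blast
 have hb: "h (b \<otimes>\<^bsub>S\<^esub> F \<one>\<^bsub>T\<^esub>) = h b \<otimes>\<^bsub>C\<^esub> f \<one>\<^bsub>A\<^esub>" if "b \<in> carrier S" for b
  using ring_hom_mult[OF hom that F[OF T.one_closed]] h1 by simp
 have "h ` ?M = {c \<otimes>\<^bsub>C\<^esub> f \<one>\<^bsub>A\<^esub> | c. c \<in> carrier C}"
 proof (intro equalityI subsetI)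
  fix y assume "y \<in> h ` ?M"
  then obtain b where "b \<in> carrier S" "y = h b \<otimes>\<^bsub>C\<^esub> f \<one>\<^bsub>A\<^esub>" using hb by auto
  thus "y \<in> {c \<otimes>\<^bsub>C\<^esub> f \<one>\<^bsub>A\<^esub> | c. c \<in> carrier C}" using ring_hom_closed[OF hom] by blast
 next
  fix y assume "y \<in> {c \<otimes>\<^bsub>C\<^esub> f \<one>\<^bsub>A\<^esub> | c. c \<in> carrier C}"
  then obtain c where c: "c \<in> carrier C" "y = c \<otimes>\<^bsub>C\<^esub> f \<one>\<^bsub>A\<^esub>" by blast
  hence "c \<in> h ` carrier S" using bij unfolding bij_betw_def by simp
  then obtain b where b: "b \<in> carrier S" "c = h b" by (rule imageE)
  have "y = h (b \<otimes>\<^bsub>S\<^esub> F \<one>\<^bsub>T\<^esub>)" unfolding c(2) b(2) hb[OF b(1)] ..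
  thus "y \<in> h ` ?M" using b(1) by (intro image_eqI) auto
 qed
 hence b: "bij_betw h ?M {c \<otimes>\<^bsub>C\<^esub> f \<one>\<^bsub>A\<^esub> | c. c \<in> carrier C}"
  using inj_on_subset[OF _ MS] bij unfolding bij_betw_def by blast
 have "h \<in> bimodule_iso S T (hom_bimodule T S F) (restrict_scalars h r (hom_bimodule A C f))"
  unfolding bimodule_iso_def
 proof (intro CollectI conjI ballI)
  show "bij_betw h (carrier (hom_bimodule T S F)) (carrier (restrict_scalars h r (hom_bimodule A C f)))" using b by simp
  fix x assume "x \<in> carrier (hom_bimodule T S F)"
  hence x: "x \<in> carrier S" using MS by auto
  show "h (x \<oplus>\<^bsub>hom_bimodule T S F\<^esub> y) = h x \<oplus>\<^bsub>restrict_scalars h r (hom_bimodule A C f)\<^esub> h y"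
   if "y \<in> carrier (hom_bimodule T S F)" for y
  proof -
   have "y \<in> carrier S" using that MS by auto
   thus ?thesis using ring_hom_add[OF hom x] by simp
  qed
  show "h (ract (hom_bimodule T S F) x t) = ract (restrict_scalars h r (hom_bimodule A C f)) (h x) t" if "t \<in> carrier T" for t
   using ring_hom_mult[OF hom x F[OF that]] comm[OF that] by simp
 next
  fix s x assume "s \<in> carrier S" "x \<in> carrier (hom_bimodule T S F)"
  moreover from this have "x \<in> carrier S" using MS by auto
  ultimately show "h (lact (hom_bimodule T S F) s x) = lact (restrict_scalars h r (hom_bimodule A C f)) s (h x)"
   using ring_hom_mult[OF hom] by simp
 qed
 thus ?thesis unfolding bimodule_isomorphic_def by blast
qed

lemma bimodule_isomorphic_trans:
 assumes "bimodule_isomorphic S R M N" "bimodule_isomorphic S R N P" shows "bimodule_isomorphic S R M P"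
proof -
 obtain f g where f: "f \<in> bimodule_iso S R M N" and g: "g \<in> bimodule_iso S R N P" using assms unfolding bimodule_isomorphic_def by blast
 have fb: "bij_betw f (carrier M) (carrier N)" and gb: "bij_betw g (carrier N) (carrier P)" using f g unfolding bimodule_iso_def by blast+
 have fN: "f x \<in> carrier N" if "x \<in> carrier M" for x using fb that unfolding bij_betw_def by blast
 have "g \<circ> f \<in> bimodule_iso S R M P"
  using f g fN bij_betw_trans[OF fb gb] unfolding bimodule_iso_def by simp
 thus ?thesis unfolding bimodule_isomorphic_def by blast
qed

context restriction_data
begin

sublocale CV: cyclic_arrangement n "k + 1" V by (standard) (rule lcV)
sublocale CVh: cyclic_arrangement "n + 1" "k + 1" Vh by (standard) (rule lcVh)
sublocale CR: cyclic_arrangement n k "V'' Vh" by (standard) (rule left_cyclic_V'')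

text \<open>Unoccupied 0 means that the first sign is plus, so the truncation to vertices without 0
  is mapped onto the plus part. Hence balancing over \<open>Bprime\<close> and over
  \<open>Btilde_plus\<close> is the same.\<close>

lemma Bprime_image:
 "identification (n + 1) (k + 1) Vh ` carrier (Bprime (n + 1) (k + 1)) = carrier (Btilde_plus (n + 1) Vh)"
proof -
 let ?T = "ksubsets {1..<n + 1} (k + 1)" and ?TT = "ksubsets {0..<n + 1} (k + 1)"
 have BT: "X \<in> carrier (Bprime (n + 1) (k + 1)) \<longleftrightarrow> (\<exists>g. keys g \<subseteq> TP (n + 1) (k + 1) ?T \<and> X = pcl (n + 1) (k + 1) g)" for X
  unfolding Bprime_def by (rule truncation_carrier[OF ksub1_vertices])
 have T: "x \<in> ?T \<longleftrightarrow> x \<in> ?TT \<and> 0 \<notin> x" for x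
 proof -
  have "x \<subseteq> {1..<n + 1} \<longleftrightarrow> x \<subseteq> {0..<n + 1} \<and> 0 \<notin> x"
  proof (intro iffI conjI subsetI)
   fix y assume a: "x \<subseteq> {0..<n + 1} \<and> 0 \<notin> x" and y: "y \<in> x"
   hence "y \<noteq> 0" by metis
   moreover have "y \<in> {0..<n + 1}" using a y by blast
   ultimately show "y \<in> {1..<n + 1}" by auto
  qed auto
  thus ?thesis unfolding ksubsets_def by blast
 qed
 have sub: "TP (n + 1) (k + 1) ?T \<subseteq> TP (n + 1) (k + 1) ?TT" unfolding TP_def using T by blast
 have pos: "\<alpha> \<in> BF_plus (n + 1) Vh \<longleftrightarrow> \<alpha> \<in> BF (n + 1) Vh \<and> sc \<alpha> \<in> ?T" for \<alpha>
 proof -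
  have "\<alpha> \<in> BF (n + 1) Vh ==> \<alpha> ! 0 \<longleftrightarrow> 0 \<notin> sc \<alpha>" using sign_changes_0[of \<alpha>] BF_length[of \<alpha> "n + 1" Vh] by simp
  thus ?thesis using T CVh.sc_TT by blast
 qed
 have id: "identification (n + 1) (k + 1) Vh (pcl (n + 1) (k + 1) g) = bcl (n + 1) Vh (PhiT (n + 1) Vh g)"
  if "keys g \<subseteq> TP (n + 1) (k + 1) ?T" for g
 proof -
  have g: "keys g \<subseteq> TP (n + 1) (k + 1) ?TT" using that sub by blast
  hence "pcl (n + 1) (k + 1) g \<in> carrier (Bl (n + 1) (k + 1))" unfolding Bl_carrier by blast
  thus ?thesis using CVh.identification_eq CVh.Phi_pcl[OF CVh.TP_sub[OF g]] by simp
 qed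
 show ?thesis
 proof (intro equalityI subsetI)
  fix Y assume "Y \<in> identification (n + 1) (k + 1) Vh ` carrier (Bprime (n + 1) (k + 1))"
  then obtain X where "Y = identification (n + 1) (k + 1) Vh X" "X \<in> carrier (Bprime (n + 1) (k + 1))" by blast
  then obtain g where g: "keys g \<subseteq> TP (n + 1) (k + 1) ?T" "Y = bcl (n + 1) Vh (PhiT (n + 1) Vh g)"
   unfolding BT using id by blast
  have "\<alpha> \<in> BF_plus (n + 1) Vh \<and> \<beta> \<in> BF_plus (n + 1) Vh" if nz: "PhiT (n + 1) Vh g \<alpha> \<beta> \<noteq> 0" for \<alpha> \<beta>
  proof -
   obtain w where w: "(sc \<alpha>, w) \<in> keys g" "sc \<beta> = the (walk (n + 1) (sc \<alpha>) w)"
    "\<alpha> \<in> BF (n + 1) Vh" "\<beta> \<in> BF (n + 1) Vh" by (rule CVh.PhiT_nonzero[OF nz])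
   have "(sc \<alpha>, w) \<in> TP (n + 1) (k + 1) ?T" using g(1) w(1) by blast
   hence "sc \<alpha> \<in> ?T" "sc \<beta> \<in> ?T" unfolding w(2) TP_def by blast+
   thus ?thesis using pos w(3,4) by blast
  qed
  hence "R.supp (PhiT (n + 1) Vh g)" unfolding R.supp_def by blast
  thus "Y \<in> carrier (Btilde_plus (n + 1) Vh)" unfolding plus_carrier g(2) using CVh.PhiT_closed by blast
 next
  fix Y assume "Y \<in> carrier (Btilde_plus (n + 1) Vh)"
  then obtain M where M: "M \<in> carrier (Bfree (n + 1) Vh)" "R.supp M" "Y = bcl (n + 1) Vh M" unfolding plus_carrier by blast
  have "sc \<alpha> \<in> ?T \<and> sc \<beta> \<in> ?T" if "M \<alpha> \<beta> \<noteq> 0" for \<alpha> \<beta>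
   using M(2) that pos unfolding R.supp_def by blast
  from CVh.PhiT_surj[OF M(1) this] obtain g where g: "keys g \<subseteq> TP (n + 1) (k + 1) ?T" "bcl (n + 1) Vh (PhiT (n + 1) Vh g) = Y"
   unfolding M(3) by blast
  hence "identification (n + 1) (k + 1) Vh (pcl (n + 1) (k + 1) g) = Y" using id by simp
  moreover have "pcl (n + 1) (k + 1) g \<in> carrier (Bprime (n + 1) (k + 1))" unfolding BT using g(1) by blast
  ultimately show "Y \<in> identification (n + 1) (k + 1) Vh ` carrier (Bprime (n + 1) (k + 1))" by blast
 qed
qed

lemma n_pos: "0 < n"
 using left_cyclic_cyc[OF lcV] cyc.kn by (metis Suc_le_lessD gr_zeroI not_less_zero)

text \<open>Changes between neighbouring signs survive a reversal; only the comparison of the first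
  sign with the fixed initial plus is affected.\<close>

lemma sign_changes_map_Not:
 assumes l: "length \<alpha> = n"
 shows "sc (map Not \<alpha>) = (if 0 \<in> sc \<alpha> then sc \<alpha> - {0} else insert 0 (sc \<alpha>))"
proof -
 have z: "0 \<in> sc (map Not \<alpha>) \<longleftrightarrow> 0 \<notin> sc \<alpha>"
  using l n_pos sign_changes_0[of \<alpha>] sign_changes_0[of "map Not \<alpha>"] by simp
 have s: "Suc j \<in> sc (map Not \<alpha>) \<longleftrightarrow> Suc j \<in> sc \<alpha>" for j
  using l by (auto simp: sign_changes_def)
 have "i \<in> sc (map Not \<alpha>) \<longleftrightarrow> i \<in> (if 0 \<in> sc \<alpha> then sc \<alpha> - {0} else insert 0 (sc \<alpha>))" for i
  using z s by (cases i) auto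
 thus ?thesis by blast
qed

text \<open>Reversal adds 0 to the k sign changes of \<alpha> if it was absent, which gives a vertex
  for \<open>V\<close>. If 0 was present, it removes it and leaves k - 1 changes, too few for
  \<open>V\<close>.\<close>

lemma map_Not_BF:
 assumes a: "\<alpha> \<in> BF n (V'' Vh)" and x: "x \<in> vertices n (k + 1)"
 shows "map Not \<alpha> \<in> BF n V \<and> sc (map Not \<alpha>) = x \<longleftrightarrow> 0 \<in> x \<and> sc \<alpha> = x - {0}"
proof -
 have l: "length \<alpha> = n" "card (sc \<alpha>) = k" using a BF_V'' by blast+
 have cx: "card x = k + 1" using x unfolding vertices_def by blast
 show ?thesis
 proof (cases "0 \<in> sc \<alpha>")
  case True
  hence "sc (map Not \<alpha>) = sc \<alpha> - {0}" using sign_changes_map_Not[OF l(1)] by simp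
  hence "card (sc (map Not \<alpha>)) \<noteq> k + 1" using l(2) True by (simp add: card_Diff_singleton)
  thus ?thesis using True cx by auto
 next
  case False
  hence e: "sc (map Not \<alpha>) = insert 0 (sc \<alpha>)" using sign_changes_map_Not[OF l(1)] by simp
  hence "map Not \<alpha> \<in> BF n V" unfolding BF_V using l False by simp
  thus ?thesis unfolding e using False by auto
 qed
qed

text \<open>Both composites are compared entry by entry on representatives. They differ only on
  paths that leave 0, and there the difference is, up to sign, a monomial that lies in the ideal by
  \<open>leaving_0_bad\<close>.\<close>

lemma F_square:
 assumes X: "X \<in> carrier (Bl n (k + 1))"
 shows "Phi n (V'' Vh) (F_hom n k X) = phi (psi (Phi n V X))"
proof -
 obtain g where g: "keys g \<subseteq> TP n (k + 1) (ksubsets {0..<n} (k + 1))" "X = pcl n (k + 1) g" using X unfolding Bl_carrier by blast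
 have gp: "keys g \<subseteq> paths n (k + 1)" by (rule CV.TP_sub[OF g(1)])
 let ?P = "\<lambda>g. PhiT n (V'' Vh) (frag_extend (F_path n) g)" and ?Q = "\<lambda>g. comp_rl (PhiT n V g)"
 have Qc: "?Q g \<in> carrier (Bfree n (V'' Vh))" unfolding comp_rl_def by (intro N.rl_closed R.rl_closed D.rl_closed CV.PhiT_closed)
 have "?P g \<alpha> \<beta> - ?Q g \<alpha> \<beta> \<in> Rideal n (V'' Vh) \<alpha> \<beta>" if ab: "\<alpha> \<in> BF n (V'' Vh)" "\<beta> \<in> BF n (V'' Vh)" for \<alpha> \<beta>
 proof -
  have Q: "?Q g \<alpha> \<beta> = PhiT n V g (map Not \<alpha>) (map Not \<beta>)" for g using comp_rl_apply[OF CV.PhiT_closed] ab by simp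
  show ?thesis
   using gp
  proof (induction g rule: frag_induction)
   case (one p)
   then obtain x w z where p: "p = (x, w)" "walk n x w = Some z" "x \<in> vertices n (k + 1)" unfolding paths_def by auto
   have zv: "z \<in> vertices n (k + 1)" by (rule walk_vertices[OF p(3,2)])
   have l: "length \<alpha> = n" "length \<beta> = n" using ab BF_length by blast+
   have Qp: "?Q (frag_of p) \<alpha> \<beta> = (if (0 \<in> x \<and> sc \<alpha> = x - {0}) \<and> (0 \<in> z \<and> sc \<beta> = z - {0}) then frag_of (half n (cnt w)) else 0)"
    unfolding Q PhiT_def frag_extend_of p(1) phf_def map_Not_BF[OF ab(1) p(3), symmetric] map_Not_BF[OF ab(2) zv, symmetric]
    using p(2) by auto
   show ?case
   proof (cases "\<forall>y\<in>set (visited n x w). 0 \<in> y")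
    case True
    note r = walk_remove_0[OF p(2) True]
    have "?P (frag_of p) \<alpha> \<beta> = (if sc \<alpha> = x - {0} \<and> sc \<beta> = z - {0} then frag_of (half n (cnt w)) else 0)"
     using True r ab by (simp add: PhiT_def F_path_def p(1) phf_def)
    thus ?thesis unfolding Qp using r by simp
   next
    case False
    hence "F_path n p = 0" by (auto simp: F_path_def p(1))
    hence P0: "?P (frag_of p) \<alpha> \<beta> = 0" by (simp add: PhiT_def)
    show ?thesis
    proof (cases "(0 \<in> x \<and> sc \<alpha> = x - {0}) \<and> (0 \<in> z \<and> sc \<beta> = z - {0})")
     case True
     have m: "map Not \<alpha> \<in> BF n V" "sc (map Not \<alpha>) = x" "map Not \<beta> \<in> BF n V" "sc (map Not \<beta>) = z"
      using map_Not_BF[OF ab(1) p(3)] map_Not_BF[OF ab(2) zv] True by blast+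
     \<comment> \<open>Reversing both vectors changes neither their disagreements nor the crossing
       numbers, so the support computed for \<open>V\<close> also describes the face of
       \<open>V'' Vh\<close>.\<close>
     have "diff_signs (map Not \<alpha>) (map Not \<beta>) = diff_signs \<alpha> \<beta>" using l by (auto simp: diff_signs_def)
     moreover have "walk n (sc (map Not \<alpha>)) w = Some (sc (map Not \<beta>))" using m p(2) by simp
     ultimately have s: "keys (half n (cnt w)) \<union> diff_signs \<alpha> \<beta> = ix ` set w" using CV.support[OF m(1,3)] by metis
     have "bad n (sc \<alpha>) (ix ` set w)" using leaving_0_bad[OF p(2) _ False] True by simp
     hence "gone (V'' Vh) \<alpha> \<beta> (keys (half n (cnt w)))"
      using CR.gone_bad[OF ab, of "keys (half n (cnt w))"] inU_half[of n "cnt w"] s unfolding inU_def by simp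
     hence "frag_of (half n (cnt w)) \<in> Rideal n (V'' Vh) \<alpha> \<beta>" unfolding Rideal_frag using inU_half by blast
     hence "0 - frag_of (half n (cnt w)) \<in> Rideal n (V'' Vh) \<alpha> \<beta>" by (rule Rideal_diff[OF Rideal_0])
     thus ?thesis unfolding Qp P0 using True by simp
    next
     case False
     hence "?Q (frag_of p) \<alpha> \<beta> = 0" unfolding Qp by (rule if_not_P)
     thus ?thesis unfolding P0 by simp
    qed
   qed
  next
   case (diff a b)
   have "?P (a - b) \<alpha> \<beta> - ?Q (a - b) \<alpha> \<beta> = (?P a \<alpha> \<beta> - ?Q a \<alpha> \<beta>) - (?P b \<alpha> \<beta> - ?Q b \<alpha> \<beta>)"
    unfolding Q by (simp add: PhiT_def frag_extend_diff)
   thus ?case using Rideal_diff[OF diff] by simp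
  next
   case zero
   show ?case unfolding Q by (simp add: PhiT_def)
  qed
 qed
 moreover have "(\<lambda>\<alpha> \<beta>. ?P g \<alpha> \<beta> - ?Q g \<alpha> \<beta>) \<in> carrier (Bfree n (V'' Vh))"
 proof (rule BfreeI)
  fix \<alpha> \<beta>
  show "?P g \<alpha> \<beta> - ?Q g \<alpha> \<beta> \<in> carrier (Zu n)"
   using Zu_add_closed[OF BfreeD(1)[OF CR.PhiT_closed[of "frag_extend (F_path n) g"], of \<alpha> \<beta>] Zu_minus_closed[OF BfreeD(1)[OF Qc, of \<alpha> \<beta>]]] by simp
  show "?P g \<alpha> \<beta> - ?Q g \<alpha> \<beta> = 0" if "\<alpha> \<notin> BF n (V'' Vh) \<or> \<beta> \<notin> BF n (V'' Vh)"
   using that BfreeD(2,3)[OF CR.PhiT_closed[of "frag_extend (F_path n) g"]] BfreeD(2,3)[OF Qc] by auto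
 qed
 ultimately have "bcl n (V'' Vh) (?P g) = bcl n (V'' Vh) (?Q g)"
  unfolding bcl_eq[OF CR.PhiT_closed Qc] Bideal_iff by blast
 thus ?thesis
  unfolding g(2) F_hom_pcl[OF gp] CR.Phi_pcl[OF F_keys[OF gp]] CV.Phi_pcl[OF gp] phi_psi[OF CV.PhiT_closed] .
qed

lemma F_bimod_tensor:
 "bimodule_isomorphic (Bl n k) (Bl n (k + 1)) (F_bimod n k) (tensor (Bprime (n + 1) (k + 1)) (Rest1 n k Vh) (Del1 n k V Vh))"
proof (rule bimodule_isomorphic_trans)
 have hV: "identification n (k + 1) V \<in> Ring.ring_hom (Bl n (k + 1)) (Btilde n V)"
  using CV.identification unfolding is_identification_def ring_iso_def by blast
 have iR: "identification n k (V'' Vh) \<in> ring_iso (Bl n k) (Btilde n (V'' Vh))"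
  using CR.identification unfolding is_identification_def by blast
 show "bimodule_isomorphic (Bl n k) (Bl n (k + 1)) (F_bimod n k)
  (restrict_scalars (identification n k (V'' Vh)) (identification n (k + 1) V) (hom_bimodule (Btilde n V) (Btilde n (V'' Vh)) (phi \<circ> psi)))"
  unfolding F_bimod_def
 proof (rule hom_bimodule_transport)
  show "ring (Bl n k)" "ring (Bl n (k + 1))" by (rule Bl_ring)+
  show "identification n k (V'' Vh) \<in> ring_iso (Bl n k) (Btilde n (V'' Vh))" by (rule iR)
  show "identification n (k + 1) V \<one>\<^bsub>Bl n (k + 1)\<^esub> = \<one>\<^bsub>Btilde n V\<^esub>" by (rule ring_hom_one[OF hV])
  show "F_hom n k t \<in> carrier (Bl n k)" if "t \<in> carrier (Bl n (k + 1))" for t using that by (rule F_hom_closed)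
  fix t assume t: "t \<in> carrier (Bl n (k + 1))"
  show "identification n k (V'' Vh) (F_hom n k t) = (phi \<circ> psi) (identification n (k + 1) V t)"
   using F_square[OF t] CR.identification_eq[OF F_hom_closed[OF t]] CV.identification_eq[OF t] by simp
 qed
 show "bimodule_isomorphic (Bl n k) (Bl n (k + 1))
  (restrict_scalars (identification n k (V'' Vh)) (identification n (k + 1) V) (hom_bimodule (Btilde n V) (Btilde n (V'' Vh)) (phi \<circ> psi)))
  (tensor (Bprime (n + 1) (k + 1)) (Rest1 n k Vh) (Del1 n k V Vh))"
  unfolding Rest1_def Del1_def psi_def[symmetric] phi_def[symmetric]
  by (rule tensor_hom_bimodules[OF Btilde_ring Btilde_plus_ring Btilde_ring psi_closed psi_mult phi_closed phi_add phi_mult _ Bprime_image])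
   (use ring_hom_closed[OF hV] ring_iso_memE(1)[OF iR] in blast)+
qed

end

theorem corollary5p7:
  fixes n k :: nat and V Vh :: arrangement
  assumes "left_cyclic n (k + 1) V"
    and "left_cyclic (n + 1) (k + 1) Vh"
    and "first_deletion Vh = V"
  shows "left_cyclic n k (opposite (first_restriction Vh)) \<and>
    bimodule_isomorphic (Bl n k) (Bl n (k + 1))
      (F_bimod n k)
      (tensor (Bprime (n + 1) (k + 1)) (Rest1 n k Vh) (Del1 n k V Vh))"
proof -
  interpret restriction_data n k V Vh using assms by unfold_locales
  show ?thesis using left_cyclic_V'' F_bimod_tensor by blast
qed

end
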